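(* Define the constants $$a_K=\frac{\sqrt{\pi}}{2}\cdot\frac{K}{\sqrt{\log K}}\quad\text{and}\quad b_K=\frac{Ka_K}{\sqrt{\pi}}\int_1^\infty\frac{\sin(x/a_K)}{x^2\sqrt{\log x}}\,dx,\qquad K=2,3,\ldots.$$ In the generalized linear model setting described in the context, suppose the null hypothesis $H_0$ is true and that assumptions A1–A8 listed in the context hold. Then $$\frac{S_n-b_K}{a_K}\xrightarrow{\mathcal{D}}S$$ as $n$ and $K$ tend to infinity, where $S$ has the stable distribution $S_1(1,1,0)$.
   Context: Model. The data are $(\mathbf{x}_1,Y_1),\ldots,(\mathbf{x}_n,Y_n)$ with fixed covariate vectors $\mathbf{x}_i$ and independent scalar responses $Y_i$ whose log-likelihood is of generalized linear form $$\ell(g,\eta)=\sum_{i=1}^n\left\{[Y_ig(\mathbf{x}_i)-b(g(\mathbf{x}_i))]/a(\eta)+c(Y_i,\eta)\right\},$$ where $a(\cdot),b(\cdot),c(\cdot)$ are known functions, $g$ is an unknown function and $\eta$ an unknown dispersion parameter with true value $\eta_0$. Thus $E(Y_i)=b'(g(\mathbf{x}_i))$ and $\mathrm{Var}(Y_i)=a(\eta_0)b''(g(\mathbf{x}_i))$. The null hypothesis is $$H_0:\ g(\mathbf{x})=\sum_{j=1}^p\theta_j\gamma_j(\mathbf{x})=:g(\mathbf{x};\boldsymbol\theta),$$ with $\gamma_1,\ldots,\gamma_p$ known functions and $\boldsymbol\theta=(\theta_1,\ldots,\theta_p)^T\in\Theta$ unknown. $\boldsymbol\theta_0$ denotes the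 asymptotic maximizer with respect to $\boldsymbol\theta$ of $\frac1n\sum_{i=1}^n[b'(g(\mathbf{x}_i))g(\mathbf{x}_i;\boldsymbol\theta)-b(g(\mathbf{x}_i;\boldsymbol\theta))]$; it is the true parameter vector when $H_0$ is true. $(\hat{\boldsymbol\theta}_0,\hat\eta_0)$ is the maximizer of the null likelihood (the likelihood with $g=g(\cdot;\boldsymbol\theta)$), and $\hat{\boldsymbol\theta}_0$ is assumed to converge in probability to $\boldsymbol\theta_0$. Orthonormal functions. $u_1,u_2,\ldots$ is a given sequence of functions (a basis for all functions of interest). The functions $v_1,v_2,\ldots$ (dependence on $n$ suppressed) satisfy $$\text{(O1)}\quad\sum_{i=1}^nv_j(\mathbf{x}_i)\gamma_k(\mathbf{x}_i)b''(g(\mathbf{x}_i;\boldsymbol\theta_0))=0,\quad j=1,2,\ldots;\ k=1,\ldots,p,$$ $$\text{(O2)}\quad\frac1n\sum_{i=1}^nb''(g(\mathbf{x}_i;\boldsymbol\theta_0))v_j(\mathbf{x}_i)v_k(\mathbf{x}_i)=\begin{cases}1,&j=k,\\0,&j\ne k,\end{cases}\quad j,k\ge1.$$ The functions $\hat v_1,\ldots,\hat v_{n-p}$ are linear combinations of $\gamma_1,\ldots,\gamma_p,u_1,\ldots,u_{n-p}$ constructed by the Gram–Schmidt procedure applied to $\gamma_1,\ldots,\gamma_p,u_1,u_2,\ldots$ in this order ($\hat v_j$ being a linear combination of $\gamma_1,\ldots,\gamma_p,u_1,\ldots,u_j$) so as to satisfy (O1) and (O2) with $\boldsymbol\theta_0$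 and the $v_j$ replaced by $\hat{\boldsymbol\theta}_0$ and the $\hat v_j$; $v_j$ is the function produced by the same procedure using $\boldsymbol\theta_0$. Statistic. $$\hat\alpha_j=\frac1n\sum_{i=1}^n[Y_i-b'(g(\mathbf{x}_i;\hat{\boldsymbol\theta}_0))]\hat v_j(\mathbf{x}_i),\quad j=1,\ldots,K,\qquad S_n=\sum_{j=1}^K\exp\left(\frac{n\hat\alpha_j^2}{2a(\hat\eta_0)}\right).$$ Assumptions. A1. The design points $\mathbf{x}_1,\ldots,\mathbf{x}_n$ are fixed and confined to a compact subset $\mathcal{S}$ of $\mathbb{R}^d$ for all $n$. A2. (i) There exists $B_1^*<\infty$ such that $\sup_{1\le j\le p,\,\mathbf{x}\in\mathcal{S}}|\gamma_j(\mathbf{x})|<B_1^*$; (ii) there exists a sequence of positive constants $\{B_j:j=1,2,\ldots\}$ such that $\sup_{1\le j\le K,\,\mathbf{x}\in\mathcal{S}}|u_j(\mathbf{x})|\le B_K$, $K=1,2,\ldots$. A3. $v_1,v_2,\ldots$ satisfy (O1) and (O2), and $\hat v_1,\hat v_2,\ldots$ are constructed from $\gamma_1,\ldots,\gamma_p,u_1,u_2,\ldots$ by the Gram–Schmidt procedure applied to these functions in this order, $\hat v_j$ being a linear combination of $\gamma_1,\ldots,\gamma_p,u_1,\ldots,u_j$, so that $\sum_{i=1}^n\hat v_j(\mathbf{x}_i)\gamma_k(\mathbf{x}_i)b''(g(\mathbf{x}_i;\hat{\boldsymbol\theta}_0))=0$ for all $j$ and $k=1,\ldots,p$, and $\frac1n\sum_{i=1}^nb''(g(\mathbf{x}_i;\hat{\boldsymbol\theta}_0))\hat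 v_j(\mathbf{x}_i)\hat v_k(\mathbf{x}_i)$ equals 1 if $j=k$ and 0 if $j\ne k$. A4. Let $\mathbf{A}_{n,K}$ denote the $n\times K$ matrix with $i,j$ element $u_j(\mathbf{x}_i)$. The diagonal elements of $\mathbf{A}_{n,K}^T\mathbf{A}_{n,K}/n$ are all 1, and the smallest eigenvalue of $\mathbf{A}_{n,K}^T\mathbf{A}_{n,K}/n$ is bounded away from 0 for all $n$ and $K$. A5. $a(\eta_0)>0$, and the maximum likelihood estimators $\hat\eta_0$ and $\hat{\boldsymbol\theta}_0$ of $\eta_0$ and $\boldsymbol\theta_0$ are such that $E(a(\hat\eta_0)-a(\eta_0))^2$ and $E\|\hat{\boldsymbol\theta}_0-\boldsymbol\theta_0\|^2$ exist and are each $O(n^{-1})$. A6. There exists a compact, connected subset $\mathcal{N}$ of the parameter space $\Theta$ such that $\boldsymbol\theta_0\in\mathcal{N}$ and, for each $\mathbf{x}\in\mathcal{S}$, $g(\mathbf{x};\boldsymbol\theta)$ is a continuous function of $\boldsymbol\theta$ on $\mathcal{N}$. A7. $b$ is thrice differentiable with $\sup_{\mathbf{x}\in\mathcal{S},\boldsymbol\theta\in\mathcal{N}}|b'''(g(\mathbf{x};\boldsymbol\theta))|\le B_2^*$ for some constant $B_2^*$; the function (of $\mathbf{x}$) $b''(g(\mathbf{x};\boldsymbol\theta))$ is nonnegative for each $\boldsymbol\theta\in\Theta$; and $\inf_{\mathbf{x}\in\mathcal{S},\boldsymbol\theta\in\mathcal{N}}b''(g(\mathbf{x};\boldsymbol\theta))>0$.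 A8. $K=K(n)$ tends to infinity with $n$ in such a way that $K\le n^{1/8-\epsilon}$ and $B_KK^{7/2}\le n^{1/2-\epsilon}$, where $\epsilon$ is a number with $0<\epsilon<1/8$. Stable law. In the notation of Samorodnitsky and Taqqu, $S_1(1,1,0)$ (index 1, scale 1, skewness 1, shift 0) is the distribution with characteristic function $t\mapsto\exp\{-|t|(1+i\frac{2}{\pi}\,\mathrm{sign}(t)\log|t|)\}$. $\xrightarrow{\mathcal{D}}$ denotes convergence in distribution. *)

theory Defs
  imports
    "HOL-Probability.Probability"
    "HOL-Library.Landau_Symbols"
    "Jordan_Normal_Form.Spectral_Radius"
begin

(* Both Matrix and Finite_Cartesian_Product use infix $; here $ is only used for real^'p. *)
no_notation Matrix.vec_index (infixl "$" 100)

definition lin_pred :: "('p::finite \<Rightarrow> 'x \<Rightarrow> real) \<Rightarrow> real^'p \<Rightarrow> 'x \<Rightarrow> real" where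
  "lin_pred \<gamma> \<theta> x = (\<Sum>j\<in>UNIV. \<theta> $ j * \<gamma> j x)"

definition glm_logdens ::
  "(real \<Rightarrow> real) \<Rightarrow> (real \<Rightarrow> real) \<Rightarrow> (real \<Rightarrow> real \<Rightarrow> real) \<Rightarrow> real \<Rightarrow> real \<Rightarrow> real \<Rightarrow> real" where
  "glm_logdens a b c z \<eta> y = (y * z - b z) / a \<eta> + c y \<eta>"

(* X and y list the design points and the observed responses, indexed by 1, ..., n. *)
definition glm_loglik ::
  "(real \<Rightarrow> real) \<Rightarrow> (real \<Rightarrow> real) \<Rightarrow> (real \<Rightarrow> real \<Rightarrow> real) \<Rightarrow> nat \<Rightarrow> (nat \<Rightarrow> 'x) \<Rightarrow> (nat \<Rightarrow> real)
    \<Rightarrow> ('x \<Rightarrow> real) \<Rightarrow> real \<Rightarrow> real" where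
  "glm_loglik a b c n X y g \<eta> = (\<Sum>i=1..n. glm_logdens a b c (g (X i)) \<eta> (y i))"

definition design_inner ::
  "nat \<Rightarrow> (nat \<Rightarrow> 'x) \<Rightarrow> ('x \<Rightarrow> real) \<Rightarrow> ('x \<Rightarrow> real) \<Rightarrow> ('x \<Rightarrow> real) \<Rightarrow> real" where
  "design_inner n X w f h = (1 / real n) * (\<Sum>i=1..n. w (X i) * f (X i) * h (X i))"

(* A function whose residual has norm 0 is mapped to the zero function (division by zero). *)
fun gram_schmidt_fn ::
  "(('x \<Rightarrow> real) \<Rightarrow> ('x \<Rightarrow> real) \<Rightarrow> real) \<Rightarrow> (nat \<Rightarrow> 'x \<Rightarrow> real) \<Rightarrow> nat \<Rightarrow> 'x \<Rightarrow> real" where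
  "gram_schmidt_fn ip f m =
    (let r = (\<lambda>x. f m x - (\<Sum>k<m. ip (f m) (gram_schmidt_fn ip f k) * gram_schmidt_fn ip f k x))
     in (\<lambda>x. r x / sqrt (ip r r)))"

declare gram_schmidt_fn.simps [simp del]

(* The sequence gamma_1, ..., gamma_p, u_1, u_2, ..., numbered from 0; u itself is numbered from 1. *)
definition gamma_then_u ::
  "('p::{finite,linorder} \<Rightarrow> 'x \<Rightarrow> real) \<Rightarrow> (nat \<Rightarrow> 'x \<Rightarrow> real) \<Rightarrow> nat \<Rightarrow> 'x \<Rightarrow> real" where
  "gamma_then_u \<gamma> u m =
    (if m < CARD('p) then \<gamma> (sorted_list_of_set (UNIV::'p set) ! m) else u (m - CARD('p) + 1))"

abbreviation glm_weight ::
  "(real \<Rightarrow> real) \<Rightarrow> ('p::finite \<Rightarrow> 'x \<Rightarrow> real) \<Rightarrow> real^'p \<Rightarrow> 'x \<Rightarrow> real" where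
  "glm_weight b \<gamma> \<theta> x \<equiv> (deriv ^^ 2) b (lin_pred \<gamma> \<theta> x)"

(* v_j for theta = theta_0, and v-hat_j for theta = theta-hat_0; meant for j >= 1. *)
definition orth_fn ::
  "(real \<Rightarrow> real) \<Rightarrow> ('p::{finite,linorder} \<Rightarrow> 'x \<Rightarrow> real) \<Rightarrow> (nat \<Rightarrow> 'x \<Rightarrow> real) \<Rightarrow> nat \<Rightarrow> (nat \<Rightarrow> 'x)
    \<Rightarrow> real^('p::{finite,linorder}) \<Rightarrow> nat \<Rightarrow> 'x \<Rightarrow> real" where
  "orth_fn b \<gamma> u n X \<theta> j =
    gram_schmidt_fn (design_inner n X (glm_weight b \<gamma> \<theta>)) (gamma_then_u \<gamma> u) (CARD('p) + j - 1)"

definition orth_to_null ::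
  "(real \<Rightarrow> real) \<Rightarrow> ('p::finite \<Rightarrow> 'x \<Rightarrow> real) \<Rightarrow> nat \<Rightarrow> (nat \<Rightarrow> 'x) \<Rightarrow> real^'p \<Rightarrow> nat
    \<Rightarrow> (nat \<Rightarrow> 'x \<Rightarrow> real) \<Rightarrow> bool" where
  "orth_to_null b \<gamma> n X \<theta> K v \<longleftrightarrow>
    (\<forall>j\<in>{1..K}. \<forall>k. (\<Sum>i=1..n. v j (X i) * \<gamma> k (X i) * glm_weight b \<gamma> \<theta> (X i)) = 0)"

definition orthonormal_fns ::
  "(real \<Rightarrow> real) \<Rightarrow> ('p::finite \<Rightarrow> 'x \<Rightarrow> real) \<Rightarrow> nat \<Rightarrow> (nat \<Rightarrow> 'x) \<Rightarrow> real^'p \<Rightarrow> nat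
    \<Rightarrow> (nat \<Rightarrow> 'x \<Rightarrow> real) \<Rightarrow> bool" where
  "orthonormal_fns b \<gamma> n X \<theta> K v \<longleftrightarrow>
    (\<forall>j\<in>{1..K}. \<forall>k\<in>{1..K}.
      (1 / real n) * (\<Sum>i=1..n. glm_weight b \<gamma> \<theta> (X i) * v j (X i) * v k (X i))
        = (if j = k then 1 else 0))"

definition alpha_hat ::
  "(real \<Rightarrow> real) \<Rightarrow> ('p::{finite,linorder} \<Rightarrow> 'x \<Rightarrow> real) \<Rightarrow> (nat \<Rightarrow> 'x \<Rightarrow> real) \<Rightarrow> nat \<Rightarrow> (nat \<Rightarrow> 'x)
    \<Rightarrow> (nat \<Rightarrow> real) \<Rightarrow> real^('p::{finite,linorder}) \<Rightarrow> nat \<Rightarrow> real" where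
  "alpha_hat b \<gamma> u n X y \<theta> j =
    (1 / real n) * (\<Sum>i=1..n. (y i - deriv b (lin_pred \<gamma> \<theta> (X i))) * orth_fn b \<gamma> u n X \<theta> j (X i))"

definition test_stat ::
  "(real \<Rightarrow> real) \<Rightarrow> (real \<Rightarrow> real) \<Rightarrow> ('p::{finite,linorder} \<Rightarrow> 'x \<Rightarrow> real) \<Rightarrow> (nat \<Rightarrow> 'x \<Rightarrow> real) \<Rightarrow> nat
    \<Rightarrow> (nat \<Rightarrow> 'x) \<Rightarrow> nat \<Rightarrow> (nat \<Rightarrow> real) \<Rightarrow> real^('p::{finite,linorder}) \<Rightarrow> real \<Rightarrow> real" where
  "test_stat a b \<gamma> u n X K y \<theta> \<eta> =
    (\<Sum>j=1..K. exp (real n * (alpha_hat b \<gamma> u n X y \<theta> j)\<^sup>2 / (2 * a \<eta>)))"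

definition basis_matrix :: "(nat \<Rightarrow> 'x \<Rightarrow> real) \<Rightarrow> nat \<Rightarrow> (nat \<Rightarrow> 'x) \<Rightarrow> nat \<Rightarrow> real mat" where
  "basis_matrix u n X K = Matrix.mat n K (\<lambda>(i, j). u (j + 1) (X (i + 1)))"

definition basis_gram :: "(nat \<Rightarrow> 'x \<Rightarrow> real) \<Rightarrow> nat \<Rightarrow> (nat \<Rightarrow> 'x) \<Rightarrow> nat \<Rightarrow> real mat" where
  "basis_gram u n X K =
    (1 / real n) \<cdot>\<^sub>m (transpose_mat (basis_matrix u n X K) * basis_matrix u n X K)"

definition a_const :: "nat \<Rightarrow> real" where
  "a_const K = sqrt pi / 2 * (real K / sqrt (ln (real K)))"

definition b_const :: "nat \<Rightarrow> real" where
  "b_const K = real K * a_const K / sqrt pi *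
    (LBINT x:{1..}. sin (x / a_const K) / (x\<^sup>2 * sqrt (ln x)))"

(* The law S_1(1,1,0) of Samorodnitsky and Taqqu; ln 0 = 0 in HOL, so the value at t = 0 is 1. *)
definition stable_S1_1_1_0 :: "real measure \<Rightarrow> bool" where
  "stable_S1_1_1_0 \<mu> \<longleftrightarrow> real_distribution \<mu> \<and>
    (\<forall>t. char \<mu> t =
      exp (- complex_of_real \<bar>t\<bar> * (1 + \<i> * complex_of_real (2 / pi * sgn t * ln \<bar>t\<bar>))))"

end

theory Submission
  imports Defs "HOL-Real_Asymp.Real_Asymp"
begin

text \<open>
  Each summand of the statistic is \<open>exp (W\<^sup>2 / 2)\<close> for a nearly standard normal \<open>W\<close>. For exact
  standard normals its tail is of order \<open>1 / (x sqrt (ln x))\<close>, so that sums of \<open>K\<close> independent copies, scaled by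
  \<open>a_K\<close> and centred by \<open>b_K\<close>, have the stable limit; this is a computation with characteristic functions.

  The variables \<open>W\<close> are linear in the errors up to a negligible term: Gram-Schmidt orthonormalization is stable
  under a small relative change of the weights, and the orthogonality to the \<open>\<gamma>\<close> removes the linear term in
  \<open>\<theta>h - \<theta>\<^sub>0\<close>. The exponential is replaced by the bounded smooth function \<open>s (1 - exp (- exp (z\<^sup>2 / 2) / s))\<close>, whose
  derivatives up to order 3 are \<open>O(s (ln s)\<^sup>2)\<close>, and the errors are exchanged one by one for Gaussian ones
  (Lindeberg). This needs small coefficients: by the eigenvalue condition they are small for the projection of
  \<open>v_j\<close> to the span of \<open>u_1, \<dots>, u_K\<close>. The rest of \<open>v_j\<close> lies in a space of dimension \<open>p\<close>; it need not be
  small, but the sum over \<open>j\<close> of the squared norms of these rests is at most \<open>p\<close>, which suffices to drop them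
  before the exchange and to restore them after it. The resulting Gaussian vector is exactly
  standard normal, by rotation invariance.
\<close>

subsection \<open>The truncated exponential\<close>

text \<open>Two obstacles shape the argument. For a standard normal Z the variable exp (Z^2 / 2) has
  infinite mean, so neither Markov bounds nor Taylor expansions apply to it directly. Summands above
  A * a_K with A = (ln K)^2 occur with vanishing probability, and truncation at s = A^2 * a_K leaves
  summands of mean O(sqrt (ln K)), against which all errors are weighted. The price is
  polylogarithmic: the derivatives up to order three of the truncated sum over a_K are bounded by
  powers of ln K. The second obstacle is the growth of K. Exchanging errors whose coefficients are
  at most cb costs K^3 * cb up to logarithms, and A8 yields cb = O(K^(-3 - 8 * \<epsilon>)), just
  enough to win. Laws are compared through the means of cos (t * S + \<theta>) for every phase
  \<theta>: the test functions stay real and bounded, and the centring by b_K becomes a change of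
  phase.\<close>

definition exp_half_sq :: "real \<Rightarrow> real" where
  "exp_half_sq z = exp (z\<^sup>2 / 2)"

text \<open>A smooth substitute for \<open>min (exp_half_sq z) s\<close>, equal to it up to a factor
  2. Its derivatives in z carry the factor exp (- exp_half_sq z / s), which beats the powers of z
  and of exp_half_sq z / s that differentiation creates.\<close>

definition trunc_exp :: "real \<Rightarrow> real \<Rightarrow> real" where
  "trunc_exp s z = s * (1 - exp (- (exp_half_sq z / s)))"

lemma exp_half_sq_ge_1: "exp_half_sq z \<ge> 1"
  by (simp add: exp_half_sq_def)

lemma exp_half_sq_pos [simp]: "exp_half_sq z > 0"
  by (simp add: exp_half_sq_def)

lemma exp_half_sq_measurable [measurable]: "exp_half_sq \<in> borel_measurable borel"
  unfolding exp_half_sq_def by measurable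

lemma trunc_exp_measurable [measurable]: "trunc_exp s \<in> borel_measurable borel"
  unfolding trunc_exp_def by measurable

lemma one_minus_exp_bounds:
  fixes y :: real
  assumes "y \<ge> 0"
  shows "1 - exp (- y) \<le> y" "y - (1 - exp (- y)) \<le> y\<^sup>2 / 2" "y \<le> 1 \<Longrightarrow> y / 2 \<le> 1 - exp (- y)"
    "y > 1 \<Longrightarrow> 1 / 2 \<le> 1 - exp (- y)"
proof -
  show "1 - exp (- y) \<le> y"
    using exp_ge_add_one_self[of "- y"] by linarith
  have "\<exists>t. \<bar>t\<bar> \<le> \<bar>- y\<bar> \<and> exp (- y) = (\<Sum>m<2. (- y) ^ m / fact m) + exp t / fact 2 * (- y) ^ 2"
    by (rule Maclaurin_exp_le)
  have sq: "exp (- y) \<le> 1 - y + y\<^sup>2 / 2"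
  proof (cases "y = 0")
    case False
    hence y: "- y < 0" using assms by simp
    have "\<exists>t. - y < t \<and> t < 0 \<and> exp (- y) = (\<Sum>m<2. exp 0 / fact m * (- y) ^ m) + exp t / fact 2 * (- y) ^ 2"
      by (rule Maclaurin_minus[OF y, of 2 "\<lambda>_. exp"]) (auto intro!: derivative_eq_intros)
    then obtain t where t: "t < 0" "exp (- y) = 1 - y + exp t / 2 * y\<^sup>2"
      by (auto simp: numeral_2_eq_2)
    have "exp t / 2 * y\<^sup>2 \<le> 1 / 2 * y\<^sup>2"
      using t by (intro mult_right_mono) auto
    thus ?thesis using t by simp
  qed simp
  thus "y - (1 - exp (- y)) \<le> y\<^sup>2 / 2" by simp
  show "y / 2 \<le> 1 - exp (- y)" if "y \<le> 1"
  proof -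
    have "y\<^sup>2 \<le> y" using that assms by (simp add: power2_eq_square mult_left_le)
    thus ?thesis using sq by linarith
  qed
  show "1 / 2 \<le> 1 - exp (- y)" if "y > 1"
  proof -
    have "exp y \<ge> 2" using exp_ge_add_one_self[of y] that by linarith
    hence "exp (- y) \<le> 1 / 2" by (simp add: exp_minus field_simps)
    thus ?thesis by simp
  qed
qed

lemma trunc_exp_bounds:
  assumes "s > 0"
  shows "trunc_exp s z \<ge> 0" "trunc_exp s z \<le> s" "trunc_exp s z \<le> exp_half_sq z"
    "exp_half_sq z - trunc_exp s z \<le> (exp_half_sq z)\<^sup>2 / (2 * s)"
proof -
  define y where "y = exp_half_sq z / s"
  have y: "y \<ge> 0" "exp_half_sq z = s * y"
    using assms by (auto simp: y_def less_imp_le[OF exp_half_sq_pos])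
  have tr: "trunc_exp s z = s * (1 - exp (- y))" by (simp add: trunc_exp_def y_def)
  show "trunc_exp s z \<ge> 0" using assms y by (simp add: tr)
  show "trunc_exp s z \<le> s" using assms y by (simp add: tr)
  show "trunc_exp s z \<le> exp_half_sq z"
    unfolding tr y(2) using one_minus_exp_bounds(1)[OF y(1)] assms by (intro mult_left_mono) auto
  have "s * (y - (1 - exp (- y))) \<le> s * (y\<^sup>2 / 2)"
    using one_minus_exp_bounds(2)[OF y(1)] assms by (intro mult_left_mono) auto
  also have "\<dots> = (exp_half_sq z)\<^sup>2 / (2 * s)" using assms by (simp add: y(2) field_simps power2_eq_square)
  finally show "exp_half_sq z - trunc_exp s z \<le> (exp_half_sq z)\<^sup>2 / (2 * s)"
    by (simp add: tr y(2) algebra_simps)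
qed

text \<open>Comparability with the minimum of \<open>exp_half_sq z\<close> and any level c up to s.
  The second bound turns an exceedance of c into a lower bound for the truncated value, so that
  exceedances can be paid for by the mean of \<open>trunc_exp\<close>.\<close>

lemma trunc_exp_ge:
  assumes "c > 0" "c \<le> s"
  shows "exp_half_sq z \<le> c \<Longrightarrow> exp_half_sq z \<le> 2 * trunc_exp s z"
    and "exp_half_sq z > c \<Longrightarrow> c \<le> 2 * trunc_exp s z"
proof -
  define y where "y = exp_half_sq z / s"
  have y: "y \<ge> 0" "exp_half_sq z = s * y"
    using assms by (auto simp: y_def less_imp_le[OF exp_half_sq_pos])
  have tr: "trunc_exp s z = s * (1 - exp (- y))" by (simp add: trunc_exp_def y_def)
  show "exp_half_sq z \<le> 2 * trunc_exp s z" if "exp_half_sq z \<le> c"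
  proof -
    have "y \<le> 1" using that assms by (simp add: y_def field_simps)
    hence "s * (y / 2) \<le> s * (1 - exp (- y))"
      using one_minus_exp_bounds(3)[OF y(1)] assms by (intro mult_left_mono) auto
    thus ?thesis by (simp add: tr y(2))
  qed
  show "c \<le> 2 * trunc_exp s z" if "exp_half_sq z > c"
  proof (cases "y \<le> 1")
    case True
    hence "s * (y / 2) \<le> s * (1 - exp (- y))"
      using one_minus_exp_bounds(3)[OF y(1)] assms by (intro mult_left_mono) auto
    thus ?thesis using that by (simp add: tr y(2))
  next
    case False
    hence "s * (1 / 2) \<le> s * (1 - exp (- y))"
      using one_minus_exp_bounds(4)[OF y(1)] assms by (intro mult_left_mono) auto
    thus ?thesis using assms unfolding tr by linarith
  qed
qed

lemma trunc_exp_mono: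
  assumes "s > 0" "\<bar>z\<bar> \<le> \<bar>z'\<bar>"
  shows "trunc_exp s z \<le> trunc_exp s z'"
proof -
  have "z\<^sup>2 \<le> z'\<^sup>2" using assms(2) by (simp add: abs_le_square_iff)
  hence "exp_half_sq z / s \<le> exp_half_sq z' / s"
    using assms(1) by (simp add: exp_half_sq_def divide_right_mono)
  thus ?thesis using assms(1) by (simp add: trunc_exp_def)
qed

definition trunc_exp1 :: "real \<Rightarrow> real \<Rightarrow> real" where
  "trunc_exp1 s z = exp_half_sq z * exp (- (exp_half_sq z / s)) * z"

definition trunc_exp2 :: "real \<Rightarrow> real \<Rightarrow> real" where
  "trunc_exp2 s z = exp_half_sq z * exp (- (exp_half_sq z / s)) * (1 + z\<^sup>2 - exp_half_sq z / s * z\<^sup>2)"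

definition trunc_exp3 :: "real \<Rightarrow> real \<Rightarrow> real" where
  "trunc_exp3 s z = exp_half_sq z * exp (- (exp_half_sq z / s)) * z *
     (3 * (1 - exp_half_sq z / s) + z\<^sup>2 * ((1 - exp_half_sq z / s)\<^sup>2 - exp_half_sq z / s))"

lemma exp_half_sq_deriv [derivative_intros]:
  assumes "(f has_real_derivative f') (at x within A)"
  shows "((\<lambda>x. exp_half_sq (f x)) has_real_derivative (exp_half_sq (f x) * f x * f')) (at x within A)"
  unfolding exp_half_sq_def
  by (auto intro!: derivative_eq_intros assms simp: field_simps)

lemma trunc_exp_derivs:
  assumes "s > 0"
  shows "(trunc_exp s has_real_derivative trunc_exp1 s z) (at z)"
    "(trunc_exp1 s has_real_derivative trunc_exp2 s z) (at z)"
    "(trunc_exp2 s has_real_derivative trunc_exp3 s z) (at z)"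
proof -
  show "(trunc_exp s has_real_derivative trunc_exp1 s z) (at z)"
    unfolding trunc_exp_def[abs_def] trunc_exp1_def using assms
    by (auto intro!: derivative_eq_intros simp: field_simps)
  show "(trunc_exp1 s has_real_derivative trunc_exp2 s z) (at z)"
    unfolding trunc_exp1_def[abs_def] trunc_exp2_def using assms
    by (auto intro!: derivative_eq_intros simp: field_simps power2_eq_square power3_eq_cube)
  show "(trunc_exp2 s has_real_derivative trunc_exp3 s z) (at z)"
    unfolding trunc_exp2_def[abs_def] trunc_exp3_def using assms
    by (auto intro!: derivative_eq_intros simp: field_simps power2_eq_square power3_eq_cube)
qed

text \<open>With y = exp_half_sq z / s every derivative is s * y * exp (- y) times a polynomial in y
  and z. From z^2 / 2 = ln s + ln y both z^2 and \<bar>z\<bar> are O(ln s * (1 + y)), and exp (- y)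
  absorbs all powers of 1 + y. Grouping z^3 as z * z^2 keeps the power of ln s at two.\<close>

lemma trunc_exp_deriv_bounds:
  assumes s: "ln s \<ge> 1" "s > 0"
  shows "\<bar>trunc_exp1 s z\<bar> \<le> 70000 * s * (ln s)\<^sup>2" "\<bar>trunc_exp2 s z\<bar> \<le> 70000 * s * (ln s)\<^sup>2"
    "\<bar>trunc_exp3 s z\<bar> \<le> 70000 * s * (ln s)\<^sup>2"
proof -
  define y where "y = exp_half_sq z / s"
  define l where "l = ln s"
  have l: "l \<ge> 1" using s by (simp add: l_def)
  have y: "y > 0" "exp_half_sq z = s * y"
    using s by (auto simp: y_def)
  have "z\<^sup>2 / 2 = ln (s * y)" unfolding y(2)[symmetric] by (simp add: exp_half_sq_def)
  also have "\<dots> = l + ln y" using y s by (simp add: ln_mult l_def)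
  also have "ln y \<le> y" using ln_le_minus_one[OF y(1)] by linarith
  finally have "z\<^sup>2 \<le> 2 * l + 2 * y" by linarith
  also have "\<dots> \<le> 2 * l + 2 * (l * y)" using l y by simp
  finally have z2: "z\<^sup>2 \<le> 2 * l * (1 + y)" by (simp add: algebra_simps)
  have "0 \<le> (\<bar>z\<bar> - 1)\<^sup>2 + \<bar>z\<bar>" by simp
  hence "\<bar>z\<bar> \<le> 1 + z\<^sup>2" by (simp add: power2_eq_square algebra_simps)
  also have "1 \<le> l * (1 + y)" using l y by (simp add: mult_ge1_I)
  finally have z1: "\<bar>z\<bar> \<le> 3 * l * (1 + y)" using z2 by linarith
  have z1': "\<bar>z\<bar> \<le> 3 * l * (1 + y)" by fact
  \<comment> \<open>The fifth power is the largest one that occurs: in the third derivative one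
    factor comes from y, one from the bound on z and three from the bracket. Comparison with (1 + y
    / 5)^5 \<le> exp y gives the constant 5^5 = 3125.\<close>
  define Q where "Q = (1 + y) ^ 5"
  have "(1 + y / 5) ^ 5 \<le> exp y"
    using exp_ge_one_plus_x_over_n_power_n[of 5 y] y by simp
  moreover have "Q \<le> (5 * (1 + y / 5)) ^ 5"
    unfolding Q_def using y by (intro power_mono) auto
  moreover have "(5 * (1 + y / 5)) ^ 5 = 3125 * (1 + y / 5) ^ 5"
    unfolding power_mult_distrib by simp
  ultimately have Q: "exp (- y) * Q \<le> 3125" by (simp add: exp_minus field_simps)
  have ql: "l \<le> l\<^sup>2" using l by (simp add: power2_eq_square)
  have pw: "(1 + y) ^ k \<le> Q" if "k \<le> 5" for k
    unfolding Q_def using y that by (intro power_increasing) auto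
  \<comment> \<open>The factor 21 = 3 * 7 is the worst case, reached by the third derivative, and 21
    * 3125 lies below 70000.\<close>
  have main: "\<bar>s * y * exp (- y) * r\<bar> \<le> 70000 * s * l\<^sup>2" if r: "\<bar>y * r\<bar> \<le> 21 * l\<^sup>2 * Q" for r
  proof -
    have "\<bar>s * y * exp (- y) * r\<bar> = s * exp (- y) * \<bar>y * r\<bar>"
      using s y by (simp add: abs_mult)
    also have "\<dots> \<le> s * exp (- y) * (21 * l\<^sup>2 * Q)"
      using r s by (intro mult_left_mono) auto
    also have "\<dots> = s * l\<^sup>2 * 21 * (exp (- y) * Q)" by simp
    also have "\<dots> \<le> s * l\<^sup>2 * 21 * 3125" using Q s by (intro mult_left_mono) auto
    also have "\<dots> \<le> 70000 * s * l\<^sup>2" using s by simp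
    finally show ?thesis .
  qed
  have ly: "l * (1 + y) ^ k \<le> l\<^sup>2 * Q" if "k \<le> 5" for k
    using pw[OF that] ql l y by (intro mult_mono) auto
  have "\<bar>y * z\<bar> \<le> 21 * l\<^sup>2 * Q"
  proof -
    have "\<bar>y * z\<bar> \<le> (1 + y) * (3 * l * (1 + y))"
      unfolding abs_mult using y z1 by (intro mult_mono) auto
    also have "\<dots> = 3 * (l * (1 + y) ^ 2)" by (simp add: power2_eq_square)
    also have "\<dots> \<le> 21 * (l\<^sup>2 * Q)"
      by (rule order_trans[OF mult_left_mono[OF ly]]) (auto simp: Q_def intro!: mult_right_mono less_imp_le[OF y(1)] mult_nonneg_nonneg, use y in auto)
    finally show ?thesis by simp
  qed
  from main[OF this] show "\<bar>trunc_exp1 s z\<bar> \<le> 70000 * s * (ln s)\<^sup>2"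
    unfolding trunc_exp1_def y(2) l_def using s by simp
  have Q0: "0 \<le> l\<^sup>2 * Q" unfolding Q_def using y by auto
  have "\<bar>y * (1 + z\<^sup>2 - y * z\<^sup>2)\<bar> \<le> 21 * l\<^sup>2 * Q"
  proof -
    have "\<bar>1 + z\<^sup>2 - y * z\<^sup>2\<bar> \<le> 1 + z\<^sup>2 + y * z\<^sup>2" using y by (simp add: abs_le_iff)
    also have "\<dots> = 1 + (1 + y) * z\<^sup>2" by (simp add: algebra_simps)
    also have "\<dots> \<le> l * (1 + y) ^ 2 + (1 + y) * (2 * l * (1 + y))"
      using y z2 l by (intro add_mono mult_left_mono mult_ge1_I) auto
    also have "\<dots> = 3 * (l * (1 + y) ^ 2)" by (simp add: power2_eq_square algebra_simps)
    finally have "\<bar>y * (1 + z\<^sup>2 - y * z\<^sup>2)\<bar> \<le> (1 + y) * (3 * (l * (1 + y) ^ 2))"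
      unfolding abs_mult using y by (intro mult_mono) auto
    also have "\<dots> = 3 * (l * (1 + y) ^ 3)" by (simp add: power2_eq_square power3_eq_cube)
    also have "\<dots> \<le> 3 * (l\<^sup>2 * Q)" using ly[of 3] by simp
    also have "\<dots> \<le> 21 * (l\<^sup>2 * Q)" using Q0 by linarith
    finally show ?thesis by simp
  qed
  from main[OF this] show "\<bar>trunc_exp2 s z\<bar> \<le> 70000 * s * (ln s)\<^sup>2"
    unfolding trunc_exp2_def y(2) l_def using s by simp
  have "\<bar>y * (z * (3 * (1 - y) + z\<^sup>2 * ((1 - y)\<^sup>2 - y)))\<bar> \<le> 21 * l\<^sup>2 * Q"
  proof -
    have b1: "\<bar>(1 - y)\<^sup>2 - y\<bar> \<le> 2 * (1 + y)\<^sup>2"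
      using y by (simp add: abs_le_iff power2_eq_square algebra_simps)
    have "\<bar>3 * (1 - y) + z\<^sup>2 * ((1 - y)\<^sup>2 - y)\<bar> \<le> \<bar>3 * (1 - y)\<bar> + \<bar>z\<^sup>2 * ((1 - y)\<^sup>2 - y)\<bar>"
      by (rule abs_triangle_ineq)
    also have "\<bar>3 * (1 - y)\<bar> \<le> 3 * (l * (1 + y) ^ 3)"
    proof -
      have "\<bar>3 * (1 - y)\<bar> \<le> 3 * (1 + y) ^ 1" using y by (simp add: abs_le_iff)
      also have "(1 + y) ^ 1 \<le> (1 + y) ^ 3" using y by (intro power_increasing) auto
      also have "(1 + y) ^ 3 \<le> l * (1 + y) ^ 3" using l y by simp
      finally show ?thesis by simp
    qed
    also have "\<bar>z\<^sup>2 * ((1 - y)\<^sup>2 - y)\<bar> \<le> (2 * l * (1 + y)) * (2 * (1 + y)\<^sup>2)"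
      unfolding abs_mult using z2 b1 y l by (intro mult_mono) auto
    also have "\<dots> = 4 * (l * (1 + y) ^ 3)" by (simp add: power2_eq_square power3_eq_cube)
    finally have b2: "\<bar>3 * (1 - y) + z\<^sup>2 * ((1 - y)\<^sup>2 - y)\<bar> \<le> 7 * (l * (1 + y) ^ 3)" by simp
    have "\<bar>y * (z * (3 * (1 - y) + z\<^sup>2 * ((1 - y)\<^sup>2 - y)))\<bar>
        \<le> (1 + y) * ((3 * l * (1 + y)) * (7 * (l * (1 + y) ^ 3)))"
      unfolding abs_mult using b2[unfolded abs_mult] z1 y l by (intro mult_mono) auto
    also have "\<dots> = 21 * l\<^sup>2 * Q" by (simp add: Q_def power2_eq_square eval_nat_numeral)
    finally show ?thesis .
  qed
  from main[OF this] show "\<bar>trunc_exp3 s z\<bar> \<le> 70000 * s * (ln s)\<^sup>2"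
    unfolding trunc_exp3_def y(2) l_def using s by (simp add: mult.assoc)
qed

section \<open>Third-order expansions along a direction\<close>

lemma taylor3_bound:
  fixes f f1 f2 f3 :: "real \<Rightarrow> real"
  assumes "\<And>x. (f has_real_derivative f1 x) (at x)" "\<And>x. (f1 has_real_derivative f2 x) (at x)"
    "\<And>x. (f2 has_real_derivative f3 x) (at x)" "\<And>x. \<bar>f3 x\<bar> \<le> D"
  shows "\<bar>f y - f 0 - y * f1 0 - y\<^sup>2 * (f2 0 / 2)\<bar> \<le> D * \<bar>y\<bar> ^ 3"
proof -
  define df where "df = (\<lambda>m::nat. if m = 0 then f else if m = 1 then f1 else if m = 2 then f2 else f3)"
  have "\<exists>t. \<bar>t\<bar> \<le> \<bar>y\<bar> \<and> f y = (\<Sum>m<3. df m 0 / fact m * y ^ m) + df 3 t / fact 3 * y ^ 3"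
  proof (rule Maclaurin_bi_le)
    show "df 0 = f" by (simp add: df_def)
    show "\<forall>m t. m < 3 \<and> \<bar>t\<bar> \<le> \<bar>y\<bar> \<longrightarrow> (df m has_real_derivative df (Suc m) t) (at t)"
      using assms(1-3) by (auto simp: df_def eval_nat_numeral less_Suc_eq)
  qed
  then obtain t where t: "f y = (\<Sum>m<3. df m 0 / fact m * y ^ m) + df 3 t / fact 3 * y ^ 3" by auto
  have "f y - f 0 - y * f1 0 - y\<^sup>2 * (f2 0 / 2) = f3 t / 6 * y ^ 3"
    using t by (simp add: df_def eval_nat_numeral)
  also have "\<bar>\<dots>\<bar> = \<bar>f3 t\<bar> / 6 * \<bar>y\<bar> ^ 3" by (simp add: abs_mult power_abs)
  also have "\<dots> \<le> D * \<bar>y\<bar> ^ 3"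
    using assms(4)[of t] by (intro mult_right_mono) auto
  finally show ?thesis .
qed

text \<open>The direction c lists the coefficients of one error in all coordinates, so adding that
  error moves F along c. L and Q may depend on the base point z but not on y: for an error with mean
  0 and variance 1 only F z + Q survives integration, up to D times the third absolute
  moment.\<close>

definition cubic_along :: "((nat \<Rightarrow> real) \<Rightarrow> real) \<Rightarrow> (nat \<Rightarrow> real) \<Rightarrow> real \<Rightarrow> bool" where
  "cubic_along F c D \<longleftrightarrow>
    (\<forall>z. \<exists>L Q. \<forall>y. \<bar>F (\<lambda>j. z j + y * c j) - F z - y * L - y\<^sup>2 * Q\<bar> \<le> D * \<bar>y\<bar> ^ 3)"

lemma cubic_alongI:
  assumes "\<And>z x. ((\<lambda>y. F (\<lambda>j. z j + y * c j)) has_real_derivative F1 z x) (at x)"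
    "\<And>z x. (F1 z has_real_derivative F2 z x) (at x)"
    "\<And>z x. (F2 z has_real_derivative F3 z x) (at x)" "\<And>z x. \<bar>F3 z x\<bar> \<le> D"
  shows "cubic_along F c D"
  unfolding cubic_along_def
proof (intro allI exI)
  fix z y
  show "\<bar>F (\<lambda>j. z j + y * c j) - F z - y * F1 z 0 - y\<^sup>2 * (F2 z 0 / 2)\<bar> \<le> D * \<bar>y\<bar> ^ 3"
    using taylor3_bound[OF assms(1)[of z] assms(2)[of z] assms(3)[of z] assms(4)[of z], of y] by simp
qed

lemma trunc_exp_line_derivs:
  assumes "s > 0"
  shows "((\<lambda>y. trunc_exp s (z + y * c)) has_real_derivative c * trunc_exp1 s (z + x * c)) (at x)"
    "((\<lambda>y. trunc_exp1 s (z + y * c)) has_real_derivative c * trunc_exp2 s (z + x * c)) (at x)"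
    "((\<lambda>y. trunc_exp2 s (z + y * c)) has_real_derivative c * trunc_exp3 s (z + x * c)) (at x)"
proof -
  have l: "((\<lambda>y. z + y * c) has_real_derivative c) (at x)"
    by (auto intro!: derivative_eq_intros)
  note ch = DERIV_chain2[OF _ l, THEN DERIV_cong]
  show "((\<lambda>y. trunc_exp s (z + y * c)) has_real_derivative c * trunc_exp1 s (z + x * c)) (at x)"
    by (rule ch[OF trunc_exp_derivs(1)[OF assms]]) simp
  show "((\<lambda>y. trunc_exp1 s (z + y * c)) has_real_derivative c * trunc_exp2 s (z + x * c)) (at x)"
    by (rule ch[OF trunc_exp_derivs(2)[OF assms]]) simp
  show "((\<lambda>y. trunc_exp2 s (z + y * c)) has_real_derivative c * trunc_exp3 s (z + x * c)) (at x)"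
    by (rule ch[OF trunc_exp_derivs(3)[OF assms]]) simp
qed

text \<open>Serves to carry the mean of a single truncated summand from Gaussian errors over to the
  true ones.\<close>

lemma cubic_along_trunc_exp:
  assumes s: "ln s \<ge> 1" "s > 0"
  shows "cubic_along (\<lambda>z. trunc_exp s (z j)) c (70000 * s * (ln s)\<^sup>2 * \<bar>c j\<bar> ^ 3)"
proof (rule cubic_alongI)
  fix z x
  show "((\<lambda>y. trunc_exp s (z j + y * c j)) has_real_derivative c j * trunc_exp1 s (z j + x * c j)) (at x)"
    by (rule trunc_exp_line_derivs(1)[OF s(2)])
  show "((\<lambda>x. c j * trunc_exp1 s (z j + x * c j)) has_real_derivative c j * (c j * trunc_exp2 s (z j + x * c j))) (at x)"
    by (rule DERIV_cmult[OF trunc_exp_line_derivs(2)[OF s(2)]])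
  show "((\<lambda>x. c j * (c j * trunc_exp2 s (z j + x * c j))) has_real_derivative
      c j * (c j * (c j * trunc_exp3 s (z j + x * c j)))) (at x)"
    by (intro DERIV_cmult trunc_exp_line_derivs(3)[OF s(2)])
  have "\<bar>c j * (c j * (c j * trunc_exp3 s (z j + x * c j)))\<bar> = \<bar>trunc_exp3 s (z j + x * c j)\<bar> * \<bar>c j\<bar> ^ 3"
    by (simp add: abs_mult power3_eq_cube)
  also have "\<dots> \<le> 70000 * s * (ln s)\<^sup>2 * \<bar>c j\<bar> ^ 3"
    using trunc_exp_deriv_bounds(3)[OF s] by (intro mult_right_mono) auto
  finally show "\<bar>c j * (c j * (c j * trunc_exp3 s (z j + x * c j)))\<bar> \<le> 70000 * s * (ln s)\<^sup>2 * \<bar>c j\<bar> ^ 3" .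
qed

lemma sum_abs_power_le:
  fixes c :: "'i \<Rightarrow> real"
  assumes "finite J"
  shows "(\<Sum>j\<in>J. \<bar>c j\<bar> ^ Suc k) \<le> (\<Sum>j\<in>J. \<bar>c j\<bar>) ^ Suc k"
proof (induction k)
  case (Suc k)
  have "(\<Sum>j\<in>J. \<bar>c j\<bar> ^ Suc (Suc k)) \<le> (\<Sum>j\<in>J. \<bar>c j\<bar> ^ Suc k * (\<Sum>j\<in>J. \<bar>c j\<bar>))"
  proof (rule sum_mono)
    fix j assume "j \<in> J"
    hence "\<bar>c j\<bar> \<le> (\<Sum>j\<in>J. \<bar>c j\<bar>)" using assms by (intro member_le_sum) auto
    thus "\<bar>c j\<bar> ^ Suc (Suc k) \<le> \<bar>c j\<bar> ^ Suc k * (\<Sum>j\<in>J. \<bar>c j\<bar>)"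
      by (simp only: power_Suc2[of _ "Suc k"]) (intro mult_left_mono, auto)
  qed
  also have "\<dots> = (\<Sum>j\<in>J. \<bar>c j\<bar> ^ Suc k) * (\<Sum>j\<in>J. \<bar>c j\<bar>)" by (simp add: sum_distrib_right)
  also have "\<dots> \<le> (\<Sum>j\<in>J. \<bar>c j\<bar>) ^ Suc k * (\<Sum>j\<in>J. \<bar>c j\<bar>)"
    using Suc by (intro mult_right_mono) (auto intro: sum_nonneg)
  finally show ?case by (simp add: mult.commute)
qed simp

text \<open>Up to bounded factors the third derivative of cos (t * q + \<theta>) along the line
  consists of t * q''', 3 * t^2 * q' * q'' and t^3 * q'^3. The k-th derivative of q is at most P
  times the k-th power of the absolute sum of c, so every term is cubic in that sum; P is the
  derivative bound of \<open>trunc_exp\<close> divided by a.\<close>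

lemma cubic_along_cos:
  fixes a t \<theta> :: real
  assumes s: "ln s \<ge> 1" "s > 0" and a: "a > 0" and J: "finite J"
  defines "P \<equiv> 70000 * (s / a) * (ln s)\<^sup>2"
  shows "cubic_along (\<lambda>z. cos (t * (\<Sum>j\<in>J. trunc_exp s (z j) / a) + \<theta>)) c
      ((\<bar>t\<bar> * P + 3 * t\<^sup>2 * P\<^sup>2 + \<bar>t\<bar> ^ 3 * P ^ 3) * (\<Sum>j\<in>J. \<bar>c j\<bar>) ^ 3)"
proof -
  define C where "C = (\<Sum>j\<in>J. \<bar>c j\<bar>)"
  define q where "q = (\<lambda>z x. \<Sum>j\<in>J. trunc_exp s (z j + x * c j) / a)"
  define q1 where "q1 = (\<lambda>z x. \<Sum>j\<in>J. c j * trunc_exp1 s (z j + x * c j) / a)"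
  define q2 where "q2 = (\<lambda>z x. \<Sum>j\<in>J. c j * (c j * trunc_exp2 s (z j + x * c j)) / a)"
  define q3 where "q3 = (\<lambda>z x. \<Sum>j\<in>J. c j * (c j * (c j * trunc_exp3 s (z j + x * c j))) / a)"
  have P0: "P \<ge> 0" unfolding P_def using s a by simp
  have C0: "C \<ge> 0" unfolding C_def by (intro sum_nonneg) auto
  have d [derivative_intros]:
    "(q z has_real_derivative q1 z x) (at x)" "(q1 z has_real_derivative q2 z x) (at x)"
    "(q2 z has_real_derivative q3 z x) (at x)" for z x
    unfolding q_def q1_def q2_def q3_def
    by (intro DERIV_sum DERIV_cdivide DERIV_cmult trunc_exp_line_derivs s)+
  have bnd: "\<bar>\<Sum>j\<in>J. r j\<bar> \<le> P * C ^ Suc k"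
    if r: "\<And>j. j \<in> J \<Longrightarrow> \<bar>r j\<bar> \<le> P * \<bar>c j\<bar> ^ Suc k" for r :: "nat \<Rightarrow> real" and k
  proof -
    have "\<bar>\<Sum>j\<in>J. r j\<bar> \<le> (\<Sum>j\<in>J. P * \<bar>c j\<bar> ^ Suc k)"
      by (rule order_trans[OF sum_abs sum_mono]) (rule r)
    also have "\<dots> = P * (\<Sum>j\<in>J. \<bar>c j\<bar> ^ Suc k)" by (simp add: sum_distrib_left)
    also have "\<dots> \<le> P * C ^ Suc k" unfolding C_def using P0 by (intro mult_left_mono sum_abs_power_le J)
    finally show ?thesis .
  qed
  have tb: "\<bar>v / a\<bar> \<le> P" if "\<bar>v\<bar> \<le> 70000 * s * (ln s)\<^sup>2" for v
    using that a unfolding P_def by (simp add: abs_div field_simps)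
  have b1: "\<bar>q1 z x\<bar> \<le> P * C ^ Suc 0" for z x
    unfolding q1_def
  proof (rule bnd)
    fix j
    have "\<bar>trunc_exp1 s (z j + x * c j) / a\<bar> * (\<bar>c j\<bar>) \<le> P * (\<bar>c j\<bar>)"
      by (rule mult_right_mono[OF tb[OF trunc_exp_deriv_bounds(1)[OF s]]]) auto
    thus "\<bar>c j * trunc_exp1 s (z j + x * c j) / a\<bar> \<le> P * \<bar>c j\<bar> ^ Suc 0"
      by (simp add: abs_mult abs_div mult_ac eval_nat_numeral del: abs_mult_self_eq)
  qed
  have b2: "\<bar>q2 z x\<bar> \<le> P * C ^ Suc 1" for z x
    unfolding q2_def
  proof (rule bnd)
    fix j
    have "\<bar>trunc_exp2 s (z j + x * c j) / a\<bar> * (\<bar>c j\<bar> * \<bar>c j\<bar>) \<le> P * (\<bar>c j\<bar> * \<bar>c j\<bar>)"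
      by (rule mult_right_mono[OF tb[OF trunc_exp_deriv_bounds(2)[OF s]]]) auto
    thus "\<bar>c j * (c j * trunc_exp2 s (z j + x * c j)) / a\<bar> \<le> P * \<bar>c j\<bar> ^ Suc 1"
      by (simp add: abs_mult abs_div mult_ac eval_nat_numeral del: abs_mult_self_eq)
  qed
  have b3: "\<bar>q3 z x\<bar> \<le> P * C ^ Suc 2" for z x
    unfolding q3_def
  proof (rule bnd)
    fix j
    have "\<bar>trunc_exp3 s (z j + x * c j) / a\<bar> * (\<bar>c j\<bar> * (\<bar>c j\<bar> * \<bar>c j\<bar>)) \<le> P * (\<bar>c j\<bar> * (\<bar>c j\<bar> * \<bar>c j\<bar>))"
      by (rule mult_right_mono[OF tb[OF trunc_exp_deriv_bounds(3)[OF s]]]) auto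
    thus "\<bar>c j * (c j * (c j * trunc_exp3 s (z j + x * c j))) / a\<bar> \<le> P * \<bar>c j\<bar> ^ Suc 2"
      by (simp add: abs_mult abs_div mult_ac eval_nat_numeral del: abs_mult_self_eq)
  qed
  show ?thesis
  proof (rule cubic_alongI)
    fix z x
    show "((\<lambda>y. cos (t * (\<Sum>j\<in>J. trunc_exp s (z j + y * c j) / a) + \<theta>)) has_real_derivative
        - sin (t * q z x + \<theta>) * (t * q1 z x)) (at x)"
    proof -
      have "((\<lambda>y. cos (t * q z y + \<theta>)) has_real_derivative - sin (t * q z x + \<theta>) * (t * q1 z x)) (at x)"
        by (auto intro!: derivative_eq_intros)
      thus ?thesis by (simp only: q_def)
    qed
    show "((\<lambda>x. - sin (t * q z x + \<theta>) * (t * q1 z x)) has_real_derivative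
        - cos (t * q z x + \<theta>) * (t * q1 z x)\<^sup>2 - sin (t * q z x + \<theta>) * (t * q2 z x)) (at x)"
      by (auto intro!: derivative_eq_intros simp: power2_eq_square algebra_simps)
    show "((\<lambda>x. - cos (t * q z x + \<theta>) * (t * q1 z x)\<^sup>2 - sin (t * q z x + \<theta>) * (t * q2 z x)) has_real_derivative
        sin (t * q z x + \<theta>) * (t * q1 z x) ^ 3 - 3 * (cos (t * q z x + \<theta>) * (t * q1 z x) * (t * q2 z x))
          - sin (t * q z x + \<theta>) * (t * q3 z x)) (at x)"
      by (auto intro!: derivative_eq_intros simp: power2_eq_square power3_eq_cube algebra_simps)
    have m1: "\<bar>t * q1 z x\<bar> \<le> \<bar>t\<bar> * P * C"
      using mult_left_mono[OF b1[of z x] abs_ge_zero[of t]] by (simp add: abs_mult mult_ac)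
    have m2: "\<bar>t * q2 z x\<bar> \<le> \<bar>t\<bar> * P * C\<^sup>2"
      using mult_left_mono[OF b2[of z x] abs_ge_zero[of t]] by (simp add: abs_mult mult_ac power2_eq_square)
    have m3: "\<bar>t * q3 z x\<bar> \<le> \<bar>t\<bar> * P * C ^ 3"
      using mult_left_mono[OF b3[of z x] abs_ge_zero[of t]] by (simp add: abs_mult mult_ac eval_nat_numeral)
    have aux: "\<bar>u * v\<bar> \<le> w" if "\<bar>u\<bar> \<le> 1" "\<bar>v\<bar> \<le> w" for u v w :: real
      using mult_mono[OF that(1) that(2)] by (simp add: abs_mult)
    have e1: "\<bar>sin (t * q z x + \<theta>) * (t * q1 z x) ^ 3\<bar> \<le> (\<bar>t\<bar> * P * C) ^ 3"
      by (rule aux[OF abs_sin_le_one]) (simp only: power_abs power_mono[OF m1 abs_ge_zero])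
    have "\<bar>(t * q1 z x) * (t * q2 z x)\<bar> \<le> (\<bar>t\<bar> * P * C) * (\<bar>t\<bar> * P * C\<^sup>2)"
      unfolding abs_mult[of "t * q1 z x"] using m1 m2 P0 C0 by (intro mult_mono) auto
    from aux[OF abs_cos_le_one this]
    have e2: "\<bar>cos (t * q z x + \<theta>) * (t * q1 z x) * (t * q2 z x)\<bar> \<le> (\<bar>t\<bar> * P * C) * (\<bar>t\<bar> * P * C\<^sup>2)"
      by (simp only: mult.assoc)
    have e3: "\<bar>sin (t * q z x + \<theta>) * (t * q3 z x)\<bar> \<le> \<bar>t\<bar> * P * C ^ 3"
      by (rule aux[OF abs_sin_le_one m3])
    have "\<bar>sin (t * q z x + \<theta>) * (t * q1 z x) ^ 3 - 3 * (cos (t * q z x + \<theta>) * (t * q1 z x) * (t * q2 z x))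
          - sin (t * q z x + \<theta>) * (t * q3 z x)\<bar>
        \<le> (\<bar>t\<bar> * P * C) ^ 3 + 3 * ((\<bar>t\<bar> * P * C) * (\<bar>t\<bar> * P * C\<^sup>2)) + \<bar>t\<bar> * P * C ^ 3"
      using e1 e2 e3 by linarith
    also have "\<dots> = (\<bar>t\<bar> * P + 3 * t\<^sup>2 * P\<^sup>2 + \<bar>t\<bar> ^ 3 * P ^ 3) * C ^ 3"
    proof -
      have "t\<^sup>2 = \<bar>t\<bar> * \<bar>t\<bar>" by (simp add: power2_eq_square)
      thus ?thesis by (simp add: power2_eq_square power3_eq_cube algebra_simps)
    qed
    finally show "\<bar>sin (t * q z x + \<theta>) * (t * q1 z x) ^ 3 - 3 * (cos (t * q z x + \<theta>) * (t * q1 z x) * (t * q2 z x))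
          - sin (t * q z x + \<theta>) * (t * q3 z x)\<bar>
        \<le> (\<bar>t\<bar> * P + 3 * t\<^sup>2 * P\<^sup>2 + \<bar>t\<bar> ^ 3 * P ^ 3) * (\<Sum>j\<in>J. \<bar>c j\<bar>) ^ 3"
      by (simp add: C_def)
  qed
qed

section \<open>Perturbation and truncation of the summands under the cosine\<close>

lemma abs_cos_diff_le: "\<bar>cos x - cos y\<bar> \<le> \<bar>x - y\<bar>" for x y :: real
proof -
  have "\<bar>cos x - cos y\<bar> = 2 * \<bar>sin ((x + y) / 2)\<bar> * \<bar>sin ((y - x) / 2)\<bar>"
    by (simp add: cos_diff_cos abs_mult)
  also have "\<dots> \<le> 2 * 1 * \<bar>(y - x) / 2\<bar>"
    by (intro mult_mono abs_sin_x_le_abs_x) auto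
  finally show ?thesis by simp
qed

lemma abs_exp_minus_1_le: "\<bar>exp u - 1\<bar> \<le> \<bar>u\<bar> * exp \<bar>u\<bar>" for u :: real
proof (cases "u \<ge> 0")
  case True
  have "1 - u \<le> exp (- u)" using exp_ge_add_one_self[of "- u"] by simp
  hence "(1 - u) * exp u \<le> exp (- u) * exp u" by (intro mult_right_mono) auto
  hence "exp u - 1 \<le> u * exp u" by (simp add: algebra_simps flip: exp_add)
  thus ?thesis using True by simp
next
  case False
  have "1 - exp u \<le> - u * 1" using exp_ge_add_one_self[of u] by linarith
  also have "\<dots> \<le> - u * exp (- u)" using False by (intro mult_left_mono) auto
  finally show ?thesis using False by simp
qed

text \<open>The quotient of the two exponentials is exp (g * h + h^2 / 2) with h = w - g. The
  envelope D enters the exponential factor, which thus is the same for all summands, while the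
  individual d stays linear and can be summed.\<close>

lemma exp_half_sq_perturb:
  assumes "\<bar>g\<bar> \<le> m" "\<bar>w - g\<bar> \<le> d" "d \<le> D"
  shows "\<bar>exp_half_sq w - exp_half_sq g\<bar> \<le> (m + D) * exp (D * m + D\<^sup>2 / 2) * d * exp_half_sq g"
proof -
  define h where "h = w - g"
  define u where "u = g * h + h\<^sup>2 / 2"
  have h: "\<bar>h\<bar> \<le> d" and D: "D \<ge> 0" "m \<ge> 0" "d \<ge> 0" using assms by (auto simp: h_def)
  have "w\<^sup>2 / 2 = g\<^sup>2 / 2 + u" by (simp add: u_def h_def power2_eq_square field_simps)
  hence w: "exp_half_sq w = exp_half_sq g * exp u" by (simp only: exp_half_sq_def exp_add)
  have "\<bar>u\<bar> \<le> \<bar>g\<bar> * \<bar>h\<bar> + \<bar>h\<bar> * \<bar>h\<bar> / 2"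
    unfolding u_def by (rule order_trans[OF abs_triangle_ineq]) (simp add: abs_mult power2_eq_square)
  also have "\<dots> \<le> m * d + D * d / 2"
    using assms(1) h D assms(3) by (intro add_mono mult_mono divide_right_mono) auto
  finally have u1: "\<bar>u\<bar> \<le> m * d + D * d / 2" .
  have u2: "\<bar>u\<bar> \<le> (m + D) * d"
    using u1 mult_nonneg_nonneg[OF D(1,3)] by (simp add: algebra_simps)
  have "m * d + D * d / 2 \<le> m * D + D * D / 2"
    using D assms(3) by (intro add_mono mult_mono divide_right_mono) auto
  hence u3: "\<bar>u\<bar> \<le> D * m + D\<^sup>2 / 2" using u1 by (simp add: power2_eq_square mult.commute)
  have "\<bar>exp_half_sq w - exp_half_sq g\<bar> = exp_half_sq g * \<bar>exp u - 1\<bar>"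
    unfolding w by (subst abs_of_pos[OF exp_half_sq_pos, symmetric], subst abs_mult[symmetric]) (simp add: algebra_simps)
  also have "\<bar>exp u - 1\<bar> \<le> \<bar>u\<bar> * exp \<bar>u\<bar>" by (rule abs_exp_minus_1_le)
  also have "\<dots> \<le> ((m + D) * d) * exp (D * m + D\<^sup>2 / 2)"
    using u2 u3 D by (intro mult_mono) auto
  finally show ?thesis by (simp add: mult_ac less_imp_le[OF exp_half_sq_pos] mult_left_mono)
qed

text \<open>Both errors, of the perturbation and of the truncation, are expressed through
  \<open>trunc_exp s (G j)\<close>, whose mean is under control, and not through
  \<open>exp_half_sq (G j)\<close>, which has no finite mean for a standard normal
  \<open>G j\<close>. If some summand exceeds A * a, the trivial bound 2 is at most 4 / (A * a)
  times its truncated value. Otherwise every \<open>G j\<close> is at most m in absolute value, and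
  each summand changes by a small multiple of its truncated value.\<close>

lemma perturb_cos:
  fixes a A t \<theta> D :: real and W G d :: "nat \<Rightarrow> real"
  assumes a: "a > 0" "A \<ge> 1" "A * a \<ge> 1" and J: "finite J"
    and d: "\<And>j. j \<in> J \<Longrightarrow> \<bar>W j - G j\<bar> \<le> d j" "\<And>j. j \<in> J \<Longrightarrow> d j \<le> D"
  defines "m \<equiv> sqrt (2 * ln (A * a))"
  defines "E \<equiv> (m + D) * exp (D * m + D\<^sup>2 / 2)"
  defines "s \<equiv> A\<^sup>2 * a"
  shows "\<bar>cos (t * (\<Sum>j\<in>J. exp_half_sq (W j) / a) + \<theta>) - cos (t * (\<Sum>j\<in>J. trunc_exp s (G j) / a) + \<theta>)\<bar>
    \<le> (\<Sum>j\<in>J. (4 / (A * a) + \<bar>t\<bar> * (1 / (A * a) + 2 * E * d j / a)) * trunc_exp s (G j))"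
proof (cases "J = {}")
  case False
  define H where "H = (\<lambda>j. 1 / (A * a) + 2 * E * d j / a)"
  have D0: "D \<ge> 0"
  proof -
    obtain j where "j \<in> J" using False by auto
    from d[OF this] show ?thesis by linarith
  qed
  have m0: "m \<ge> 0" using a by (simp add: m_def)
  have E0: "E \<ge> 0" using m0 D0 by (simp add: E_def)
  have dj: "d j \<ge> 0" if "j \<in> J" for j using d(1)[OF that] by linarith
  have H0: "H j \<ge> 0" if "j \<in> J" for j unfolding H_def using dj[OF that] E0 a by simp
  have "A * a \<le> A * (A * a)" using a by simp
  hence As: "0 < A * a" "A * a \<le> s" "s > 0" using a by (auto simp: s_def power2_eq_square algebra_simps)
  have f0: "trunc_exp s (G j) \<ge> 0" for j by (rule trunc_exp_bounds(1)[OF As(3)])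
  have nn: "0 \<le> (4 / (A * a) + \<bar>t\<bar> * H j) * trunc_exp s (G j)" if "j \<in> J" for j
    using H0[OF that] f0 As by simp
  show ?thesis
  proof (cases "\<exists>j\<in>J. exp_half_sq (G j) > A * a")
    case True
    then obtain j where j: "j \<in> J" "exp_half_sq (G j) > A * a" by auto
    have "\<bar>cos (t * (\<Sum>j\<in>J. exp_half_sq (W j) / a) + \<theta>) - cos (t * (\<Sum>j\<in>J. trunc_exp s (G j) / a) + \<theta>)\<bar> \<le> 2"
      using cos_le_one[of "t * (\<Sum>j\<in>J. exp_half_sq (W j) / a) + \<theta>"] cos_ge_minus_one[of "t * (\<Sum>j\<in>J. exp_half_sq (W j) / a) + \<theta>"]
        cos_le_one[of "t * (\<Sum>j\<in>J. trunc_exp s (G j) / a) + \<theta>"] cos_ge_minus_one[of "t * (\<Sum>j\<in>J. trunc_exp s (G j) / a) + \<theta>"]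
      by linarith
    also have "2 \<le> (4 / (A * a)) * trunc_exp s (G j)"
      using trunc_exp_ge(2)[OF As(1,2) j(2)] As by (simp add: field_simps)
    also have "\<dots> \<le> (4 / (A * a) + \<bar>t\<bar> * H j) * trunc_exp s (G j)"
      using H0[OF j(1)] f0 by (intro mult_right_mono) auto
    also have "\<dots> \<le> (\<Sum>j\<in>J. (4 / (A * a) + \<bar>t\<bar> * H j) * trunc_exp s (G j))"
      using nn J j by (intro member_le_sum) auto
    finally show ?thesis by (simp add: H_def)
  next
    case nb: False
    have "\<bar>cos (t * (\<Sum>j\<in>J. exp_half_sq (W j) / a) + \<theta>) - cos (t * (\<Sum>j\<in>J. trunc_exp s (G j) / a) + \<theta>)\<bar>
      \<le> \<bar>t * ((\<Sum>j\<in>J. exp_half_sq (W j) / a) - (\<Sum>j\<in>J. trunc_exp s (G j) / a))\<bar>"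
      by (rule order_trans[OF abs_cos_diff_le]) (simp add: algebra_simps)
    also have "\<dots> = \<bar>t\<bar> * \<bar>\<Sum>j\<in>J. (exp_half_sq (W j) - trunc_exp s (G j)) / a\<bar>"
      by (simp add: abs_mult sum_subtractf diff_divide_distrib)
    also have "\<dots> \<le> \<bar>t\<bar> * (\<Sum>j\<in>J. H j * trunc_exp s (G j))"
    proof (intro mult_left_mono order_trans[OF sum_abs] sum_mono)
      fix j assume j: "j \<in> J"
      have X: "exp_half_sq (G j) \<le> A * a" using nb j by auto
      have X2: "exp_half_sq (G j) \<le> 2 * trunc_exp s (G j)" by (rule trunc_exp_ge(1)[OF As(1,2) X])
      have "(G j)\<^sup>2 / 2 \<le> ln (A * a)"
        using X As unfolding exp_half_sq_def by (subst ln_ge_iff) auto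
      hence "(G j)\<^sup>2 \<le> m\<^sup>2" using a by (simp add: m_def)
      hence gm: "\<bar>G j\<bar> \<le> m" using m0 by (simp add: abs_le_square_iff[symmetric])
      have p1: "\<bar>exp_half_sq (W j) - exp_half_sq (G j)\<bar> \<le> E * d j * exp_half_sq (G j)"
        unfolding E_def by (rule exp_half_sq_perturb[OF gm d[OF j]])
      have "E * d j * exp_half_sq (G j) \<le> E * d j * (2 * trunc_exp s (G j))"
        using X2 E0 dj[OF j] by (intro mult_left_mono) auto
      hence p1': "\<bar>exp_half_sq (W j) - exp_half_sq (G j)\<bar> \<le> E * d j * (2 * trunc_exp s (G j))"
        using p1 by linarith
      have "\<bar>exp_half_sq (G j) - trunc_exp s (G j)\<bar> = exp_half_sq (G j) - trunc_exp s (G j)"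
        using trunc_exp_bounds(3)[OF As(3)] by simp
      also have "\<dots> \<le> (exp_half_sq (G j))\<^sup>2 / (2 * s)" by (rule trunc_exp_bounds(4)[OF As(3)])
      \<comment> \<open>One factor of the square is bounded by the level A * a, the other by twice
        the truncated value. The quotient is 1 / A because the truncation level s = A^2 * a lies a
        factor A above the exceedance level.\<close>
      also have "\<dots> \<le> (A * a) * (2 * trunc_exp s (G j)) / (2 * s)"
        unfolding power2_eq_square using X X2 As f0[of j]
        by (intro divide_right_mono mult_mono) (auto simp: less_imp_le[OF exp_half_sq_pos])
      also have "\<dots> = a / (A * a) * trunc_exp s (G j)"
        using a by (simp add: s_def power2_eq_square)
      finally have p2: "\<bar>exp_half_sq (G j) - trunc_exp s (G j)\<bar> \<le> a / (A * a) * trunc_exp s (G j)" .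
      have "\<bar>exp_half_sq (W j) - trunc_exp s (G j)\<bar> \<le> E * d j * (2 * trunc_exp s (G j)) + a / (A * a) * trunc_exp s (G j)"
        using p1' p2 by linarith
      also have "\<dots> = a * (H j * trunc_exp s (G j))"
        unfolding H_def using a by (simp add: field_simps)
      finally show "\<bar>(exp_half_sq (W j) - trunc_exp s (G j)) / a\<bar> \<le> H j * trunc_exp s (G j)"
        using a by (simp add: abs_div divide_le_eq mult.commute)
    qed auto
    also have "\<dots> \<le> (\<Sum>j\<in>J. (4 / (A * a) + \<bar>t\<bar> * H j) * trunc_exp s (G j))"
      unfolding sum_distrib_left using f0 As by (intro sum_mono) (simp add: algebra_simps)
    finally show ?thesis by (simp add: H_def)
  qed
qed simp

lemma trunc_exp_normal_expectation:
  assumes s: "ln s \<ge> 1" "s > 0" and r: "\<bar>r\<bar> \<le> 1"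
  shows "integral\<^sup>L std_normal_distribution (\<lambda>z. trunc_exp s (r * z)) \<le> exp 1 * sqrt (ln s)"
proof -
  define l where "l = ln s"
  have l: "l \<ge> 1" using s by (simp add: l_def)
  have pw: "trunc_exp s (r * z) \<le> exp (1 + (1 - 1 / l) * (z\<^sup>2 / 2))" for z
  proof -
    have "\<bar>r * z\<bar> \<le> \<bar>z\<bar>" using r by (simp add: abs_mult mult_left_le_one_le)
    hence "trunc_exp s (r * z) \<le> trunc_exp s z" by (rule trunc_exp_mono[OF s(2)])
    also have "\<dots> \<le> exp (min (z\<^sup>2 / 2) l)"
      using trunc_exp_bounds(2,3)[OF s(2), of z] s by (simp add: exp_half_sq_def l_def min_def)
    also have "min (z\<^sup>2 / 2) l \<le> 1 + (1 - 1 / l) * (z\<^sup>2 / 2)"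
    proof (cases "z\<^sup>2 / 2 \<le> l")
      case True
      hence "(z\<^sup>2 / 2) / l \<le> 1" using l by simp
      moreover have "(1 - 1 / l) * (z\<^sup>2 / 2) = z\<^sup>2 / 2 - (z\<^sup>2 / 2) / l"
        by (simp only: left_diff_distrib) simp
      ultimately show ?thesis using True by linarith
    next
      case False
      hence "(1 - 1 / l) * l \<le> (1 - 1 / l) * (z\<^sup>2 / 2)" using l by (intro mult_left_mono) auto
      moreover have "(1 - 1 / l) * l = l - 1" using l by (simp add: field_simps)
      moreover have "min (z\<^sup>2 / 2) l \<le> l" by simp
      ultimately show ?thesis by linarith
    qed
    finally show ?thesis by simp
  qed
  have eq: "std_normal_density z * exp (1 + (1 - 1 / l) * (z\<^sup>2 / 2)) = exp 1 * sqrt l * normal_density 0 (sqrt l) z" for z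
    unfolding normal_density_def std_normal_density_def using l
    by (simp add: exp_add real_sqrt_mult field_simps flip: exp_add) 
  have i2: "integrable lborel (\<lambda>z. exp 1 * sqrt l * normal_density 0 (sqrt l) z)"
    using l by (intro integrable_mult_right integrable_normal_density) auto
  have "integral\<^sup>L std_normal_distribution (\<lambda>z. trunc_exp s (r * z)) =
      (\<integral>z. std_normal_density z * trunc_exp s (r * z) \<partial>lborel)"
    by (subst integral_density) (auto intro!: AE_I2 simp: normal_density_nonneg)
  also have "\<dots> \<le> (\<integral>z. exp 1 * sqrt l * normal_density 0 (sqrt l) z \<partial>lborel)"
  proof (rule integral_mono)
    show "integrable lborel (\<lambda>z. std_normal_density z * trunc_exp s (r * z))"
    proof (rule Bochner_Integration.integrable_bound[OF i2])
      show "AE z in lborel. norm (std_normal_density z * trunc_exp s (r * z)) \<le> norm (exp 1 * sqrt l * normal_density 0 (sqrt l) z)"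
      proof (rule AE_I2)
        fix z
        have "norm (std_normal_density z * trunc_exp s (r * z)) = std_normal_density z * trunc_exp s (r * z)"
          using trunc_exp_bounds(1)[OF s(2)] by (simp add: normal_density_nonneg)
        also have "\<dots> \<le> exp 1 * sqrt l * normal_density 0 (sqrt l) z"
          unfolding eq[symmetric] by (intro mult_left_mono pw) (simp add: normal_density_nonneg)
        finally show "norm (std_normal_density z * trunc_exp s (r * z)) \<le> norm (exp 1 * sqrt l * normal_density 0 (sqrt l) z)"
          by simp
      qed
    qed measurable
  next
    show "std_normal_density z * trunc_exp s (r * z) \<le> exp 1 * sqrt l * normal_density 0 (sqrt l) z" for z
      unfolding eq[symmetric] by (intro mult_left_mono pw) (simp add: normal_density_nonneg)
  qed (fact i2)
  also have "\<dots> = exp 1 * sqrt l"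
    using l by (simp add: integral_normal_density)
  finally show ?thesis by (simp add: l_def)
qed

subsection \<open>The heavy-tailed limit\<close>

text \<open>The density of exp (Z^2 / 2) for a standard normal Z: both signs of Z contribute, and z
  = sqrt (2 * ln x) gives dx = x * z dz. It has an integrable singularity at x = 1, and its tail is
  just too heavy for a finite mean.\<close>

definition heavy_density :: "real \<Rightarrow> real" where
  "heavy_density x = indicator {1<..} x * (1 / (sqrt pi * x\<^sup>2 * sqrt (ln x)))"

lemma heavy_density_nonneg: "heavy_density x \<ge> 0"
  by (simp add: heavy_density_def indicator_def)

lemma heavy_density_measurable [measurable]: "heavy_density \<in> borel_measurable borel"
  unfolding heavy_density_def by measurable

text \<open>\<open>exp_half_sq\<close> is even and becomes injective on the positive half-line,
  where the substitution x = exp_half_sq z is made.\<close>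

lemma std_normal_half:
  fixes h :: "real \<Rightarrow> real"
  assumes [measurable]: "h \<in> borel_measurable borel" and B: "\<And>x. \<bar>h x\<bar> \<le> B"
  shows "integrable lborel (\<lambda>z. indicator {0<..} z * (2 * std_normal_density z * h (exp_half_sq z)))"
    "integral\<^sup>L std_normal_distribution (\<lambda>z. h (exp_half_sq z)) = (\<integral>z. indicator {0<..} z * (2 * std_normal_density z * h (exp_half_sq z)) \<partial>lborel)"
proof -
  define f where "f = (\<lambda>z. std_normal_density z * h (exp_half_sq z))"
  have [measurable]: "f \<in> borel_measurable borel" unfolding f_def by measurable
  have i0: "integrable lborel (\<lambda>z. B * std_normal_density z)" by (intro integrable_mult_right integrable_normal_density) simp
  have fi: "integrable lborel f"
  proof (rule Bochner_Integration.integrable_bound[OF i0])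
    show "AE z in lborel. norm (f z) \<le> norm (B * std_normal_density z)"
    proof (rule AE_I2)
      fix z
      have "\<bar>f z\<bar> = std_normal_density z * \<bar>h (exp_half_sq z)\<bar>" by (simp add: f_def abs_mult)
      also have "\<dots> \<le> std_normal_density z * B" by (intro mult_left_mono B) simp
      finally show "norm (f z) \<le> norm (B * std_normal_density z)" by (simp add: mult.commute)
    qed
  qed simp
  have fp: "integrable lborel (\<lambda>z. indicator {0<..} z * f z)"
    using integrable_mult_indicator[OF _ fi, of "{0<..}"] by simp
  have fn: "integrable lborel (\<lambda>z. indicator {..<0} z * f z)"
    using integrable_mult_indicator[OF _ fi, of "{..<0}"] by simp
  show "integrable lborel (\<lambda>z. indicator {0<..} z * (2 * std_normal_density z * h (exp_half_sq z)))"
    using integrable_mult_right[OF fp, of 2] by (simp add: f_def mult_ac)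
  have even: "f (- z) = f z" for z by (simp add: f_def exp_half_sq_def std_normal_density_def)
  have "integral\<^sup>L std_normal_distribution (\<lambda>z. h (exp_half_sq z)) = (\<integral>z. f z \<partial>lborel)"
    by (subst integral_density) (auto simp: f_def)
  also have "\<dots> = (\<integral>z. indicator {0<..} z * f z + indicator {..<0} z * f z \<partial>lborel)"
  proof (rule integral_cong_AE)
    have "AE z in lborel. z \<noteq> (0::real)" by (rule AE_lborel_singleton)
    thus "AE z in lborel. f z = indicator {0<..} z * f z + indicator {..<0} z * f z"
      by eventually_elim (auto simp: indicator_def)
  qed measurable
  also have "\<dots> = (\<integral>z. indicator {0<..} z * f z \<partial>lborel) + (\<integral>z. indicator {..<0} z * f z \<partial>lborel)"
    using fp fn by simp
  also have "(\<integral>z. indicator {..<0} z * f z \<partial>lborel) = (\<integral>z. indicator {..<0} (0 + -1 * z) * f (0 + -1 * z) \<partial>lborel)"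
    by (subst lborel_integral_real_affine[where c = "-1" and t = 0]) auto
  also have "\<dots> = (\<integral>z. indicator {0<..} z * f z \<partial>lborel)"
    by (intro Bochner_Integration.integral_cong refl) (auto simp: even indicator_def)
  finally show "integral\<^sup>L std_normal_distribution (\<lambda>z. h (exp_half_sq z)) = (\<integral>z. indicator {0<..} z * (2 * std_normal_density z * h (exp_half_sq z)) \<partial>lborel)"
    by (simp add: f_def mult_ac)
qed

lemma heavy_density_integral:
  fixes h :: "real \<Rightarrow> real"
  assumes h: "continuous_on UNIV h" and B: "\<And>x. \<bar>h x\<bar> \<le> B"
  shows "integrable lborel (\<lambda>x. heavy_density x * h x)"
    "integral\<^sup>L std_normal_distribution (\<lambda>z. h (exp_half_sq z)) = (\<integral>x. heavy_density x * h x \<partial>lborel)"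
proof -
  have hm[measurable]: "h \<in> borel_measurable borel" using h by (rule borel_measurable_continuous_onI)
  have hc: "isCont h x" for x using h by (simp add: continuous_on_eq_continuous_at)
  define p where "p = (\<lambda>x::real. 1 / (sqrt pi * x\<^sup>2 * sqrt (ln x)))"
  define g' where "g' = (\<lambda>z. exp_half_sq z * z)"
  have pg: "p (exp_half_sq z) * g' z = 2 * std_normal_density z" if "z > 0" for z
  proof -
    have "ln (exp_half_sq z) = z\<^sup>2 / 2" by (simp add: exp_half_sq_def)
    hence "sqrt (ln (exp_half_sq z)) = sqrt (z\<^sup>2 / 2)" by (simp only:)
    also have "\<dots> = z / sqrt 2" using that by (simp add: real_sqrt_divide)
    finally have s: "sqrt (ln (exp_half_sq z)) = z / sqrt 2" .
    have n: "std_normal_density z = 1 / (sqrt 2 * sqrt pi) * inverse (exp_half_sq z)"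
      by (simp add: std_normal_density_def exp_half_sq_def real_sqrt_mult exp_minus)
    show ?thesis unfolding p_def g'_def s n using that exp_half_sq_pos[of z]
      by (simp add: field_simps power2_eq_square)
  qed
  have g1: "exp_half_sq z > 1" if "z > 0" for z using that by (simp add: exp_half_sq_def)
  have dg: "DERIV exp_half_sq z :> g' z" for z
    unfolding g'_def using exp_half_sq_deriv[OF DERIV_ident, of z UNIV] by simp
  have cp: "isCont p x" if "x > 1" for x
    unfolding p_def using that by (intro continuous_intros) auto
  have cg': "isCont g' z" for z
    unfolding g'_def[abs_def] exp_half_sq_def by (intro continuous_intros) auto
  have A: "((ereal \<circ> exp_half_sq \<circ> real_of_ereal) \<longlongrightarrow> ereal 1) (at_right (ereal 0))"
  proof -
    have "(exp_half_sq \<longlongrightarrow> exp_half_sq 0) (at_right 0)"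
      unfolding exp_half_sq_def by (intro tendsto_intros) auto
    hence "(exp_half_sq \<longlongrightarrow> 1) (at_right 0)" by (simp add: exp_half_sq_def)
    thus ?thesis by (simp only: ereal_tendsto_simps)
  qed
  have Bl: "((ereal \<circ> exp_half_sq \<circ> real_of_ereal) \<longlongrightarrow> \<infinity>) (at_left \<infinity>)"
  proof -
    have "filterlim exp_half_sq at_top at_top" unfolding exp_half_sq_def by real_asymp
    thus ?thesis by (simp only: ereal_tendsto_simps)
  qed
  have si: "set_integrable lborel (einterval (ereal 0) \<infinity>) (\<lambda>z. (p (exp_half_sq z) * k (exp_half_sq z)) * g' z)"
    if km: "k \<in> borel_measurable borel" "\<And>x. \<bar>k x\<bar> \<le> B" for k :: "real \<Rightarrow> real" and B
  proof -
    have "integrable lborel (\<lambda>z. indicator {0<..} z * (2 * std_normal_density z * k (exp_half_sq z)))"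
      by (rule std_normal_half(1)[OF km])
    moreover have "indicator {0<..} z * (2 * std_normal_density z * k (exp_half_sq z)) =
        indicator {0<..} z *\<^sub>R ((p (exp_half_sq z) * k (exp_half_sq z)) * g' z)" for z
      using pg[of z] by (auto simp: indicator_def mult_ac)
    ultimately show ?thesis unfolding set_integrable_def einterval_eq by simp
  qed
  \<comment> \<open>Integrability of the density itself comes from the substitution rule for
    nonnegative integrands. The rule for general integrands, applied below to h, asks for
    integrability on both sides beforehand.\<close>
  have "set_integrable lborel (einterval (ereal 1) \<infinity>) p"
  proof (rule interval_integral_substitution_nonneg(1)[where a = "ereal 0" and g = exp_half_sq and g' = g'])
    show "set_integrable lborel (einterval (ereal 0) \<infinity>) (\<lambda>x. p (exp_half_sq x) * g' x)"
      using si[of "\<lambda>_. 1" 1] by simp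
  qed (use dg cp cg' g1 A Bl in \<open>auto simp: p_def g'_def exp_half_sq_ge_1 less_imp_le[OF exp_half_sq_pos] intro!: mult_nonneg_nonneg\<close>)
  hence "integrable lborel (\<lambda>x. heavy_density x)"
    by (simp add: set_integrable_def heavy_density_def[abs_def] p_def)
  hence "integrable lborel (\<lambda>x. B * heavy_density x)" by simp
  thus int: "integrable lborel (\<lambda>x. heavy_density x * h x)"
  proof (rule Bochner_Integration.integrable_bound)
    show "AE x in lborel. norm (heavy_density x * h x) \<le> norm (B * heavy_density x)"
    proof (rule AE_I2)
      fix x
      have "norm (heavy_density x * h x) = heavy_density x * \<bar>h x\<bar>" by (simp add: abs_mult heavy_density_nonneg)
      also have "\<dots> \<le> heavy_density x * B" by (intro mult_left_mono B heavy_density_nonneg)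
      finally show "norm (heavy_density x * h x) \<le> norm (B * heavy_density x)" by (simp add: mult.commute)
    qed
  qed simp
  have "(LBINT x=ereal 1..\<infinity>. p x * h x) = (LBINT z=ereal 0..\<infinity>. g' z *\<^sub>R (p (exp_half_sq z) * h (exp_half_sq z)))"
  proof (rule interval_integral_substitution_integrable)
    show "set_integrable lborel (einterval (ereal 0) \<infinity>) (\<lambda>z. g' z *\<^sub>R (p (exp_half_sq z) * h (exp_half_sq z)))"
      using si[OF hm B] by (simp add: mult_ac)
    have eq: "(\<lambda>x. indicator {1<..} x *\<^sub>R (p x * h x)) = (\<lambda>x. heavy_density x * h x)"
      by (simp add: fun_eq_iff heavy_density_def p_def)
    show "set_integrable lborel (einterval (ereal 1) \<infinity>) (\<lambda>x. p x * h x)"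
      unfolding set_integrable_def einterval_eq eq by (rule int)
    show "isCont (\<lambda>x. p x * h x) (exp_half_sq z)" if "ereal 0 < ereal z" for z
      using cp[OF g1[of z]] hc[of "exp_half_sq z"] that by (intro continuous_mult) auto
  qed (use dg cg' A Bl in \<open>auto simp: g'_def less_imp_le[OF exp_half_sq_pos] intro!: mult_nonneg_nonneg\<close>)
  also have "\<dots> = (\<integral>z. indicator {0<..} z * (2 * std_normal_density z * h (exp_half_sq z)) \<partial>lborel)"
    unfolding interval_integral_to_infinity_eq set_lebesgue_integral_def
    by (intro Bochner_Integration.integral_cong refl) (use pg in \<open>auto simp: indicator_def mult_ac\<close>)
  also have "\<dots> = integral\<^sup>L std_normal_distribution (\<lambda>z. h (exp_half_sq z))"
    by (rule std_normal_half(2)[OF hm B, symmetric])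
  finally show "integral\<^sup>L std_normal_distribution (\<lambda>z. h (exp_half_sq z)) = (\<integral>x. heavy_density x * h x \<partial>lborel)"
    unfolding interval_integral_to_infinity_eq set_lebesgue_integral_def
    by (simp add: heavy_density_def p_def mult.assoc)
qed

text \<open>This is what the formula for b_K stands for: it is a_K * K times the mean of sin (X /
  a_K) with X = exp (Z^2 / 2), hence for each K, and not only in the limit, the compensator of the
  imaginary part of the characteristic exponent.\<close>

lemma b_const_expectation:
  assumes "K \<ge> 2"
  shows "b_const K / a_const K = real K * integral\<^sup>L std_normal_distribution (\<lambda>z. sin (exp_half_sq z / a_const K))"
proof -
  define a where "a = a_const K"
  have a: "a > 0" unfolding a_def a_const_def using assms by simp
  have "integral\<^sup>L std_normal_distribution (\<lambda>z. sin (exp_half_sq z / a)) = (\<integral>x. heavy_density x * sin (x / a) \<partial>lborel)"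
    by (rule heavy_density_integral(2)[where B = 1 and h = "\<lambda>x. sin (x / a)"]) (use a in \<open>auto intro!: continuous_intros\<close>)
  also have "\<dots> = (\<integral>x. (indicator {1..} x * (sin (x / a) / (x\<^sup>2 * sqrt (ln x)))) / sqrt pi \<partial>lborel)"
  proof (rule Bochner_Integration.integral_cong[OF refl])
    fix x :: real
    \<comment> \<open>At x = 1 the right-hand integrand divides by sqrt (ln 1) = 0 and is therefore
      0, like the density; the two functions agree everywhere.\<close>
    show "heavy_density x * sin (x / a) = (indicator {1..} x * (sin (x / a) / (x\<^sup>2 * sqrt (ln x)))) / sqrt pi"
      by (cases "x = 1") (auto simp: heavy_density_def indicator_def)
  qed
  also have "\<dots> = (LBINT x:{1..}. sin (x / a) / (x\<^sup>2 * sqrt (ln x))) / sqrt pi"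
    unfolding set_lebesgue_integral_def real_scaleR_def by (rule integral_divide_zero)
  finally show ?thesis using a by (simp add: b_const_def a_def[symmetric])
qed

text \<open>Integration against the Levy measure y^(-2) dy on the positive half-line; up to the
  factor 2 / pi it is the limit of K times the law of exp (Z^2 / 2) / a_K.\<close>

definition stable_kernel :: "(real \<Rightarrow> real) \<Rightarrow> real" where
  "stable_kernel h = (\<integral>y. indicator {0<..} y * (h y / y\<^sup>2) \<partial>lborel)"

lemma inverse_square_tail:
  fixes v :: real
  assumes "v > 0"
  shows "set_integrable lborel {v<..} (\<lambda>u. 1 / u\<^sup>2)"
proof -
  have "set_integrable lborel (einterval (ereal v) \<infinity>) (\<lambda>u. 1 / u\<^sup>2)"
  proof (rule interval_integral_FTC_nonneg(1)[where F = "\<lambda>u. - 1 / u" and A = "- 1 / v" and B = 0])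
    show "DERIV (\<lambda>u. - 1 / u) u :> 1 / u\<^sup>2" if "ereal v < ereal u" for u
      using that assms by (auto intro!: derivative_eq_intros simp: power2_eq_square)
    show "isCont (\<lambda>u. 1 / u\<^sup>2) u" if "ereal v < ereal u" for u
      using that assms by (intro continuous_intros) auto
    have "((\<lambda>u. - 1 / u) \<longlongrightarrow> - 1 / v) (at_right v)"
      using assms by (intro tendsto_intros) auto
    thus "(((\<lambda>u. - 1 / u) \<circ> real_of_ereal) \<longlongrightarrow> - 1 / v) (at_right (ereal v))"
      by (simp only: ereal_tendsto_simps)
    have "((\<lambda>u::real. - 1 / u) \<longlongrightarrow> 0) at_top" by real_asymp
    thus "(((\<lambda>u. - 1 / u) \<circ> real_of_ereal) \<longlongrightarrow> 0) (at_left \<infinity>)"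
      by (simp only: ereal_tendsto_simps)
  qed auto
  thus ?thesis by simp
qed

lemma stable_kernel_dominator:
  "integrable lborel (\<lambda>y::real. indicator {0<..} y * min 1 (1 / y\<^sup>2))"
proof -
  have "integrable lborel (\<lambda>y::real. indicator {0..1} y + indicator {1<..} y *\<^sub>R (1 / y\<^sup>2))"
    using inverse_square_tail[of 1] unfolding set_integrable_def
    by (intro Bochner_Integration.integrable_add) auto
  thus ?thesis
  proof (rule Bochner_Integration.integrable_bound)
    show "AE y in lborel. norm (indicator {0<..} y * min 1 (1 / y\<^sup>2) :: real)
        \<le> norm (indicator {0..1} y + indicator {1<..} y *\<^sub>R (1 / y\<^sup>2) :: real)"
      by (rule AE_I2) (auto simp: indicator_def)
  qed measurable
qed

lemma bounded_over_square:
  fixes h :: "real \<Rightarrow> real"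
  assumes "\<bar>h y\<bar> \<le> C" "\<bar>h y\<bar> \<le> C * y\<^sup>2" "C \<ge> 0" "y > 0"
  shows "\<bar>h y / y\<^sup>2\<bar> \<le> C * min 1 (1 / y\<^sup>2)"
  using assms by (auto simp: abs_div min_def divide_le_eq)

text \<open>The substitution x = a_K * y turns K times the law into 2 / pi * sqrt (ln K / ln (a_K *
  y)) / y^2 dy, where 2 / pi results from the constant in a_K. The logarithmic quotient tends to 1
  and is bounded for y above a_K^(-3/4), so dominated convergence applies there. The range x \<le>
  a_K^(1/4) contributes O(K * a_K^(-3/2)), because h is quadratic near 0.\<close>

lemma heavy_scaled_limit:
  fixes h :: "real \<Rightarrow> real"
  assumes h: "continuous_on UNIV h" and C: "\<And>y. \<bar>h y\<bar> \<le> C" "\<And>y. y > 0 \<Longrightarrow> \<bar>h y\<bar> \<le> C * y\<^sup>2"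
  shows "(\<lambda>K. real K * integral\<^sup>L std_normal_distribution (\<lambda>z. h (exp_half_sq z / a_const K)))
    \<longlonglongrightarrow> 2 / pi * stable_kernel h"
proof -
  have C0: "C \<ge> 0" using C(1)[of 0] by linarith
  have [measurable]: "h \<in> borel_measurable borel" using h by (rule borel_measurable_continuous_onI)
  define a where "a = (\<lambda>K::nat. sqrt pi / 2 * (real K / sqrt (ln (real K))))"
  have aK: "a_const K = a K" for K by (simp add: a_def a_const_def)
  define P where "P = (\<lambda>K::nat. \<integral>x. indicator {..a K powr (1/4)} x * (heavy_density x * h (x / a K)) \<partial>lborel)"
  define s where "s = (\<lambda>K y. indicator {a K powr (- 3/4)<..} y * (sqrt (ln (real K) / ln (a K * y)) * (h y / y\<^sup>2)))"
  \<comment> \<open>Above the cut ln (a K * y) is at least ln (a K) / 4; the factor 4 / 9 makes this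
    at least ln K / 9, so that the square root of the quotient is at most 3.\<close>
  have a1: "eventually (\<lambda>K. a K > 1 \<and> ln (a K) \<ge> 4/9 * ln (real K) \<and> real K \<ge> 3) sequentially"
    unfolding a_def by (intro eventually_conj; real_asymp)
  have cont: "continuous_on UNIV (\<lambda>x. h (x / a K))" for K
  proof (cases "a K = 0")
    case False
    thus ?thesis by (intro continuous_on_compose2[OF h] continuous_intros) auto
  qed simp
  have one: "integral\<^sup>L lborel heavy_density = 1" "integrable lborel heavy_density"
    using heavy_density_integral[of "\<lambda>_. 1" 1] prob_space.prob_space[OF prob_space_normal_density[of 1 0]] by simp_all
  have dec: "real K * integral\<^sup>L std_normal_distribution (\<lambda>z. h (exp_half_sq z / a_const K)) =
      real K * P K + 2 / pi * (\<integral>y. s K y \<partial>lborel)"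
    if K: "a K > 1" "ln (a K) \<ge> 4/9 * ln (real K)" "real K \<ge> 3" for K
  proof -
    note hd = heavy_density_integral[OF cont[of K] C(1)]
    have i1: "integrable lborel (\<lambda>x. indicator {..a K powr (1/4)} x * (heavy_density x * h (x / a K)))"
      using integrable_mult_indicator[OF _ hd(1), of "{..a K powr (1/4)}"] by simp
    have i2: "integrable lborel (\<lambda>x. indicator {a K powr (1/4)<..} x * (heavy_density x * h (x / a K)))"
      using integrable_mult_indicator[OF _ hd(1), of "{a K powr (1/4)<..}"] by simp
    have "integral\<^sup>L std_normal_distribution (\<lambda>z. h (exp_half_sq z / a_const K)) = (\<integral>x. heavy_density x * h (x / a K) \<partial>lborel)"
      using hd(2) by (simp add: aK)
    also have "\<dots> = (\<integral>x. indicator {..a K powr (1/4)} x * (heavy_density x * h (x / a K)) + indicator {a K powr (1/4)<..} x * (heavy_density x * h (x / a K)) \<partial>lborel)"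
      by (intro Bochner_Integration.integral_cong refl) (auto simp: indicator_def)
    also have "\<dots> = P K + (\<integral>x. indicator {a K powr (1/4)<..} x * (heavy_density x * h (x / a K)) \<partial>lborel)"
      unfolding P_def using i1 i2 by simp
    also have "(\<integral>x. indicator {a K powr (1/4)<..} x * (heavy_density x * h (x / a K)) \<partial>lborel)
        = a K * (\<integral>y. indicator {a K powr (1/4)<..} (a K * y) * (heavy_density (a K * y) * h y) \<partial>lborel)"
      using K by (subst lborel_integral_real_affine[where c = "a K" and t = 0]) auto
    also have "(\<integral>y. indicator {a K powr (1/4)<..} (a K * y) * (heavy_density (a K * y) * h y) \<partial>lborel)
        = (\<integral>y. 2 / pi * s K y / (real K * a K) \<partial>lborel)"
    proof (rule Bochner_Integration.integral_cong[OF refl])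
      fix y :: real
      have e: "a K powr (1/4) = a K * a K powr (- 3/4)"
        using K powr_add[of "a K" 1 "- 3/4"] by simp
      have iff: "a K powr (1/4) < a K * y \<longleftrightarrow> a K powr (- 3/4) < y" unfolding e using K by simp
      show "indicator {a K powr (1/4)<..} (a K * y) * (heavy_density (a K * y) * h y) = 2 / pi * s K y / (real K * a K)"
      proof (cases "a K powr (- 3/4) < y")
        case True
        have "1 = 1 powr (1/4)" by simp
        also have "\<dots> \<le> a K powr (1/4)" using K by (intro powr_mono2) auto
        finally have y1: "a K * y > 1" using True iff by linarith
        have y0: "y > 0" using True powr_ge_zero[of "a K" "-3/4"] by linarith
        have l: "ln (a K * y) > 0" "ln (real K) > 0" using y1 K by simp_all
        have "heavy_density (a K * y) * h y = h y / y\<^sup>2 * (1 / (sqrt pi * (a K)\<^sup>2 * sqrt (ln (a K * y))))"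
          using y1 by (simp add: heavy_density_def power_mult_distrib)
        also have "1 / (sqrt pi * (a K)\<^sup>2 * sqrt (ln (a K * y))) = 2 / pi * (sqrt (ln (real K)) / sqrt (ln (a K * y))) / (real K * a K)"
        proof -
          have "a K * sqrt (ln (real K)) * 2 = sqrt pi * real K" using l by (simp add: a_def)
          hence "(a K * sqrt (ln (real K)) * 2) * sqrt pi = pi * real K" by simp
          thus ?thesis using l K by (simp add: field_simps power2_eq_square)
        qed
        finally show ?thesis using True iff y1 by (simp add: s_def real_sqrt_divide mult_ac)
      qed (use iff in \<open>simp add: s_def\<close>)
    qed
    finally show ?thesis using K by (simp add: algebra_simps)
  qed
  have Pb: "\<bar>real K * P K\<bar> \<le> real K * (C * (a K powr (1/4) / a K)\<^sup>2)"
    if K: "a K > 1" "ln (a K) \<ge> 4/9 * ln (real K)" "real K \<ge> 3" for K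
  proof -
    have "\<bar>P K\<bar> \<le> (\<integral>x. heavy_density x * (C * (a K powr (1/4) / a K)\<^sup>2) \<partial>lborel)"
      unfolding P_def
    proof (rule order_trans[OF integral_abs_bound integral_mono])
      show "integrable lborel (\<lambda>x. \<bar>indicator {..a K powr (1/4)} x * (heavy_density x * h (x / a K))\<bar>)"
        using integrable_mult_indicator[OF _ heavy_density_integral(1)[OF cont[of K] C(1)], of "{..a K powr (1/4)}"]
        by (intro integrable_abs) simp
      show "integrable lborel (\<lambda>x. heavy_density x * (C * (a K powr (1/4) / a K)\<^sup>2))" using one by simp
      fix x
      show "\<bar>indicator {..a K powr (1/4)} x * (heavy_density x * h (x / a K))\<bar> \<le> heavy_density x * (C * (a K powr (1/4) / a K)\<^sup>2)"
      proof (cases "x > 1 \<and> x \<le> a K powr (1/4)")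
        case True
        have "\<bar>h (x / a K)\<bar> \<le> C * (x / a K)\<^sup>2" using True K by (intro C(2)) simp
        also have "\<dots> \<le> C * (a K powr (1/4) / a K)\<^sup>2"
          using True K C0 by (intro mult_left_mono power_mono divide_right_mono) auto
        finally have "heavy_density x * \<bar>h (x / a K)\<bar> \<le> heavy_density x * (C * (a K powr (1/4) / a K)\<^sup>2)"
          by (intro mult_left_mono heavy_density_nonneg)
        thus ?thesis using True by (simp add: abs_mult heavy_density_nonneg)
      next
        case False
        hence "indicator {..a K powr (1/4)} x * (heavy_density x * h (x / a K)) = 0"
          by (auto simp: indicator_def heavy_density_def)
        thus ?thesis using mult_nonneg_nonneg[OF heavy_density_nonneg mult_nonneg_nonneg[OF C0 zero_le_power2]]
          by (simp only: abs_zero)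
      qed
    qed
    also have "\<dots> = C * (a K powr (1/4) / a K)\<^sup>2" using one by simp
    finally show ?thesis by (simp add: abs_mult mult_left_mono)
  qed
  have P0: "(\<lambda>K. real K * P K) \<longlonglongrightarrow> 0"
  proof (rule Lim_null_comparison)
    show "eventually (\<lambda>K. norm (real K * P K) \<le> real K * (C * (a K powr (1/4) / a K)\<^sup>2)) sequentially"
      using a1 by eventually_elim (use Pb in auto)
    have "(\<lambda>K. real K * (a K powr (1/4) / a K)\<^sup>2) \<longlonglongrightarrow> 0"
      unfolding a_def by real_asymp
    from tendsto_mult_left[OF this, of C] show "(\<lambda>K. real K * (C * (a K powr (1/4) / a K)\<^sup>2)) \<longlonglongrightarrow> 0"
      by (simp add: mult_ac)
  qed
  \<comment> \<open>Dominated convergence asks for the bound at every index, so the sequence is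
    shifted past the threshold in \<open>a1\<close>.\<close>
  obtain K0 where K0: "\<And>K. K \<ge> K0 \<Longrightarrow> a K > 1 \<and> ln (a K) \<ge> 4/9 * ln (real K) \<and> real K \<ge> 3"
    using a1 unfolding eventually_sequentially by blast
  have S: "(\<lambda>i. \<integral>y. s (i + K0) y \<partial>lborel) \<longlonglongrightarrow> stable_kernel h"
    unfolding stable_kernel_def
  proof (rule integral_dominated_convergence[where w = "\<lambda>y. 3 * C * (indicator {0<..} y * min 1 (1 / y\<^sup>2))"])
    show "integrable lborel (\<lambda>y. 3 * C * (indicator {0<..} y * min 1 (1 / y\<^sup>2)))"
      using stable_kernel_dominator by (rule integrable_mult_right)
    show "AE y in lborel. norm (s (i + K0) y) \<le> 3 * C * (indicator {0<..} y * min 1 (1 / y\<^sup>2))" for i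
    proof (rule AE_I2)
      fix y :: real
      define K where "K = i + K0"
      have K: "a K > 1" "ln (a K) \<ge> 4/9 * ln (real K)" "real K \<ge> 3" using K0[of K] by (auto simp: K_def)
      show "norm (s (i + K0) y) \<le> 3 * C * (indicator {0<..} y * min 1 (1 / y\<^sup>2))"
      proof (cases "a K powr (- 3/4) < y")
        case True
        have y0: "y > 0" using True powr_ge_zero[of "a K" "-3/4"] by linarith
        have "ln (a K powr (- 3/4)) < ln y" using True y0 K by (subst ln_less_cancel_iff) auto
        hence "ln (a K * y) \<ge> ln (a K) / 4" using K y0 by (simp add: ln_powr ln_mult)
        also have "ln (a K) / 4 \<ge> ln (real K) / 9" using K by simp
        finally have l: "ln (real K) \<le> 9 * ln (a K * y)" by simp
        have lp: "ln (a K * y) > 0" using l K by (smt (verit) ln_gt_zero)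
        hence "ln (real K) / ln (a K * y) \<le> 9" using l by (simp add: divide_le_eq)
        hence "sqrt (ln (real K) / ln (a K * y)) \<le> sqrt 9" by (rule real_sqrt_le_mono)
        also have "sqrt 9 = (3::real)" using real_sqrt_abs[of 3] by simp
        finally have r: "sqrt (ln (real K) / ln (a K * y)) \<le> 3" .
        have "norm (s K y) = sqrt (ln (real K) / ln (a K * y)) * \<bar>h y / y\<^sup>2\<bar>"
          using True lp K by (simp add: s_def abs_mult)
        also have "\<dots> \<le> 3 * (C * min 1 (1 / y\<^sup>2))"
          using r lp K y0 by (intro mult_mono bounded_over_square[of h y C, OF C(1) C(2)[OF y0] C0 y0]) auto
        finally show ?thesis using y0 by (simp add: K_def)
      next
        case False
        thus ?thesis using C0 by (simp add: s_def K_def indicator_def)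
      qed
    qed
    show "AE y in lborel. (\<lambda>i. s (i + K0) y) \<longlonglongrightarrow> indicator {0<..} y * (h y / y\<^sup>2)"
    proof (rule AE_I2)
      fix y :: real
      show "(\<lambda>i. s (i + K0) y) \<longlonglongrightarrow> indicator {0<..} y * (h y / y\<^sup>2)"
      proof (cases "y > 0")
        case True
        have "eventually (\<lambda>K. a K powr (- 3/4) < y) sequentially"
        proof -
          have "(\<lambda>K. a K powr (- 3/4)) \<longlonglongrightarrow> 0" unfolding a_def by real_asymp
          thus ?thesis using True by (rule order_tendstoD)
        qed
        hence ev: "eventually (\<lambda>K. sqrt (ln (real K) / ln (a K * y)) * (h y / y\<^sup>2) = s K y) sequentially"
          by eventually_elim (simp add: s_def)
        have "(\<lambda>K. ln (real K) / ln (a K * y)) \<longlonglongrightarrow> 1" unfolding a_def using True by real_asymp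
        hence "(\<lambda>K. sqrt (ln (real K) / ln (a K * y)) * (h y / y\<^sup>2)) \<longlonglongrightarrow> sqrt 1 * (h y / y\<^sup>2)"
          by (intro tendsto_intros)
        hence "(\<lambda>K. s K y) \<longlonglongrightarrow> h y / y\<^sup>2" using Lim_transform_eventually[OF _ ev] by simp
        thus ?thesis using True LIMSEQ_ignore_initial_segment[of "\<lambda>K. s K y" "h y / y\<^sup>2" K0] by simp
      next
        case False
        have "\<not> a K powr (- 3/4) < y" for K using False powr_ge_zero[of "a K" "-3/4"] by linarith
        hence "s K y = 0" for K by (simp add: s_def)
        thus ?thesis using False by simp
      qed
    qed
  qed (simp_all add: s_def[abs_def])
  have "(\<lambda>K. real K * P K + 2 / pi * (\<integral>y. s K y \<partial>lborel)) \<longlonglongrightarrow> 0 + 2 / pi * stable_kernel h"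
    by (intro tendsto_intros P0 LIMSEQ_offset[OF S])
  moreover have "eventually (\<lambda>K. real K * P K + 2 / pi * (\<integral>y. s K y \<partial>lborel) =
      real K * integral\<^sup>L std_normal_distribution (\<lambda>z. h (exp_half_sq z / a_const K))) sequentially"
    using a1 by eventually_elim (use dec in auto)
  ultimately show ?thesis using Lim_transform_eventually by force
qed

text \<open>Determines how fast the characteristic function of one scaled summand approaches
  1.\<close>

lemma min_exp_half_sq_expectation:
  assumes "ln s \<ge> 1" "s > 0"
  shows "integral\<^sup>L std_normal_distribution (\<lambda>z. min (exp_half_sq z) s) \<le> 2 * exp 1 * sqrt (ln s)"
proof -
  have le: "min (exp_half_sq z) s \<le> 2 * trunc_exp s z" for z
    using trunc_exp_ge[of s s z] assms by (cases "exp_half_sq z \<le> s") auto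
  have ab: "\<bar>min (exp_half_sq z) s\<bar> \<le> s" for z
    using exp_half_sq_pos[of z] assms(2) by linarith
  interpret real_distribution std_normal_distribution by (rule real_dist_normal_dist)
  have "integral\<^sup>L std_normal_distribution (\<lambda>z. min (exp_half_sq z) s) \<le> (\<integral>z. 2 * trunc_exp s z \<partial>std_normal_distribution)"
  proof (rule integral_mono)
    show "integrable std_normal_distribution (\<lambda>z. min (exp_half_sq z) s)"
      by (rule integrable_const_bound[where B = s]) (use ab in auto)
    show "integrable std_normal_distribution (\<lambda>z. 2 * trunc_exp s z)"
      by (intro integrable_mult_right integrable_const_bound[where B = s])
        (use trunc_exp_bounds[OF assms(2)] in auto)
  qed (rule le)
  also have "\<dots> \<le> 2 * (exp 1 * sqrt (ln s))"
    using trunc_exp_normal_expectation[OF assms, of 1] by simp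
  finally show ?thesis by simp
qed

section \<open>The integrals of the limiting characteristic exponent\<close>

lemma sin_linear_bounds: "\<bar>sin x - x\<bar> \<le> x\<^sup>2 / 2" for x :: real
  using Maclaurin_sin_bound[of x 2] by (simp add: eval_nat_numeral sin_coeff_def)

lemma cos_quadratic_bound: "\<bar>cos x - 1\<bar> \<le> x\<^sup>2 / 2" for x :: real
proof -
  have "cos x = 1 - 2 * (sin (x / 2))\<^sup>2" using cos_double_sin[of "x / 2"] by simp
  moreover have "(sin (x / 2))\<^sup>2 \<le> (x / 2)\<^sup>2"
    using power_mono[OF abs_sin_x_le_abs_x[of "x / 2"] abs_ge_zero, of 2] by (simp add: power_divide)
  ultimately show ?thesis by (simp add: power_divide)
qed

text \<open>The same constant serves near the origin and at infinity, because
  \<open>heavy_scaled_limit\<close> and \<open>stable_kernel_integrable\<close> take a single C. It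
  is also the constant for the sine kernel.\<close>

lemma cos_kernel_bounds: "\<bar>cos (t * y) - 1\<bar> \<le> 2 + t\<^sup>2 + \<bar>t\<bar>" "\<bar>cos (t * y) - 1\<bar> \<le> (2 + t\<^sup>2 + \<bar>t\<bar>) * y\<^sup>2" for t y :: real
proof -
  have "\<bar>cos (t * y) - 1\<bar> \<le> 2" using cos_le_one[of "t * y"] cos_ge_minus_one[of "t * y"] by linarith
  thus "\<bar>cos (t * y) - 1\<bar> \<le> 2 + t\<^sup>2 + \<bar>t\<bar>" by (simp add: add_increasing2)
  have "\<bar>cos (t * y) - 1\<bar> \<le> t\<^sup>2 / 2 * y\<^sup>2" using cos_quadratic_bound[of "t * y"] by (simp add: power_mult_distrib)
  also have "\<dots> \<le> (2 + t\<^sup>2 + \<bar>t\<bar>) * y\<^sup>2"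
    by (intro mult_right_mono) (auto simp: field_simps intro: add_nonneg_nonneg)
  finally show "\<bar>cos (t * y) - 1\<bar> \<le> (2 + t\<^sup>2 + \<bar>t\<bar>) * y\<^sup>2" .
qed

lemma sin_kernel_bounds: "\<bar>sin (t * y) - t * sin y\<bar> \<le> 2 + t\<^sup>2 + \<bar>t\<bar>"
    "\<bar>sin (t * y) - t * sin y\<bar> \<le> (2 + t\<^sup>2 + \<bar>t\<bar>) * y\<^sup>2" for t y :: real
proof -
  have "\<bar>t * sin y\<bar> \<le> \<bar>t\<bar> * 1" unfolding abs_mult by (intro mult_left_mono) auto
  moreover have "\<bar>sin (t * y)\<bar> \<le> 1" by simp
  ultimately have "\<bar>sin (t * y) - t * sin y\<bar> \<le> 1 + \<bar>t\<bar>" by linarith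
  thus "\<bar>sin (t * y) - t * sin y\<bar> \<le> 2 + t\<^sup>2 + \<bar>t\<bar>" using zero_le_power2[of t] by linarith
  have "\<bar>t * (y - sin y)\<bar> \<le> \<bar>t\<bar> * (y\<^sup>2 / 2)"
    unfolding abs_mult using sin_linear_bounds[of y] by (intro mult_left_mono) (simp_all add: abs_minus_commute)
  moreover have "sin (t * y) - t * sin y = (sin (t * y) - t * y) + t * (y - sin y)" by (simp add: algebra_simps)
  ultimately have "\<bar>sin (t * y) - t * sin y\<bar> \<le> (t * y)\<^sup>2 / 2 + \<bar>t\<bar> * (y\<^sup>2 / 2)"
    using sin_linear_bounds[of "t * y"] by linarith
  also have "\<dots> = (t\<^sup>2 / 2 + \<bar>t\<bar> / 2) * y\<^sup>2" by (simp add: power_mult_distrib algebra_simps)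
  also have "\<dots> \<le> (2 + t\<^sup>2 + \<bar>t\<bar>) * y\<^sup>2"
    using zero_le_power2[of t] abs_ge_zero[of t] by (intro mult_right_mono zero_le_power2) linarith
  finally show "\<bar>sin (t * y) - t * sin y\<bar> \<le> (2 + t\<^sup>2 + \<bar>t\<bar>) * y\<^sup>2" .
qed

lemma stable_kernel_integrable:
  fixes h :: "real \<Rightarrow> real"
  assumes [measurable]: "h \<in> borel_measurable borel" and C: "\<And>y. \<bar>h y\<bar> \<le> C" "\<And>y. \<bar>h y\<bar> \<le> C * y\<^sup>2"
  shows "integrable lborel (\<lambda>y. indicator {0<..} y * (h y / y\<^sup>2))"
proof (rule Bochner_Integration.integrable_bound[OF integrable_mult_right[OF stable_kernel_dominator, of C]])
  have C0: "C \<ge> 0" using C(1)[of 0] by linarith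
  show "AE y in lborel. norm (indicator {0<..} y * (h y / y\<^sup>2)) \<le> norm (C * (indicator {0<..} y * min 1 (1 / y\<^sup>2)))"
  proof (rule AE_I2)
    fix y :: real
    show "norm (indicator {0<..} y * (h y / y\<^sup>2)) \<le> norm (C * (indicator {0<..} y * min 1 (1 / y\<^sup>2)))"
      using bounded_over_square[of h y C, OF C(1) C(2) C0] C0 by (cases "y > 0") (auto simp: abs_mult)
  qed
qed measurable

text \<open>For t > 0 an antiderivative of (cos (t * y) - 1) / y^2 is (1 - cos (t * y)) / y - t * Si
  (t * y). It tends to 0 at the origin and to - t * pi / 2 at infinity, as Si tends to pi / 2. The
  integral is even in t.\<close>

lemma stable_kernel_cos: "stable_kernel (\<lambda>y. cos (t * y) - 1) = - (pi * \<bar>t\<bar> / 2)"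
proof -
  have pos: "stable_kernel (\<lambda>y. cos (t * y) - 1) = - (pi * t / 2)" if t: "t > 0" for t
  proof -
    define F where "F = (\<lambda>y. (1 - cos (t * y)) / y - t * Si (t * y))"
    have "(LBINT y=ereal 0..\<infinity>. (cos (t * y) - 1) / y\<^sup>2) = - (t * (pi / 2)) - 0"
    proof (rule interval_integral_FTC_integrable)
      show "(F has_vector_derivative (cos (t * y) - 1) / y\<^sup>2) (at y)" if "ereal 0 < ereal y" for y
      proof -
        have "((\<lambda>y. Si (t * y)) has_real_derivative sinc (t * y) * t) (at y)"
          by (rule DERIV_chain2[where f = Si and g = "\<lambda>y. t * y", OF DERIV_Si]) (auto intro!: derivative_eq_intros)
        hence "(F has_real_derivative ((sin (t * y) * t * y - (1 - cos (t * y))) / (y * y) - t * (sinc (t * y) * t))) (at y)"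
          unfolding F_def using that by (auto intro!: derivative_eq_intros)
        also have "(sin (t * y) * t * y - (1 - cos (t * y))) / (y * y) - t * (sinc (t * y) * t) = (cos (t * y) - 1) / y\<^sup>2"
          using that t by (simp add: sin_zero_iff_int2 power2_eq_square field_simps)
        finally show ?thesis by (simp add: has_real_derivative_iff_has_vector_derivative)
      qed
      show "isCont (\<lambda>y. (cos (t * y) - 1) / y\<^sup>2) y" if "ereal 0 < ereal y" for y
        using that by (intro continuous_intros) auto
      have "integrable lborel (\<lambda>y. indicator {0<..} y * ((cos (t * y) - 1) / y\<^sup>2))"
        by (rule stable_kernel_integrable[OF _ cos_kernel_bounds]) measurable
      thus "set_integrable lborel (einterval (ereal 0) \<infinity>) (\<lambda>y. (cos (t * y) - 1) / y\<^sup>2)"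
        by (simp add: set_integrable_def)
      have sq: "((\<lambda>y. (1 - cos (t * y)) / y) \<longlongrightarrow> 0) (at_right 0)"
      proof (rule Lim_null_comparison)
        show "eventually (\<lambda>y. norm ((1 - cos (t * y)) / y) \<le> t\<^sup>2 / 2 * y) (at_right 0)"
          unfolding eventually_at_right_field
        proof (intro exI[of _ 1] conjI allI impI)
          fix y :: real assume y: "0 < y" "y < 1"
          have "\<bar>1 - cos (t * y)\<bar> \<le> (t * y)\<^sup>2 / 2" using cos_quadratic_bound[of "t * y"] by (simp add: abs_minus_commute)
          thus "norm ((1 - cos (t * y)) / y) \<le> t\<^sup>2 / 2 * y"
            using y by (simp add: abs_div divide_le_eq power2_eq_square mult_ac)
        qed simp
        show "((\<lambda>y. t\<^sup>2 / 2 * y) \<longlongrightarrow> 0) (at_right 0)" by real_asymp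
      qed
      have "((\<lambda>y. Si (t * y)) \<longlongrightarrow> Si (t * 0)) (at_right 0)"
        by (rule isCont_tendsto_compose[OF isCont_Si]) (intro tendsto_intros)
      moreover have "Si 0 = 0" by (simp add: Si_def flip: zero_ereal_def)
      ultimately have "((\<lambda>y. Si (t * y)) \<longlongrightarrow> 0) (at_right 0)" by simp
      from tendsto_diff[OF sq tendsto_mult_left[OF this, of t]] have "(F \<longlongrightarrow> 0) (at_right 0)" by (simp add: F_def[abs_def])
      thus "((F \<circ> real_of_ereal) \<longlongrightarrow> 0) (at_right (ereal 0))" by (simp only: ereal_tendsto_simps)
      have sq2: "((\<lambda>y. (1 - cos (t * y)) / y) \<longlongrightarrow> 0) at_top"
      proof (rule Lim_null_comparison)
        show "eventually (\<lambda>y. norm ((1 - cos (t * y)) / y) \<le> 2 / y) at_top"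
          using eventually_gt_at_top[of 0]
        proof eventually_elim
          case (elim y)
          have "\<bar>1 - cos (t * y)\<bar> \<le> 2" using cos_le_one[of "t * y"] cos_ge_minus_one[of "t * y"] by linarith
          thus ?case using elim by (simp add: abs_div divide_right_mono)
        qed
        show "((\<lambda>y::real. 2 / y) \<longlongrightarrow> 0) at_top" by real_asymp
      qed
      have "filterlim (\<lambda>y. t * y) at_top at_top" using t by real_asymp
      from filterlim_compose[OF Si_at_top this] have "((\<lambda>y. Si (t * y)) \<longlongrightarrow> pi / 2) at_top" .
      from tendsto_diff[OF sq2 tendsto_mult_left[OF this, of t]] have "(F \<longlongrightarrow> - (t * (pi / 2))) at_top" by (simp add: F_def[abs_def])
      thus "((F \<circ> real_of_ereal) \<longlongrightarrow> - (t * (pi / 2))) (at_left \<infinity>)" by (simp only: ereal_tendsto_simps)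
    qed simp
    thus ?thesis
      by (simp add: stable_kernel_def interval_integral_to_infinity_eq set_lebesgue_integral_def mult.commute)
  qed
  show ?thesis
  proof (cases "t = 0")
    case True
    thus ?thesis by (simp add: stable_kernel_def)
  next
    case False
    have "(\<lambda>y. cos (t * y) - 1) = (\<lambda>y. cos (\<bar>t\<bar> * y) - 1)" by (auto simp: abs_if)
    thus ?thesis using pos[of "\<bar>t\<bar>"] False by simp
  qed
qed

text \<open>The tail integral S of sin u / u^2 grows like - ln v as v tends to 0, since sin u / u^2
  and 1 / u differ by at most 1 / 2 between v and v'.\<close>

lemma sine_tail_difference:
  assumes v: "0 < v" "v \<le> v'"
  defines "S \<equiv> \<lambda>v. \<integral>u. indicator {v<..} u * (sin u / u\<^sup>2) \<partial>(lborel :: real measure)"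
  shows "\<bar>S v - S v' - (ln v' - ln v)\<bar> \<le> v'"
proof -
  have iS: "integrable lborel (\<lambda>u. indicator {x<..} u * (sin u / u\<^sup>2))" if "x > 0" for x :: real
  proof (rule Bochner_Integration.integrable_bound)
    show "integrable lborel (\<lambda>u. indicator {x<..} u *\<^sub>R (1 / u\<^sup>2))"
      using inverse_square_tail[OF that] by (simp add: set_integrable_def)
    show "AE u in lborel. norm (indicator {x<..} u * (sin u / u\<^sup>2)) \<le> norm (indicator {x<..} u *\<^sub>R (1 / u\<^sup>2))"
      by (rule AE_I2) (auto simp: indicator_def abs_div divide_right_mono)
  qed measurable
  have fi: "has_bochner_integral lborel (\<lambda>u. (1 / u) * indicator {v..v'} u) (ln v' - ln v)"
    by (rule has_bochner_integral_FTC_Icc_real)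
      (use v in \<open>auto intro!: derivative_eq_intros continuous_intros\<close>)
  have ci: "integrable lborel (\<lambda>u::real. indicator {v..v'} u * (1/2 :: real))" using v by simp
  have i3: "integrable lborel (\<lambda>u. indicator {v<..} u * (sin u / u\<^sup>2) - indicator {v'<..} u * (sin u / u\<^sup>2) - (1 / u) * indicator {v..v'} u)"
    using iS[of v] iS[of v'] v fi by (intro Bochner_Integration.integrable_diff) (auto simp: has_bochner_integral_iff)
  have eq: "S v - S v' - (ln v' - ln v) = (\<integral>u. indicator {v<..} u * (sin u / u\<^sup>2) - indicator {v'<..} u * (sin u / u\<^sup>2) - (1 / u) * indicator {v..v'} u \<partial>lborel)"
    unfolding S_def using iS[of v] iS[of v'] v fi by (simp add: has_bochner_integral_iff)
  have bd: "\<bar>\<integral>u. indicator {v<..} u * (sin u / u\<^sup>2) - indicator {v'<..} u * (sin u / u\<^sup>2) - (1 / u) * indicator {v..v'} u \<partial>lborel\<bar>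
      \<le> (\<integral>u. indicator {v..v'} u * (1/2) \<partial>lborel)"
  proof (rule order_trans[OF integral_abs_bound], rule integral_mono_AE)
    show "AE u in lborel. \<bar>indicator {v<..} u * (sin u / u\<^sup>2) - indicator {v'<..} u * (sin u / u\<^sup>2) - (1 / u) * indicator {v..v'} u\<bar>
        \<le> indicator {v..v'} u * (1/2)"
      using AE_lborel_singleton[of v]
    proof eventually_elim
      case (elim u)
      show ?case
      proof (cases "v < u \<and> u \<le> v'")
        case True
        hence u: "u > 0" using v by simp
        have "sin u / u\<^sup>2 - 1 / u = (sin u - u) / u\<^sup>2" using u by (simp add: field_simps power2_eq_square)
        also have "\<bar>\<dots>\<bar> \<le> 1 / 2" using sin_linear_bounds[of u] u by (simp add: abs_div divide_le_eq)
        finally show ?thesis using True by simp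
      qed (use elim v in \<open>auto simp: indicator_def\<close>)
    qed
    show "integrable lborel (\<lambda>u. \<bar>indicator {v<..} u * (sin u / u\<^sup>2) - indicator {v'<..} u * (sin u / u\<^sup>2) - (1 / u) * indicator {v..v'} u\<bar>)"
      by (rule integrable_abs[OF i3])
    show "integrable lborel (\<lambda>u. indicator {v..v'} u * (1/2 :: real))" by (rule ci)
  qed
  have half: "(\<integral>u. indicator {v..v'} u * (1/2) \<partial>lborel) = (v' - v) / 2"
  proof -
    have "(\<integral>u. indicator {v..v'} u * (1/2) \<partial>lborel) = (\<integral>u. indicator {v..v'} u \<partial>lborel) * (1/2 :: real)"
      by (rule integral_mult_left_zero)
    thus ?thesis using v by simp
  qed
  show ?thesis unfolding eq by (rule order_trans[OF bd], unfold half) (use v in \<open>simp add: field_simps\<close>)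
qed

text \<open>A Frullani integral: cut off at d and rescaled, it is t * (S (t * d) - S d), and this
  difference of tail integrals tends to - ln t as d tends to 0. Negative t reduces to positive t
  because the integrand is odd in t.\<close>

lemma stable_kernel_sin: "stable_kernel (\<lambda>y. sin (t * y) - t * sin y) = - (t * ln \<bar>t\<bar>)"
proof -
  have pos: "stable_kernel (\<lambda>y. sin (t * y) - t * sin y) = - (t * ln t)" if t: "t > 0" for t
  proof -
    define S where "S = (\<lambda>v. \<integral>u. indicator {v<..} u * (sin u / u\<^sup>2) \<partial>(lborel :: real measure))"
    define h where "h = (\<lambda>y. sin (t * y) - t * sin y)"
    define d where "d = (\<lambda>n::nat. 1 / real (Suc n))"
    have d0: "d n > 0" for n by (simp add: d_def)
    have dl: "d \<longlonglongrightarrow> 0" unfolding d_def using LIMSEQ_Suc[OF lim_1_over_n[where 'a = real]] by (simp add: field_simps)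
    have hm [measurable]: "h \<in> borel_measurable borel" unfolding h_def by measurable
    have ki: "integrable lborel (\<lambda>y. indicator {0<..} y * (h y / y\<^sup>2))"
      by (rule stable_kernel_integrable[OF hm, where C = "2 + t\<^sup>2 + \<bar>t\<bar>"]) (simp_all only: h_def sin_kernel_bounds)
    have lim1: "(\<lambda>n. \<integral>y. indicator {d n<..} y * (h y / y\<^sup>2) \<partial>lborel) \<longlonglongrightarrow> stable_kernel h"
      unfolding stable_kernel_def
    proof (rule integral_dominated_convergence[where w = "\<lambda>y. \<bar>indicator {0<..} y * (h y / y\<^sup>2)\<bar>"])
      show "AE y in lborel. (\<lambda>n. indicator {d n<..} y * (h y / y\<^sup>2)) \<longlonglongrightarrow> indicator {0<..} y * (h y / y\<^sup>2)"
      proof (rule AE_I2)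
        fix y :: real
        show "(\<lambda>n. indicator {d n<..} y * (h y / y\<^sup>2)) \<longlonglongrightarrow> indicator {0<..} y * (h y / y\<^sup>2)"
        proof (cases "y > 0")
          case True
          have "eventually (\<lambda>n. d n < y) sequentially" using order_tendstoD(2)[OF dl True] .
          hence "eventually (\<lambda>n. indicator {0<..} y * (h y / y\<^sup>2) = indicator {d n<..} y * (h y / y\<^sup>2)) sequentially"
            by eventually_elim (use True in auto)
          thus ?thesis by (rule Lim_transform_eventually[OF tendsto_const])
        next
          case False
          have "indicator {d n<..} y = (0::real)" for n using False d0[of n] by (auto simp: indicator_def)
          thus ?thesis using False by simp
        qed
      qed
      show "AE y in lborel. norm (indicator {d n<..} y * (h y / y\<^sup>2)) \<le> \<bar>indicator {0<..} y * (h y / y\<^sup>2)\<bar>" for n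
      proof (rule AE_I2)
        fix y :: real
        show "norm (indicator {d n<..} y * (h y / y\<^sup>2)) \<le> \<bar>indicator {0<..} y * (h y / y\<^sup>2)\<bar>"
          using d0[of n] by (auto simp: indicator_def)
      qed
    qed (use integrable_abs[OF ki] in simp_all)
    have iS: "integrable lborel (\<lambda>u. indicator {x<..} u * (sin (c * u) / u\<^sup>2))" if "x > 0" for x c :: real
    proof (rule Bochner_Integration.integrable_bound)
      show "integrable lborel (\<lambda>u. indicator {x<..} u *\<^sub>R (1 / u\<^sup>2))"
        using inverse_square_tail[OF that] by (simp add: set_integrable_def)
      show "AE u in lborel. norm (indicator {x<..} u * (sin (c * u) / u\<^sup>2)) \<le> norm (indicator {x<..} u *\<^sub>R (1 / u\<^sup>2))"
        by (rule AE_I2) (auto simp: indicator_def abs_div divide_right_mono)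
    qed measurable
    have eq: "(\<integral>y. indicator {d n<..} y * (h y / y\<^sup>2) \<partial>lborel) = t * (S (t * d n) - S (d n))" for n
    proof -
      have "S (t * d n) = t * (\<integral>y. indicator {t * d n<..} (t * y) * (sin (t * y) / (t * y)\<^sup>2) \<partial>lborel)"
        unfolding S_def using t by (subst lborel_integral_real_affine[where c = t and t = 0]) auto
      also have "(\<integral>y. indicator {t * d n<..} (t * y) * (sin (t * y) / (t * y)\<^sup>2) \<partial>lborel) = (\<integral>y. (indicator {d n<..} y * (sin (t * y) / y\<^sup>2)) / t\<^sup>2 \<partial>lborel)"
        using t by (intro Bochner_Integration.integral_cong refl) (auto simp: indicator_def power_mult_distrib)
      also have "\<dots> = (\<integral>y. indicator {d n<..} y * (sin (t * y) / y\<^sup>2) \<partial>lborel) / t\<^sup>2" by (rule integral_divide_zero)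
      finally have S1: "(\<integral>y. indicator {d n<..} y * (sin (t * y) / y\<^sup>2) \<partial>lborel) = t * S (t * d n)"
        using t by (simp add: power2_eq_square)
      have "(\<integral>y. indicator {d n<..} y * (h y / y\<^sup>2) \<partial>lborel) =
          (\<integral>y. indicator {d n<..} y * (sin (t * y) / y\<^sup>2) - t * (indicator {d n<..} y * (sin (1 * y) / y\<^sup>2)) \<partial>lborel)"
        by (intro Bochner_Integration.integral_cong refl) (simp add: h_def diff_divide_distrib algebra_simps)
      also have "\<dots> = (\<integral>y. indicator {d n<..} y * (sin (t * y) / y\<^sup>2) \<partial>lborel) - t * (\<integral>y. indicator {d n<..} y * (sin (1 * y) / y\<^sup>2) \<partial>lborel)"
        using Bochner_Integration.integral_diff[OF iS[OF d0, of n t] integrable_mult_right[OF iS[OF d0, of n 1], of t]]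
        unfolding integral_mult_right_zero .
      finally show ?thesis using S1 by (simp add: S_def right_diff_distrib)
    qed
    have bound: "\<bar>S (t * d n) - S (d n) - (- ln t)\<bar> \<le> (1 + t) * d n" for n
    proof -
      have td: "t * d n > 0" using t d0[of n] by simp
      have ll: "ln (t * d n) = ln t + ln (d n)" using t d0[of n] by (simp add: ln_mult)
      show ?thesis
      proof (cases "t \<le> 1")
        case True
        hence "t * d n \<le> d n" using d0[of n] by (simp add: mult_left_le_one_le)
        from sine_tail_difference[OF td this] have "\<bar>S (t * d n) - S (d n) - (- ln t)\<bar> \<le> d n"
          using ll by (simp add: S_def)
        thus ?thesis using td by (simp add: distrib_right)
      next
        case False
        hence "d n \<le> t * d n" using d0[of n] by simp
        from sine_tail_difference[OF d0 this] have "\<bar>S (d n) - S (t * d n) - ln t\<bar> \<le> t * d n"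
          using ll by (simp add: S_def)
        thus ?thesis using d0[of n] by (simp add: distrib_right)
      qed
    qed
    have "(\<lambda>n. S (t * d n) - S (d n) - (- ln t)) \<longlonglongrightarrow> 0"
    proof (rule Lim_null_comparison)
      show "eventually (\<lambda>n. norm (S (t * d n) - S (d n) - (- ln t)) \<le> (1 + t) * d n) sequentially"
        using bound by (intro always_eventually) auto
      show "(\<lambda>n. (1 + t) * d n) \<longlonglongrightarrow> 0" using tendsto_mult_left[OF dl, of "1 + t"] by simp
    qed
    hence "(\<lambda>n. S (t * d n) - S (d n)) \<longlonglongrightarrow> - ln t" by (subst (asm) LIM_zero_iff)
    hence "(\<lambda>n. t * (S (t * d n) - S (d n))) \<longlonglongrightarrow> t * (- ln t)" by (intro tendsto_intros)
    from LIMSEQ_unique[OF lim1[unfolded eq] this] show ?thesis by (simp add: h_def)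
  qed
  show ?thesis
  proof (cases "t = 0")
    case True
    thus ?thesis by (simp add: stable_kernel_def)
  next
    case False
    show ?thesis
    proof (cases "t > 0")
      case neg: False
      have "stable_kernel (\<lambda>y. sin (t * y) - t * sin y) = - stable_kernel (\<lambda>y. sin (- t * y) - (- t) * sin y)"
        unfolding stable_kernel_def
        by (subst Bochner_Integration.integral_minus[symmetric], intro Bochner_Integration.integral_cong refl) (simp add: field_simps diff_divide_distrib)
      also have "\<dots> = - (t * ln \<bar>t\<bar>)" using pos[of "- t"] neg False by simp
      finally show ?thesis .
    qed (use pos in simp)
  qed
qed

definition gauss_cf :: "nat \<Rightarrow> real \<Rightarrow> complex" where
  "gauss_cf K t = (\<integral>z. cis (t * (exp_half_sq z / a_const K)) \<partial>std_normal_distribution)"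

text \<open>With \<phi> the characteristic function of one scaled summand, \<phi>^K is compared with
  exp (K * (\<phi> - 1)), which is legitimate since both bases lie in the unit disc and K * norm
  (\<phi> - 1)^2 tends to 0. The real part of the exponent converges by the cosine integral, the
  centred imaginary part by the sine integral.\<close>

lemma gauss_cf_limit:
  "(\<lambda>K. gauss_cf K t ^ K * cis (- (t * (b_const K / a_const K)))) \<longlonglongrightarrow>
    exp (- complex_of_real \<bar>t\<bar> * (1 + \<i> * complex_of_real (2 / pi * sgn t * ln \<bar>t\<bar>)))"
proof -
  interpret real_distribution std_normal_distribution by (rule real_dist_normal_dist)
  define X where "X = (\<lambda>K z. exp_half_sq z / a_const K)"
  have [measurable]: "X K \<in> borel_measurable borel" for K unfolding X_def by measurable
  define E where "E = (\<lambda>f. integral\<^sup>L std_normal_distribution f :: real)"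
  have ib: "integrable std_normal_distribution f" if "f \<in> borel_measurable borel" "\<And>z. \<bar>f z\<bar> \<le> c" for f :: "real \<Rightarrow> real" and c :: real
    by (rule integrable_const_bound[of f c]) (use that in auto)
  have ic: "integrable std_normal_distribution (\<lambda>z. cos (t * X K z))" "integrable std_normal_distribution (\<lambda>z. sin (t * X K z))"
    "integrable std_normal_distribution (\<lambda>z. sin (X K z))" for K
    by (rule ib[of _ 1]; simp)+
  define W1 where "W1 = (\<lambda>K. real K * E (\<lambda>z. cos (t * X K z) - 1))"
  define W2 where "W2 = (\<lambda>K. real K * E (\<lambda>z. sin (t * X K z) - t * sin (X K z)))"
  have W1: "W1 \<longlonglongrightarrow> 2 / pi * (- (pi * \<bar>t\<bar> / 2))"
    unfolding W1_def E_def X_def stable_kernel_cos[symmetric]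
    by (rule heavy_scaled_limit[OF _ cos_kernel_bounds]) (intro continuous_intros)
  have W2: "W2 \<longlonglongrightarrow> 2 / pi * (- (t * ln \<bar>t\<bar>))"
    unfolding W2_def E_def X_def stable_kernel_sin[symmetric]
    by (rule heavy_scaled_limit[OF _ sin_kernel_bounds]) (intro continuous_intros)
  define \<phi> where "\<phi> = (\<lambda>K. gauss_cf K t)"
  have icis: "integrable std_normal_distribution (\<lambda>z. cis (t * X K z))" for K
    by (rule integrable_const_bound[where B = 1]) (auto simp: cis_conv_exp)
  have \<phi>: "\<phi> K - 1 = Complex (E (\<lambda>z. cos (t * X K z) - 1)) (E (\<lambda>z. sin (t * X K z)))" for K
  proof (rule complex_eqI)
    have "Re (\<phi> K) = E (\<lambda>z. cos (t * X K z))"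
      unfolding \<phi>_def gauss_cf_def E_def using integral_Re[OF icis[of K]] by (simp add: X_def)
    thus "Re (\<phi> K - 1) = Re (Complex (E (\<lambda>z. cos (t * X K z) - 1)) (E (\<lambda>z. sin (t * X K z))))"
      using ic(1)[of K] prob_space unfolding E_def by simp
    have "Im (\<phi> K) = E (\<lambda>z. sin (t * X K z))"
      unfolding \<phi>_def gauss_cf_def E_def using integral_Im[OF icis[of K]] by (simp add: X_def)
    thus "Im (\<phi> K - 1) = Im (Complex (E (\<lambda>z. cos (t * X K z) - 1)) (E (\<lambda>z. sin (t * X K z))))" by simp
  qed
  have n1: "norm (\<phi> K) \<le> 1" for K
  proof -
    have "norm (\<phi> K) \<le> (\<integral>z. norm (cis (t * X K z)) \<partial>std_normal_distribution)"
      unfolding \<phi>_def gauss_cf_def X_def by (rule integral_norm_bound)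
    thus ?thesis using prob_space by simp
  qed
  \<comment> \<open>The centring is K times the mean of sin (X K), so it subtracts exactly the term
    t * sin y of the compensated kernel, without remainder.\<close>
  have expo: "of_nat K * (\<phi> K - 1) + \<i> * of_real (- (t * (b_const K / a_const K))) = Complex (W1 K) (W2 K)" if "K \<ge> 2" for K
  proof -
    have "W2 K = real K * (E (\<lambda>z. sin (t * X K z)) - t * E (\<lambda>z. sin (X K z)))"
      unfolding W2_def E_def using ic(2,3)[of K] by simp
    moreover have "b_const K / a_const K = real K * E (\<lambda>z. sin (X K z))"
      using b_const_expectation[OF that] by (simp add: E_def X_def)
    ultimately show ?thesis unfolding \<phi> W1_def
      by (simp add: complex_eq_iff algebra_simps)
  qed
  have lim1: "(\<lambda>K. exp (of_nat K * (\<phi> K - 1)) * cis (- (t * (b_const K / a_const K)))) \<longlonglongrightarrow>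
    exp (- complex_of_real \<bar>t\<bar> * (1 + \<i> * complex_of_real (2 / pi * sgn t * ln \<bar>t\<bar>)))"
  proof -
    have "(\<lambda>K. exp (Complex (W1 K) (W2 K))) \<longlonglongrightarrow> exp (Complex (2 / pi * (- (pi * \<bar>t\<bar> / 2))) (2 / pi * (- (t * ln \<bar>t\<bar>))))"
      by (intro tendsto_intros W1 W2)
    also have "Complex (2 / pi * (- (pi * \<bar>t\<bar> / 2))) (2 / pi * (- (t * ln \<bar>t\<bar>))) =
        - complex_of_real \<bar>t\<bar> * (1 + \<i> * complex_of_real (2 / pi * sgn t * ln \<bar>t\<bar>))"
    proof -
      have "\<bar>t\<bar> * sgn t = t" by (simp add: abs_mult_sgn)
      hence "\<bar>t\<bar> * (2 / pi * sgn t * ln \<bar>t\<bar>) = 2 / pi * (t * ln \<bar>t\<bar>)" by (metis mult.assoc mult.left_commute)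
      thus ?thesis by (simp add: complex_eq_iff abs_mult_sgn)
    qed
    finally have l: "(\<lambda>K. exp (Complex (W1 K) (W2 K))) \<longlonglongrightarrow> exp (- complex_of_real \<bar>t\<bar> * (1 + \<i> * complex_of_real (2 / pi * sgn t * ln \<bar>t\<bar>)))" .
    have "eventually (\<lambda>K. exp (Complex (W1 K) (W2 K)) = exp (of_nat K * (\<phi> K - 1)) * cis (- (t * (b_const K / a_const K)))) sequentially"
      using eventually_ge_at_top[of 2]
    proof eventually_elim
      case (elim K)
      show ?case unfolding expo[OF elim, symmetric] exp_add by (simp only: cis_conv_exp)
    qed
    thus ?thesis by (rule Lim_transform_eventually[OF l])
  qed
  \<comment> \<open>Real and imaginary part of \<open>\<phi> K - 1\<close> are bounded by the mean
    of (2 + \<bar>t\<bar>) times the minimum of exp_half_sq z / a_K and 1, which is O(sqrt (ln a_K)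
    / a_K).\<close>
  define r where "r = (\<lambda>K. (2 + \<bar>t\<bar>) * (2 * exp 1 * sqrt (ln (a_const K))) / a_const K)"
  have ev: "eventually (\<lambda>K. norm (\<phi> K - 1) \<le> 2 * r K) sequentially"
  proof -
    have "eventually (\<lambda>K. a_const K > 0 \<and> ln (a_const K) \<ge> 1) sequentially"
      unfolding a_const_def by (intro eventually_conj; real_asymp)
    thus ?thesis
    proof eventually_elim
      case (elim K)
      hence a: "a_const K > 0" "ln (a_const K) \<ge> 1" by auto
      have mi: "E (\<lambda>z. (2 + \<bar>t\<bar>) / a_const K * min (exp_half_sq z) (a_const K)) \<le> r K"
        unfolding E_def using mult_left_mono[OF min_exp_half_sq_expectation[OF a(2,1)], of "(2 + \<bar>t\<bar>) / a_const K"] a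
        by (simp add: r_def)
      have ab: "\<bar>min (exp_half_sq z) (a_const K)\<bar> \<le> a_const K" for z
        using exp_half_sq_pos[of z] a(1) by linarith
      have i: "integrable std_normal_distribution (\<lambda>z. (2 + \<bar>t\<bar>) / a_const K * min (exp_half_sq z) (a_const K))"
        by (intro integrable_mult_right ib[of _ "a_const K"]) (use ab in auto)
      have b: "\<bar>f (t * X K z)\<bar> \<le> (2 + \<bar>t\<bar>) / a_const K * min (exp_half_sq z) (a_const K)"
        if f: "\<And>x. \<bar>f x\<bar> \<le> 2" "\<And>x. \<bar>f x\<bar> \<le> \<bar>x\<bar>" for f :: "real \<Rightarrow> real" and z
      proof (cases "exp_half_sq z \<le> a_const K")
        case True
        have "\<bar>f (t * X K z)\<bar> \<le> \<bar>t * X K z\<bar>" by (rule f(2))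
        also have "\<dots> = \<bar>t\<bar> * (exp_half_sq z / a_const K)" using a by (simp add: X_def abs_mult less_imp_le[OF exp_half_sq_pos])
        also have "\<dots> \<le> (2 + \<bar>t\<bar>) * (exp_half_sq z / a_const K)"
          using a by (intro mult_right_mono) (auto simp: less_imp_le[OF exp_half_sq_pos])
        finally show ?thesis using True by simp
      next
        case False
        have "\<bar>f (t * X K z)\<bar> \<le> 2 + \<bar>t\<bar>" using f(1)[of "t * X K z"] by simp
        thus ?thesis using False a by simp
      qed
      have b1: "\<bar>E (\<lambda>z. f (t * X K z))\<bar> \<le> r K"
        if f: "f \<in> borel_measurable borel" "\<And>x. \<bar>f x\<bar> \<le> 2" "\<And>x. \<bar>f x\<bar> \<le> \<bar>x\<bar>" for f :: "real \<Rightarrow> real"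
      proof -
        have [measurable]: "(\<lambda>z. f (t * X K z)) \<in> borel_measurable borel" by (rule measurable_compose[OF _ f(1)]) measurable
        have "\<bar>E (\<lambda>z. f (t * X K z))\<bar> \<le> E (\<lambda>z. \<bar>f (t * X K z)\<bar>)" unfolding E_def by (rule integral_abs_bound)
        also have "\<dots> \<le> E (\<lambda>z. (2 + \<bar>t\<bar>) / a_const K * min (exp_half_sq z) (a_const K))"
          unfolding E_def using b[OF f(2,3)] f(2) by (intro integral_mono i ib[of _ 2]) auto
        finally show ?thesis using mi by linarith
      qed
      have "\<bar>E (\<lambda>z. cos (t * X K z) - 1)\<bar> \<le> r K"
      proof (rule b1[of "\<lambda>x. cos x - 1"])
        show "\<bar>cos x - 1\<bar> \<le> 2" for x :: real using cos_le_one[of x] cos_ge_minus_one[of x] by linarith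
        show "\<bar>cos x - 1\<bar> \<le> \<bar>x\<bar>" for x :: real using abs_cos_diff_le[of x 0] by simp
      qed measurable
      moreover have "\<bar>E (\<lambda>z. sin (t * X K z))\<bar> \<le> r K"
      proof (rule b1[of sin])
        show "\<bar>sin x\<bar> \<le> 2" for x :: real using abs_sin_le_one[of x] by linarith
      qed (auto simp: abs_sin_x_le_abs_x)
      moreover have "norm (\<phi> K - 1) \<le> \<bar>E (\<lambda>z. cos (t * X K z) - 1)\<bar> + \<bar>E (\<lambda>z. sin (t * X K z))\<bar>"
        unfolding \<phi> using cmod_le[of "Complex (E (\<lambda>z. cos (t * X K z) - 1)) (E (\<lambda>z. sin (t * X K z)))"] by simp
      ultimately show ?case by linarith
    qed
  qed
  have lim2: "(\<lambda>K. gauss_cf K t ^ K * cis (- (t * (b_const K / a_const K))) - exp (of_nat K * (\<phi> K - 1)) * cis (- (t * (b_const K / a_const K)))) \<longlonglongrightarrow> 0"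
  proof (rule Lim_null_comparison)
    show "eventually (\<lambda>K. norm (gauss_cf K t ^ K * cis (- (t * (b_const K / a_const K))) - exp (of_nat K * (\<phi> K - 1)) * cis (- (t * (b_const K / a_const K))))
        \<le> exp 2 * (4 * (real K * (r K)\<^sup>2))) sequentially"
      using ev
    proof eventually_elim
      case (elim K)
      have "norm (gauss_cf K t ^ K * cis (- (t * (b_const K / a_const K))) - exp (of_nat K * (\<phi> K - 1)) * cis (- (t * (b_const K / a_const K))))
        = norm (\<phi> K ^ K - exp (\<phi> K - 1) ^ K)"
        unfolding left_diff_distrib[symmetric] norm_mult exp_of_nat_mult by (simp add: \<phi>_def)
      also have "\<dots> \<le> real K * norm (\<phi> K - exp (\<phi> K - 1))"
      proof (rule norm_power_diff[OF n1])
        have "Re (\<phi> K) \<le> 1" using n1[of K] complex_Re_le_cmod[of "\<phi> K"] by linarith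
        thus "norm (exp (\<phi> K - 1)) \<le> 1" by simp
      qed
      finally have n2: "norm (gauss_cf K t ^ K * cis (- (t * (b_const K / a_const K))) - exp (of_nat K * (\<phi> K - 1)) * cis (- (t * (b_const K / a_const K))))
        \<le> real K * norm (\<phi> K - exp (\<phi> K - 1))" .
      have "norm (\<phi> K - exp (\<phi> K - 1)) = norm (exp (\<phi> K - 1) - (\<Sum>i\<le>1. (\<phi> K - 1) ^ i / fact i))"
        by (simp add: norm_minus_commute)
      also have "\<dots> \<le> exp (norm (\<phi> K - 1)) * (norm (\<phi> K - 1) ^ Suc 1) / fact 1" by (rule Taylor_exp_field)
      also have "\<dots> \<le> exp 2 * (2 * r K)\<^sup>2"
      proof -
        have "norm (\<phi> K - 1) \<le> 2" using norm_triangle_ineq4[of "\<phi> K" 1] n1[of K] by simp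
        moreover have "(norm (\<phi> K - 1))\<^sup>2 \<le> (2 * r K)\<^sup>2" using elim by (intro power_mono) auto
        ultimately show ?thesis by (simp add: numeral_2_eq_2 mult_mono)
      qed
      finally have "real K * norm (\<phi> K - exp (\<phi> K - 1)) \<le> real K * (exp 2 * (2 * r K)\<^sup>2)"
        by (rule mult_left_mono) simp
      moreover have "real K * (exp 2 * (2 * r K)\<^sup>2) = exp 2 * (4 * (real K * (r K)\<^sup>2))"
        by (simp add: power_mult_distrib)
      ultimately show ?case using n2 by linarith
    qed
    have "(\<lambda>K. real K * (r K)\<^sup>2) \<longlonglongrightarrow> 0" unfolding r_def a_const_def by real_asymp
    from tendsto_mult_left[OF this, of "exp 2 * 4"]
    show "(\<lambda>K. exp 2 * (4 * (real K * (r K)\<^sup>2))) \<longlonglongrightarrow> 0" by (simp add: mult.assoc)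
  qed
  from tendsto_add[OF lim2 lim1] show ?thesis by simp
qed

subsection \<open>Lindeberg replacement\<close>

abbreviation (input) seq_space :: "(nat \<Rightarrow> real) measure" where
  "seq_space \<equiv> PiM UNIV (\<lambda>_. borel)"

text \<open>y i is the i-th error and c i j its coefficient in coordinate j. The value is a function
  of all j, so that test functions live on one space for every choice of the index sets.\<close>

definition comb :: "nat set \<Rightarrow> (nat \<Rightarrow> nat \<Rightarrow> real) \<Rightarrow> (nat \<Rightarrow> real) \<Rightarrow> nat \<Rightarrow> real" where
  "comb I c y = (\<lambda>j. \<Sum>i\<in>I. y i * c i j)"

lemma comb_insert:
  assumes "finite I" "k \<notin> I"
  shows "comb (insert k I) c (x(k := y)) = (\<lambda>j. y * c k j + comb I c x j)"
proof
  fix j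
  have "(\<Sum>i\<in>I. (x(k := y)) i * c i j) = (\<Sum>i\<in>I. x i * c i j)"
    using assms by (intro sum.cong) auto
  thus "comb (insert k I) c (x(k := y)) j = y * c k j + comb I c x j"
    using assms by (simp add: comb_def)
qed

lemma comb_measurable:
  assumes F: "F \<in> borel_measurable seq_space" and D: "\<And>i. sets (D i) = sets (borel :: real measure)"
  shows "(\<lambda>y. F (\<lambda>j. z j + comb I c y j)) \<in> borel_measurable (PiM I D)"
proof (rule measurable_compose[OF _ F], rule measurable_abs_UNIV)
  fix j
  have [measurable]: "(\<lambda>y. y i) \<in> borel_measurable (PiM I D)" if "i \<in> I" for i
    using measurable_component_singleton[OF that, of D] D[of i] by (simp cong: measurable_cong_sets)
  show "(\<lambda>y. z j + comb I c y j) \<in> borel_measurable (PiM I D)"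
    unfolding comb_def by (intro borel_measurable_add borel_measurable_sum borel_measurable_times) auto
qed

lemma line_measurable:
  assumes F: "F \<in> borel_measurable seq_space"
  shows "(\<lambda>y. F (\<lambda>j. z j + y * c j)) \<in> borel_measurable borel"
  by (rule measurable_compose[OF _ F], rule measurable_abs_UNIV) measurable

lemma shift_measurable:
  assumes F: "F \<in> borel_measurable seq_space"
  shows "(\<lambda>y. F (\<lambda>j. z j + y j)) \<in> borel_measurable seq_space"
  by (rule measurable_compose[OF _ F], rule measurable_abs_UNIV) measurable

text \<open>Both orders of integration are needed: with coordinate k outermost the other coordinates
  can be exchanged under the integral, with k innermost coordinate k itself.\<close>

lemma (in product_prob_space) product_integral_insert_rev:
  fixes f :: "_ \<Rightarrow> real"
  assumes J: "finite J" "k \<notin> J"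
    and f: "f \<in> borel_measurable (PiM (insert k J) M)" "\<And>x. \<bar>f x\<bar> \<le> B"
  shows "integral\<^sup>L (PiM (insert k J) M) f = (\<integral>y. (\<integral>x. f (x(k := y)) \<partial>PiM J M) \<partial>M k)"
    and "integral\<^sup>L (PiM (insert k J) M) f = (\<integral>x. (\<integral>y. f (x(k := y)) \<partial>M k) \<partial>PiM J M)"
proof -
  interpret PI: finite_product_prob_space M J by standard fact
  interpret PK: finite_product_prob_space M "insert k J" by standard (use J in auto)
  have PIp: "prob_space (PiM J M)" "prob_space (PiM (insert k J) M)" "prob_space (M k)"
    by (rule prob_space_PiM prob_space)+
  interpret P: pair_prob_space "PiM J M" "M k"
    unfolding pair_prob_space_def pair_sigma_finite_def
    using PIp by (simp add: prob_space_imp_sigma_finite)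
  have int: "integrable (PiM (insert k J) M) f"
    by (rule finite_measure.integrable_const_bound[where B = B])
      (use PIp f in \<open>auto simp: prob_space_def\<close>)
  show 1: "integral\<^sup>L (PiM (insert k J) M) f = (\<integral>x. (\<integral>y. f (x(k := y)) \<partial>M k) \<partial>PiM J M)"
    by (rule product_integral_insert[OF J int])
  have m: "(\<lambda>(x, y). f (x(k := y))) \<in> borel_measurable (PiM J M \<Otimes>\<^sub>M M k)"
    using measurable_compose[OF measurable_add_dim f(1)] by (simp add: split_beta')
  have "integrable (PiM J M \<Otimes>\<^sub>M M k) (\<lambda>(x, y). f (x(k := y)))"
    by (rule P.P.integrable_const_bound[where B = B]) (use m f in \<open>auto\<close>)
  from P.Fubini_integral[OF this]
  show "integral\<^sup>L (PiM (insert k J) M) f = (\<integral>y. (\<integral>x. f (x(k := y)) \<partial>PiM J M) \<partial>M k)"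
    using 1 by simp
qed

lemma real_dist_product_prob_space:
  assumes "\<And>i. real_distribution (D i)"
  shows "product_prob_space D"
proof -
  interpret real_distribution "D i" for i by fact
  show ?thesis by (rule product_prob_spaceI) unfold_locales
qed

text \<open>m is an upper bound and not the value of the third absolute moment, so that one m can
  serve all errors together with the Gaussian ones.\<close>

definition std3 :: "real measure \<Rightarrow> real \<Rightarrow> bool" where
  "std3 D m \<longleftrightarrow> real_distribution D \<and> integrable D (\<lambda>y. \<bar>y\<bar> ^ 3) \<and> integral\<^sup>L D (\<lambda>y. y) = 0 \<and>
     integral\<^sup>L D (\<lambda>y. y\<^sup>2) = 1 \<and> integral\<^sup>L D (\<lambda>y. \<bar>y\<bar> ^ 3) \<le> m"

text \<open>Mean 0 removes the linear term and variance 1 turns the quadratic one into Q, so E = F z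
  + Q. This number does not depend on D, hence any two standardised laws can be compared through
  it.\<close>

lemma std3_expand:
  assumes F: "F \<in> borel_measurable seq_space" "\<And>z. \<bar>F z\<bar> \<le> B" and cub: "cubic_along F c d" "d \<ge> 0"
  shows "\<exists>E. \<forall>D m. std3 D m \<longrightarrow> \<bar>(\<integral>y. F (\<lambda>j. z j + y * c j) \<partial>D) - E\<bar> \<le> d * m"
proof -
  obtain L Q where LQ: "\<And>y. \<bar>F (\<lambda>j. z j + y * c j) - F z - y * L - y\<^sup>2 * Q\<bar> \<le> d * \<bar>y\<bar> ^ 3"
    using cub unfolding cubic_along_def by meson
  show ?thesis
  proof (intro exI allI impI)
    fix D' m3' assume "std3 D' m3'"
    hence D: "real_distribution D'" "integrable D' (\<lambda>y. \<bar>y\<bar> ^ 3)" "integral\<^sup>L D' (\<lambda>y. y) = 0"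
      "integral\<^sup>L D' (\<lambda>y. y\<^sup>2) = 1" "integral\<^sup>L D' (\<lambda>y. \<bar>y\<bar> ^ 3) \<le> m3'"
      by (simp_all add: std3_def)
    interpret real_distribution D' by fact
    have dom: "\<bar>y\<bar> \<le> 1 + \<bar>y\<bar> ^ 3" "y\<^sup>2 \<le> 1 + \<bar>y\<bar> ^ 3" for y :: real
    proof -
      have "\<bar>y\<bar> \<le> 1 + \<bar>y\<bar> ^ 3 \<and> \<bar>y\<bar>\<^sup>2 \<le> 1 + \<bar>y\<bar> ^ 3"
      proof (cases "\<bar>y\<bar> \<le> 1")
        case True
        thus ?thesis using power_le_one[of "\<bar>y\<bar>" 2] zero_le_power[of "\<bar>y\<bar>" 3] by linarith
      next
        case False
        hence "\<bar>y\<bar> ^ 1 \<le> \<bar>y\<bar> ^ 3" "\<bar>y\<bar> ^ 2 \<le> \<bar>y\<bar> ^ 3" by (intro power_increasing; simp)+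
        thus ?thesis by simp
      qed
      thus "\<bar>y\<bar> \<le> 1 + \<bar>y\<bar> ^ 3" "y\<^sup>2 \<le> 1 + \<bar>y\<bar> ^ 3" by auto
    qed
    have i3: "integrable D' (\<lambda>y. 1 + \<bar>y\<bar> ^ 3)" using D(2) by simp
    have i1: "integrable D' (\<lambda>y. y)"
      by (rule Bochner_Integration.integrable_bound[OF i3]) (use dom in auto)
    have i2: "integrable D' (\<lambda>y. y\<^sup>2)"
      by (rule Bochner_Integration.integrable_bound[OF i3]) (use dom in auto)
    have [measurable]: "(\<lambda>y. F (\<lambda>j. z j + y * c j)) \<in> borel_measurable borel"
      by (rule line_measurable[OF F(1)])
    have iF: "integrable D' (\<lambda>y. F (\<lambda>j. z j + y * c j))"
      by (rule integrable_const_bound[where B = B]) (use F(2) in auto)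
    define R where "R = (\<lambda>y. F (\<lambda>j. z j + y * c j) - F z - y * L - y\<^sup>2 * Q)"
    have iR: "integrable D' R" unfolding R_def using i1 i2 iF by auto
    have "integral\<^sup>L D' R = (\<integral>y. F (\<lambda>j. z j + y * c j) \<partial>D') - (F z + Q)"
      unfolding R_def using i1 i2 iF D(3,4) prob_space by simp
    moreover have "\<bar>integral\<^sup>L D' R\<bar> \<le> (\<integral>y. d * \<bar>y\<bar> ^ 3 \<partial>D')"
      using LQ D(2) iR unfolding R_def[symmetric]
      by (intro order_trans[OF integral_abs_bound] integral_mono) (auto simp: R_def)
    moreover have "(\<integral>y. d * \<bar>y\<bar> ^ 3 \<partial>D') \<le> d * m3'"
      using D(5) cub(2) by (simp add: mult_left_mono)
    ultimately show "\<bar>(\<integral>y. F (\<lambda>j. z j + y * c j) \<partial>D') - (F z + Q)\<bar> \<le> d * m3'"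
      by linarith
  qed
qed

lemma std3_swap:
  assumes D: "std3 D m" "std3 D' m'" 
    and F: "F \<in> borel_measurable seq_space" "\<And>z. \<bar>F z\<bar> \<le> B" and cub: "cubic_along F c d" "d \<ge> 0"
  shows "\<bar>(\<integral>y. F (\<lambda>j. z j + y * c j) \<partial>D) - (\<integral>y. F (\<lambda>j. z j + y * c j) \<partial>D')\<bar> \<le> d * (m + m')"
proof -
  obtain E where E: "\<And>D' m3'. std3 D' m3' \<Longrightarrow> \<bar>(\<integral>y. F (\<lambda>j. z j + y * c j) \<partial>D') - E\<bar> \<le> d * m3'"
    using std3_expand[OF F cub, of z] by blast
  from E[OF D(1)] E[OF D(2)] show ?thesis by (simp add: distrib_left abs_le_iff)
qed

lemma bounded_integral_diff_le:
  fixes f g :: "'a \<Rightarrow> real"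
  assumes "prob_space M" "f \<in> borel_measurable M" "g \<in> borel_measurable M"
    "\<And>x. x \<in> space M \<Longrightarrow> \<bar>f x\<bar> \<le> B" "\<And>x. x \<in> space M \<Longrightarrow> \<bar>g x\<bar> \<le> B" "\<And>x. x \<in> space M \<Longrightarrow> \<bar>f x - g x\<bar> \<le> e"
  shows "\<bar>integral\<^sup>L M f - integral\<^sup>L M g\<bar> \<le> e"
proof -
  interpret prob_space M by fact
  have i: "integrable M f" "integrable M g"
    by (rule integrable_const_bound[where B = B]; use assms in auto)+
  have "\<bar>integral\<^sup>L M f - integral\<^sup>L M g\<bar> = \<bar>\<integral>x. f x - g x \<partial>M\<bar>" using i by simp
  also have "\<dots> \<le> (\<integral>x. \<bar>f x - g x\<bar> \<partial>M)" by (rule integral_abs_bound)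
  also have "\<dots> \<le> (\<integral>x. e \<partial>M)" using i assms(6) by (intro integral_mono) auto
  finally show ?thesis by (simp add: prob_space)
qed

lemma integral_bounded_abs_le:
  fixes f :: "'a \<Rightarrow> real"
  assumes "prob_space M" "f \<in> borel_measurable M" "\<And>x. x \<in> space M \<Longrightarrow> \<bar>f x\<bar> \<le> B"
  shows "\<bar>integral\<^sup>L M f\<bar> \<le> B"
proof -
  interpret prob_space M by fact
  have "space M \<noteq> {}" by (rule not_empty)
  hence "B \<ge> 0" using assms(3) by fastforce
  thus ?thesis using bounded_integral_diff_le[OF assms(1,2), of "\<lambda>_. 0" B B] assms(3) by simp
qed

text \<open>The claim is made for every shift z, since in the induction step the contribution of one
  error is absorbed into the shift.\<close>

lemma lindeberg_swap:
  assumes I: "finite I" and D: "\<And>i. std3 (D i) (m i)" "\<And>i. std3 (D' i) (m' i)"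
    and F: "F \<in> borel_measurable seq_space" "\<And>z. \<bar>F z\<bar> \<le> B"
    and cub: "\<And>i. i \<in> I \<Longrightarrow> cubic_along F (c i) (d i)" "\<And>i. i \<in> I \<Longrightarrow> d i \<ge> 0"
  shows "\<bar>(\<integral>y. F (\<lambda>j. z j + comb I c y j) \<partial>PiM I D) - (\<integral>y. F (\<lambda>j. z j + comb I c y j) \<partial>PiM I D')\<bar>
    \<le> (\<Sum>i\<in>I. d i * (m i + m' i))"
  using I cub
proof (induction I arbitrary: z rule: finite_induct)
  case empty
  show ?case by (simp add: PiM_empty comb_def)
next
  case (insert k I)
  \<comment> \<open>A hybrid: index k is still distributed as in D, every other index already as in
    D'. Passing from D to M is the induction hypothesis under the integral over the k-th error;
    passing from M to D' exchanges that single error.\<close>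
  define M where "M = D'(k := D k)"
  have rd: "real_distribution (D i)" "real_distribution (D' i)" "real_distribution (M i)" for i
    using D unfolding std3_def M_def by auto
  have sb: "sets (D i) = sets borel" "sets (D' i) = sets borel" "sets (M i) = sets borel" for i
    using rd[of i] by (auto simp: real_distribution_def real_distribution_axioms_def)
  interpret PD: product_prob_space D by (rule real_dist_product_prob_space) (rule rd)
  interpret PD': product_prob_space D' by (rule real_dist_product_prob_space) (rule rd)
  interpret PM: product_prob_space M by (rule real_dist_product_prob_space) (rule rd)
  note prob = PD.prob_space PD'.prob_space PM.prob_space
  define f where "f = (\<lambda>y. F (\<lambda>j. z j + comb (insert k I) c y j))"
  have fm: "f \<in> borel_measurable (PiM (insert k I) X)" if "\<And>i. sets (X i) = sets borel" for X
    unfolding f_def by (rule comb_measurable[OF F(1) that])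
  have fB: "\<bar>f x\<bar> \<le> B" for x unfolding f_def by (rule F(2))
  have fupd: "f (x(k := y)) = F (\<lambda>j. (z j + y * c k j) + comb I c x j)"
      "f (x(k := y)) = F (\<lambda>j. (z j + comb I c x j) + y * c k j)" for x y
    unfolding f_def comb_insert[OF insert.hyps] by (simp_all add: algebra_simps)
  have eqM: "PiM I M = PiM I D'" unfolding M_def using insert.hyps by (intro PiM_cong) auto
  note iD = PD.product_integral_insert_rev[OF insert.hyps fm[of D, OF sb(1)] fB]
  note iD' = PD'.product_integral_insert_rev[OF insert.hyps fm[of D', OF sb(2)] fB]
  note iM = PM.product_integral_insert_rev[OF insert.hyps fm[of M, OF sb(3)] fB]
  have pI: "prob_space (PiM I D)" "prob_space (PiM I D')"
    by (rule prob_space_PiM, rule prob)+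
  have in_bd: "\<bar>\<integral>x. f (x(k := y)) \<partial>PiM I X\<bar> \<le> B" if "prob_space (PiM I X)" "\<And>i. sets (X i) = sets borel" for y X
    unfolding fupd by (rule integral_bounded_abs_le[OF that(1) comb_measurable[OF F(1) that(2)]]) (rule F(2))
  have m1: "(\<lambda>y. \<integral>x. f (x(k := y)) \<partial>PiM I X) \<in> borel_measurable (D k)" if X: "\<And>i. sets (X i) = sets borel" "\<And>i. prob_space (X i)" for X
  proof -
    interpret sigma_finite_measure "PiM I X"
      by (rule prob_space_imp_sigma_finite, rule prob_space_PiM, rule X)
    have cX: "sets (PiM I X) = sets (PiM I (\<lambda>_. borel))" by (rule sets_PiM_cong) (auto simp: X)
    have "(\<lambda>p. f ((snd p)(k := fst p))) \<in> borel_measurable (borel \<Otimes>\<^sub>M PiM I (\<lambda>_. borel))"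
      by (rule measurable_compose[OF _ fm[of "\<lambda>_. borel"]]) measurable
    hence "(\<lambda>(y, x). f (x(k := y))) \<in> borel_measurable (D k \<Otimes>\<^sub>M PiM I X)"
      by (subst measurable_cong_sets[OF sets_pair_measure_cong[OF sb(1) cX] refl]) (simp add: split_beta')
    from borel_measurable_lebesgue_integral[OF this] show ?thesis by simp
  qed
  have "\<bar>integral\<^sup>L (PiM (insert k I) D) f - integral\<^sup>L (PiM (insert k I) M) f\<bar> \<le> (\<Sum>i\<in>I. d i * (m i + m' i))"
  proof -
    have "M k = D k" by (simp add: M_def)
    show ?thesis
      unfolding iD(1) iM(1) eqM \<open>M k = D k\<close>
    proof (rule bounded_integral_diff_le[OF prob(1)])
      fix y
      show "\<bar>(\<integral>x. f (x(k := y)) \<partial>PiM I D) - (\<integral>x. f (x(k := y)) \<partial>PiM I D')\<bar> \<le> (\<Sum>i\<in>I. d i * (m i + m' i))"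
        unfolding fupd(1) by (rule insert.IH) (use insert.prems in auto)
      show "\<bar>\<integral>x. f (x(k := y)) \<partial>PiM I D\<bar> \<le> B" "\<bar>\<integral>x. f (x(k := y)) \<partial>PiM I D'\<bar> \<le> B"
        by (rule in_bd pI sb)+
    qed (rule m1 sb prob)+
  qed
  moreover have "\<bar>integral\<^sup>L (PiM (insert k I) M) f - integral\<^sup>L (PiM (insert k I) D') f\<bar> \<le> d k * (m k + m' k)"
  proof -
    have "M k = D k" by (simp add: M_def)
    have m2: "(\<lambda>x. \<integral>y. f (x(k := y)) \<partial>X) \<in> borel_measurable (PiM I D')" if X: "real_distribution X" for X
    proof -
      interpret X: real_distribution X by fact
      have cX: "sets (PiM I D') = sets (PiM I (\<lambda>_. borel))" by (rule sets_PiM_cong) (auto simp: sb)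
      have "(\<lambda>p. f ((fst p)(k := snd p))) \<in> borel_measurable (PiM I (\<lambda>_. borel) \<Otimes>\<^sub>M borel)"
        by (rule measurable_compose[OF _ fm[of "\<lambda>_. borel"]]) measurable
      hence "(\<lambda>(x, y). f (x(k := y))) \<in> borel_measurable (PiM I D' \<Otimes>\<^sub>M X)"
        by (subst measurable_cong_sets[OF sets_pair_measure_cong[OF cX X.events_eq_borel] refl]) (simp add: split_beta')
      from X.borel_measurable_lebesgue_integral[OF this] show ?thesis by simp
    qed
    have lb: "\<bar>\<integral>y. f (x(k := y)) \<partial>X\<bar> \<le> B" if "real_distribution X" for x X
    proof -
      interpret X: real_distribution X by fact
      show ?thesis unfolding fupd(2)
        by (rule integral_bounded_abs_le[OF X.prob_space_axioms])
           (use F(2) line_measurable[OF F(1)] in auto)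
    qed
    show ?thesis
      unfolding iD'(2) iM(2) eqM \<open>M k = D k\<close>
    proof (rule bounded_integral_diff_le[OF pI(2)])
      fix x
      show "\<bar>(\<integral>y. f (x(k := y)) \<partial>D k) - (\<integral>y. f (x(k := y)) \<partial>D' k)\<bar> \<le> d k * (m k + m' k)"
        unfolding fupd(2) by (rule std3_swap[OF D F]) (use insert.prems in auto)
      show "\<bar>\<integral>y. f (x(k := y)) \<partial>D k\<bar> \<le> B" "\<bar>\<integral>y. f (x(k := y)) \<partial>D' k\<bar> \<le> B"
        by (rule lb rd)+
    qed (rule m2 rd)+
  qed
  ultimately show ?case
    using insert.hyps unfolding f_def by simp
qed

lemma std3_normal: "\<exists>m. std3 std_normal_distribution m"
proof (rule exI[of _ "integral\<^sup>L std_normal_distribution (\<lambda>y. \<bar>y\<bar> ^ 3)"])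
  have "integrable std_normal_distribution (\<lambda>y. \<bar>y\<bar> ^ 3)"
    using integrable_norm[OF integrable_std_normal_distribution_moment[of 3]] by (simp add: power_abs)
  moreover have "integral\<^sup>L std_normal_distribution (\<lambda>y. y\<^sup>2) = 1"
    using std_normal_distribution_even_moments(1)[of 1] by (simp add: fact_numeral)
  moreover have "integral\<^sup>L std_normal_distribution (\<lambda>y. y) = 0"
    using integral_std_normal_distribution_moment_odd[of 1] by simp
  ultimately show "std3 std_normal_distribution (integral\<^sup>L std_normal_distribution (\<lambda>y. \<bar>y\<bar> ^ 3))"
    unfolding std3_def using real_dist_normal_dist by simp
qed

subsection \<open>Rotation invariance\<close>

text \<open>A shear translates one coordinate by an amount determined by the other, so Fubini and
  translation invariance on the line suffice.\<close>

lemma plane_shear_invariant: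
  assumes [measurable]: "f \<in> borel_measurable (borel :: (real \<times> real) measure)"
  shows "(\<integral>\<^sup>+p. f (fst p + t * snd p, snd p) \<partial>(lborel \<Otimes>\<^sub>M lborel)) = (\<integral>\<^sup>+p. f p \<partial>(lborel \<Otimes>\<^sub>M lborel))"
    and "(\<integral>\<^sup>+p. f (fst p, t * fst p + snd p) \<partial>(lborel \<Otimes>\<^sub>M lborel)) = (\<integral>\<^sup>+p. f p \<partial>(lborel \<Otimes>\<^sub>M lborel))"
proof -
  have [measurable]: "f \<in> borel_measurable (borel \<Otimes>\<^sub>M borel)" using assms by (simp add: borel_prod)
  have t: "(\<integral>\<^sup>+x. h (s + x) \<partial>lborel) = (\<integral>\<^sup>+x. h x \<partial>lborel)" if [measurable]: "h \<in> borel_measurable borel" for h :: "real \<Rightarrow> ennreal" and s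
    using nn_integral_real_affine[of h 1 s] by simp
  have "(\<integral>\<^sup>+p. f (fst p + t * snd p, snd p) \<partial>(lborel \<Otimes>\<^sub>M lborel)) = (\<integral>\<^sup>+y. \<integral>\<^sup>+x. f (t * y + x, y) \<partial>lborel \<partial>lborel)"
  proof -
    have "(\<lambda>p. f (fst p + t * snd p, snd p)) \<in> borel_measurable (lborel \<Otimes>\<^sub>M lborel)" by measurable
    from lborel_pair.nn_integral_snd[OF this] show ?thesis by (simp add: add.commute)
  qed
  also have "\<dots> = (\<integral>\<^sup>+y. \<integral>\<^sup>+x. f (x, y) \<partial>lborel \<partial>lborel)"
    by (intro nn_integral_cong t) simp
  also have "\<dots> = (\<integral>\<^sup>+p. f p \<partial>(lborel \<Otimes>\<^sub>M lborel))"
    using lborel_pair.nn_integral_snd[of f] by simp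
  finally show "(\<integral>\<^sup>+p. f (fst p + t * snd p, snd p) \<partial>(lborel \<Otimes>\<^sub>M lborel)) = (\<integral>\<^sup>+p. f p \<partial>(lborel \<Otimes>\<^sub>M lborel))" .
  have "(\<integral>\<^sup>+p. f (fst p, t * fst p + snd p) \<partial>(lborel \<Otimes>\<^sub>M lborel)) = (\<integral>\<^sup>+x. \<integral>\<^sup>+y. f (x, t * x + y) \<partial>lborel \<partial>lborel)"
  proof -
    have "(\<lambda>p. f (fst p, t * fst p + snd p)) \<in> borel_measurable (lborel \<Otimes>\<^sub>M lborel)" by measurable
    from lborel.nn_integral_fst[OF this] show ?thesis by simp
  qed
  also have "\<dots> = (\<integral>\<^sup>+x. \<integral>\<^sup>+y. f (x, y) \<partial>lborel \<partial>lborel)"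
    by (intro nn_integral_cong t) simp
  also have "\<dots> = (\<integral>\<^sup>+p. f p \<partial>(lborel \<Otimes>\<^sub>M lborel))"
    using lborel.nn_integral_fst[of f lborel] by simp
  finally show "(\<integral>\<^sup>+p. f (fst p, t * fst p + snd p) \<partial>(lborel \<Otimes>\<^sub>M lborel)) = (\<integral>\<^sup>+p. f p \<partial>(lborel \<Otimes>\<^sub>M lborel))" .
qed

definition rot :: "real \<Rightarrow> real \<Rightarrow> real \<times> real \<Rightarrow> real \<times> real" where
  "rot c s p = (c * fst p - s * snd p, s * fst p + c * snd p)"

lemma rot_measurable [measurable]: "rot c s \<in> borel_measurable borel"
  unfolding rot_def[abs_def] by (intro borel_measurable_continuous_onI continuous_intros)

text \<open>A rotation with \<open>s \<noteq> 0\<close> is a product of three shears.\<close>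

lemma plane_rotation_invariant:
  assumes [measurable]: "f \<in> borel_measurable (borel :: (real \<times> real) measure)" and cs: "c\<^sup>2 + s\<^sup>2 = 1"
    and that: "s \<noteq> 0"
  shows "(\<integral>\<^sup>+p. f (rot c s p) \<partial>(lborel \<Otimes>\<^sub>M lborel)) = (\<integral>\<^sup>+p. f p \<partial>(lborel \<Otimes>\<^sub>M lborel))"
proof -
  \<comment> \<open>For c = cos \<phi> and s = sin \<phi> this is - tan (\<phi> / 2), the parameter
    of the two outer shears; the middle shear has parameter s.\<close>
  define t where "t = (c - 1) / s"
  define A where "A = (\<lambda>p::real\<times>real. (fst p + t * snd p, snd p))"
  define Bm where "Bm = (\<lambda>p::real\<times>real. (fst p, s * fst p + snd p))"
  have [measurable]: "A \<in> borel_measurable borel" "Bm \<in> borel_measurable borel"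
    unfolding A_def Bm_def by (intro borel_measurable_continuous_onI continuous_intros)+
  have ts: "t * s = c - 1" using that by (simp add: t_def)
  have "s * (t * (c + 1)) = (t * s) * (c + 1)" by simp
  also have "\<dots> = s * (- s)" using cs unfolding ts by (simp add: power2_eq_square algebra_simps)
  finally have "s * (t * (c + 1)) = s * (- s)" .
  hence tc: "t * (c + 1) = - s" by (rule mult_left_cancel[OF that, THEN iffD1])
  have r: "rot c s p = A (Bm (A p))" for p
  proof -
    obtain x y where p: "p = (x, y)" by force
    have "x + t * y + t * (s * (x + t * y) + y) = x * (1 + t * s) + y * (t * (t * s + 1) + t)" by (simp add: algebra_simps)
    also have "\<dots> = c * x + y * (t * (c + 1))" using ts by (simp add: algebra_simps)
    finally have 1: "x + t * y + t * (s * (x + t * y) + y) = c * x - s * y" using tc by simp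
    have "s * (x + t * y) + y = s * x + (t * s + 1) * y" by (simp add: algebra_simps)
    hence 2: "s * (x + t * y) + y = s * x + c * y" using ts by simp
    show ?thesis using 1 2 by (simp add: p rot_def A_def Bm_def)
  qed
  have "(\<integral>\<^sup>+p. f (rot c s p) \<partial>(lborel \<Otimes>\<^sub>M lborel)) = (\<integral>\<^sup>+p. f (A (Bm (A p))) \<partial>(lborel \<Otimes>\<^sub>M lborel))"
    by (simp add: r)
  also have "\<dots> = (\<integral>\<^sup>+p. f (A (Bm p)) \<partial>(lborel \<Otimes>\<^sub>M lborel))"
  proof -
    have "(\<lambda>p. f (A (Bm p))) \<in> borel_measurable borel" by measurable
    from plane_shear_invariant(1)[OF this, of t] show ?thesis by (simp only: A_def)
  qed
  also have "\<dots> = (\<integral>\<^sup>+p. f (A p) \<partial>(lborel \<Otimes>\<^sub>M lborel))"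
  proof -
    have "(\<lambda>p. f (A p)) \<in> borel_measurable borel" by measurable
    from plane_shear_invariant(2)[OF this, of s] show ?thesis by (simp only: Bm_def)
  qed
  also have "\<dots> = (\<integral>\<^sup>+p. f p \<partial>(lborel \<Otimes>\<^sub>M lborel))"
  proof -
    have "(f) \<in> borel_measurable borel" by measurable
    from plane_shear_invariant(1)[OF this, of t] show ?thesis by (simp only: A_def)
  qed
  finally show ?thesis .
qed

text \<open>The product density depends on x^2 + y^2 only. The image measures are shown to be equal
  through indicator functions, because the invariance of Lebesgue measure is stated for nonnegative
  integrals.\<close>

lemma normal_rotation_invariant:
  fixes h :: "real \<times> real \<Rightarrow> real"
  assumes [measurable]: "h \<in> borel_measurable borel" and cs: "c\<^sup>2 + s\<^sup>2 = 1" "s \<noteq> 0"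
  shows "(\<integral>p. h (rot c s p) \<partial>(std_normal_distribution \<Otimes>\<^sub>M std_normal_distribution))
    = (\<integral>p. h p \<partial>(std_normal_distribution \<Otimes>\<^sub>M std_normal_distribution))"
proof -
  define \<phi> where "\<phi> = (\<lambda>p::real\<times>real. ennreal (std_normal_density (fst p)) * ennreal (std_normal_density (snd p)))"
  define NN where "NN = std_normal_distribution \<Otimes>\<^sub>M std_normal_distribution"
  have [measurable]: "\<phi> \<in> borel_measurable borel"
    unfolding \<phi>_def by (simp flip: borel_prod)
  have sl: "sets (lborel \<Otimes>\<^sub>M lborel) = sets (borel :: (real\<times>real) measure)"
    using sets_pair_measure_cong[OF sets_lborel sets_lborel] by (simp only: borel_prod)
  have NN: "NN = density (lborel \<Otimes>\<^sub>M lborel) \<phi>"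
    unfolding NN_def \<phi>_def
    by (subst pair_measure_density)
      (auto simp: split_beta' intro!: prob_space_imp_sigma_finite prob_space_normal_density lborel.sigma_finite_measure_axioms)
  have inv: "\<phi> (rot c s p) = \<phi> p" for p
  proof -
    obtain x y where p: "p = (x, y)" by force
    have "(c * x - s * y)\<^sup>2 + (s * x + c * y)\<^sup>2 = (c\<^sup>2 + s\<^sup>2) * (x\<^sup>2 + y\<^sup>2)"
      by (simp add: power2_eq_square algebra_simps)
    hence e: "(c * x - s * y)\<^sup>2 + (s * x + c * y)\<^sup>2 = x\<^sup>2 + y\<^sup>2" using cs by simp
    have dens: "std_normal_density u * std_normal_density v = (1 / sqrt (2 * pi))\<^sup>2 * exp (- (u\<^sup>2 + v\<^sup>2) / 2)" for u v
      by (simp add: std_normal_density_def power2_eq_square exp_add[symmetric] field_simps)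
    show ?thesis
      by (simp only: p rot_def \<phi>_def fst_conv snd_conv ennreal_mult'[OF normal_density_nonneg, symmetric] dens e)
  qed
  have m0: "f \<in> borel_measurable (lborel \<Otimes>\<^sub>M lborel)" if "f \<in> borel_measurable (borel :: (real\<times>real) measure)" for f :: "_ \<Rightarrow> ennreal"
    using that by (simp add: measurable_cong_sets[OF sl refl])
  have "distr NN borel (rot c s) = distr NN borel (\<lambda>p. p)"
  proof (rule measure_eqI)
    fix A assume "A \<in> sets (distr NN borel (rot c s))"
    hence [measurable]: "A \<in> sets borel" by simp
    have "(\<lambda>p. indicator A (rot c s p)::ennreal) \<in> borel_measurable borel" by measurable
    from m0[OF this] m0[OF borel_measurable_indicator[OF \<open>A \<in> sets borel\<close>]] m0[OF \<open>\<phi> \<in> borel_measurable borel\<close>]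
    have mA: "(\<lambda>p. indicator A (rot c s p)::ennreal) \<in> borel_measurable (lborel \<Otimes>\<^sub>M lborel)"
       "(\<lambda>p. indicator A p::ennreal) \<in> borel_measurable (lborel \<Otimes>\<^sub>M lborel)" "\<phi> \<in> borel_measurable (lborel \<Otimes>\<^sub>M lborel)" .
    have sNN: "sets NN = sets borel" unfolding NN sets_density by (rule sl)
    have [measurable]: "rot c s \<in> measurable NN borel" "(\<lambda>p. p) \<in> measurable NN borel" by (subst measurable_cong_sets[OF sNN refl], simp)+
    have "emeasure (distr NN borel (rot c s)) A = (\<integral>\<^sup>+p. indicator A p \<partial>distr NN borel (rot c s))" by simp
    also have "\<dots> = (\<integral>\<^sup>+p. indicator A (rot c s p) \<partial>NN)" by (rule nn_integral_distr) auto
    also have "\<dots> = (\<integral>\<^sup>+p. \<phi> p * indicator A (rot c s p) \<partial>(lborel \<Otimes>\<^sub>M lborel))"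
      unfolding NN by (rule nn_integral_density[OF mA(3,1)])
    also have "\<dots> = (\<integral>\<^sup>+p. \<phi> (rot c s p) * indicator A (rot c s p) \<partial>(lborel \<Otimes>\<^sub>M lborel))"
      by (simp only: inv)
    also have "\<dots> = (\<integral>\<^sup>+p. \<phi> p * indicator A p \<partial>(lborel \<Otimes>\<^sub>M lborel))"
      by (rule plane_rotation_invariant[of "\<lambda>p. \<phi> p * indicator A p"]) (use cs in auto)
    also have "\<dots> = (\<integral>\<^sup>+p. indicator A p \<partial>NN)"
      unfolding NN by (rule nn_integral_density[OF mA(3,2), symmetric])
    also have "\<dots> = (\<integral>\<^sup>+p. indicator A p \<partial>distr NN borel (\<lambda>p. p))" by (rule nn_integral_distr[symmetric]) auto
    also have "\<dots> = emeasure (distr NN borel (\<lambda>p. p)) A" by simp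
    finally show "emeasure (distr NN borel (rot c s)) A = emeasure (distr NN borel (\<lambda>p. p)) A" .
  qed simp
  hence "integral\<^sup>L (distr NN borel (rot c s)) h = integral\<^sup>L (distr NN borel (\<lambda>p. p)) h" by simp
  moreover have sNN: "sets NN = sets borel" unfolding NN sets_density by (rule sl)
  have m1: "rot c s \<in> measurable NN borel" by (subst measurable_cong_sets[OF sNN refl]) (rule rot_measurable)
  have m2: "(\<lambda>p. p) \<in> measurable NN borel" by (subst measurable_cong_sets[OF sNN refl]) simp
  ultimately show ?thesis unfolding NN_def[symmetric]
    using integral_distr[OF m1 assms(1)] integral_distr[OF m2 assms(1)] by simp
qed

section \<open>Gaussian vectors given by coefficient arrays\<close>

abbreviation (input) std_gauss :: "nat set \<Rightarrow> (nat \<Rightarrow> real) measure" where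
  "std_gauss I \<equiv> PiM I (\<lambda>_. std_normal_distribution)"

interpretation std_normal: real_distribution std_normal_distribution
  by (rule real_dist_normal_dist)

interpretation gauss: product_prob_space "\<lambda>_::nat. std_normal_distribution" "UNIV :: nat set"
  by (rule real_dist_product_prob_space) (rule real_dist_normal_dist)

lemma std_gauss_prob: "prob_space (std_gauss I)"
  by (rule prob_space_PiM) (rule std_normal.prob_space_axioms)

definition bdd_meas :: "((nat \<Rightarrow> real) \<Rightarrow> real) \<Rightarrow> bool" where
  "bdd_meas F \<longleftrightarrow> F \<in> borel_measurable seq_space \<and> (\<exists>B. \<forall>z. \<bar>F z\<bar> \<le> B)"

text \<open>A Gaussian vector is represented by its array c, and its law by these means over all
  bounded measurable F: two arrays have the same law if the means agree.\<close>

definition gauss_mean :: "nat set \<Rightarrow> (nat \<Rightarrow> nat \<Rightarrow> real) \<Rightarrow> ((nat \<Rightarrow> real) \<Rightarrow> real) \<Rightarrow> real" where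
  "gauss_mean I c F = (\<integral>y. F (comb I c y) \<partial>std_gauss I)"

lemma bdd_meas_shift: "bdd_meas F \<Longrightarrow> bdd_meas (\<lambda>z. F (\<lambda>j. u j + z j))"
  unfolding bdd_meas_def using shift_measurable[of F u] by auto

lemma gauss_mean_insert:
  assumes "finite I" "k \<notin> I" "bdd_meas F"
  shows "gauss_mean (insert k I) c F = (\<integral>y. gauss_mean I c (\<lambda>z. F (\<lambda>j. y * c k j + z j)) \<partial>std_normal_distribution)"
proof -
  obtain B where B: "\<And>z. \<bar>F z\<bar> \<le> B" and F: "F \<in> borel_measurable seq_space"
    using assms(3) by (auto simp: bdd_meas_def)
  have m: "(\<lambda>y. F (comb (insert k I) c y)) \<in> borel_measurable (std_gauss (insert k I))"
    using comb_measurable[OF F, of "\<lambda>_. std_normal_distribution" "\<lambda>_. 0"] by simp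
  show ?thesis
    unfolding gauss_mean_def gauss.product_integral_insert_rev(1)[OF assms(1,2) m B] comb_insert[OF assms(1,2)] ..
qed

lemma gauss_mean_cong:
  assumes "\<And>i j. i \<in> I \<Longrightarrow> c i j = c' i j"
  shows "gauss_mean I c F = gauss_mean I c' F"
proof -
  have "comb I c = comb I c'" unfolding comb_def using assms by (auto intro!: ext sum.cong)
  thus ?thesis by (simp add: gauss_mean_def)
qed

text \<open>Rotating the rows i and k of the array amounts to rotating the pair of errors (y i, y
  k). Fubini isolates this pair as the inner integral, where the planar invariance applies.\<close>

lemma gauss_mean_rotate:
  assumes I: "finite I" "i \<in> I" "k \<in> I" "i \<noteq> k" and F: "bdd_meas F" and cs: "a\<^sup>2 + s\<^sup>2 = 1" "s \<noteq> 0"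
  shows "gauss_mean I (c(i := \<lambda>j. a * c i j + s * c k j, k := \<lambda>j. - s * c i j + a * c k j)) F = gauss_mean I c F"
proof -
  define c' where "c' = c(i := \<lambda>j. a * c i j + s * c k j, k := \<lambda>j. - s * c i j + a * c k j)"
  define I0 where "I0 = I - {i, k}"
  have II: "I = insert i (insert k I0)" "finite I0" "i \<notin> insert k I0" "k \<notin> I0" "finite (insert k I0)"
    using I by (auto simp: I0_def)
  obtain B where B: "\<And>z. \<bar>F z\<bar> \<le> B" and Fm: "F \<in> borel_measurable seq_space"
    using F by (auto simp: bdd_meas_def)
  have co: "\<exists>h. h \<in> borel_measurable borel \<and> (\<forall>u v. F (comb I c'' (x(k := v, i := u))) = h (u, v))" for c'' and x :: "nat \<Rightarrow> real"
  proof (intro exI conjI allI)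
    show "F (comb I c'' (x(k := v, i := u))) = (\<lambda>p. F (comb I c'' (x(k := snd p, i := fst p)))) (u, v)" for u v by simp
    have m: "(\<lambda>p. comb I c'' (x(k := snd p, i := fst p)) j) \<in> borel_measurable borel" for j
    proof -
      have "(\<lambda>p::real\<times>real. (x(k := snd p, i := fst p)) m) \<in> borel_measurable borel" for m
        by (cases "m = i"; cases "m = k") (simp_all add: borel_measurable_continuous_onI continuous_intros)
      thus ?thesis unfolding comb_def by (intro borel_measurable_sum borel_measurable_times) auto
    qed
    show "(\<lambda>p. F (comb I c'' (x(k := snd p, i := fst p)))) \<in> borel_measurable borel"
    proof (rule measurable_compose[OF _ Fm])
      show "(\<lambda>p. comb I c'' (x(k := snd p, i := fst p))) \<in> measurable borel seq_space"
        using measurable_abs_UNIV[of "\<lambda>j p. comb I c'' (x(k := snd p, i := fst p)) j" borel "\<lambda>_. borel"] m by simp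
    qed
  qed
  define NN where "NN = std_normal_distribution \<Otimes>\<^sub>M std_normal_distribution"
  interpret P: pair_prob_space std_normal_distribution std_normal_distribution
    unfolding pair_prob_space_def pair_sigma_finite_def
    by (simp add: prob_space_imp_sigma_finite std_normal.prob_space_axioms)
  have sNN: "sets NN = sets borel"
    unfolding NN_def using sets_pair_measure_cong[OF std_normal.events_eq_borel std_normal.events_eq_borel] by (simp only: borel_prod)
  have exp: "gauss_mean I c'' F = (\<integral>x. (\<integral>p. F (comb I c'' (x(k := snd p, i := fst p))) \<partial>NN) \<partial>std_gauss I0)" for c''
  proof -
    define f where "f = (\<lambda>y. F (comb I c'' y))"
    have fB: "\<bar>f x\<bar> \<le> B" for x unfolding f_def by (rule B)
    have fm: "f \<in> borel_measurable (std_gauss I)"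
      unfolding f_def using comb_measurable[OF Fm, of "\<lambda>_. std_normal_distribution" "\<lambda>_. 0"] by simp
    define g where "g = (\<lambda>x. \<integral>u. f (x(i := u)) \<partial>std_normal_distribution)"
    have gB: "\<bar>g x\<bar> \<le> B" for x
    proof -
      obtain h where h: "h \<in> borel_measurable borel" "\<And>u v. F (comb I c'' (x(k := v, i := u))) = h (u, v)"
        using co[of c'' x] by blast
      have "f (x(i := u)) = h (u, x k)" for u using h(2)[of "x k" u] by (simp add: f_def)
      moreover have "(\<lambda>u. h (u, x k)) \<in> borel_measurable borel"
        by (rule measurable_compose[OF _ h(1)]) (intro borel_measurable_continuous_onI continuous_intros)
      ultimately have "(\<lambda>u. f (x(i := u))) \<in> borel_measurable std_normal_distribution"
        by simp
      thus ?thesis unfolding g_def using fB by (intro integral_bounded_abs_le[OF std_normal.prob_space_axioms])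
    qed
    have gm: "g \<in> borel_measurable (std_gauss (insert k I0))"
    proof -
      have "(\<lambda>(x, u). f (x(i := u))) \<in> borel_measurable (std_gauss (insert k I0) \<Otimes>\<^sub>M std_normal_distribution)"
        using measurable_compose[OF measurable_add_dim fm[unfolded II(1)]] by (simp add: split_beta')
      from std_normal.borel_measurable_lebesgue_integral[OF this] show ?thesis by (simp add: g_def)
    qed
    have "gauss_mean I c'' F = integral\<^sup>L (std_gauss (insert i (insert k I0))) f"
      unfolding gauss_mean_def f_def by (simp only: II(1)[symmetric])
    also have "\<dots> = integral\<^sup>L (std_gauss (insert k I0)) g"
      unfolding g_def by (rule gauss.product_integral_insert_rev(2)[OF II(5,3) fm[unfolded II(1)] fB])
    also have "\<dots> = (\<integral>x. (\<integral>v. g (x(k := v)) \<partial>std_normal_distribution) \<partial>std_gauss I0)"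
      by (rule gauss.product_integral_insert_rev(2)[OF II(2,4) gm gB])
    also have "\<dots> = (\<integral>x. (\<integral>p. F (comb I c'' (x(k := snd p, i := fst p))) \<partial>NN) \<partial>std_gauss I0)"
    proof (intro Bochner_Integration.integral_cong refl)
      fix x :: "nat \<Rightarrow> real"
      obtain h where h: "h \<in> borel_measurable borel" "\<And>u v. F (comb I c'' (x(k := v, i := u))) = h (u, v)"
        using co[of c'' x] by blast
      have hB: "\<bar>h p\<bar> \<le> B" for p using B h(2)[of "snd p" "fst p"] by (metis prod.collapse)
      have "h \<in> borel_measurable NN" using h(1) by (simp add: measurable_cong_sets[OF sNN refl])
      hence "integrable NN h"
        using hB unfolding NN_def by (intro P.P.integrable_const_bound[where B = B]) auto
      hence "integrable (std_normal_distribution \<Otimes>\<^sub>M std_normal_distribution) (\<lambda>(u, v). h (u, v))"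
        by (simp add: NN_def)
      from P.integral_snd[OF this]
      have "(\<integral>v. \<integral>u. h (u, v) \<partial>std_normal_distribution \<partial>std_normal_distribution) = integral\<^sup>L NN h"
        by (simp add: NN_def)
      thus "(\<integral>v. g (x(k := v)) \<partial>std_normal_distribution) = (\<integral>p. F (comb I c'' (x(k := snd p, i := fst p))) \<partial>NN)"
        by (simp add: g_def f_def h(2))
    qed
    finally show ?thesis .
  qed
  have "gauss_mean I c' F = gauss_mean I c F"
    unfolding exp
  proof (rule Bochner_Integration.integral_cong[OF refl])
    fix x :: "nat \<Rightarrow> real"
    obtain h where h: "h \<in> borel_measurable borel" "\<And>u v. F (comb I c (x(k := v, i := u))) = h (u, v)"
      using co[of c x] by blast
    have "comb I c' (x(k := v, i := u)) = comb I c (x(k := s * u + a * v, i := a * u - s * v))" for u v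
    proof
      fix j
      have s0: "(\<Sum>m\<in>I0. (x(k := v, i := u)) m * c' m j) = (\<Sum>m\<in>I0. (x(k := s * u + a * v, i := a * u - s * v)) m * c m j)"
        by (intro sum.cong) (auto simp: I0_def c'_def)
      show "comb I c' (x(k := v, i := u)) j = comb I c (x(k := s * u + a * v, i := a * u - s * v)) j"
        unfolding comb_def II(1) using II(2-5) I(4) s0
        by (simp add: c'_def algebra_simps)
    qed
    hence "F (comb I c' (x(k := snd p, i := fst p))) = h (rot a s p)" for p
      using h(2)[of "s * fst p + a * snd p" "a * fst p - s * snd p"] by (simp add: rot_def)
    thus "(\<integral>p. F (comb I c' (x(k := snd p, i := fst p))) \<partial>NN) = (\<integral>p. F (comb I c (x(k := snd p, i := fst p))) \<partial>NN)"
      using normal_rotation_invariant[OF h(1) cs] by (simp add: NN_def h(2))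
  qed
  thus ?thesis by (simp only: c'_def)
qed

text \<open>The covariance of the coordinates j and l of \<open>comb I c y\<close> for standard
  normal y; it is preserved by the row rotations.\<close>

definition gram_of :: "nat set \<Rightarrow> (nat \<Rightarrow> nat \<Rightarrow> real) \<Rightarrow> nat \<Rightarrow> nat \<Rightarrow> real" where
  "gram_of I c j l = (\<Sum>i\<in>I. c i j * c i l)"

lemma gram_of_rotate:
  assumes I: "finite I" "i \<in> I" "k \<in> I" "i \<noteq> k" and cs: "a\<^sup>2 + s\<^sup>2 = 1"
  shows "gram_of I (c(i := \<lambda>j. a * c i j + s * c k j, k := \<lambda>j. - s * c i j + a * c k j)) j l = gram_of I c j l"
proof -
  define I0 where "I0 = I - {i, k}"
  have II: "I = insert i (insert k I0)" "finite I0" "i \<notin> insert k I0" "k \<notin> I0" "finite (insert k I0)"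
    using I by (auto simp: I0_def)
  define c' where "c' = c(i := \<lambda>j. a * c i j + s * c k j, k := \<lambda>j. - s * c i j + a * c k j)"
  have "gram_of I c' j l = (c' i j * c' i l + c' k j * c' k l) + (\<Sum>m\<in>I0. c' m j * c' m l)"
    unfolding gram_of_def II(1) using II(2-5) by simp
  also have "(\<Sum>m\<in>I0. c' m j * c' m l) = (\<Sum>m\<in>I0. c m j * c m l)"
    by (intro sum.cong) (auto simp: I0_def c'_def)
  also have "c' i j * c' i l + c' k j * c' k l = (a\<^sup>2 + s\<^sup>2) * (c i j * c i l + c k j * c k l)"
    using I(4) by (simp add: c'_def power2_eq_square algebra_simps)
  also have "(a\<^sup>2 + s\<^sup>2) * (c i j * c i l + c k j * c k l) + (\<Sum>m\<in>I0. c m j * c m l) = gram_of I c j l"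
    unfolding gram_of_def II(1) using II(2-5) cs by simp
  finally show ?thesis by (simp only: c'_def)
qed

text \<open>Givens rotations: each remaining row is rotated against row i0 so that its entry in
  column k vanishes. Entries removed earlier stay zero, because every rotation involves only i0 and
  the current row.\<close>

lemma gauss_eliminate:
  assumes I: "finite I" "i0 \<in> I"
  shows "\<exists>c'. (\<forall>F. bdd_meas F \<longrightarrow> gauss_mean I c' F = gauss_mean I c F) \<and>
    (\<forall>j l. gram_of I c' j l = gram_of I c j l) \<and> (\<forall>i\<in>I - {i0}. c' i k = 0)"
proof -
  have "\<exists>c'. (\<forall>F. bdd_meas F \<longrightarrow> gauss_mean I c' F = gauss_mean I c F) \<and>
    (\<forall>j l. gram_of I c' j l = gram_of I c j l) \<and> (\<forall>i\<in>J. c' i k = 0)"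
    if "finite J" "J \<subseteq> I - {i0}" for J
    using that
  proof (induction J rule: finite_induct)
    case empty
    show ?case by (intro exI[of _ c]) auto
  next
    case (insert m J)
    have "J \<subseteq> I - {i0}" using insert.prems by auto
    from insert.IH[OF this] obtain c' where c': "\<And>F. bdd_meas F \<Longrightarrow> gauss_mean I c' F = gauss_mean I c F"
      "\<And>j l. gram_of I c' j l = gram_of I c j l" "\<And>i. i \<in> J \<Longrightarrow> c' i k = 0" by blast
    show ?case
    proof (cases "c' m k = 0")
      case True
      thus ?thesis using c' by (intro exI[of _ c']) auto
    next
      case False
      define r where "r = sqrt ((c' i0 k)\<^sup>2 + (c' m k)\<^sup>2)"
      have r2: "(c' i0 k)\<^sup>2 + (c' m k)\<^sup>2 > 0" using False by (simp add: add_nonneg_pos)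
      hence r: "r > 0" "r\<^sup>2 = (c' i0 k)\<^sup>2 + (c' m k)\<^sup>2" by (auto simp: r_def)
      define a where "a = c' i0 k / r"
      define s where "s = c' m k / r"
      have cs: "a\<^sup>2 + s\<^sup>2 = 1" "s \<noteq> 0"
        using r r2 False by (auto simp: a_def s_def power_divide add_divide_distrib[symmetric])
      have m: "m \<in> I" "i0 \<noteq> m" using insert.prems by auto
      define c'' where "c'' = c'(i0 := \<lambda>j. a * c' i0 j + s * c' m j, m := \<lambda>j. - s * c' i0 j + a * c' m j)"
      have "gauss_mean I c'' F = gauss_mean I c F" if "bdd_meas F" for F
        unfolding c''_def using gauss_mean_rotate[OF I m that cs] c'(1)[OF that] by simp
      moreover have "gram_of I c'' j l = gram_of I c j l" for j l
        unfolding c''_def using gram_of_rotate[OF I m cs(1)] c'(2) by simp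
      moreover have "c'' i k = 0" if "i \<in> insert m J" for i
      proof (cases "i = m")
        case True
        thus ?thesis using m by (simp add: c''_def a_def s_def)
      next
        case False
        thus ?thesis using that insert.prems c'(3) by (auto simp: c''_def)
      qed
      ultimately show ?thesis by blast
    qed
  qed
  from this[of "I - {i0}"] I show ?thesis by auto
qed

lemma std_normal_reflect:
  fixes h :: "real \<Rightarrow> real"
  assumes [measurable]: "h \<in> borel_measurable borel" and s: "s = 1 \<or> s = -1"
  shows "(\<integral>y. h (s * y) \<partial>std_normal_distribution) = (\<integral>y. h y \<partial>std_normal_distribution)"
proof -
  have "(\<integral>y. h (- y) \<partial>std_normal_distribution) = (\<integral>y. h y \<partial>std_normal_distribution)"
  proof -
    have "(\<integral>y. h (- y) \<partial>std_normal_distribution) = (\<integral>y. std_normal_density y * h (- y) \<partial>lborel)"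
      by (subst integral_density) (auto simp: normal_density_nonneg)
    also have "\<dots> = (\<integral>y. std_normal_density (- y) * h (- y) \<partial>lborel)"
      by (simp add: std_normal_density_def)
    also have "\<dots> = (\<integral>y. std_normal_density y * h y \<partial>lborel)"
      using lborel_integral_real_affine[of "-1" "\<lambda>y. std_normal_density y * h y" 0] by simp
    also have "\<dots> = (\<integral>y. h y \<partial>std_normal_distribution)"
      by (subst integral_density) (auto simp: normal_density_nonneg)
    finally show ?thesis .
  qed
  thus ?thesis using s by auto
qed

text \<open>After elimination only row i0 contributes to coordinate j, which is then a multiple r of
  one standard normal variable. The sign of r is left open, as only its square is
  determined.\<close>

lemma gauss_mean_one:
  assumes I: "finite I" and f: "f \<in> borel_measurable borel" "\<And>z. \<bar>f z\<bar> \<le> B"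
  shows "\<exists>r. r\<^sup>2 = gram_of I c j j \<and> gauss_mean I c (\<lambda>z. f (z j)) = (\<integral>y. f (r * y) \<partial>std_normal_distribution)"
proof (cases "I = {}")
  case True
  thus ?thesis
    by (intro exI[of _ 0]) (simp add: gauss_mean_def comb_def gram_of_def PiM_empty std_normal.prob_space[simplified])
next
  case False
  then obtain i0 where i0: "i0 \<in> I" by auto
  have [measurable]: "(\<lambda>z::nat\<Rightarrow>real. z j) \<in> borel_measurable seq_space"
    by (rule measurable_component_singleton) simp
  have F: "bdd_meas (\<lambda>z. f (z j))"
    unfolding bdd_meas_def using f by (auto intro!: measurable_compose[OF _ f(1)])
  obtain c' where c': "\<And>F. bdd_meas F \<Longrightarrow> gauss_mean I c' F = gauss_mean I c F"
    "\<And>l m. gram_of I c' l m = gram_of I c l m" "\<And>i. i \<in> I - {i0} \<Longrightarrow> c' i j = 0"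
    using gauss_eliminate[OF I i0, of c j] by blast
  define I0 where "I0 = I - {i0}"
  have II: "I = insert i0 I0" "finite I0" "i0 \<notin> I0" using I i0 by (auto simp: I0_def)
  have z: "(\<Sum>i\<in>I0. x i * c' i j) = 0" for x :: "nat \<Rightarrow> real" using c'(3) by (intro sum.neutral) (auto simp: I0_def)
  have "gram_of I c j j = (c' i0 j)\<^sup>2"
  proof -
    have "gram_of I c j j = gram_of (insert i0 I0) c' j j" using c'(2)[of j j] by (simp only: II(1)[symmetric])
    also have "\<dots> = (c' i0 j)\<^sup>2"
      unfolding gram_of_def using II(2,3) z[of "\<lambda>i. c' i j"] by (simp add: power2_eq_square)
    finally show ?thesis .
  qed
  moreover have "gauss_mean I c (\<lambda>z. f (z j)) = (\<integral>y. f (c' i0 j * y) \<partial>std_normal_distribution)"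
  proof -
    have "gauss_mean I c (\<lambda>z. f (z j)) = gauss_mean (insert i0 I0) c' (\<lambda>z. f (z j))"
      using c'(1)[OF F] II(1) by simp
    also have "\<dots> = (\<integral>y. gauss_mean I0 c' (\<lambda>z. f (y * c' i0 j + z j)) \<partial>std_normal_distribution)"
      by (rule gauss_mean_insert[OF II(2,3) F])
    also have "\<dots> = (\<integral>y. f (c' i0 j * y) \<partial>std_normal_distribution)"
    proof -
      have "gauss_mean I0 c' (\<lambda>z. f (y * c' i0 j + z j)) = f (c' i0 j * y)" for y
        unfolding gauss_mean_def comb_def z using prob_space.prob_space[OF std_gauss_prob]
        by (simp add: mult.commute)
      thus ?thesis by simp
    qed
    finally show ?thesis .
  qed
  ultimately show ?thesis by metis
qed

text \<open>Column k is eliminated into row i0. Its unit norm makes the remaining entry 1 or -1, and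
  orthogonality to the other columns clears the rest of that row, so coordinate k separates and the
  other rows are handled by induction. A reflection removes the sign. By \<open>supp\<close> the
  coordinates outside J are 0 on both sides, hence F may depend on them.\<close>

lemma gauss_mean_orthonormal:
  assumes "finite J" "finite I" and F: "bdd_meas F"
    and gram: "\<And>j l. j \<in> J \<Longrightarrow> l \<in> J \<Longrightarrow> gram_of I c j l = (if j = l then 1 else 0)"
    and supp: "\<And>i j. i \<in> I \<Longrightarrow> j \<notin> J \<Longrightarrow> c i j = 0"
  shows "gauss_mean I c F = gauss_mean J (\<lambda>i j. if i = j then 1 else 0) F"
  using assms
proof (induction J arbitrary: I c F rule: finite_induct)
  case empty
  have "comb I c y = (\<lambda>j. 0)" "comb {} d y = (\<lambda>j. 0)" for y d using empty by (auto simp: comb_def)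
  thus ?case using prob_space.prob_space[OF std_gauss_prob] by (simp add: gauss_mean_def)
next
  case (insert k J)
  have gk: "gram_of I c k k = 1" using insert.prems(3)[of k k] by simp
  have "I \<noteq> {}" using gk by (auto simp: gram_of_def)
  then obtain i0 where i0: "i0 \<in> I" by auto
  obtain c' where c': "\<And>F. bdd_meas F \<Longrightarrow> gauss_mean I c' F = gauss_mean I c F"
    "\<And>l m. gram_of I c' l m = gram_of I c l m" "\<And>i. i \<in> I - {i0} \<Longrightarrow> c' i k = 0"
    using gauss_eliminate[OF insert.prems(1) i0, of c k] by blast
  define I0 where "I0 = I - {i0}"
  have II: "I = insert i0 I0" "finite I0" "i0 \<notin> I0" using insert.prems(1) i0 by (auto simp: I0_def)
  have gram': "gram_of I c' j l = c' i0 j * c' i0 l + gram_of I0 c' j l" for j l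
    unfolding gram_of_def using II by simp
  have z: "gram_of I0 c' k l = 0" "gram_of I0 c' l k = 0" for l
    unfolding gram_of_def using c'(3) by (auto intro!: sum.neutral simp: I0_def)
  have ck: "c' i0 k * c' i0 l = gram_of I c k l" for l using gram'[of k l] z(1)[of l] c'(2)[of k l] by simp
  have k2: "(c' i0 k)\<^sup>2 = 1" using ck[of k] gk by (simp add: power2_eq_square)
  hence sgn: "c' i0 k = 1 \<or> c' i0 k = -1" by (simp add: power2_eq_1_iff)
  \<comment> \<open>Rotations mix rows, but a zero column has zero Gram diagonal, and this is
    preserved.\<close>
  have supp': "c' i j = 0" if "i \<in> I" "j \<notin> insert k J" for i j
  proof -
    have "gram_of I c j j = 0" unfolding gram_of_def using insert.prems(4) that by (intro sum.neutral) auto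
    hence "(\<Sum>i\<in>I. (c' i j)\<^sup>2) = 0" using c'(2)[of j j] by (simp add: gram_of_def power2_eq_square)
    thus ?thesis using that insert.prems(1) by (simp add: sum_nonneg_eq_0_iff)
  qed
  have i0z: "c' i0 l = 0" if "l \<noteq> k" for l
  proof (cases "l \<in> J")
    case True
    hence "c' i0 k * c' i0 l = 0" using ck[of l] insert.prems(3)[of k l] that by simp
    thus ?thesis using sgn by auto
  qed (use supp'[OF i0] that in auto)
  have IH: "gauss_mean I0 c' F' = gauss_mean J (\<lambda>i j. if i = j then 1 else 0) F'" if F': "bdd_meas F'" for F'
  proof (rule insert.IH)
    fix j l assume jl: "j \<in> J" "l \<in> J"
    hence "j \<noteq> k" using insert.hyps by auto
    hence "gram_of I0 c' j l = gram_of I c j l" using gram'[of j l] i0z[of j] c'(2)[of j l] by simp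
    thus "gram_of I0 c' j l = (if j = l then 1 else 0)" using insert.prems(3) jl by simp
  next
    fix i j assume "i \<in> I0" "j \<notin> J"
    thus "c' i j = 0" using supp'[of i j] c'(3)[of i] by (cases "j = k") (auto simp: I0_def)
  qed (use II F' in auto)
  define \<delta> where "\<delta> = (\<lambda>i j :: nat. if i = j then 1 else (0::real))"
  define H where "H = (\<lambda>y. gauss_mean J \<delta> (\<lambda>z. F (\<lambda>j. y * \<delta> k j + z j)))"
  have Hm: "H \<in> borel_measurable borel"
  proof -
    have Fm: "F \<in> borel_measurable seq_space" using insert.prems(2) by (simp add: bdd_meas_def)
    interpret sigma_finite_measure "std_gauss J" by (rule prob_space_imp_sigma_finite[OF std_gauss_prob])
    have c1: "(\<lambda>p. snd p i) \<in> borel_measurable (borel \<Otimes>\<^sub>M std_gauss J)" if "i \<in> J" for i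
      using measurable_compose[OF measurable_snd measurable_component_singleton[OF that, of "\<lambda>_. std_normal_distribution"]] by simp
    have "(\<lambda>p. fst p * \<delta> k j + comb J \<delta> (snd p) j) \<in> borel_measurable (borel \<Otimes>\<^sub>M std_gauss J)" for j
      unfolding comb_def using c1
      by (intro borel_measurable_add borel_measurable_times borel_measurable_sum) auto
    hence "(\<lambda>p. (\<lambda>j. fst p * \<delta> k j + comb J \<delta> (snd p) j)) \<in> measurable (borel \<Otimes>\<^sub>M std_gauss J) seq_space"
      by (rule measurable_abs_UNIV)
    from measurable_compose[OF this Fm]
    have "(\<lambda>(y, x). F (\<lambda>j. y * \<delta> k j + comb J \<delta> x j)) \<in> borel_measurable (borel \<Otimes>\<^sub>M std_gauss J)"
      by (simp add: split_beta')
    from borel_measurable_lebesgue_integral[OF this] show ?thesis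
      by (simp add: H_def gauss_mean_def)
  qed
  have "gauss_mean I c F = gauss_mean (insert i0 I0) c' F" using c'(1)[OF insert.prems(2)] II(1) by simp
  also have "\<dots> = (\<integral>y. gauss_mean I0 c' (\<lambda>z. F (\<lambda>j. y * c' i0 j + z j)) \<partial>std_normal_distribution)"
    by (rule gauss_mean_insert[OF II(2,3) insert.prems(2)])
  also have "\<dots> = (\<integral>y. gauss_mean J \<delta> (\<lambda>z. F (\<lambda>j. y * c' i0 j + z j)) \<partial>std_normal_distribution)"
    unfolding IH[OF bdd_meas_shift[OF insert.prems(2)]] \<delta>_def ..
  also have "\<dots> = (\<integral>y. H (c' i0 k * y) \<partial>std_normal_distribution)"
  proof -
    have "(\<lambda>j. y * c' i0 j + z j) = (\<lambda>j. (c' i0 k * y) * \<delta> k j + z j)" for y z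
      using i0z by (auto simp: \<delta>_def fun_eq_iff)
    thus ?thesis by (simp add: H_def)
  qed
  also have "\<dots> = (\<integral>y. H y \<partial>std_normal_distribution)" by (rule std_normal_reflect[OF Hm sgn])
  also have "\<dots> = gauss_mean (insert k J) \<delta> F"
    unfolding H_def by (rule gauss_mean_insert[OF insert.hyps insert.prems(2), symmetric])
  finally show ?case by (simp add: \<delta>_def)
qed

subsection \<open>Gram-Schmidt orthonormalization\<close>

lemma design_inner_sym: "design_inner n X w f h = design_inner n X w h f"
  unfolding design_inner_def by (simp add: mult_ac)

lemma design_inner_cong_left:
  assumes "\<And>i. i \<in> {1..n} \<Longrightarrow> f (X i) = f' (X i)"
  shows "design_inner n X w f h = design_inner n X w f' h"
  unfolding design_inner_def
  by (intro arg_cong2[where f = times] refl sum.cong) (simp_all only: assms)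

lemma design_inner_sum_left:
  "design_inner n X w (\<lambda>x. \<Sum>k\<in>A. c k * h k x) f = (\<Sum>k\<in>A. c k * design_inner n X w (h k) f)"
proof (cases "finite A")
  case True
  thus ?thesis
    by (induction A rule: finite_induct)
      (simp_all add: design_inner_def sum.distrib distrib_left distrib_right sum_distrib_left mult_ac)
qed (simp add: design_inner_def)

lemma design_inner_diff_left:
  "design_inner n X w (\<lambda>x. f x - g x) h = design_inner n X w f h - design_inner n X w g h"
  unfolding design_inner_def by (simp add: algebra_simps sum_subtractf)

lemma design_inner_scale_left:
  "design_inner n X w (\<lambda>x. c * f x) h = c * design_inner n X w f h"
  unfolding design_inner_def by (simp add: sum_distrib_left mult_ac)

lemma design_inner_divide_left:
  "design_inner n X w (\<lambda>x. f x / c) h = design_inner n X w f h / c"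
  using design_inner_scale_left[of n X w "1 / c" f h] by simp

lemma design_inner_sum_right:
  "design_inner n X w f (\<lambda>x. \<Sum>k\<in>A. c k * h k x) = (\<Sum>k\<in>A. c k * design_inner n X w f (h k))"
  by (subst (1 2) design_inner_sym) (rule design_inner_sum_left)

lemma design_inner_diff_right:
  "design_inner n X w h (\<lambda>x. f x - g x) = design_inner n X w h f - design_inner n X w h g"
  by (subst (1 2 3) design_inner_sym) (rule design_inner_diff_left)

text \<open>With positive weights \<open>ip\<close> is definite for functions restricted to the
  design points, though not for functions on the whole space. Expansions are therefore stated at the
  points \<open>X i\<close>.\<close>

locale weighted_design =
  fixes n :: nat and X :: "nat \<Rightarrow> 'x" and w :: "'x \<Rightarrow> real"
  assumes wpos: "i \<in> {1..n} \<Longrightarrow> w (X i) > 0"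
begin

abbreviation ip :: "('x \<Rightarrow> real) \<Rightarrow> ('x \<Rightarrow> real) \<Rightarrow> real" where
  "ip \<equiv> design_inner n X w"

abbreviation gs :: "(nat \<Rightarrow> 'x \<Rightarrow> real) \<Rightarrow> nat \<Rightarrow> 'x \<Rightarrow> real" where
  "gs \<equiv> gram_schmidt_fn ip"

lemma ip_nonneg: "ip f f \<ge> 0"
proof -
  have "0 \<le> (\<Sum>i=1..n. w (X i) * (f (X i) * f (X i)))"
    using less_imp_le[OF wpos] by (intro sum_nonneg mult_nonneg_nonneg[OF _ zero_le_square])
  thus ?thesis by (simp add: design_inner_def mult.assoc)
qed

text \<open>The weights w' may be signed. With w' = w and t = 1 this is the usual inequality; with a
  difference of weights it bounds the effect of changing the weights on an inner product.\<close>

lemma ip_cauchy_schwarz_weights: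
  assumes "\<And>i. i \<in> {1..n} \<Longrightarrow> \<bar>w' (X i)\<bar> \<le> t * w (X i)" "t \<ge> 0"
  shows "\<bar>design_inner n X w' f h\<bar> \<le> t * (sqrt (ip f f) * sqrt (ip h h))"
proof -
  have w0: "w (X i) \<ge> 0" if "i \<in> {1..n}" for i using wpos[OF that] by simp
  have "\<bar>\<Sum>i=1..n. w' (X i) * f (X i) * h (X i)\<bar> \<le> (\<Sum>i=1..n. t * ((sqrt (w (X i)) * \<bar>f (X i)\<bar>) * (sqrt (w (X i)) * \<bar>h (X i)\<bar>)))"
  proof (rule order_trans[OF sum_abs sum_mono])
    fix i assume i: "i \<in> {1..n}"
    have "\<bar>w' (X i) * f (X i) * h (X i)\<bar> = \<bar>w' (X i)\<bar> * (\<bar>f (X i)\<bar> * \<bar>h (X i)\<bar>)" by (simp add: abs_mult)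
    also have "\<dots> \<le> (t * w (X i)) * (\<bar>f (X i)\<bar> * \<bar>h (X i)\<bar>)"
      by (intro mult_right_mono assms i) auto
    also have "w (X i) = sqrt (w (X i)) * sqrt (w (X i))" using w0[OF i] by simp
    finally show "\<bar>w' (X i) * f (X i) * h (X i)\<bar> \<le> t * ((sqrt (w (X i)) * \<bar>f (X i)\<bar>) * (sqrt (w (X i)) * \<bar>h (X i)\<bar>))"
      by (simp add: mult_ac)
  qed
  also have "\<dots> = t * (\<Sum>i=1..n. (sqrt (w (X i)) * \<bar>f (X i)\<bar>) * (sqrt (w (X i)) * \<bar>h (X i)\<bar>))"
    by (simp add: sum_distrib_left)
  also have "\<dots> \<le> t * sqrt ((\<Sum>i=1..n. (sqrt (w (X i)) * \<bar>f (X i)\<bar>)\<^sup>2) * (\<Sum>i=1..n. (sqrt (w (X i)) * \<bar>h (X i)\<bar>)\<^sup>2))"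
    by (intro mult_left_mono real_le_rsqrt Cauchy_Schwarz_ineq_sum assms(2))
  also have "\<dots> = t * sqrt ((\<Sum>i=1..n. w (X i) * f (X i) * f (X i)) * (\<Sum>i=1..n. w (X i) * h (X i) * h (X i)))"
  proof -
    have "(\<Sum>i=1..n. (sqrt (w (X i)) * \<bar>f (X i)\<bar>)\<^sup>2) = (\<Sum>i=1..n. w (X i) * f (X i) * f (X i))" for f
    by (intro sum.cong refl) (simp only: power_mult_distrib real_sqrt_pow2[OF w0] power2_abs, simp add: power2_eq_square)
    thus ?thesis by (simp only:)
  qed
  finally have "(1 / real n) * \<bar>\<Sum>i=1..n. w' (X i) * f (X i) * h (X i)\<bar> \<le>
      (1 / real n) * (t * sqrt ((\<Sum>i=1..n. w (X i) * f (X i) * f (X i)) * (\<Sum>i=1..n. w (X i) * h (X i) * h (X i))))"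
    by (intro mult_left_mono) auto
  also have "\<dots> = t * (sqrt (ip f f) * sqrt (ip h h))"
    unfolding design_inner_def by (simp add: real_sqrt_mult real_sqrt_divide field_simps)
  finally show ?thesis unfolding design_inner_def by (simp add: abs_mult)
qed

lemma ip_cauchy_schwarz: "\<bar>ip f h\<bar> \<le> sqrt (ip f f) * sqrt (ip h h)"
  using ip_cauchy_schwarz_weights[of w 1 f h] less_imp_le[OF wpos] by simp

lemma ip_zero_imp: "ip f f = 0 \<Longrightarrow> ip f h = 0"
  using ip_cauchy_schwarz[of f h] by simp

lemma ip_zero_pointwise:
  assumes "ip f f = 0" "i \<in> {1..n}"
  shows "f (X i) = 0"
proof -
  have n: "n > 0" using assms(2) by auto
  have nn: "0 \<le> w (X k) * f (X k) * f (X k)" if "k \<in> {1..n}" for k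
    using wpos[OF that] by (simp add: mult.assoc)
  have "(\<Sum>i=1..n. w (X i) * f (X i) * f (X i)) = 0"
    using assms(1) n by (simp add: design_inner_def)
  hence "w (X i) * f (X i) * f (X i) = 0"
    using sum_nonneg_eq_0_iff[of "{1..n}" "\<lambda>i. w (X i) * f (X i) * f (X i)"] nn assms(2) by auto
  thus ?thesis using wpos[OF assms(2)] by simp
qed

definition gs_res :: "(nat \<Rightarrow> 'x \<Rightarrow> real) \<Rightarrow> nat \<Rightarrow> 'x \<Rightarrow> real" where
  "gs_res f m x = f m x - (\<Sum>k<m. ip (f m) (gs f k) * gs f k x)"

lemma gs_eq: "gs f m x = gs_res f m x / sqrt (ip (gs_res f m) (gs_res f m))"
  by (subst gram_schmidt_fn.simps) (simp add: gs_res_def[abs_def] Let_def)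

text \<open>A vanishing residual gives a function of norm 0, which is orthogonal to everything by
  Cauchy-Schwarz. Admitting the norm 0 beside 1 lets the induction run without linear
  independence.\<close>

lemma gs_orthogonal:
  "(\<forall>k<m. ip (gs f m) (gs f k) = 0) \<and> (ip (gs f m) (gs f m) = 0 \<or> ip (gs f m) (gs f m) = 1)"
proof (induction m rule: less_induct)
  case (less m)
  have orth: "ip (gs f l) (gs f k) = 0" if "l < m" "k < m" "l \<noteq> k" for l k
  proof (cases "k < l")
    case False
    hence "l < k" using that by simp
    thus ?thesis using less[OF that(2)] by (subst design_inner_sym) auto
  qed (use less[OF that(1)] in auto)
  have res: "ip (gs_res f m) (gs f k) = 0" if k: "k < m" for k
  proof -
    have "ip (gs_res f m) (gs f k) = ip (f m) (gs f k) - (\<Sum>l<m. ip (f m) (gs f l) * ip (gs f l) (gs f k))"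
      unfolding gs_res_def[abs_def] design_inner_diff_left design_inner_sum_left ..
    also have "(\<Sum>l<m. ip (f m) (gs f l) * ip (gs f l) (gs f k)) = (\<Sum>l\<in>{k}. ip (f m) (gs f l) * ip (gs f l) (gs f k))"
      using k orth by (intro sum.mono_neutral_right) auto
    also have "\<dots> = ip (f m) (gs f k) * ip (gs f k) (gs f k)" by simp
    also have "\<dots> = ip (f m) (gs f k)"
    proof (cases "ip (gs f k) (gs f k) = 0")
      case True
      have "ip (f m) (gs f k) = 0" by (subst design_inner_sym) (rule ip_zero_imp[OF True])
      thus ?thesis by simp
    next
      case False
      thus ?thesis using less[OF k] by auto
    qed
    finally show ?thesis by simp
  qed
  have g: "ip (gs f m) h = ip (gs_res f m) h / sqrt (ip (gs_res f m) (gs_res f m))" for h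
    unfolding gs_eq[abs_def] design_inner_divide_left ..
  have gg: "ip (gs f m) (gs f m) = ip (gs_res f m) (gs_res f m) / (sqrt (ip (gs_res f m) (gs_res f m)))\<^sup>2"
    using g[of "gs f m"] g[of "gs_res f m"] design_inner_sym[of n X w "gs f m" "gs_res f m"]
    by (simp add: power2_eq_square)
  have "ip (gs f m) (gs f m) = 0 \<or> ip (gs f m) (gs f m) = 1"
    using ip_nonneg[of "gs_res f m"] unfolding gg by auto
  thus ?case using res by (simp add: g[of "gs f _"])
qed

lemma gs_orth:
  assumes "k \<noteq> l"
  shows "ip (gs f k) (gs f l) = 0"
proof (cases "k < l")
  case True
  hence "ip (gs f l) (gs f k) = 0" using gs_orthogonal[of l f] by blast
  thus ?thesis by (subst design_inner_sym)
next
  case False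
  hence "l < k" using assms by simp
  thus ?thesis using gs_orthogonal[of k f] by blast
qed

lemma gs_norm_le: "ip (gs f k) (gs f k) \<le> 1"
  using gs_orthogonal[of k f] by auto

lemma gs_norm_zero_or_one: "ip (gs f k) (gs f k) * ip h (gs f k) = ip h (gs f k)"
proof (cases "ip (gs f k) (gs f k) = 0")
  case True
  have "ip h (gs f k) = 0" by (subst design_inner_sym) (rule ip_zero_imp[OF True])
  thus ?thesis by simp
qed (use gs_orthogonal[of k f] in auto)

text \<open>The residual is a multiple of the last orthonormal function. If it has norm 0,
  definiteness at the design points makes it vanish there and the expansion still holds.\<close>

lemma gs_expand_one:
  assumes i: "i \<in> {1..n}"
  shows "f m (X i) = (\<Sum>k\<le>m. ip (f m) (gs f k) * gs f k (X i))"
proof -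
  define r where "r = ip (gs_res f m) (gs_res f m)"
  have "f m (X i) = gs_res f m (X i) + (\<Sum>k<m. ip (f m) (gs f k) * gs f k (X i))"
    by (simp add: gs_res_def)
  also have "gs_res f m (X i) = ip (f m) (gs f m) * gs f m (X i)"
  proof (cases "r = 0")
    case True
    thus ?thesis using ip_zero_pointwise[of "gs_res f m", OF _ i] by (simp add: r_def gs_eq)
  next
    case False
    hence rp: "r > 0" using ip_nonneg[of "gs_res f m"] by (simp add: r_def)
    have "ip (f m) (gs f m) = ip (gs_res f m) (gs f m) + (\<Sum>k<m. ip (f m) (gs f k) * ip (gs f k) (gs f m))"
      unfolding gs_res_def[abs_def] design_inner_diff_left design_inner_sum_left by simp
    also have "(\<Sum>k<m. ip (f m) (gs f k) * ip (gs f k) (gs f m)) = 0"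
      by (intro sum.neutral) (auto simp: gs_orth)
    also have "ip (gs_res f m) (gs f m) = ip (gs f m) (gs_res f m)" by (rule design_inner_sym)
    also have "\<dots> = r / sqrt r" unfolding gs_eq[abs_def] design_inner_divide_left r_def ..
    also have "\<dots> = sqrt r" using rp by (simp add: real_div_sqrt)
    finally have "ip (f m) (gs f m) * gs f m (X i) = sqrt r * (gs_res f m (X i) / sqrt r)"
      by (simp only: gs_eq[of f m "X i"] r_def add_0_right)
    thus ?thesis using rp by simp
  qed
  finally show ?thesis by (simp add: lessThan_Suc_atMost[symmetric])
qed

lemma ip_gs_zero:
  assumes "l < k"
  shows "ip (f l) (gs f k) = 0"
proof -
  have "ip (f l) (gs f k) = ip (\<lambda>x. \<Sum>j\<le>l. ip (f l) (gs f j) * gs f j x) (gs f k)"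
    by (rule design_inner_cong_left) (rule gs_expand_one[of _ f l])
  also have "\<dots> = (\<Sum>j\<le>l. ip (f l) (gs f j) * ip (gs f j) (gs f k))" by (rule design_inner_sum_left)
  also have "\<dots> = 0" using assms by (intro sum.neutral) (auto simp: gs_orth)
  finally show ?thesis .
qed

lemma gs_expand:
  assumes h: "\<And>i. i \<in> {1..n} \<Longrightarrow> h (X i) = (\<Sum>l<M. c l * f l (X i))" and i: "i \<in> {1..n}"
  shows "h (X i) = (\<Sum>k<M. ip h (gs f k) * gs f k (X i))"
proof -
  have e: "f l (X i) = (\<Sum>k<M. ip (f l) (gs f k) * gs f k (X i))" if "l < M" for l
  proof -
    have "f l (X i) = (\<Sum>k\<le>l. ip (f l) (gs f k) * gs f k (X i))" by (rule gs_expand_one[OF i, of f l])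
    also have "\<dots> = (\<Sum>k<M. ip (f l) (gs f k) * gs f k (X i))"
      by (rule sum.mono_neutral_left) (use that in \<open>auto simp: ip_gs_zero[of l _ f]\<close>)
    finally show ?thesis .
  qed
  have "ip h (gs f k) = ip (\<lambda>x. \<Sum>l<M. c l * f l x) (gs f k)" for k
    by (rule design_inner_cong_left) (simp_all only: h)
  hence hk: "ip h (gs f k) = (\<Sum>l<M. c l * ip (f l) (gs f k))" for k by (simp add: design_inner_sum_left)
  have "h (X i) = (\<Sum>l<M. c l * (\<Sum>k<M. ip (f l) (gs f k) * gs f k (X i)))"
    unfolding h[OF i] by (intro sum.cong refl) (simp only: e[symmetric] lessThan_iff)
  also have "\<dots> = (\<Sum>k<M. (\<Sum>l<M. c l * ip (f l) (gs f k)) * gs f k (X i))"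
    unfolding sum_distrib_left sum_distrib_right by (subst sum.swap) (simp add: mult_ac)
  finally show ?thesis by (simp add: hk)
qed

lemma gs_parseval:
  assumes h: "\<And>i. i \<in> {1..n} \<Longrightarrow> h (X i) = (\<Sum>l<M. c l * f l (X i))"
  shows "ip h h' = (\<Sum>k<M. ip h (gs f k) * ip h' (gs f k))"
proof -
  have "ip h h' = ip (\<lambda>x. \<Sum>k<M. ip h (gs f k) * gs f k x) h'"
    by (rule design_inner_cong_left) (rule gs_expand[of h c f M, OF h])
  also have "\<dots> = (\<Sum>k<M. ip h (gs f k) * ip (gs f k) h')" by (rule design_inner_sum_left)
  finally show ?thesis by (simp add: design_inner_sym[of n X w _ h'])
qed

lemma bessel:
  assumes A: "finite A" and orth: "\<And>k l. k \<in> A \<Longrightarrow> l \<in> A \<Longrightarrow> k \<noteq> l \<Longrightarrow> ip (v k) (v l) = 0"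
    and norm: "\<And>k. k \<in> A \<Longrightarrow> ip (v k) (v k) \<le> 1"
  shows "(\<Sum>k\<in>A. (ip h (v k))\<^sup>2) \<le> ip h h"
proof -
  define s where "s = (\<lambda>x. \<Sum>k\<in>A. ip h (v k) * v k x)"
  have hs: "ip h s = (\<Sum>k\<in>A. (ip h (v k))\<^sup>2)"
    unfolding s_def design_inner_sum_right by (simp add: power2_eq_square)
  have "ip s s = (\<Sum>k\<in>A. ip h (v k) * ip (v k) s)"
    by (subst s_def) (simp add: design_inner_sum_left)
  also have "\<dots> \<le> (\<Sum>k\<in>A. (ip h (v k))\<^sup>2)"
  proof (rule sum_mono)
    fix k assume k: "k \<in> A"
    have "ip (v k) s = (\<Sum>l\<in>A. ip h (v l) * ip (v k) (v l))" unfolding s_def by (rule design_inner_sum_right)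
    also have "\<dots> = (\<Sum>l\<in>{k}. ip h (v l) * ip (v k) (v l))"
      using k A by (intro sum.mono_neutral_right) (auto simp: orth)
    finally have "ip h (v k) * ip (v k) s = (ip h (v k))\<^sup>2 * ip (v k) (v k)" by (simp add: power2_eq_square)
    also have "\<dots> \<le> (ip h (v k))\<^sup>2 * 1" by (intro mult_left_mono norm k) auto
    finally show "ip h (v k) * ip (v k) s \<le> (ip h (v k))\<^sup>2" by simp
  qed
  finally have ss: "ip s s \<le> (\<Sum>k\<in>A. (ip h (v k))\<^sup>2)" .
  have "0 \<le> ip (\<lambda>x. h x - s x) (\<lambda>x. h x - s x)" by (rule ip_nonneg)
  also have "\<dots> = ip h h - 2 * ip h s + ip s s"
    unfolding design_inner_diff_left design_inner_diff_right by (simp add: design_inner_sym[of n X w s h])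
  finally show ?thesis using hs ss by linarith
qed

text \<open>The form exhibits the coefficient of f m as the inverse norm of the residual; with it,
  functions built from different weights can be matched so that f m cancels.\<close>

lemma gs_lincomb:
  "\<exists>c. \<forall>x. gs f m x = (f m x - (\<Sum>l<m. c l * f l x)) / sqrt (ip (gs_res f m) (gs_res f m))"
proof (induction m rule: less_induct)
  case (less m)
  have "\<exists>c. \<forall>x. gs f k x = (\<Sum>l<m. c l * f l x)" if k: "k < m" for k
  proof -
    define r where "r = sqrt (ip (gs_res f k) (gs_res f k))"
    obtain c where c: "\<And>x. gs f k x = (f k x - (\<Sum>l<k. c l * f l x)) / r"
      using less[OF k] unfolding r_def by blast
    define c' where "c' = (\<lambda>l. (if l = k then 1 else if l < k then - c l else 0) / r)"
    have "(\<Sum>l<m. c' l * f l x) = (\<Sum>l<Suc k. c' l * f l x)" for x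
      using k by (intro sum.mono_neutral_right) (auto simp: c'_def)
    also have "\<dots> x = gs f k x" for x
      by (simp add: c c'_def diff_divide_distrib sum_divide_distrib sum_negf)
    finally show ?thesis by metis
  qed
  then obtain C where C: "\<And>k x. k < m \<Longrightarrow> gs f k x = (\<Sum>l<m. C k l * f l x)" by metis
  have "gs_res f m x = f m x - (\<Sum>l<m. (\<Sum>k<m. ip (f m) (gs f k) * C k l) * f l x)" for x
  proof -
    have "(\<Sum>k<m. ip (f m) (gs f k) * gs f k x) = (\<Sum>k<m. ip (f m) (gs f k) * (\<Sum>l<m. C k l * f l x))"
      using C by (intro sum.cong) auto
    also have "\<dots> = (\<Sum>l<m. (\<Sum>k<m. ip (f m) (gs f k) * C k l) * f l x)"
      unfolding sum_distrib_left sum_distrib_right by (subst sum.swap) (simp add: mult_ac)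
    finally show ?thesis by (simp add: gs_res_def)
  qed
  hence "gs f m x = (f m x - (\<Sum>l<m. (\<Sum>k<m. ip (f m) (gs f k) * C k l) * f l x)) / sqrt (ip (gs_res f m) (gs_res f m))" for x
    by (simp only: gs_eq)
  thus ?case by (intro exI[of _ "\<lambda>l. \<Sum>k<m. ip (f m) (gs f k) * C k l"] allI)
qed

lemma gs_lincomb_lt:
  assumes "m < M"
  shows "\<exists>c. \<forall>x. gs f m x = (\<Sum>l<M. c l * f l x)"
proof -
  define r where "r = sqrt (ip (gs_res f m) (gs_res f m))"
  obtain c where c: "\<And>x. gs f m x = (f m x - (\<Sum>l<m. c l * f l x)) / r"
    using gs_lincomb[of f m] unfolding r_def by blast
  define c' where "c' = (\<lambda>l. (if l = m then 1 else if l < m then - c l else 0) / r)"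
  have "gs f m x = (\<Sum>l<M. c' l * f l x)" for x
  proof -
    have "(\<Sum>l<M. c' l * f l x) = (\<Sum>l<Suc m. c' l * f l x)"
      using assms by (intro sum.mono_neutral_right) (auto simp: c'_def)
    also have "\<dots> = gs f m x"
      by (simp add: c c'_def diff_divide_distrib sum_divide_distrib sum_negf)
    finally show ?thesis by simp
  qed
  thus ?thesis by blast
qed

end

text \<open>The difference of the two normalised residuals is, up to a scalar multiple of \<open>v\<close>, a combination of
  the earlier functions, and both residuals are orthogonal to those, each for its own weights.\<close>

lemma gram_schmidt_stable:
  fixes w w' :: "'x \<Rightarrow> real" and X :: "nat \<Rightarrow> 'x" and n :: nat
  defines "ip \<equiv> design_inner n X w" and "ip' \<equiv> design_inner n X w'"
  assumes w: "\<And>i. i \<in> {1..n} \<Longrightarrow> w (X i) > 0"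
    and ww: "\<And>i. i \<in> {1..n} \<Longrightarrow> \<bar>w' (X i) - w (X i)\<bar> \<le> t * w (X i)" and t: "0 \<le> t" "t \<le> 1 / 2"
    and norm: "ip (gram_schmidt_fn ip f m) (gram_schmidt_fn ip f m) = 1"
      "ip' (gram_schmidt_fn ip' f m) (gram_schmidt_fn ip' f m) = 1"
  shows "ip (\<lambda>x. gram_schmidt_fn ip' f m x - gram_schmidt_fn ip f m x)
      (\<lambda>x. gram_schmidt_fn ip' f m x - gram_schmidt_fn ip f m x) \<le> (4 * t)\<^sup>2"
proof -
  interpret W: weighted_design n X w by unfold_locales (rule w)
  interpret W': weighted_design n X w'
  proof
    fix i assume i: "i \<in> {1..n}"
    have "t * w (X i) \<le> 1 / 2 * w (X i)" using t w[OF i] by (intro mult_right_mono) auto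
    thus "0 < w' (X i)" using ww[OF i] w[OF i] by linarith
  qed
  define v where "v = gram_schmidt_fn ip f m"
  define v' where "v' = gram_schmidt_fn ip' f m"
  define r where "r = sqrt (ip (W.gs_res f m) (W.gs_res f m))"
  define r' where "r' = sqrt (ip' (W'.gs_res f m) (W'.gs_res f m))"
  obtain c where c: "\<And>x. v x = (f m x - (\<Sum>l<m. c l * f l x)) / r"
    using W.gs_lincomb[of f m] unfolding v_def r_def ip_def by blast
  obtain c' where c': "\<And>x. v' x = (f m x - (\<Sum>l<m. c' l * f l x)) / r'"
    using W'.gs_lincomb[of f m] unfolding v'_def r'_def ip'_def by blast
  have nv: "ip v v = 1" "ip' v' v' = 1" using norm by (simp_all add: v_def v'_def)
  have "r \<noteq> 0"
  proof
    assume "r = 0"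
    hence "v = (\<lambda>x. 0)" using c by auto
    thus False using nv by (simp add: ip_def design_inner_def)
  qed
  moreover have "r \<ge> 0" unfolding r_def ip_def using W.ip_nonneg by simp
  ultimately have r: "r > 0" by simp
  have "r' \<noteq> 0"
  proof
    assume "r' = 0"
    hence "v' = (\<lambda>x. 0)" using c' by auto
    thus False using nv by (simp add: ip'_def design_inner_def)
  qed
  moreover have "r' \<ge> 0" unfolding r'_def ip'_def using W'.ip_nonneg by simp
  ultimately have r': "r' > 0" by simp
  \<comment> \<open>The multiple of v for which f m cancels in v' - la * v, so that this difference
    h is a combination of the earlier functions only.\<close>
  define la where "la = r / r'"
  have la: "la > 0" using r r' by (simp add: la_def)
  define h where "h = (\<lambda>x. \<Sum>l<m. ((c l - c' l) / r') * f l x)"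
  have h: "h x = v' x - la * v x" for x
  proof -
    have "h x = ((\<Sum>l<m. c l * f l x) - (\<Sum>l<m. c' l * f l x)) / r'"
      unfolding h_def sum_subtractf[symmetric] sum_divide_distrib by (intro sum.cong refl) (simp add: left_diff_distrib)
    moreover have "la * v x = (f m x - (\<Sum>l<m. c l * f l x)) / r'"
      using r by (simp add: la_def c)
    ultimately show ?thesis unfolding c' by (simp add: diff_divide_distrib)
  qed
  have vf: "ip v (f l) = 0" if "l < m" for l
    unfolding ip_def by (subst design_inner_sym) (simp only: v_def ip_def W.ip_gs_zero[OF that])
  have vh: "ip v h = 0"
    unfolding h_def ip_def design_inner_sum_right by (intro sum.neutral ballI) (simp add: vf[unfolded ip_def])
  have v'f: "ip' v' (f l) = 0" if "l < m" for l
    unfolding ip'_def by (subst design_inner_sym) (simp only: v'_def ip'_def W'.ip_gs_zero[OF that])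
  have v'h: "ip' v' h = 0"
    unfolding h_def ip'_def design_inner_sum_right by (intro sum.neutral ballI) (simp add: v'f[unfolded ip'_def])
  have pert: "\<bar>ip' f1 f2 - ip f1 f2\<bar> \<le> t * (sqrt (ip f1 f1) * sqrt (ip f2 f2))" for f1 f2
  proof -
    have "ip' f1 f2 - ip f1 f2 = design_inner n X (\<lambda>x. w' x - w x) f1 f2"
      unfolding ip_def ip'_def design_inner_def by (simp add: algebra_simps sum_subtractf)
    thus ?thesis using W.ip_cauchy_schwarz_weights[of "\<lambda>x. w' x - w x" t f1 f2] ww t by (simp add: ip_def)
  qed
  have sc: "ip g (\<lambda>x. c * v x) = c * ip g v" for g c
    unfolding ip_def by (subst (1 2) design_inner_sym) (rule design_inner_scale_left)
  define N where "N = ip v' v'"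
  have N0: "N \<ge> 0" unfolding N_def ip_def by (rule W.ip_nonneg)
  have N1: "\<bar>1 - N\<bar> \<le> t * N" using pert[of v' v'] nv N0 by (simp add: N_def)
  have "t * N \<le> 1 / 2 * N" using t N0 by (intro mult_right_mono)
  hence N2: "N \<le> 2" using N1 by linarith
  have hf: "h = (\<lambda>x. v' x - la * v x)" "v' = (\<lambda>x. h x - (- la) * v x)"
    "(\<lambda>x. v' x - v x) = (\<lambda>x. h x - (1 - la) * v x)" by (auto simp: h algebra_simps)
  have "ip h h = ip (\<lambda>x. v' x - la * v x) h" by (rule arg_cong[where f = "\<lambda>g. ip g h", OF hf(1)])
  also have "\<dots> = ip v' h" unfolding ip_def design_inner_diff_left design_inner_scale_left
    using vh by (simp add: ip_def)
  finally have hh: "ip h h = ip v' h" .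
  have hh0: "ip h h \<ge> 0" unfolding ip_def by (rule W.ip_nonneg)
  \<comment> \<open>As h is orthogonal to v for w and to v' for w', ip h h equals ip v' h - ip' v'
    h: a pure effect of the change of weights.\<close>
  have "ip h h \<le> t * (sqrt N * sqrt (ip h h))" using pert[of v' h] v'h hh by (simp add: N_def)
  hence "sqrt (ip h h) * sqrt (ip h h) \<le> t * sqrt N * sqrt (ip h h)" using hh0 by simp
  hence "sqrt (ip h h) \<le> t * sqrt N \<or> sqrt (ip h h) = 0"
    using hh0 by (metis mult_le_cancel_right real_sqrt_ge_0_iff less_le)
  hence "sqrt (ip h h) \<le> t * sqrt N" using t N0 by auto
  hence "(sqrt (ip h h))\<^sup>2 \<le> (t * sqrt N)\<^sup>2" using hh0 by (intro power_mono) auto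
  hence h2: "ip h h \<le> 2 * t\<^sup>2"
    using hh0 N0 N2 mult_left_mono[OF N2, of "t\<^sup>2"] by (simp add: power_mult_distrib mult.commute)
  \<comment> \<open>Pythagoras for v' = h + la * v. Since N is near 1 and h is small, la must be
    near 1.\<close>
  have "N = la\<^sup>2 + ip h h"
  proof -
    have "N = ip (\<lambda>x. h x - (- la) * v x) (\<lambda>x. h x - (- la) * v x)"
      unfolding N_def by (rule arg_cong[where f = "\<lambda>g. ip g g", OF hf(2)])
    also have "\<dots> = ip h h + 2 * la * ip v h + la * la * ip v v"
      unfolding ip_def design_inner_diff_left design_inner_diff_right design_inner_scale_left
      by (simp only: sc[unfolded ip_def] design_inner_sym[of n X w h v])
    finally show ?thesis using vh nv by (simp add: power2_eq_square)
  qed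
  hence "\<bar>la\<^sup>2 - 1\<bar> \<le> 2 * t + 2 * t\<^sup>2" using N1 h2 hh0 mult_left_mono[OF N2 t(1)] by linarith
  moreover have "t\<^sup>2 \<le> t / 2" using mult_left_mono[OF t(2) t(1)] by (simp add: power2_eq_square)
  ultimately have la2: "\<bar>la\<^sup>2 - 1\<bar> \<le> 3 * t" by linarith
  have "\<bar>la - 1\<bar> * 1 \<le> \<bar>la - 1\<bar> * (la + 1)" using la by (intro mult_left_mono) auto
  also have "\<dots> = \<bar>la\<^sup>2 - 1\<bar>" using la by (simp add: power2_eq_square square_diff_one_factored abs_mult mult.commute)
  finally have "\<bar>la - 1\<bar> \<le> 3 * t" using la2 by simp
  hence la3: "(la - 1)\<^sup>2 \<le> (3 * t)\<^sup>2" using power_mono[of "\<bar>la - 1\<bar>" "3 * t" 2] by simp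
  have "ip (\<lambda>x. v' x - v x) (\<lambda>x. v' x - v x) = ip (\<lambda>x. h x - (1 - la) * v x) (\<lambda>x. h x - (1 - la) * v x)"
    by (rule arg_cong[where f = "\<lambda>g. ip g g", OF hf(3)])
  also have "\<dots> = ip h h - 2 * (1 - la) * ip v h + (1 - la) * (1 - la) * ip v v"
    unfolding ip_def design_inner_diff_left design_inner_diff_right design_inner_scale_left
    by (simp only: sc[unfolded ip_def] design_inner_sym[of n X w h v])
  also have "\<dots> = ip h h + (la - 1)\<^sup>2" using vh nv by (simp add: power2_eq_square algebra_simps)
  also have "\<dots> \<le> (4 * t)\<^sup>2" 
  proof -
    have "(3 * t)\<^sup>2 = 9 * t\<^sup>2" "(4 * t)\<^sup>2 = 16 * t\<^sup>2" by (simp_all add: power_mult_distrib)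
    thus ?thesis using h2 la3 zero_le_power2[of t] by linarith
  qed
  finally show ?thesis by (simp add: v_def v'_def)
qed

text \<open>For e with a e = d, which the right inverse c provides, positivity of the form at d - s
  * e reads 0 \<le> P - 2 * s * S + s^2 * (sum of e i * d i), where P is the form at d and S its
  squared length. The last sum is at most C * S, and s = 1 / C yields P \<ge> S / C.\<close>

lemma quadratic_form_gap:
  fixes a :: "nat \<Rightarrow> nat \<Rightarrow> real"
  assumes sym: "\<And>i k. i < K \<Longrightarrow> k < K \<Longrightarrow> a i k = a k i"
    and psd: "\<And>d. 0 \<le> (\<Sum>i<K. \<Sum>k<K. d i * a i k * d k)"
    and inv: "\<And>i j. i < K \<Longrightarrow> j < K \<Longrightarrow> (\<Sum>k<K. a i k * c k j) = (if i = j then 1 else 0)"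
  shows "\<exists>\<epsilon>>0. \<forall>d. \<epsilon> * (\<Sum>i<K. (d i)\<^sup>2) \<le> (\<Sum>i<K. \<Sum>k<K. d i * a i k * d k)"
proof -
  define C where "C = (\<Sum>i<K. \<Sum>j<K. \<bar>c i j\<bar>) + 1"
  have C: "C \<ge> 1" unfolding C_def by (simp add: sum_nonneg)
  have "1 / C * (\<Sum>i<K. (d i)\<^sup>2) \<le> (\<Sum>i<K. \<Sum>k<K. d i * a i k * d k)" for d
  proof -
    define e where "e = (\<lambda>k. \<Sum>j<K. c k j * d j)"
    have ae: "(\<Sum>k<K. a i k * e k) = d i" if i: "i < K" for i
    proof -
      have "(\<Sum>k<K. a i k * e k) = (\<Sum>j<K. (\<Sum>k<K. a i k * c k j) * d j)"
        unfolding e_def sum_distrib_left sum_distrib_right by (subst sum.swap) (simp add: mult_ac)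
      also have "\<dots> = (\<Sum>j<K. (if i = j then 1 else 0) * d j)" using inv i by (intro sum.cong) auto
      also have "\<dots> = (\<Sum>j<K. if i = j then d j else 0)" by (intro sum.cong) auto
      also have "\<dots> = d i" using i by simp
      finally show ?thesis .
    qed
    define S where "S = (\<Sum>i<K. (d i)\<^sup>2)"
    define P where "P = (\<Sum>i<K. \<Sum>k<K. d i * a i k * d k)"
    have S0: "S \<ge> 0" by (simp add: S_def sum_nonneg)
    have dd: "\<bar>d i\<bar> * \<bar>d j\<bar> \<le> S" if "i < K" "j < K" for i j
    proof -
      have m: "(d i)\<^sup>2 \<le> S" if "i < K" for i unfolding S_def using that by (intro member_le_sum) auto
      have "\<bar>d i\<bar> * \<bar>d j\<bar> \<le> ((d i)\<^sup>2 + (d j)\<^sup>2) / 2"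
        using zero_le_power2[of "\<bar>d i\<bar> - \<bar>d j\<bar>"] by (simp add: power2_eq_square algebra_simps)
      also have "\<dots> \<le> S" using m[OF that(1)] m[OF that(2)] by simp
      finally show ?thesis .
    qed
    have Q1: "(\<Sum>i<K. \<Sum>k<K. d i * a i k * e k) = S"
    proof -
      have "(\<Sum>i<K. \<Sum>k<K. d i * a i k * e k) = (\<Sum>i<K. d i * (\<Sum>k<K. a i k * e k))"
        by (simp add: sum_distrib_left mult_ac)
      also have "\<dots> = S" unfolding S_def using ae by (intro sum.cong) (auto simp: power2_eq_square)
      finally show ?thesis .
    qed
    have Q2: "(\<Sum>i<K. \<Sum>k<K. e i * a i k * d k) = S"
    proof -
      have "(\<Sum>i<K. \<Sum>k<K. e i * a i k * d k) = (\<Sum>k<K. \<Sum>i<K. e i * a i k * d k)" by (rule sum.swap)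
      also have "\<dots> = (\<Sum>k<K. \<Sum>i<K. d k * a k i * e i)"
        using sym by (intro sum.cong refl) auto
      finally show ?thesis using Q1 by simp
    qed
    have Q3: "(\<Sum>i<K. \<Sum>k<K. e i * a i k * e k) \<le> C * S"
    proof -
      have "(\<Sum>i<K. \<Sum>k<K. e i * a i k * e k) = (\<Sum>i<K. e i * (\<Sum>k<K. a i k * e k))"
        by (simp add: sum_distrib_left mult_ac)
      also have "\<dots> = (\<Sum>i<K. e i * d i)" using ae by (intro sum.cong) auto
      also have "\<dots> = (\<Sum>i<K. \<Sum>j<K. c i j * (d j * d i))" by (simp add: e_def sum_distrib_left sum_distrib_right mult_ac)
      also have "\<dots> \<le> (\<Sum>i<K. \<Sum>j<K. \<bar>c i j\<bar> * S)"
      proof (intro sum_mono)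
        fix i j assume "i \<in> {..<K}" "j \<in> {..<K}"
        hence "\<bar>c i j\<bar> * (\<bar>d j\<bar> * \<bar>d i\<bar>) \<le> \<bar>c i j\<bar> * S" using dd by (intro mult_left_mono) auto
        moreover have "c i j * (d j * d i) \<le> \<bar>c i j * (d j * d i)\<bar>" by simp
        ultimately show "c i j * (d j * d i) \<le> \<bar>c i j\<bar> * S" by (simp add: abs_mult)
      qed
      also have "\<dots> = (\<Sum>i<K. \<Sum>j<K. \<bar>c i j\<bar>) * S" by (simp add: sum_distrib_right)
      also have "\<dots> \<le> C * S" unfolding C_def using S0 by (intro mult_right_mono) auto
      finally show ?thesis .
    qed
    define s where "s = 1 / C"
    have "0 \<le> (\<Sum>i<K. \<Sum>k<K. (d i - s * e i) * a i k * (d k - s * e k))" by (rule psd)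
    also have "\<dots> = (\<Sum>i<K. \<Sum>k<K. d i * a i k * d k - s * (d i * a i k * e k) - s * (e i * a i k * d k) + s * s * (e i * a i k * e k))"
      by (intro sum.cong refl) (simp add: algebra_simps)
    also have "\<dots> = P - s * S - s * S + s * s * (\<Sum>i<K. \<Sum>k<K. e i * a i k * e k)"
      unfolding sum.distrib sum_subtractf sum_distrib_left[symmetric] Q1 Q2 P_def ..
    also have "\<dots> \<le> P - s * S - s * S + s * s * (C * S)"
      using Q3 by (intro add_left_mono mult_left_mono) auto
    also have "s * s * (C * S) = s * S" using C by (simp add: s_def)
    finally show ?thesis by (simp add: s_def S_def P_def)
  qed
  thus ?thesis using C by (intro exI[of _ "1 / C"]) auto
qed

text \<open>Let t0 be the largest t for which q - t * N is nonnegative. If t0 were below \<kappa>,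
  hence below the whole spectrum, G - t0 would be invertible (by the adjugate) and positive
  semidefinite; the gap lemma would then allow a larger t0. So t0 \<ge> \<kappa>, with no
  diagonalisation.\<close>

lemma symmetric_matrix_rayleigh:
  fixes G :: "real mat"
  assumes G: "G \<in> carrier_mat K K" "0 < K"
    and sym: "\<And>i k. i < K \<Longrightarrow> k < K \<Longrightarrow> G $$ (i, k) = G $$ (k, i)"
    and psd: "\<And>d. 0 \<le> (\<Sum>i<K. \<Sum>k<K. d i * G $$ (i, k) * d k)"
    and spec: "\<And>t. t \<in> spectrum G \<Longrightarrow> \<kappa> \<le> t"
  shows "\<kappa> * (\<Sum>i<K. (d i)\<^sup>2) \<le> (\<Sum>i<K. \<Sum>k<K. d i * G $$ (i, k) * d k)"
proof -
  define q where "q = (\<lambda>d :: nat \<Rightarrow> real. \<Sum>i<K. \<Sum>k<K. d i * G $$ (i, k) * d k)"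
  define N where "N = (\<lambda>d :: nat \<Rightarrow> real. \<Sum>i<K. (d i)\<^sup>2)"
  define T where "T = {t. \<forall>d. t * N d \<le> q d}"
  have N0: "N d \<ge> 0" for d by (simp add: N_def sum_nonneg)
  have q0: "q d \<ge> 0" for d unfolding q_def by (rule psd)
  have "N (\<lambda>_. 1) > 0" using G(2) by (simp add: N_def)
  hence bdd: "bdd_above T"
    by (intro bdd_aboveI[of _ "q (\<lambda>_. 1) / N (\<lambda>_. 1)"]) (auto simp: T_def field_simps)
  have T0: "0 \<in> T" using q0 by (simp add: T_def)
  define t0 where "t0 = Sup T"
  have t0: "t0 * N d \<le> q d" for d
  proof (cases "N d = 0")
    case False
    hence Np: "N d > 0" using N0[of d] by simp
    have "t0 \<le> q d / N d"
      unfolding t0_def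
    proof (rule cSup_least)
      show "T \<noteq> {}" using T0 by blast
      show "t \<le> q d / N d" if "t \<in> T" for t
        using that Np by (simp add: T_def le_divide_eq)
    qed
    thus ?thesis using Np by (simp add: le_divide_eq)
  qed (use q0 in simp)
  have "\<kappa> \<le> t0"
  proof (rule ccontr)
    assume "\<not> \<kappa> \<le> t0"
    hence "t0 \<notin> spectrum G" using spec by fastforce
    hence "\<not> eigenvalue G t0" by (simp add: spectrum_def)
    hence det: "det (char_matrix G t0) \<noteq> 0" using eigenvalue_det[OF G(1)] by simp
    define A where "A = char_matrix G t0"
    have A: "A \<in> carrier_mat K K" using G(1) by (simp add: A_def char_matrix_def)
    have Aik: "A $$ (i, k) = G $$ (i, k) - (if i = k then t0 else 0)" if "i < K" "k < K" for i k
      using that G(1) by (auto simp: A_def char_matrix_def)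
    define c where "c = (\<lambda>k j. adj_mat A $$ (k, j) / det A)"
    have inv: "(\<Sum>k<K. A $$ (i, k) * c k j) = (if i = j then 1 else 0)" if ij: "i < K" "j < K" for i j
    proof -
      have "(A * adj_mat A) $$ (i, j) = (\<Sum>k<K. A $$ (i, k) * adj_mat A $$ (k, j))"
        using ij A adj_mat(1)[OF A] by (simp add: scalar_prod_def atLeast0LessThan)
      moreover have "(A * adj_mat A) $$ (i, j) = (if i = j then det A else 0)"
        unfolding adj_mat(2)[OF A] using ij by simp
      ultimately have "(\<Sum>k<K. A $$ (i, k) * adj_mat A $$ (k, j)) = (if i = j then det A else 0)" by (simp only:)
      hence "(\<Sum>k<K. A $$ (i, k) * adj_mat A $$ (k, j)) / det A = (if i = j then 1 else 0)"
        using det unfolding A_def[symmetric] by (cases "i = j") simp_all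
      thus ?thesis by (simp add: c_def sum_divide_distrib)
    qed
    have qA: "(\<Sum>i<K. \<Sum>k<K. d i * A $$ (i, k) * d k) = q d - t0 * N d" for d
    proof -
      have "(\<Sum>i<K. \<Sum>k<K. d i * A $$ (i, k) * d k) =
          (\<Sum>i<K. \<Sum>k<K. d i * G $$ (i, k) * d k - (if i = k then t0 * (d i * d k) else 0))"
        by (intro sum.cong refl) (auto simp: Aik algebra_simps)
      also have "\<dots> = q d - (\<Sum>i<K. t0 * (d i * d i))"
        by (simp add: sum_subtractf q_def)
      finally show ?thesis by (simp add: N_def sum_distrib_left power2_eq_square)
    qed
    have "\<exists>\<epsilon>>0. \<forall>d. \<epsilon> * (\<Sum>i<K. (d i)\<^sup>2) \<le> (\<Sum>i<K. \<Sum>k<K. d i * A $$ (i, k) * d k)"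
    proof (rule quadratic_form_gap)
      show "A $$ (i, k) = A $$ (k, i)" if "i < K" "k < K" for i k
        using Aik[OF that] Aik[OF that(2,1)] sym[OF that] by simp
      show "0 \<le> (\<Sum>i<K. \<Sum>k<K. d i * A $$ (i, k) * d k)" for d unfolding qA using t0[of d] by simp
      show "(\<Sum>k<K. A $$ (i, k) * c k j) = (if i = j then 1 else 0)" if "i < K" "j < K" for i j
        by (rule inv[OF that])
    qed
    then obtain e where e': "e > 0" "\<forall>d. e * (\<Sum>i<K. (d i)\<^sup>2) \<le> q d - t0 * N d"
      unfolding qA by blast
    hence e: "e > 0" "\<And>d. e * N d \<le> q d - t0 * N d" by (simp_all only: N_def)
    have "t0 + e \<in> T" unfolding T_def using e(2) by (auto simp: algebra_simps)
    hence "t0 + e \<le> Sup T" by (rule cSup_upper[OF _ bdd])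
    thus False using e(1) by (simp add: t0_def[symmetric])
  qed
  hence "\<kappa> * N d \<le> t0 * N d" using N0 by (rule mult_right_mono)
  thus ?thesis using t0[of d] by (simp add: N_def q_def)
qed

text \<open>The form in which the eigenvalue condition is used: coefficients are controlled by the
  empirical second moment of the combination. The index l + 1 appears because matrices count from 0
  and u from 1.\<close>

lemma basis_gram_coeff_bound:
  assumes \<kappa>: "\<kappa> \<le> Min (spectrum (basis_gram u n X K))"
  shows "\<kappa> * (\<Sum>l<K. (d l)\<^sup>2) \<le> (1 / real n) * (\<Sum>i=1..n. (\<Sum>l<K. d l * u (l + 1) (X i))\<^sup>2)"
proof (cases "K = 0")
  case False
  define G where "G = basis_gram u n X K"
  have G: "G \<in> carrier_mat K K" by (intro carrier_matI) (simp_all add: G_def basis_gram_def basis_matrix_def)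
  have Gik: "G $$ (j, l) = (1 / real n) * (\<Sum>i=1..n. u (j + 1) (X i) * u (l + 1) (X i))" if "j < K" "l < K" for j l
  proof -
    have "G $$ (j, l) = (1 / real n) * (\<Sum>i = 0..<n. u (j + 1) (X (i + 1)) * u (l + 1) (X (i + 1)))"
      using that by (simp add: G_def basis_gram_def basis_matrix_def scalar_prod_def)
    also have "(\<Sum>i = 0..<n. u (j + 1) (X (i + 1)) * u (l + 1) (X (i + 1))) = (\<Sum>i=1..n. u (j + 1) (X i) * u (l + 1) (X i))"
      by (rule sum.reindex_bij_witness[of _ "\<lambda>i. i - 1" "\<lambda>i. i + 1"]) auto
    finally show ?thesis .
  qed
  have q: "(\<Sum>j<K. \<Sum>l<K. d j * G $$ (j, l) * d l) = (1 / real n) * (\<Sum>i=1..n. (\<Sum>l<K. d l * u (l + 1) (X i))\<^sup>2)" for d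
  proof -
    have "(\<Sum>j<K. \<Sum>l<K. d j * G $$ (j, l) * d l)
      = (\<Sum>j<K. \<Sum>l<K. \<Sum>i=1..n. (1 / real n) * ((d j * u (j + 1) (X i)) * (d l * u (l + 1) (X i))))"
      by (intro sum.cong refl) (simp add: Gik sum_distrib_left sum_distrib_right mult_ac)
    also have "\<dots> = (\<Sum>j<K. \<Sum>i=1..n. \<Sum>l<K. (1 / real n) * ((d j * u (j + 1) (X i)) * (d l * u (l + 1) (X i))))"
      by (intro sum.cong refl sum.swap)
    also have "\<dots> = (\<Sum>i=1..n. \<Sum>j<K. \<Sum>l<K. (1 / real n) * ((d j * u (j + 1) (X i)) * (d l * u (l + 1) (X i))))"
      by (rule sum.swap)
    also have "\<dots> = (\<Sum>i=1..n. (1 / real n) * (\<Sum>l<K. d l * u (l + 1) (X i))\<^sup>2)"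
      unfolding power2_eq_square sum_product by (simp add: sum_distrib_left)
    finally show ?thesis by (simp add: sum_distrib_left)
  qed
  have "finite (spectrum G)" using card_finite_spectrum[OF G] by simp
  hence spec: "\<kappa> \<le> t" if "t \<in> spectrum G" for t
    using order_trans[OF \<kappa>[folded G_def] Min_le[OF _ that]] by blast
  show ?thesis
    unfolding q[symmetric]
  proof (rule symmetric_matrix_rayleigh[OF G _ _ _ spec])
    show "0 \<le> (\<Sum>i<K. \<Sum>k<K. d i * G $$ (i, k) * d k)" for d
      unfolding q by (intro mult_nonneg_nonneg sum_nonneg) auto
    show "G $$ (i, k) = G $$ (k, i)" if "i < K" "k < K" for i k
      using that by (simp add: Gik mult.commute)
  qed (use False in auto)
qed (simp add: sum_nonneg)

subsection \<open>Exponential families\<close>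

lemma power_le_exp:
  fixes y \<rho> :: real
  assumes "\<rho> > 0" "k > 0"
  shows "\<bar>y\<bar> ^ k \<le> (real k / \<rho>) ^ k * exp (\<rho> * \<bar>y\<bar>)"
proof -
  have "(\<rho> * \<bar>y\<bar> / real k) ^ k \<le> (1 + \<rho> * \<bar>y\<bar> / real k) ^ k"
    using assms by (intro power_mono) auto
  also have "\<dots> \<le> exp (\<rho> * \<bar>y\<bar>)"
    using assms by (intro exp_ge_one_plus_x_over_n_power_n) (auto intro: order_trans[of _ 0])
  finally have "(real k / \<rho>) ^ k * (\<rho> * \<bar>y\<bar> / real k) ^ k \<le> (real k / \<rho>) ^ k * exp (\<rho> * \<bar>y\<bar>)"
    using assms by (intro mult_left_mono) auto
  thus ?thesis using assms by (simp flip: power_mult_distrib)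
qed

text \<open>The laws of the responses at fixed dispersion, a0 standing for the value of a at it.
  Only exponential tilting relates them; the base measure and the normalising term c cancel in the
  quotient of two densities. Openness of G provides tilts in both directions, hence exponential
  moments.\<close>

locale exp_family =
  fixes D :: "real \<Rightarrow> real measure" and b :: "real \<Rightarrow> real" and a0 :: real and G :: "real set"
  assumes open_G: "open G" and a0: "a0 > 0"
    and rd: "z \<in> G \<Longrightarrow> real_distribution (D z)"
    and tilt: "z \<in> G \<Longrightarrow> z' \<in> G \<Longrightarrow>
      D z' = density (D z) (\<lambda>y. ennreal (exp ((y * (z' - z) - (b z' - b z)) / a0)))"
    and diff0: "z \<in> G \<Longrightarrow> b field_differentiable at z"
    and diff1: "z \<in> G \<Longrightarrow> deriv b field_differentiable at z"
begin

lemma db: "z \<in> G \<Longrightarrow> (b has_real_derivative deriv b z) (at z)"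
  using diff0 DERIV_deriv_iff_field_differentiable by blast

lemma ddb: "z \<in> G \<Longrightarrow> (deriv b has_real_derivative deriv (deriv b) z) (at z)"
  using diff1 DERIV_deriv_iff_field_differentiable by blast

lemma meas_iff: "z \<in> G \<Longrightarrow> f \<in> borel_measurable (D z) \<longleftrightarrow> f \<in> borel_measurable borel" for f :: "real \<Rightarrow> real"
  using rd[of z] by (simp add: real_distribution_def real_distribution_axioms_def cong: measurable_cong_sets)

lemma tilt_integral:
  assumes "z \<in> G" "z' \<in> G" and [measurable]: "h \<in> borel_measurable borel"
  shows "integral\<^sup>L (D z') h = (\<integral>y. exp ((y * (z' - z) - (b z' - b z)) / a0) * h y \<partial>D z)"
    and "integrable (D z') h \<longleftrightarrow> integrable (D z) (\<lambda>y. exp ((y * (z' - z) - (b z' - b z)) / a0) * h y)"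
proof -
  have h: "h \<in> borel_measurable (D z)" "(\<lambda>y. exp ((y * (z' - z) - (b z' - b z)) / a0)) \<in> borel_measurable (D z)"
    unfolding meas_iff[OF assms(1)] by measurable
  show "integral\<^sup>L (D z') h = (\<integral>y. exp ((y * (z' - z) - (b z' - b z)) / a0) * h y \<partial>D z)"
    unfolding tilt[OF assms(1,2)] using h by (subst integral_density) auto
  show "integrable (D z') h \<longleftrightarrow> integrable (D z) (\<lambda>y. exp ((y * (z' - z) - (b z' - b z)) / a0) * h y)"
    unfolding tilt[OF assms(1,2)] using h by (subst integrable_density) auto
qed

text \<open>The tilted law at z + t has total mass 1; read under the law at z, this is the moment
  generating function.\<close>

lemma mgf:
  assumes "z \<in> G" "z + t \<in> G"
  shows "integrable (D z) (\<lambda>y. exp (y * t / a0))" "(\<integral>y. exp (y * t / a0) \<partial>D z) = exp ((b (z + t) - b z) / a0)"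
proof -
  interpret real_distribution "D (z + t)" by (rule rd[OF assms(2)])
  define c where "c = exp (- ((b (z + t) - b z) / a0))"
  have eq: "exp ((y * (z + t - z) - (b (z + t) - b z)) / a0) * 1 = c * exp (y * t / a0)" for y
    unfolding c_def by (simp add: diff_divide_distrib flip: exp_add)
  have "integrable (D z) (\<lambda>y. c * exp (y * t / a0))"
    using tilt_integral(2)[OF assms, of "\<lambda>_. 1"] unfolding eq by simp
  hence "integrable (D z) (\<lambda>y. inverse c * (c * exp (y * t / a0)))" by (rule integrable_mult_right)
  thus "integrable (D z) (\<lambda>y. exp (y * t / a0))" by (simp add: c_def mult.assoc[symmetric])
  have "1 = (\<integral>y. c * exp (y * t / a0) \<partial>D z)"
    using tilt_integral(1)[OF assms, of "\<lambda>_. 1"] prob_space unfolding eq by simp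
  hence "c * (\<integral>y. exp (y * t / a0) \<partial>D z) = 1" by simp
  thus "(\<integral>y. exp (y * t / a0) \<partial>D z) = exp ((b (z + t) - b z) / a0)"
    by (simp add: c_def exp_minus field_simps)
qed

lemma exp_abs_moment:
  assumes "z \<in> G" "z + t \<in> G" "z - t \<in> G" "t \<ge> 0"
  shows "integrable (D z) (\<lambda>y. exp (t / a0 * \<bar>y\<bar>))"
    "(\<integral>y. exp (t / a0 * \<bar>y\<bar>) \<partial>D z) \<le> exp ((b (z + t) - b z) / a0) + exp ((b (z - t) - b z) / a0)"
proof -
  note 1 = mgf[OF assms(1,2)]
  note 2 = mgf[of z "- t", simplified, OF assms(1,3)]
  have le: "exp (t / a0 * \<bar>y\<bar>) \<le> exp (y * t / a0) + exp (- (y * t / a0))" for y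
    by (cases "y \<ge> 0") (auto simp: mult.commute intro: add_increasing add_increasing2)
  have i: "integrable (D z) (\<lambda>y. exp (y * t / a0) + exp (- (y * t / a0)))"
    using 1 2 by auto
  have m: "(\<lambda>y. exp (t / a0 * \<bar>y\<bar>)) \<in> borel_measurable (D z)" unfolding meas_iff[OF assms(1)] by measurable
  show ii: "integrable (D z) (\<lambda>y. exp (t / a0 * \<bar>y\<bar>))"
    by (rule Bochner_Integration.integrable_bound[OF i m]) (use le in \<open>auto intro!: AE_I2 order_trans[OF le abs_ge_self]\<close>)
  have "(\<integral>y. exp (t / a0 * \<bar>y\<bar>) \<partial>D z) \<le> (\<integral>y. exp (y * t / a0) + exp (- (y * t / a0)) \<partial>D z)"
    by (rule integral_mono[OF ii i]) (rule le)
  also have "\<dots> = exp ((b (z + t) - b z) / a0) + exp ((b (z - t) - b z) / a0)"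
    using 1 2 by simp
  finally show "(\<integral>y. exp (t / a0 * \<bar>y\<bar>) \<partial>D z) \<le> exp ((b (z + t) - b z) / a0) + exp ((b (z - t) - b z) / a0)" .
qed

lemma room:
  assumes "z \<in> G"
  shows "\<exists>r>0. \<forall>t. \<bar>t\<bar> \<le> r \<longrightarrow> z + t \<in> G"
proof -
  obtain e where "e > 0" "cball z e \<subseteq> G" using open_G assms open_contains_cball by blast
  thus ?thesis by (intro exI[of _ e]) (auto simp: dist_real_def subset_iff)
qed

text \<open>Differentiation under the integral at t = 0, along a null sequence and by dominated
  convergence. The weight h is 1 for the mean and y for the second moment, whence the bound 1 +
  \<bar>y\<bar>.\<close>

lemma moment_derivative:
  assumes z: "z \<in> G" and h[measurable]: "h \<in> borel_measurable borel"
    and hb: "\<And>y. \<bar>h y\<bar> \<le> 1 + \<bar>y\<bar>"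
    and m: "\<And>t. z + t \<in> G \<Longrightarrow> (\<integral>y. h y * exp (y * t / a0) \<partial>D z) = m t"
    and d: "(m has_real_derivative d) (at 0)"
  shows "(\<integral>y. y * h y \<partial>D z) = a0 * d"
proof -
  obtain r where r: "r > 0" "\<And>t. \<bar>t\<bar> \<le> r \<Longrightarrow> z + t \<in> G" using room[OF z] by blast
  define \<rho> where "\<rho> = r / a0"
  have \<rho>: "\<rho> > 0" using r a0 by (simp add: \<rho>_def)
  have iE: "integrable (D z) (\<lambda>y. exp (\<rho> * \<bar>y\<bar>))"
    unfolding \<rho>_def using r(2)[of r] r(2)[of "-r"] r(1) by (intro exp_abs_moment z) auto
  define t where "t = (\<lambda>n::nat. (r / 2) / real (n + 1))"
  have t: "t n > 0" "t n \<le> r / 2" for n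
  proof -
    show "t n > 0" using r by (simp add: t_def)
    have "(r / 2) / real (n + 1) \<le> (r / 2) / 1" using r by (intro divide_left_mono) auto
    thus "t n \<le> r / 2" by (simp add: t_def)
  qed
  have t0: "t \<longlonglongrightarrow> 0" using LIMSEQ_Suc[OF lim_const_over_n[of "r / 2"]] by (simp add: t_def[abs_def])
  have tG: "z + t n \<in> G" for n using t[of n] r by auto
  define q where "q = (\<lambda>n y. h y * (exp (y * t n / a0) - 1) / t n)"
  \<comment> \<open>Half of the exponent \<rho> is spent on the exponential in the difference
    quotient, the other half on the quadratic polynomial in \<bar>y\<bar>, by
    \<open>power_le_exp\<close> with k = 2.\<close>
  define C where "C = (1 + 1 + 2 * (real 2 / (\<rho> / 2)) ^ 2) / a0"
  have dom: "\<bar>q n y\<bar> \<le> C * exp (\<rho> * \<bar>y\<bar>)" for n y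
  proof -
    define u where "u = t n * (\<bar>y\<bar> / a0)"
    have u0: "u \<ge> 0" using t(1)[of n] a0 by (simp add: u_def)
    have "\<bar>y * t n / a0\<bar> = u" using t(1)[of n] a0 by (simp add: abs_mult u_def)
    hence e1: "\<bar>exp (y * t n / a0) - 1\<bar> \<le> u * exp u" using abs_exp_minus_1_le[of "y * t n / a0"] by simp
    have "u \<le> r / 2 * (\<bar>y\<bar> / a0)" unfolding u_def using t(2)[of n] a0 by (intro mult_right_mono) auto
    hence "exp u \<le> exp (\<rho> / 2 * \<bar>y\<bar>)" by (simp add: \<rho>_def)
    from order_trans[OF e1 mult_left_mono[OF this u0]]
    have "\<bar>exp (y * t n / a0) - 1\<bar> \<le> t n * (\<bar>y\<bar> / a0) * exp (\<rho> / 2 * \<bar>y\<bar>)" by (simp add: u_def)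
    hence "\<bar>exp (y * t n / a0) - 1\<bar> / t n \<le> (\<bar>y\<bar> / a0) * exp (\<rho> / 2 * \<bar>y\<bar>)"
      using t(1)[of n] by (simp add: divide_le_eq mult_ac)
    hence "\<bar>h y\<bar> * (\<bar>exp (y * t n / a0) - 1\<bar> / t n) \<le> (1 + \<bar>y\<bar>) * ((\<bar>y\<bar> / a0) * exp (\<rho> / 2 * \<bar>y\<bar>))"
      using hb[of y] t(1)[of n] by (intro mult_mono) auto
    hence "\<bar>q n y\<bar> \<le> (1 + \<bar>y\<bar>) * ((\<bar>y\<bar> / a0) * exp (\<rho> / 2 * \<bar>y\<bar>))"
      using t(1)[of n] by (simp add: q_def abs_mult)
    also have "\<dots> = (\<bar>y\<bar> + \<bar>y\<bar>\<^sup>2) / a0 * exp (\<rho> / 2 * \<bar>y\<bar>)"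
      by (simp add: power2_eq_square algebra_simps add_divide_distrib)
    also have "\<dots> \<le> (C * exp (\<rho> / 2 * \<bar>y\<bar>)) * exp (\<rho> / 2 * \<bar>y\<bar>)"
    proof (rule mult_right_mono)
      have p: "\<bar>y\<bar>\<^sup>2 \<le> (real 2 / (\<rho> / 2)) ^ 2 * exp (\<rho> / 2 * \<bar>y\<bar>)"
        using power_le_exp[of "\<rho> / 2" 2 y] \<rho> by simp
      have "\<bar>y\<bar> \<le> 1 + \<bar>y\<bar>\<^sup>2" using zero_le_power2[of "\<bar>y\<bar> - 1"] abs_ge_zero[of y] unfolding power2_eq_square
        by (simp add: algebra_simps)
      moreover have "1 \<le> exp (\<rho> / 2 * \<bar>y\<bar>)" using \<rho> by simp
      ultimately have "\<bar>y\<bar> + \<bar>y\<bar>\<^sup>2 \<le> (1 + 1 + 2 * (real 2 / (\<rho> / 2)) ^ 2) * exp (\<rho> / 2 * \<bar>y\<bar>)"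
        using p unfolding distrib_right by linarith
      thus "(\<bar>y\<bar> + \<bar>y\<bar>\<^sup>2) / a0 \<le> C * exp (\<rho> / 2 * \<bar>y\<bar>)"
        unfolding C_def using a0 by (simp add: divide_right_mono)
    qed simp
    also have "\<dots> = C * exp (\<rho> * \<bar>y\<bar>)" by (simp flip: exp_add)
    finally show ?thesis .
  qed
  have hI: "integrable (D z) (\<lambda>y. h y)"
  proof (rule Bochner_Integration.integrable_bound)
    show "integrable (D z) (\<lambda>y. (1 + 1 / \<rho>) * exp (\<rho> * \<bar>y\<bar>))" using iE by simp
    show "AE y in D z. norm (h y) \<le> norm ((1 + 1 / \<rho>) * exp (\<rho> * \<bar>y\<bar>))"
    proof (rule AE_I2)
      fix y
      have "\<bar>y\<bar> \<le> 1 / \<rho> * exp (\<rho> * \<bar>y\<bar>)" using power_le_exp[of \<rho> 1 y] \<rho> by simp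
      moreover have "1 \<le> exp (\<rho> * \<bar>y\<bar>)" using \<rho> by simp
      ultimately have "\<bar>h y\<bar> \<le> (1 + 1 / \<rho>) * exp (\<rho> * \<bar>y\<bar>)" using hb[of y] unfolding distrib_right by linarith
      thus "norm (h y) \<le> norm ((1 + 1 / \<rho>) * exp (\<rho> * \<bar>y\<bar>))" by (simp add: order_trans[OF _ abs_ge_self])
    qed
  qed (simp add: meas_iff[OF z])
  have qI: "integrable (D z) (q n)" for n
    by (rule Bochner_Integration.integrable_bound[OF integrable_mult_right[OF iE, of C]])
      (use dom in \<open>auto simp: meas_iff[OF z] q_def intro!: AE_I2 order_trans[OF _ abs_ge_self]\<close>)
  have lim1: "(\<lambda>n. integral\<^sup>L (D z) (q n)) \<longlonglongrightarrow> (\<integral>y. h y * (y / a0) \<partial>D z)"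
  proof (rule integral_dominated_convergence[where w = "\<lambda>y. C * exp (\<rho> * \<bar>y\<bar>)"])
    show "AE y in D z. (\<lambda>n. q n y) \<longlonglongrightarrow> h y * (y / a0)"
    proof (rule AE_I2)
      fix y
      have "((\<lambda>s. exp (y * s / a0)) has_real_derivative y / a0) (at 0)"
        using a0 by (auto intro!: derivative_eq_intros)
      hence "((\<lambda>s. (exp (y * s / a0) - 1) / s) \<longlongrightarrow> y / a0) (at 0)" by (simp add: DERIV_def)
      hence "(\<lambda>n. (exp (y * t n / a0) - 1) / t n) \<longlonglongrightarrow> y / a0"
        by (rule filterlim_compose) (use t0 t(1) in \<open>auto simp: filterlim_at less_imp_neq[symmetric]\<close>)
      from tendsto_mult[OF tendsto_const this, of "h y"] show "(\<lambda>n. q n y) \<longlonglongrightarrow> h y * (y / a0)"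
        by (simp add: q_def)
    qed
    show "integrable (D z) (\<lambda>y. C * exp (\<rho> * \<bar>y\<bar>))" using iE by simp
  qed (use dom in \<open>auto simp: meas_iff[OF z] q_def[abs_def]\<close>)
  have "integral\<^sup>L (D z) (q n) = (m (t n) - m 0) / t n" for n
  proof -
    have hE: "integrable (D z) (\<lambda>y. h y * exp (y * t n / a0))"
    proof -
      have "(\<lambda>y. t n * q n y + h y) = (\<lambda>y. h y * exp (y * t n / a0))"
      proof
        fix y
        have "t n * q n y = h y * (exp (y * t n / a0) - 1)" using t(1)[of n] by (simp add: q_def)
        thus "t n * q n y + h y = h y * exp (y * t n / a0)" by (simp add: right_diff_distrib)
      qed
      moreover have "integrable (D z) (\<lambda>y. t n * q n y + h y)" using qI hI by auto
      ultimately show ?thesis by simp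
    qed
    have "integral\<^sup>L (D z) (q n) = (\<integral>y. (h y * exp (y * t n / a0) - h y) / t n \<partial>D z)"
      by (simp add: q_def[abs_def] algebra_simps)
    also have "\<dots> = ((\<integral>y. h y * exp (y * t n / a0) \<partial>D z) - (\<integral>y. h y \<partial>D z)) / t n"
      using hE hI by simp
    also have "(\<integral>y. h y \<partial>D z) = m 0" using m[of 0] z by simp
    finally show ?thesis using m[OF tG] by simp
  qed
  moreover have "(\<lambda>n. (m (t n) - m 0) / t n) \<longlonglongrightarrow> d"
  proof -
    have "((\<lambda>s. (m s - m 0) / s) \<longlongrightarrow> d) (at 0)" using d by (simp add: DERIV_def)
    thus ?thesis
      by (rule filterlim_compose) (use t0 t(1) in \<open>auto simp: filterlim_at less_imp_neq[symmetric]\<close>)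
  qed
  ultimately have "(\<integral>y. h y * (y / a0) \<partial>D z) = d" using LIMSEQ_unique[OF lim1] by simp
  moreover have "(\<integral>y. h y * (y / a0) \<partial>D z) = (\<integral>y. y * h y \<partial>D z) / a0" by (simp add: mult.commute)
  ultimately show ?thesis using a0 by (simp add: field_simps)
qed

lemma mean: "z \<in> G \<Longrightarrow> (\<integral>y. y \<partial>D z) = deriv b z"
proof -
  assume z: "z \<in> G"
  have "((\<lambda>t. b (z + t)) has_real_derivative deriv b z) (at 0)"
    by (rule DERIV_chain2[where g = "\<lambda>t. z + t" and x = 0 and f = b and s = UNIV, THEN DERIV_cong])
      (use db[OF z] in \<open>auto intro!: derivative_eq_intros\<close>)
  hence "((\<lambda>t. exp ((b (z + t) - b z) / a0)) has_real_derivative deriv b z / a0) (at 0)"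
    using a0 by (auto intro!: derivative_eq_intros)
  from moment_derivative[OF z, of "\<lambda>_. 1", OF _ _ _ this] have "(\<integral>y. y \<partial>D z) = a0 * (deriv b z / a0)"
    using mgf(2)[OF z] by simp
  thus ?thesis using a0 by simp
qed

text \<open>The formula for the mean holds at z + t as well; untilted, it gives the mean of y * exp
  (y * t / a0) under the law at z, whose derivative at t = 0 is the second moment divided by
  a0.\<close>

lemma second_moment: "z \<in> G \<Longrightarrow> (\<integral>y. y\<^sup>2 \<partial>D z) = a0 * deriv (deriv b) z + (deriv b z)\<^sup>2"
proof -
  assume z: "z \<in> G"
  have d1: "((\<lambda>t. b (z + t)) has_real_derivative deriv b z) (at 0)"
    by (rule DERIV_chain2[where g = "\<lambda>t. z + t" and x = 0 and f = b and s = UNIV, THEN DERIV_cong])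
      (use db[OF z] in \<open>auto intro!: derivative_eq_intros\<close>)
  have d2: "((\<lambda>t. deriv b (z + t)) has_real_derivative deriv (deriv b) z) (at 0)"
    by (rule DERIV_chain2[where g = "\<lambda>t. z + t" and x = 0 and f = "deriv b" and s = UNIV, THEN DERIV_cong])
      (use ddb[OF z] in \<open>auto intro!: derivative_eq_intros\<close>)
  have d: "((\<lambda>t. deriv b (z + t) * exp ((b (z + t) - b z) / a0)) has_real_derivative
      deriv (deriv b) z + deriv b z * (deriv b z / a0)) (at 0)"
    using a0 by (auto intro!: derivative_eq_intros d1 d2)
  have "(\<integral>y. y * exp (y * t / a0) \<partial>D z) = deriv b (z + t) * exp ((b (z + t) - b z) / a0)" if zt: "z + t \<in> G" for t
  proof -
    have "deriv b (z + t) = (\<integral>y. exp ((y * (z + t - z) - (b (z + t) - b z)) / a0) * y \<partial>D z)"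
      using mean[OF zt] tilt_integral(1)[OF z zt, of "\<lambda>y. y"] by simp
    also have "\<dots> = (\<integral>y. exp (- ((b (z + t) - b z) / a0)) * (y * exp (y * t / a0)) \<partial>D z)"
    proof (rule Bochner_Integration.integral_cong[OF refl])
      fix y
      have "(y * (z + t - z) - (b (z + t) - b z)) / a0 = - ((b (z + t) - b z) / a0) + y * t / a0"
        by (simp add: diff_divide_distrib)
      thus "exp ((y * (z + t - z) - (b (z + t) - b z)) / a0) * y = exp (- ((b (z + t) - b z) / a0)) * (y * exp (y * t / a0))"
        by (simp only: exp_add) simp
    qed
    also have "\<dots> = exp (- ((b (z + t) - b z) / a0)) * (\<integral>y. y * exp (y * t / a0) \<partial>D z)" by simp
    finally show ?thesis by (simp add: exp_minus field_simps)
  qed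
  from moment_derivative[OF z _ _ this d] have "(\<integral>y. y * y \<partial>D z) = a0 * (deriv (deriv b) z + deriv b z * (deriv b z / a0))"
    by simp
  also have "\<dots> = a0 * deriv (deriv b) z + (deriv b z)\<^sup>2" using a0 by (simp add: power2_eq_square field_simps)
  finally show ?thesis by (simp add: power2_eq_square)
qed

text \<open>A compact set keeps a positive distance e from the complement of G. The e-neighbourhood
  is again compact, so b and its derivative are bounded on it, and tilts by e in both directions
  bound the exponential moments uniformly.\<close>

lemma compact_room:
  assumes C: "compact C" "C \<subseteq> G"
  shows "\<exists>r B1 M. r > 0 \<and> B1 \<ge> 0 \<and> M \<ge> 0 \<and> (\<forall>z\<in>C. \<forall>t. \<bar>t\<bar> \<le> r \<longrightarrow> z + t \<in> G \<and> \<bar>deriv b (z + t)\<bar> \<le> B1) \<and>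
    (\<forall>z\<in>C. integrable (D z) (\<lambda>y. exp (r / a0 * \<bar>y\<bar>)) \<and> (\<integral>y. exp (r / a0 * \<bar>y\<bar>) \<partial>D z) \<le> M)"
proof -
  have "\<exists>e>0. \<forall>z\<in>C. cball z e \<subseteq> G"
  proof (cases "C = {}")
    case False
    obtain e where e: "e > 0" "{x. infdist x C \<le> e} \<subseteq> G"
      using compact_in_open_separated[OF False C(1) open_G C(2)] by blast
    have "infdist x C \<le> e" if "z \<in> C" "x \<in> cball z e" for z x
      using infdist_le[OF that(1), of x] that(2) by (simp add: dist_commute)
    thus ?thesis using e by blast
  qed (auto intro: exI[of _ 1])
  then obtain e where e: "e > 0" "\<And>z. z \<in> C \<Longrightarrow> cball z e \<subseteq> G" by blast
  define C' where "C' = {z + t | z t. z \<in> C \<and> t \<in> cball 0 e}"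
  have cC': "compact C'" unfolding C'_def by (rule compact_sums[OF C(1) compact_cball])
  have C'G: "C' \<subseteq> G"
  proof
    fix x assume "x \<in> C'"
    then obtain z t where zt: "x = z + t" "z \<in> C" "\<bar>t\<bar> \<le> e" by (auto simp: C'_def)
    hence "x \<in> cball z e" by (simp add: dist_real_def)
    thus "x \<in> G" using e(2)[OF zt(2)] by auto
  qed
  have inC': "z + t \<in> C'" if "z \<in> C" "\<bar>t\<bar> \<le> e" for z t using that by (auto simp: C'_def)
  have "continuous_on C' b"
    by (intro continuous_at_imp_continuous_on ballI DERIV_isCont[OF db]) (use C'G in auto)
  then obtain B where B: "\<And>z. z \<in> C' \<Longrightarrow> \<bar>b z\<bar> \<le> B"
    using compact_continuous_image[OF _ cC'] compact_imp_bounded bounded_iff by (metis imageI real_norm_def)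
  have "continuous_on C' (deriv b)"
    by (intro continuous_at_imp_continuous_on ballI DERIV_isCont[OF ddb]) (use C'G in auto)
  then obtain B1 where B1: "\<And>z. z \<in> C' \<Longrightarrow> \<bar>deriv b z\<bar> \<le> B1"
    using compact_continuous_image[OF _ cC'] compact_imp_bounded bounded_iff by (metis imageI real_norm_def)
  define M where "M = 2 * exp (2 * B / a0)"
  have "integrable (D z) (\<lambda>y. exp (e / a0 * \<bar>y\<bar>)) \<and> (\<integral>y. exp (e / a0 * \<bar>y\<bar>) \<partial>D z) \<le> M" if z: "z \<in> C" for z
  proof -
    have in': "z \<in> C'" "z + e \<in> C'" "z - e \<in> C'" using inC'[OF z, of 0] inC'[OF z, of e] inC'[OF z, of "-e"] e by auto
    have "b (z + e) - b z \<le> 2 * B" "b (z - e) - b z \<le> 2 * B"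
      using B[OF in'(1)] B[OF in'(2)] B[OF in'(3)] by auto
    hence "exp ((b (z + e) - b z) / a0) + exp ((b (z - e) - b z) / a0) \<le> M"
      unfolding M_def using a0 by (smt (verit) divide_right_mono exp_le_cancel_iff)
    thus ?thesis using exp_abs_moment[of z e] in' C'G e by force
  qed
  thus ?thesis
    using e(1) inC' C'G B1 by (intro exI[of _ e] exI[of _ "\<bar>B1\<bar>"] exI[of _ M] conjI ballI allI impI)
      (auto simp: M_def intro: order_trans[OF _ abs_ge_self])
qed

lemma poly_moment_bound:
  assumes "\<rho> > 0" "z \<in> G" "integrable (D z) (\<lambda>y. exp (\<rho> * \<bar>y\<bar>))" "(\<integral>y. exp (\<rho> * \<bar>y\<bar>) \<partial>D z) \<le> M"
    and [measurable]: "h \<in> borel_measurable borel" and h: "\<And>y. \<bar>h y\<bar> \<le> c * exp (\<rho> * \<bar>y\<bar>)" "c \<ge> 0"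
  shows "integrable (D z) h" "\<bar>integral\<^sup>L (D z) h\<bar> \<le> c * M"
proof -
  show i: "integrable (D z) h"
    by (rule Bochner_Integration.integrable_bound[OF integrable_mult_right[OF assms(3), of c]])
      (use h in \<open>auto simp: meas_iff[OF assms(2)] intro!: AE_I2 order_trans[OF _ abs_ge_self]\<close>)
  have "\<bar>integral\<^sup>L (D z) h\<bar> \<le> (\<integral>y. \<bar>h y\<bar> \<partial>D z)" by (rule integral_abs_bound)
  also have "\<dots> \<le> (\<integral>y. c * exp (\<rho> * \<bar>y\<bar>) \<partial>D z)" using i assms(3) h by (intro integral_mono) auto
  also have "\<dots> \<le> c * M" using assms(4) h by (simp add: mult_left_mono)
  finally show "\<bar>integral\<^sup>L (D z) h\<bar> \<le> c * M" .
qed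

text \<open>The Lipschitz bound for the second derivative of b comes from moments: a0 times this
  derivative is the second moment minus the squared mean, and both moments are Lipschitz in the
  tilt. The exponential moments also bound the third central moments.\<close>

lemma uniform_bounds:
  assumes C: "compact C" "C \<subseteq> G"
  shows "\<exists>r L M3. r > 0 \<and> L \<ge> 0 \<and> M3 \<ge> 0 \<and>
    (\<forall>z\<in>C. \<forall>t. \<bar>t\<bar> \<le> r \<longrightarrow> z + t \<in> G \<and> \<bar>deriv (deriv b) (z + t) - deriv (deriv b) z\<bar> \<le> L * \<bar>t\<bar>) \<and>
    (\<forall>z\<in>C. integrable (D z) (\<lambda>y. \<bar>y - deriv b z\<bar> ^ 3) \<and> (\<integral>y. \<bar>y - deriv b z\<bar> ^ 3 \<partial>D z) \<le> M3) \<and>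
    (\<forall>z\<in>C. integrable (D z) (\<lambda>y. y) \<and> integrable (D z) (\<lambda>y. y\<^sup>2))"
proof -
  obtain r B1 M where r': "r > 0 \<and> B1 \<ge> 0 \<and> M \<ge> 0 \<and> (\<forall>z\<in>C. \<forall>t. \<bar>t\<bar> \<le> r \<longrightarrow> z + t \<in> G \<and> \<bar>deriv b (z + t)\<bar> \<le> B1) \<and>
    (\<forall>z\<in>C. integrable (D z) (\<lambda>y. exp (r / a0 * \<bar>y\<bar>)) \<and> (\<integral>y. exp (r / a0 * \<bar>y\<bar>) \<partial>D z) \<le> M)"
    using compact_room[OF C] by (elim exE)
  have r: "r > 0" "B1 \<ge> 0" "M \<ge> 0"
    "\<And>z t. z \<in> C \<Longrightarrow> \<bar>t\<bar> \<le> r \<Longrightarrow> z + t \<in> G" "\<And>z t. z \<in> C \<Longrightarrow> \<bar>t\<bar> \<le> r \<Longrightarrow> \<bar>deriv b (z + t)\<bar> \<le> B1"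
    "\<And>z. z \<in> C \<Longrightarrow> integrable (D z) (\<lambda>y. exp (r / a0 * \<bar>y\<bar>))"
    "\<And>z. z \<in> C \<Longrightarrow> (\<integral>y. exp (r / a0 * \<bar>y\<bar>) \<partial>D z) \<le> M"
    using r' by simp_all
  define \<rho> where "\<rho> = r / a0"
  have \<rho>: "\<rho> > 0" using r a0 by (simp add: \<rho>_def)
  have CG: "z \<in> G" if "z \<in> C" for z using that C by auto
  note pmb = poly_moment_bound[OF \<rho> CG r(6,7)[folded \<rho>_def]]
  have pe: "\<bar>y\<bar> ^ k \<le> (real k / (\<rho> / 2)) ^ k * exp (\<rho> / 2 * \<bar>y\<bar>)" if "k > 0" for k y
    using power_le_exp[of "\<rho> / 2" k y] that \<rho> by simp
  have half: "exp (\<rho> / 2 * \<bar>y\<bar>) \<le> exp (\<rho> * \<bar>y\<bar>)" for y using \<rho> by (simp add: mult_right_mono)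
  define p where "p = (\<lambda>k. (real k / (\<rho> / 2)) ^ k)"
  have p0: "p k \<ge> 0" for k using \<rho> by (simp add: p_def)
  have pf: "\<bar>y\<bar> ^ k \<le> p k * exp (\<rho> * \<bar>y\<bar>)" if "k > 0" for k y
    using pe[OF that, of y] mult_left_mono[OF half[of y] p0[of k]] by (simp add: p_def)
  have i1: "integrable (D z) (\<lambda>y. y)" "integrable (D z) (\<lambda>y. y\<^sup>2)" if "z \<in> C" for z
    by (rule pmb(1)[OF that that that, of _ "p 1"], use pf[of 1] p0 in auto)
       (rule pmb(1)[OF that that that, of _ "p 2"], use pf[of 2] p0 in auto)
  define M3 where "M3 = (4 * p 3 + 4 * B1 ^ 3) * M"
  have third: "integrable (D z) (\<lambda>y. \<bar>y - deriv b z\<bar> ^ 3) \<and> (\<integral>y. \<bar>y - deriv b z\<bar> ^ 3 \<partial>D z) \<le> M3" if z: "z \<in> C" for z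
  proof -
    have "\<bar>\<bar>y - deriv b z\<bar> ^ 3\<bar> \<le> (4 * p 3 + 4 * B1 ^ 3) * exp (\<rho> * \<bar>y\<bar>)" for y
    proof -
      have "\<bar>deriv b z\<bar> \<le> B1" using r(5)[OF z, of 0] r(1) by simp
      hence "\<bar>y - deriv b z\<bar> ^ 3 \<le> (\<bar>y\<bar> + B1) ^ 3" by (intro power_mono) auto
      also have "(\<bar>y\<bar> + B1) ^ 3 \<le> 4 * \<bar>y\<bar> ^ 3 + 4 * B1 ^ 3"
      proof -
        have "0 \<le> 3 * (\<bar>y\<bar> + B1) * (\<bar>y\<bar> - B1)\<^sup>2" using r(2) by simp
        thus ?thesis by (simp add: power2_eq_square power3_eq_cube algebra_simps)
      qed
      also have "\<dots> \<le> 4 * (p 3 * exp (\<rho> * \<bar>y\<bar>)) + 4 * B1 ^ 3 * exp (\<rho> * \<bar>y\<bar>)"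
        using pf[of 3 y] r(2) \<rho> by (intro add_mono mult_left_mono mult_right_le_one_le) (auto simp: mult_le_cancel_left1)
      finally show ?thesis by (simp add: algebra_simps)
    qed
    from pmb[OF z z z _ this] show ?thesis using p0[of 3] r(2) by (simp add: M3_def)
  qed
  define c where "c = (\<lambda>k. (p (k + 1) + B1 * p k) / a0 * exp (\<rho> / 2 * B1))"
  \<comment> \<open>The tilt factor may use half of the available exponential moment and the
    polynomial the other half; this is why \<bar>t\<bar> is restricted to r / 2.\<close>
  have tiltdiff: "\<bar>(\<integral>y. y ^ k \<partial>D (z + t)) - (\<integral>y. y ^ k \<partial>D z)\<bar> \<le> c k * M * \<bar>t\<bar>"
    if z: "z \<in> C" and t: "\<bar>t\<bar> \<le> r / 2" and k: "k > 0" for z t k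
  proof -
    have zt: "z + t \<in> G" using r(4)[OF z, of t] t r(1) by auto
    define f where "f = (\<lambda>y. exp ((y * t - (b (z + t) - b z)) / a0))"
    have bd: "\<bar>b (z + t) - b z\<bar> \<le> B1 * \<bar>t\<bar>"
    proof -
      have "\<exists>\<xi>. \<bar>\<xi>\<bar> \<le> \<bar>t\<bar> \<and> b (z + t) - b z = t * deriv b (z + \<xi>)"
      proof (cases "t = 0")
        case False
        have dd: "((\<lambda>s. b (z + s * t)) has_real_derivative t * deriv b (z + s * t)) (at s)" if "0 \<le> s" "s \<le> 1" for s
        proof -
          have "\<bar>s * t\<bar> \<le> 1 * \<bar>t\<bar>" unfolding abs_mult using that by (intro mult_right_mono) auto
          hence "z + s * t \<in> G" using r(4)[OF z, of "s * t"] t r(1) by auto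
          thus ?thesis
            by (intro DERIV_chain2[where g = "\<lambda>s. z + s * t" and f = b and x = s, OF db, THEN DERIV_cong])
               (auto intro!: derivative_eq_intros)
        qed
        obtain s where s: "0 < s" "s < 1" "b (z + 1 * t) - b (z + 0 * t) = (1 - 0) * (t * deriv b (z + s * t))"
          using MVT2[of 0 1 "\<lambda>s. b (z + s * t)" "\<lambda>s. t * deriv b (z + s * t)"] dd by auto
        have "\<bar>s * t\<bar> \<le> 1 * \<bar>t\<bar>" unfolding abs_mult using s by (intro mult_right_mono) auto
        thus ?thesis using s(3) by (intro exI[of _ "s * t"]) auto
      qed (use z in auto)
      then obtain \<xi> where \<xi>: "\<bar>\<xi>\<bar> \<le> \<bar>t\<bar>" "b (z + t) - b z = t * deriv b (z + \<xi>)" by blast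
      have "\<bar>deriv b (z + \<xi>)\<bar> \<le> B1" using r(5)[OF z, of \<xi>] \<xi>(1) t r(1) by auto
      hence "\<bar>t\<bar> * \<bar>deriv b (z + \<xi>)\<bar> \<le> \<bar>t\<bar> * B1" by (rule mult_left_mono) auto
      thus ?thesis unfolding \<xi>(2) abs_mult by (simp add: mult.commute)
    qed
    have bound: "\<bar>f y * y ^ k - y ^ k\<bar> \<le> (c k * \<bar>t\<bar>) * exp (\<rho> * \<bar>y\<bar>)" for y
    proof -
      define u where "u = (y * t - (b (z + t) - b z)) / a0"
      have "\<bar>y * t - (b (z + t) - b z)\<bar> \<le> \<bar>t\<bar> * (\<bar>y\<bar> + B1)"
        using bd by (rule_tac order_trans[OF abs_triangle_ineq4]) (simp add: abs_mult algebra_simps)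
      hence u1: "\<bar>u\<bar> \<le> \<bar>t\<bar> * (\<bar>y\<bar> + B1) / a0" using a0 by (simp add: u_def abs_div divide_right_mono)
      also have "\<dots> \<le> (r / 2) * (\<bar>y\<bar> + B1) / a0" using t a0 r(2) by (intro divide_right_mono mult_right_mono) auto
      also have "\<dots> = \<rho> / 2 * \<bar>y\<bar> + \<rho> / 2 * B1" using a0 by (simp add: \<rho>_def field_simps)
      finally have "exp \<bar>u\<bar> \<le> exp (\<rho> / 2 * \<bar>y\<bar>) * exp (\<rho> / 2 * B1)" by (simp flip: exp_add)
      hence "\<bar>exp u - 1\<bar> \<le> (\<bar>t\<bar> * (\<bar>y\<bar> + B1) / a0) * (exp (\<rho> / 2 * \<bar>y\<bar>) * exp (\<rho> / 2 * B1))"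
        using u1 r(2) a0 by (intro order_trans[OF abs_exp_minus_1_le] mult_mono) auto
      hence "\<bar>y\<bar> ^ k * \<bar>exp u - 1\<bar> \<le> \<bar>y\<bar> ^ k * ((\<bar>t\<bar> * (\<bar>y\<bar> + B1) / a0) * (exp (\<rho> / 2 * \<bar>y\<bar>) * exp (\<rho> / 2 * B1)))"
        by (intro mult_left_mono) auto
      also have "\<dots> = (\<bar>y\<bar> ^ (k + 1) + B1 * \<bar>y\<bar> ^ k) * (exp (\<rho> / 2 * \<bar>y\<bar>) * (\<bar>t\<bar> / a0 * exp (\<rho> / 2 * B1)))"
        by (simp add: algebra_simps add_divide_distrib)
      also have "\<dots> \<le> (p (k + 1) * exp (\<rho> / 2 * \<bar>y\<bar>) + B1 * (p k * exp (\<rho> / 2 * \<bar>y\<bar>))) * (exp (\<rho> / 2 * \<bar>y\<bar>) * (\<bar>t\<bar> / a0 * exp (\<rho> / 2 * B1)))"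
        using pe[of "k + 1" y] pe[OF k, of y] r(2) a0 unfolding p_def by (intro mult_right_mono add_mono mult_left_mono) auto
      also have "\<dots> = (c k * \<bar>t\<bar>) * (exp (\<rho> / 2 * \<bar>y\<bar>) * exp (\<rho> / 2 * \<bar>y\<bar>))"
        by (simp add: c_def algebra_simps add_divide_distrib)
      also have "exp (\<rho> / 2 * \<bar>y\<bar>) * exp (\<rho> / 2 * \<bar>y\<bar>) = exp (\<rho> * \<bar>y\<bar>)" by (simp flip: exp_add)
      finally have "\<bar>y\<bar> ^ k * \<bar>exp u - 1\<bar> \<le> (c k * \<bar>t\<bar>) * exp (\<rho> * \<bar>y\<bar>)" .
      moreover have "\<bar>f y * y ^ k - y ^ k\<bar> = \<bar>y\<bar> ^ k * \<bar>exp u - 1\<bar>"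
        by (simp add: f_def u_def power_abs[symmetric] abs_mult[symmetric] algebra_simps)
      ultimately show ?thesis by simp
    qed
    have c0: "c k * \<bar>t\<bar> \<ge> 0" unfolding c_def using p0 r(2) a0 by simp
    have mf: "(\<lambda>y. f y * y ^ k - y ^ k) \<in> borel_measurable borel" unfolding f_def by measurable
    note pb = pmb[OF z z z mf bound c0]
    have iy: "integrable (D z) (\<lambda>y. y ^ k)"
      by (rule pmb(1)[OF z z z, of _ "p k"]) (use pf[OF k] p0 in \<open>auto simp: power_abs\<close>)
    have ify: "integrable (D z) (\<lambda>y. f y * y ^ k)"
    proof -
      have "integrable (D z) (\<lambda>y. (f y * y ^ k - y ^ k) + y ^ k)"
        by (rule Bochner_Integration.integrable_add[OF pb(1) iy])
      thus ?thesis by simp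
    qed
    have "(\<integral>y. y ^ k \<partial>D (z + t)) = (\<integral>y. f y * y ^ k \<partial>D z)"
      using tilt_integral(1)[OF CG[OF z] zt, of "\<lambda>y. y ^ k"] by (simp add: f_def)
    hence "(\<integral>y. y ^ k \<partial>D (z + t)) - (\<integral>y. y ^ k \<partial>D z) = (\<integral>y. f y * y ^ k - y ^ k \<partial>D z)" using ify iy by simp
    thus ?thesis using pb(2) by (simp add: mult_ac)
  qed
  define L where "L = (c 2 * M + c 1 * M * (2 * B1)) / a0"
  have c0: "c k \<ge> 0" for k unfolding c_def using p0 r(2) a0 by simp
  have lip: "z + t \<in> G \<and> \<bar>deriv (deriv b) (z + t) - deriv (deriv b) z\<bar> \<le> L * \<bar>t\<bar>" if z: "z \<in> C" and t: "\<bar>t\<bar> \<le> r / 2" for z t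
  proof -
    have zt: "z + t \<in> G" using r(4)[OF z, of t] t r(1) by auto
    have d1: "\<bar>deriv b (z + t) - deriv b z\<bar> \<le> c 1 * M * \<bar>t\<bar>"
      using tiltdiff[OF z t, of 1] mean[OF zt] mean[OF CG[OF z]] by simp
    have d2: "\<bar>(a0 * deriv (deriv b) (z + t) + (deriv b (z + t))\<^sup>2) - (a0 * deriv (deriv b) z + (deriv b z)\<^sup>2)\<bar> \<le> c 2 * M * \<bar>t\<bar>"
      using tiltdiff[OF z t, of 2] second_moment[OF zt] second_moment[OF CG[OF z]] by simp
    have "\<bar>(deriv b (z + t))\<^sup>2 - (deriv b z)\<^sup>2\<bar> = \<bar>deriv b (z + t) - deriv b z\<bar> * \<bar>deriv b (z + t) + deriv b z\<bar>"
      by (simp add: power2_eq_square abs_mult[symmetric] algebra_simps)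
    also have "\<dots> \<le> (c 1 * M * \<bar>t\<bar>) * (2 * B1)"
    proof (intro mult_mono d1)
      have "\<bar>deriv b (z + t)\<bar> \<le> B1" "\<bar>deriv b (z + 0)\<bar> \<le> B1" using r(5)[OF z, of t] r(5)[OF z, of 0] t r(1) by auto
      thus "\<bar>deriv b (z + t) + deriv b z\<bar> \<le> 2 * B1" by simp
    qed (use c0 r(3) in auto)
    finally have "\<bar>a0 * (deriv (deriv b) (z + t) - deriv (deriv b) z)\<bar> \<le> c 2 * M * \<bar>t\<bar> + (c 1 * M * \<bar>t\<bar>) * (2 * B1)"
      using d2 by (simp add: algebra_simps)
    also have "c 2 * M * \<bar>t\<bar> + (c 1 * M * \<bar>t\<bar>) * (2 * B1) = a0 * (L * \<bar>t\<bar>)"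
      using a0 by (simp add: L_def field_simps)
    finally have "a0 * \<bar>deriv (deriv b) (z + t) - deriv (deriv b) z\<bar> \<le> a0 * (L * \<bar>t\<bar>)"
      using a0 by (simp only: abs_mult abs_of_pos)
    hence "\<bar>deriv (deriv b) (z + t) - deriv (deriv b) z\<bar> \<le> L * \<bar>t\<bar>"
      using a0 by (simp only: mult_le_cancel_left_pos)
    thus ?thesis using zt by simp
  qed
  have "L \<ge> 0" unfolding L_def using c0 r a0 by simp
  moreover have "M3 \<ge> 0" unfolding M3_def using p0 r by simp
  ultimately show ?thesis using r(1) lip third i1
    by (intro exI[of _ "r / 2"] exI[of _ L] exI[of _ M3]) auto
qed

end

subsection \<open>Comparison with Gaussian errors\<close>

lemma cauchy_schwarz_sum_abs:
  fixes f g :: "'i \<Rightarrow> real"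
  shows "\<bar>\<Sum>i\<in>I. f i * g i\<bar> \<le> sqrt (\<Sum>i\<in>I. (f i)\<^sup>2) * sqrt (\<Sum>i\<in>I. (g i)\<^sup>2)"
  using Cauchy_Schwarz_ineq_sum[of f g I] by (simp add: real_sqrt_mult[symmetric] real_le_rsqrt abs_le_square_iff flip: real_sqrt_abs)

lemma sum_le_sqrt_card:
  fixes f :: "'i \<Rightarrow> real"
  assumes "finite I"
  shows "(\<Sum>i\<in>I. \<bar>f i\<bar>) \<le> sqrt (real (card I)) * sqrt (\<Sum>i\<in>I. (f i)\<^sup>2)"
  using cauchy_schwarz_sum_abs[of "\<lambda>_. 1" "\<lambda>i. \<bar>f i\<bar>" I] by simp

definition trunc_sum_cos :: "real \<Rightarrow> real \<Rightarrow> real \<Rightarrow> real \<Rightarrow> nat set \<Rightarrow> (nat \<Rightarrow> real) \<Rightarrow> real" where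
  "trunc_sum_cos s a t \<theta> J z = cos (t * (\<Sum>j\<in>J. trunc_exp s (z j) / a) + \<theta>)"

lemma trunc_sum_cos_measurable: "trunc_sum_cos s a t \<theta> J \<in> borel_measurable seq_space"
  unfolding trunc_sum_cos_def[abs_def] by measurable

lemma trunc_coord_measurable: "(\<lambda>z. trunc_exp s (z j)) \<in> borel_measurable seq_space"
  by measurable

lemma abs_cos_le1: "\<bar>trunc_sum_cos s a t \<theta> J z\<bar> \<le> 1"
  by (simp add: trunc_sum_cos_def)

text \<open>The integrated form of \<open>perturb_cos\<close>, with the trivial bound 2 outside E. W
  is required pointwise on E only and need not be measurable. Stated for any probability space, it
  applies to the true errors and to the Gaussian ones.\<close>

lemma perturb_expectation:
  fixes a A t \<theta> D :: real and G :: "nat \<Rightarrow> 'w \<Rightarrow> real" and d :: "nat \<Rightarrow> real"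
  assumes M: "prob_space M" and a: "a > 0" "A \<ge> 1" "A * a \<ge> 1" and J: "finite J"
    and [measurable]: "S \<in> borel_measurable M" "\<And>j. j \<in> J \<Longrightarrow> G j \<in> borel_measurable M" "E \<in> sets M"
    and good: "AE \<omega> in M. \<omega> \<in> E \<longrightarrow> (\<exists>W. S \<omega> = (\<Sum>j\<in>J. exp_half_sq (W j) / a) \<and> (\<forall>j\<in>J. \<bar>W j - G j \<omega>\<bar> \<le> d j))"
    and d: "\<And>j. j \<in> J \<Longrightarrow> 0 \<le> d j" "\<And>j. j \<in> J \<Longrightarrow> d j \<le> D" "D \<ge> 0"
  defines "m \<equiv> sqrt (2 * ln (A * a))"
  defines "Ep \<equiv> (m + D) * exp (D * m + D\<^sup>2 / 2)"
  defines "s \<equiv> A\<^sup>2 * a"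
  assumes Q: "\<And>j. j \<in> J \<Longrightarrow> (\<integral>\<omega>. trunc_exp s (G j \<omega>) \<partial>M) \<le> Q" and Q0: "Q \<ge> 0"
  shows "\<bar>(\<integral>\<omega>. cos (t * S \<omega> + \<theta>) \<partial>M) - (\<integral>\<omega>. cos (t * (\<Sum>j\<in>J. trunc_exp s (G j \<omega>) / a) + \<theta>) \<partial>M)\<bar>
    \<le> 2 * measure M (space M - E) + Q * ((4 + \<bar>t\<bar>) * (real (card J) / (A * a)) + 2 * \<bar>t\<bar> * Ep * (\<Sum>j\<in>J. d j) / a)"
proof -
  interpret prob_space M by fact
  define H where "H = (\<lambda>j. 4 / (A * a) + \<bar>t\<bar> * (1 / (A * a) + 2 * Ep * d j / a))"
  have s0: "s > 0" using a by (simp add: s_def)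
  have m0: "m \<ge> 0" using a by (simp add: m_def)
  have E0: "Ep \<ge> 0" using m0 d(3) by (simp add: Ep_def)
  have Aa: "A * a > 0" using a by simp
  have H0: "H j \<ge> 0" if "j \<in> J" for j
    unfolding H_def using d(1)[OF that] E0 a by simp
  have f0: "trunc_exp s z \<ge> 0" "trunc_exp s z \<le> s" for z using trunc_exp_bounds[OF s0] by auto
  have if_: "integrable M (\<lambda>\<omega>. trunc_exp s (G j \<omega>))" if "j \<in> J" for j
    by (rule integrable_const_bound[where B = s]) (use f0 that in auto)
  have pw: "AE \<omega> in M. \<bar>cos (t * S \<omega> + \<theta>) - cos (t * (\<Sum>j\<in>J. trunc_exp s (G j \<omega>) / a) + \<theta>)\<bar>
      \<le> 2 * indicator (space M - E) \<omega> + (\<Sum>j\<in>J. H j * trunc_exp s (G j \<omega>))"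
    using good AE_space
  proof eventually_elim
    case (elim \<omega>)
    have nn: "0 \<le> (\<Sum>j\<in>J. H j * trunc_exp s (G j \<omega>))" using H0 f0 by (intro sum_nonneg) auto
    show ?case
    proof (cases "\<omega> \<in> E")
      case True
      then obtain W where W: "S \<omega> = (\<Sum>j\<in>J. exp_half_sq (W j) / a)" "\<And>j. j \<in> J \<Longrightarrow> \<bar>W j - G j \<omega>\<bar> \<le> d j"
        using elim by auto
      from perturb_cos[OF a J W(2) d(2), where t = t and \<theta> = \<theta>] show ?thesis
        using True unfolding W(1) H_def s_def Ep_def m_def by simp
    next
      case False
      have "\<bar>cos x - cos y\<bar> \<le> 2" for x y :: real
        using cos_le_one[of x] cos_ge_minus_one[of x] cos_le_one[of y] cos_ge_minus_one[of y] by linarith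
      thus ?thesis using False elim nn by (simp add: add_increasing2)
    qed
  qed
  have ic: "integrable M (\<lambda>\<omega>. cos (t * S \<omega> + \<theta>))"
    "integrable M (\<lambda>\<omega>. cos (t * (\<Sum>j\<in>J. trunc_exp s (G j \<omega>) / a) + \<theta>))"
    by (rule integrable_const_bound[where B = 1]; simp)+
  have iR: "integrable M (\<lambda>\<omega>. 2 * indicator (space M - E) \<omega> + (\<Sum>j\<in>J. H j * trunc_exp s (G j \<omega>)))"
    using if_ by (intro Bochner_Integration.integrable_add Bochner_Integration.integrable_sum integrable_mult_right
        integrable_const_bound[of "indicator (space M - E)" 1]) auto
  have "\<bar>(\<integral>\<omega>. cos (t * S \<omega> + \<theta>) \<partial>M) - (\<integral>\<omega>. cos (t * (\<Sum>j\<in>J. trunc_exp s (G j \<omega>) / a) + \<theta>) \<partial>M)\<bar>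
    = \<bar>\<integral>\<omega>. cos (t * S \<omega> + \<theta>) - cos (t * (\<Sum>j\<in>J. trunc_exp s (G j \<omega>) / a) + \<theta>) \<partial>M\<bar>"
    using ic by simp
  also have "\<dots> \<le> (\<integral>\<omega>. 2 * indicator (space M - E) \<omega> + (\<Sum>j\<in>J. H j * trunc_exp s (G j \<omega>)) \<partial>M)"
    by (rule order_trans[OF integral_abs_bound], rule integral_mono_AE) (use ic iR pw in auto)
  also have "\<dots> = (\<integral>\<omega>. 2 * indicator (space M - E) \<omega> \<partial>M) + (\<integral>\<omega>. (\<Sum>j\<in>J. H j * trunc_exp s (G j \<omega>)) \<partial>M)"
    using if_ by (intro Bochner_Integration.integral_add Bochner_Integration.integrable_sum integrable_mult_right
        integrable_const_bound[of "indicator (space M - E)" 1]) auto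
  also have "(\<integral>\<omega>. (\<Sum>j\<in>J. H j * trunc_exp s (G j \<omega>)) \<partial>M) = (\<Sum>j\<in>J. (\<integral>\<omega>. H j * trunc_exp s (G j \<omega>) \<partial>M))"
    using if_ by (intro Bochner_Integration.integral_sum integrable_mult_right) auto
  also have "(\<integral>\<omega>. 2 * indicator (space M - E) \<omega> \<partial>M) + (\<Sum>j\<in>J. (\<integral>\<omega>. H j * trunc_exp s (G j \<omega>) \<partial>M))
      = 2 * measure M (space M - E) + (\<Sum>j\<in>J. H j * (\<integral>\<omega>. trunc_exp s (G j \<omega>) \<partial>M))"
    by simp
  also have "(\<Sum>j\<in>J. H j * (\<integral>\<omega>. trunc_exp s (G j \<omega>) \<partial>M)) \<le> (\<Sum>j\<in>J. H j * Q)"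
    by (intro sum_mono mult_left_mono Q H0)
  also have "(\<Sum>j\<in>J. H j * Q) = Q * ((4 + \<bar>t\<bar>) * (real (card J) / (A * a)) + 2 * \<bar>t\<bar> * Ep * (\<Sum>j\<in>J. d j) / a)"
  proof -
    have "(\<Sum>j\<in>J. H j) = (\<Sum>j\<in>J. (4 + \<bar>t\<bar>) / (A * a) + (2 * \<bar>t\<bar> * Ep / a) * d j)"
      by (intro sum.cong refl) (simp add: H_def add_divide_distrib algebra_simps)
    also have "\<dots> = real (card J) * ((4 + \<bar>t\<bar>) / (A * a)) + (2 * \<bar>t\<bar> * Ep / a) * (\<Sum>j\<in>J. d j)"
      unfolding sum.distrib sum_distrib_left[symmetric] by simp
    finally have "Q * (\<Sum>j\<in>J. H j) = Q * ((4 + \<bar>t\<bar>) * (real (card J) / (A * a)) + 2 * \<bar>t\<bar> * Ep * (\<Sum>j\<in>J. d j) / a)"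
      by simp
    moreover have "(\<Sum>j\<in>J. H j * Q) = Q * (\<Sum>j\<in>J. H j)" by (simp add: sum_distrib_right[symmetric])
    ultimately show ?thesis by simp
  qed
  finally show ?thesis by simp
qed

lemma gauss_second_moment:
  assumes "finite I" "i \<in> I"
  shows "integrable (std_gauss I) (\<lambda>y. (y i)\<^sup>2)" "(\<integral>y. (y i)\<^sup>2 \<partial>std_gauss I) = 1"
proof -
  have d: "distr (std_gauss I) std_normal_distribution (\<lambda>y. y i) = std_normal_distribution"
    by (rule distr_PiM_component) (use std_normal.prob_space_axioms assms in auto)
  have m: "(\<lambda>y. y i) \<in> measurable (std_gauss I) std_normal_distribution"
    by (rule measurable_component_singleton[OF assms(2)])
  have i: "integrable std_normal_distribution (\<lambda>y. y\<^sup>2)" "integral\<^sup>L std_normal_distribution (\<lambda>y. y\<^sup>2) = 1"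
    using std_normal_distribution_even_moments[of 1] by (auto simp: fact_numeral)
  have b: "(\<lambda>y::real. y\<^sup>2) \<in> borel_measurable std_normal_distribution" by simp
  show "integrable (std_gauss I) (\<lambda>y. (y i)\<^sup>2)"
    using integrable_distr_eq[OF m b] i(1) unfolding d by simp
  show "(\<integral>y. (y i)\<^sup>2 \<partial>std_gauss I) = 1"
    using integral_distr[OF m b] i(2) unfolding d by simp
qed

text \<open>Errors with zero coefficients integrate out; this relates arrays with and without the
  additional rows.\<close>

lemma gauss_mean_pad:
  assumes "finite I'" "finite I" "I \<inter> I' = {}" and F: "bdd_meas F" and z: "\<And>i j. i \<in> I' \<Longrightarrow> c i j = 0"
  shows "gauss_mean (I \<union> I') c F = gauss_mean I c F"
  using assms
proof (induction I' rule: finite_induct)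
  case (insert k I')
  have "gauss_mean (insert k (I \<union> I')) c F = (\<integral>y. gauss_mean (I \<union> I') c (\<lambda>z. F (\<lambda>j. y * c k j + z j)) \<partial>std_normal_distribution)"
    by (rule gauss_mean_insert) (use insert in auto)
  also have "\<dots> = gauss_mean (I \<union> I') c F"
    using insert.prems(4)[of k] std_normal.prob_space by simp
  also have "\<dots> = gauss_mean I c F" using insert by auto
  finally show ?case by simp
qed simp

lemma comb_component_measurable:
  assumes "\<And>i. sets (D i) = sets (borel :: real measure)"
  shows "(\<lambda>y. comb I c y j) \<in> borel_measurable (PiM I D)"
  using comb_measurable[of "\<lambda>z. z j" D "\<lambda>_. 0" I c, OF _ assms] by simp

text \<open>In the Gaussian model the part of the linear combination with indices in \<open>I'\<close> is a
  perturbation with a deterministic envelope, outside an event of small probability.\<close>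

lemma gaussian_comparison:
  fixes c :: "nat \<Rightarrow> nat \<Rightarrow> real"
  assumes I: "finite I" "finite I'" "I \<inter> I' = {}" and J: "finite J"
    and gram: "\<And>j l. j \<in> J \<Longrightarrow> l \<in> J \<Longrightarrow> gram_of (I \<union> I') c j l = (if j = l then 1 else 0)"
    and supp: "\<And>i j. i \<in> I \<union> I' \<Longrightarrow> j \<notin> J \<Longrightarrow> c i j = 0"
    and a: "a > 0" "A \<ge> 1" "A * a \<ge> 1" and R: "R > 0" "0 \<le> e0" "e0 \<le> 1"
  defines "m \<equiv> sqrt (2 * ln (A * a))"
  defines "Ep \<equiv> (m + (R + 1)) * exp ((R + 1) * m + (R + 1)\<^sup>2 / 2)"
  defines "s \<equiv> A\<^sup>2 * a"
  defines "d \<equiv> \<lambda>j. R * sqrt (\<Sum>i\<in>I'. (c i j)\<^sup>2) + e0"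
  assumes ls: "ln s \<ge> 1"
  shows "\<bar>(\<integral>y. cos (t * (\<Sum>j\<in>J. exp_half_sq (y j) / a) + \<theta>) \<partial>std_gauss J) - gauss_mean I c (trunc_sum_cos s a t \<theta> J)\<bar>
    \<le> 2 * (real (card I') / R\<^sup>2) + (exp 1 * sqrt (ln s)) * ((4 + \<bar>t\<bar>) * (real (card J) / (A * a)) + 2 * \<bar>t\<bar> * Ep * (\<Sum>j\<in>J. d j) / a)"
proof -
  define U where "U = I \<union> I'"
  have U: "finite U" "I \<subseteq> U" "I' \<subseteq> U" using I by (auto simp: U_def)
  \<comment> \<open>The rows in I' are set to zero but keep their indices, so the full and the
    reduced combination live on one probability space.\<close>
  define c0 where "c0 = (\<lambda>i j. if i \<in> I then c i j else 0)"
  have s0: "s > 0" using a by (simp add: s_def)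
  have fU: "sets std_normal_distribution = sets (borel :: real measure)" by simp
  \<comment> \<open>On E the contribution of the rows in I' to coordinate j is at most R times the
    norm of that part of column j, by Cauchy-Schwarz; Markov's inequality bounds the complement by
    card I' / R^2.\<close>
  define E where "E = {y \<in> space (std_gauss U). (\<Sum>i\<in>I'. (y i)\<^sup>2) \<le> R\<^sup>2}"
  have ci: "(\<lambda>y. y i) \<in> borel_measurable (std_gauss U)" if "i \<in> U" for i
    using measurable_component_singleton[OF that, of "\<lambda>_. std_normal_distribution"] by simp
  have sm[measurable]: "(\<lambda>y. \<Sum>i\<in>I'. (y i)\<^sup>2) \<in> borel_measurable (std_gauss U)"
    using ci U by (intro borel_measurable_sum borel_measurable_power) auto
  have Em: "E \<in> sets (std_gauss U)" unfolding E_def by measurable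
  interpret PU: prob_space "std_gauss U" by (rule std_gauss_prob)
  have PE: "measure (std_gauss U) (space (std_gauss U) - E) \<le> real (card I') / R\<^sup>2"
  proof -
    have i: "integrable (std_gauss U) (\<lambda>y. \<Sum>i\<in>I'. (y i)\<^sup>2)"
      using gauss_second_moment(1)[OF U(1)] U by (intro Bochner_Integration.integrable_sum) auto
    have "measure (std_gauss U) (space (std_gauss U) - E) \<le> measure (std_gauss U) {y \<in> space (std_gauss U). (\<Sum>i\<in>I'. (y i)\<^sup>2) \<ge> R\<^sup>2}"
      by (rule PU.finite_measure_mono) (auto simp: E_def)
    also have "\<dots> \<le> (\<integral>y. (\<Sum>i\<in>I'. (y i)\<^sup>2) \<partial>std_gauss U) / R\<^sup>2"
      by (rule integral_Markov_inequality_measure[OF i, where A = "{}"]) (use R in \<open>auto intro!: AE_I2 sum_nonneg\<close>)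
    also have "(\<integral>y. (\<Sum>i\<in>I'. (y i)\<^sup>2) \<partial>std_gauss U) = (\<Sum>i\<in>I'. 1)"
    proof -
      have "(\<integral>y. (\<Sum>i\<in>I'. (y i)\<^sup>2) \<partial>std_gauss U) = (\<Sum>i\<in>I'. (\<integral>y. (y i)\<^sup>2 \<partial>std_gauss U))"
        using gauss_second_moment(1)[OF U(1)] U by (intro Bochner_Integration.integral_sum) auto
      also have "\<dots> = (\<Sum>i\<in>I'. 1)" using gauss_second_moment(2)[OF U(1)] U by (intro sum.cong) auto
      finally show ?thesis .
    qed
    finally show ?thesis by simp
  qed
  have rho1: "(\<Sum>i\<in>I'. (c i j)\<^sup>2) \<le> 1" "(\<Sum>i\<in>I. (c i j)\<^sup>2) \<le> 1" if "j \<in> J" for j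
  proof -
    have "(\<Sum>i\<in>I. (c i j)\<^sup>2) + (\<Sum>i\<in>I'. (c i j)\<^sup>2) = 1"
      using gram[OF that that] I by (simp add: gram_of_def sum.union_disjoint power2_eq_square)
    moreover have "(\<Sum>i\<in>I. (c i j)\<^sup>2) \<ge> 0" "(\<Sum>i\<in>I'. (c i j)\<^sup>2) \<ge> 0" by (auto intro: sum_nonneg)
    ultimately show "(\<Sum>i\<in>I'. (c i j)\<^sup>2) \<le> 1" "(\<Sum>i\<in>I. (c i j)\<^sup>2) \<le> 1" by linarith+
  qed
  have S: "(\<lambda>y. \<Sum>j\<in>J. exp_half_sq (comb U c y j) / a) \<in> borel_measurable (std_gauss U)"
    using comb_component_measurable[of "\<lambda>_. std_normal_distribution"] by (intro borel_measurable_sum borel_measurable_divide) auto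
  have Gm: "(\<lambda>y. comb U c0 y j) \<in> borel_measurable (std_gauss U)" for j
    by (rule comb_component_measurable) simp
  have bdT: "bdd_meas (trunc_sum_cos s a t \<theta> J)"
    unfolding bdd_meas_def using trunc_sum_cos_measurable abs_cos_le1 by blast
  have "\<bar>(\<integral>y. cos (t * (\<Sum>j\<in>J. exp_half_sq (comb U c y j) / a) + \<theta>) \<partial>std_gauss U)
      - (\<integral>y. cos (t * (\<Sum>j\<in>J. trunc_exp s (comb U c0 y j) / a) + \<theta>) \<partial>std_gauss U)\<bar>
    \<le> 2 * measure (std_gauss U) (space (std_gauss U) - E) + (exp 1 * sqrt (ln s)) * ((4 + \<bar>t\<bar>) * (real (card J) / (A * a)) + 2 * \<bar>t\<bar> * Ep * (\<Sum>j\<in>J. d j) / a)"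
    unfolding s_def Ep_def m_def
  proof (rule perturb_expectation[OF std_gauss_prob a J S Gm Em])
    show "AE y in std_gauss U. y \<in> E \<longrightarrow> (\<exists>W. (\<Sum>j\<in>J. exp_half_sq (comb U c y j) / a) = (\<Sum>j\<in>J. exp_half_sq (W j) / a) \<and>
        (\<forall>j\<in>J. \<bar>W j - comb U c0 y j\<bar> \<le> d j))"
    proof (intro AE_I2 impI exI conjI ballI)
      fix y j assume y: "y \<in> E" and j: "j \<in> J"
      have "(\<Sum>i\<in>I'. y i * c0 i j) = 0" using I by (intro sum.neutral) (auto simp: c0_def)
      moreover have "(\<Sum>i\<in>I. y i * c0 i j) = (\<Sum>i\<in>I. y i * c i j)" by (intro sum.cong) (auto simp: c0_def)
      ultimately have "comb U c0 y j = (\<Sum>i\<in>I. y i * c i j)"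
        unfolding comb_def U_def sum.union_disjoint[OF I] by simp
      moreover have "comb U c y j = (\<Sum>i\<in>I. y i * c i j) + (\<Sum>i\<in>I'. y i * c i j)"
        unfolding comb_def U_def using I by (auto simp: sum.union_disjoint)
      ultimately have "\<bar>comb U c y j - comb U c0 y j\<bar> = \<bar>\<Sum>i\<in>I'. y i * c i j\<bar>" by simp
      also have "\<dots> \<le> sqrt (\<Sum>i\<in>I'. (y i)\<^sup>2) * sqrt (\<Sum>i\<in>I'. (c i j)\<^sup>2)" by (rule cauchy_schwarz_sum_abs)
      also have "\<dots> \<le> R * sqrt (\<Sum>i\<in>I'. (c i j)\<^sup>2)"
        using y R real_sqrt_le_mono[of "\<Sum>i\<in>I'. (y i)\<^sup>2" "R\<^sup>2"] by (intro mult_right_mono) (auto simp: E_def sum_nonneg)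
      also have "\<dots> \<le> d j" using R by (simp add: d_def)
      finally show "\<bar>comb U c y j - comb U c0 y j\<bar> \<le> d j" .
    qed auto
    show "0 \<le> d j" for j using R by (simp add: d_def sum_nonneg)
    show "d j \<le> R + 1" if "j \<in> J" for j
    proof -
      have "sqrt (\<Sum>i\<in>I'. (c i j)\<^sup>2) \<le> sqrt 1" using rho1(1)[OF that] by (rule real_sqrt_le_mono)
      hence "R * sqrt (\<Sum>i\<in>I'. (c i j)\<^sup>2) \<le> R * 1" using R by (intro mult_left_mono) auto
      thus ?thesis using R unfolding d_def by linarith
    qed
    show "(\<integral>y. trunc_exp (A\<^sup>2 * a) (comb U c0 y j) \<partial>std_gauss U) \<le> exp 1 * sqrt (ln (A\<^sup>2 * a))" if j: "j \<in> J" for j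
    proof -
      have sb: "\<bar>trunc_exp s z\<bar> \<le> s" for z using trunc_exp_bounds[OF s0, of z] by linarith
      obtain r where r: "r\<^sup>2 = gram_of U c0 j j" "gauss_mean U c0 (\<lambda>z. trunc_exp s (z j)) = (\<integral>y. trunc_exp s (r * y) \<partial>std_normal_distribution)"
        using gauss_mean_one[OF U(1) trunc_exp_measurable sb, of c0 j] by auto
      have "gram_of U c0 j j = (\<Sum>i\<in>I. (c i j)\<^sup>2)"
      proof -
        have "(\<Sum>i\<in>I'. c0 i j * c0 i j) = 0" using I by (intro sum.neutral) (auto simp: c0_def)
        moreover have "(\<Sum>i\<in>I. c0 i j * c0 i j) = (\<Sum>i\<in>I. (c i j)\<^sup>2)" by (intro sum.cong) (auto simp: c0_def power2_eq_square)
        ultimately show ?thesis unfolding gram_of_def U_def sum.union_disjoint[OF I] by simp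
      qed
      hence "r\<^sup>2 \<le> 1" using r(1) rho1(2)[OF j] by simp
      hence "\<bar>r\<bar> \<le> 1" by (simp add: abs_square_le_1)
      from trunc_exp_normal_expectation[OF ls s0 this] r(2) show ?thesis by (simp add: gauss_mean_def s_def)
    qed
  qed (use R ls in \<open>auto simp: s_def\<close>)
  moreover have "(\<integral>y. cos (t * (\<Sum>j\<in>J. trunc_exp s (comb U c0 y j) / a) + \<theta>) \<partial>std_gauss U) = gauss_mean I c (trunc_sum_cos s a t \<theta> J)"
  proof -
    have "(\<integral>y. cos (t * (\<Sum>j\<in>J. trunc_exp s (comb U c0 y j) / a) + \<theta>) \<partial>std_gauss U) = gauss_mean (I \<union> I') c0 (trunc_sum_cos s a t \<theta> J)"
      by (simp add: gauss_mean_def trunc_sum_cos_def U_def)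
    also have "\<dots> = gauss_mean I c0 (trunc_sum_cos s a t \<theta> J)"
      by (rule gauss_mean_pad[OF I(2,1,3) bdT]) (use I in \<open>auto simp: c0_def\<close>)
    also have "\<dots> = gauss_mean I c (trunc_sum_cos s a t \<theta> J)" by (rule gauss_mean_cong) (simp add: c0_def)
    finally show ?thesis .
  qed
  moreover have "(\<integral>y. cos (t * (\<Sum>j\<in>J. exp_half_sq (comb U c y j) / a) + \<theta>) \<partial>std_gauss U) = (\<integral>y. cos (t * (\<Sum>j\<in>J. exp_half_sq (y j) / a) + \<theta>) \<partial>std_gauss J)"
  proof -
    define F where "F = (\<lambda>z :: nat \<Rightarrow> real. cos (t * (\<Sum>j\<in>J. exp_half_sq (z j) / a) + \<theta>))"
    have "F \<in> borel_measurable seq_space" unfolding F_def by measurable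
    hence F: "bdd_meas F" unfolding bdd_meas_def F_def by (auto intro!: exI[of _ 1])
    \<comment> \<open>All rows together have orthonormal columns, so the full Gaussian combination
      is standard normal and no error arises here.\<close>
    have "gauss_mean U c F = gauss_mean J (\<lambda>i j. if i = j then 1 else 0) F"
      by (rule gauss_mean_orthonormal[OF J U(1) F]) (use gram supp in \<open>auto simp: U_def\<close>)
    moreover have "comb J (\<lambda>i j. if i = j then 1 else 0) y j = y j" if "j \<in> J" for y j
      unfolding comb_def using that J by (simp add: if_distrib[of "times _"] cong: if_cong)
    ultimately show ?thesis by (simp add: gauss_mean_def F_def)
  qed
  ultimately show ?thesis using PE by linarith
qed

text \<open>Independence factorises the mean of the complex exponential; the phase stays outside as
  cis \<theta>, and the real part returns to the cosine.\<close>

lemma std_gauss_cos_product: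
  assumes J: "finite J"
  shows "(\<integral>y. cos (t * (\<Sum>j\<in>J. exp_half_sq (y j) / a) + \<theta>) \<partial>std_gauss J)
    = Re (cis \<theta> * (\<integral>z. cis (t * (exp_half_sq z / a)) \<partial>std_normal_distribution) ^ card J)"
proof -
  have i1: "integrable std_normal_distribution (\<lambda>z. cis (t * (exp_half_sq z / a)))"
    by (rule std_normal.integrable_const_bound[where B = 1]) (auto simp: cis_conv_exp)
  have "(\<integral>y. (\<Prod>j\<in>J. cis (t * (exp_half_sq (y j) / a))) \<partial>std_gauss J) = (\<Prod>j\<in>J. (\<integral>z. cis (t * (exp_half_sq z / a)) \<partial>std_normal_distribution))"
    by (rule gauss.product_integral_prod[OF J i1])
  hence e: "(\<integral>y. (\<Prod>j\<in>J. cis (t * (exp_half_sq (y j) / a))) \<partial>std_gauss J) = (\<integral>z. cis (t * (exp_half_sq z / a)) \<partial>std_normal_distribution) ^ card J"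
    by simp
  have p: "(\<Prod>j\<in>J. cis (t * (exp_half_sq (y j) / a))) = cis (t * (\<Sum>j\<in>J. exp_half_sq (y j) / a))" for y :: "nat \<Rightarrow> real"
    using J by (induction J rule: finite_induct) (simp_all add: cis_mult distrib_left)
  interpret P: prob_space "std_gauss J" by (rule std_gauss_prob)
  have cj: "(\<lambda>y. y j) \<in> borel_measurable (std_gauss J)" if "j \<in> J" for j
    using measurable_component_singleton[OF that, of "\<lambda>_. std_normal_distribution"] by simp
  have Sm: "(\<lambda>y. \<Sum>j\<in>J. exp_half_sq (y j) / a) \<in> borel_measurable (std_gauss J)"
    using cj by (intro borel_measurable_sum borel_measurable_divide measurable_compose[OF _ exp_half_sq_measurable]) auto
  hence i2: "integrable (std_gauss J) (\<lambda>y. cis \<theta> * cis (t * (\<Sum>j\<in>J. exp_half_sq (y j) / a)))"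
    by (intro P.integrable_const_bound[where B = 1]) (auto simp: norm_mult cis_conv_exp)
  have "(\<integral>y. cos (t * (\<Sum>j\<in>J. exp_half_sq (y j) / a) + \<theta>) \<partial>std_gauss J) = (\<integral>y. Re (cis \<theta> * cis (t * (\<Sum>j\<in>J. exp_half_sq (y j) / a))) \<partial>std_gauss J)"
    by (simp add: cis_mult add.commute)
  also have "\<dots> = Re (\<integral>y. cis \<theta> * cis (t * (\<Sum>j\<in>J. exp_half_sq (y j) / a)) \<partial>std_gauss J)" by (rule integral_Re[OF i2])
  also have "\<dots> = Re (cis \<theta> * (\<integral>z. cis (t * (exp_half_sq z / a)) \<partial>std_normal_distribution) ^ card J)"
    using e[unfolded p] by simp
  finally show ?thesis .
qed

lemma indep_expectation_swap:
  fixes \<xi> :: "nat \<Rightarrow> 'w \<Rightarrow> real"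
  assumes M: "prob_space M" and I: "finite I" "I \<noteq> {}"
    and \<xi>: "prob_space.indep_vars M (\<lambda>_. borel) \<xi> I" "\<And>i. i \<in> I \<Longrightarrow> std3 (distr M borel (\<xi> i)) m"
    and N: "std3 std_normal_distribution m"
    and F: "F \<in> borel_measurable seq_space" "\<And>z. \<bar>F z\<bar> \<le> B"
    and cub: "\<And>i. i \<in> I \<Longrightarrow> cubic_along F (c i) (d i)" "\<And>i. i \<in> I \<Longrightarrow> d i \<ge> 0"
  shows "\<bar>(\<integral>\<omega>. F (\<lambda>j. \<Sum>i\<in>I. \<xi> i \<omega> * c i j) \<partial>M) - gauss_mean I c F\<bar> \<le> 2 * m * (\<Sum>i\<in>I. d i)"
proof -
  interpret prob_space M by fact
  \<comment> \<open>Indices outside I receive the standard normal law, so that the family is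
    standardised at every index.\<close>
  define D where "D = (\<lambda>i. if i \<in> I then distr M borel (\<xi> i) else std_normal_distribution)"
  have rv: "\<xi> i \<in> borel_measurable M" if "i \<in> I" for i using \<xi>(1) that unfolding indep_vars_def2 by simp
  have D: "std3 (D i) m" for i using \<xi>(2) N by (simp add: D_def)
  have pm: "PiM I D = PiM I (\<lambda>i. distr M borel (\<xi> i))" by (rule PiM_cong) (auto simp: D_def)
  have e: "distr M (PiM I (\<lambda>_. borel)) (\<lambda>\<omega>. \<lambda>i\<in>I. \<xi> i \<omega>) = PiM I D"
    unfolding pm using indep_vars_iff_distr_eq_PiM'[OF I(2), of \<xi> "\<lambda>_. borel"] rv \<xi>(1) by simp
  have cm: "(\<lambda>y. F (comb I c y)) \<in> borel_measurable (PiM I (\<lambda>_. borel))"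
    using comb_measurable[of F "\<lambda>_. borel" "\<lambda>_. 0" I c, OF F(1)] by simp
  have rm: "(\<lambda>\<omega>. \<lambda>i\<in>I. \<xi> i \<omega>) \<in> measurable M (PiM I (\<lambda>_. borel))"
    using rv by (rule measurable_restrict)
  have cr: "comb I c (\<lambda>i\<in>I. \<xi> i \<omega>) = (\<lambda>j. \<Sum>i\<in>I. \<xi> i \<omega> * c i j)" for \<omega>
    unfolding comb_def by (intro ext sum.cong) auto
  have "(\<integral>\<omega>. F (\<lambda>j. \<Sum>i\<in>I. \<xi> i \<omega> * c i j) \<partial>M) = (\<integral>y. F (\<lambda>j. 0 + comb I c y j) \<partial>PiM I D)"
    using integral_distr[OF rm cm] unfolding e cr by simp
  moreover have "gauss_mean I c F = (\<integral>y. F (\<lambda>j. 0 + comb I c y j) \<partial>std_gauss I)"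
    by (simp add: gauss_mean_def)
  moreover have "\<bar>(\<integral>y. F (\<lambda>j. 0 + comb I c y j) \<partial>PiM I D) - (\<integral>y. F (\<lambda>j. 0 + comb I c y j) \<partial>std_gauss I)\<bar> \<le> (\<Sum>i\<in>I. d i * (m + m))"
    by (rule lindeberg_swap[OF I(1) D N F cub])
  moreover have "(\<Sum>i\<in>I. d i * (m + m)) = 2 * m * (\<Sum>i\<in>I. d i)" unfolding sum_distrib_right[symmetric] by simp
  ultimately show ?thesis by simp
qed

text \<open>One of the three factors of each row sum is bounded by K * cb, the square of the row sum
  by K times its sum of squares. Summed over all rows, the squares give at most K, the number of
  columns. Hence the factor K^3 in the Lindeberg error.\<close>

lemma cubed_row_sums:
  fixes c :: "'i \<Rightarrow> 'j \<Rightarrow> real"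
  assumes J: "finite J" and col: "\<And>j. j \<in> J \<Longrightarrow> (\<Sum>i\<in>I. (c i j)\<^sup>2) \<le> 1"
    and chi: "\<And>i j. i \<in> I \<Longrightarrow> j \<in> J \<Longrightarrow> \<bar>c i j\<bar> \<le> cb" and chi0: "cb \<ge> 0"
  shows "(\<Sum>i\<in>I. (\<Sum>j\<in>J. \<bar>c i j\<bar>) ^ 3) \<le> real (card J) ^ 3 * cb"
proof -
  have "(\<Sum>i\<in>I. (\<Sum>j\<in>J. \<bar>c i j\<bar>) ^ 3) \<le> (\<Sum>i\<in>I. real (card J) * cb * (real (card J) * (\<Sum>j\<in>J. (c i j)\<^sup>2)))"
  proof (rule sum_mono)
    fix i assume i: "i \<in> I"
    have s0: "0 \<le> (\<Sum>j\<in>J. \<bar>c i j\<bar>)" by (rule sum_nonneg) simp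
    have q0: "0 \<le> (\<Sum>j\<in>J. (c i j)\<^sup>2)" by (rule sum_nonneg) simp
    have "(\<Sum>j\<in>J. \<bar>c i j\<bar>) \<le> real (card J) * cb" using chi[OF i] sum_mono[of J "\<lambda>j. \<bar>c i j\<bar>" "\<lambda>_. cb"] by simp
    moreover have "(\<Sum>j\<in>J. \<bar>c i j\<bar>)\<^sup>2 \<le> real (card J) * (\<Sum>j\<in>J. (c i j)\<^sup>2)"
      using power_mono[OF sum_le_sqrt_card[OF J, of "c i"] s0, of 2] q0 by (simp add: power_mult_distrib)
    ultimately have "(\<Sum>j\<in>J. \<bar>c i j\<bar>) * (\<Sum>j\<in>J. \<bar>c i j\<bar>)\<^sup>2 \<le> real (card J) * cb * (real (card J) * (\<Sum>j\<in>J. (c i j)\<^sup>2))"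
      using s0 chi0 by (intro mult_mono) auto
    thus "(\<Sum>j\<in>J. \<bar>c i j\<bar>) ^ 3 \<le> real (card J) * cb * (real (card J) * (\<Sum>j\<in>J. (c i j)\<^sup>2))"
      by (simp add: power2_eq_square power3_eq_cube mult.assoc)
  qed
  also have "\<dots> = real (card J) * cb * (real (card J) * (\<Sum>j\<in>J. \<Sum>i\<in>I. (c i j)\<^sup>2))"
    unfolding sum_distrib_left[symmetric] by (subst sum.swap) simp
  also have "(\<Sum>j\<in>J. \<Sum>i\<in>I. (c i j)\<^sup>2) \<le> real (card J)"
    using sum_mono[of J "\<lambda>j. \<Sum>i\<in>I. (c i j)\<^sup>2" "\<lambda>_. 1"] col by simp
  hence "real (card J) * cb * (real (card J) * (\<Sum>j\<in>J. \<Sum>i\<in>I. (c i j)\<^sup>2)) \<le> real (card J) * cb * (real (card J) * real (card J))"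
    using chi0 by (intro mult_left_mono) auto
  also have "\<dots> = real (card J) ^ 3 * cb" by (simp add: power3_eq_cube)
  finally show ?thesis .
qed

lemma exp_sum_comparison:
  fixes c :: "nat \<Rightarrow> nat \<Rightarrow> real" and \<xi> :: "nat \<Rightarrow> 'w \<Rightarrow> real" and t \<theta> :: real
  assumes M: "prob_space M"
    and I: "finite I" "I \<noteq> {}" "finite I'" "I \<inter> I' = {}" and J: "finite J"
    and gram: "\<And>j l. j \<in> J \<Longrightarrow> l \<in> J \<Longrightarrow> gram_of (I \<union> I') c j l = (if j = l then 1 else 0)"
    and supp: "\<And>i j. i \<in> I \<union> I' \<Longrightarrow> j \<notin> J \<Longrightarrow> c i j = 0"
    and chi: "\<And>i j. i \<in> I \<Longrightarrow> j \<in> J \<Longrightarrow> \<bar>c i j\<bar> \<le> cb" "cb \<ge> 0"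
    and \<xi>: "prob_space.indep_vars M (\<lambda>_. borel) \<xi> I" "\<And>i. i \<in> I \<Longrightarrow> std3 (distr M borel (\<xi> i)) m3"
    and N: "std3 std_normal_distribution m3"
    and a: "a > 0" "A \<ge> 1" "A * a \<ge> 1" and R: "R > 0" "0 \<le> e0" "e0 \<le> 1"
    and S: "S \<in> borel_measurable M" and E: "E \<in> sets M"
  defines "m \<equiv> sqrt (2 * ln (A * a))"
  defines "Ep \<equiv> (m + (R + 1)) * exp ((R + 1) * m + (R + 1)\<^sup>2 / 2)"
  defines "s \<equiv> A\<^sup>2 * a"
  defines "d \<equiv> \<lambda>j. R * sqrt (\<Sum>i\<in>I'. (c i j)\<^sup>2) + e0"
  defines "P \<equiv> 70000 * (s / a) * (ln s)\<^sup>2"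
  defines "Bd \<equiv> (4 + \<bar>t\<bar>) * (real (card J) / (A * a)) + 2 * \<bar>t\<bar> * Ep * (\<Sum>j\<in>J. d j) / a"
  assumes ls: "ln s \<ge> 1"
    and good: "AE \<omega> in M. \<omega> \<in> E \<longrightarrow> (\<exists>W. S \<omega> = (\<Sum>j\<in>J. exp_half_sq (W j) / a) \<and>
        (\<forall>j\<in>J. \<bar>W j - (\<Sum>i\<in>I. \<xi> i \<omega> * c i j)\<bar> \<le> d j))"
  shows "\<bar>(\<integral>\<omega>. cos (t * S \<omega> + \<theta>) \<partial>M) - (\<integral>y. cos (t * (\<Sum>j\<in>J. exp_half_sq (y j) / a) + \<theta>) \<partial>std_gauss J)\<bar>
    \<le> 2 * measure M (space M - E) + 2 * (real (card I') / R\<^sup>2)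
      + (2 * (exp 1 * sqrt (ln s)) + 2 * m3 * (70000 * s * (ln s)\<^sup>2 * cb)) * Bd
      + 2 * m3 * ((\<bar>t\<bar> * P + 3 * t\<^sup>2 * P\<^sup>2 + \<bar>t\<bar> ^ 3 * P ^ 3) * (real (card J) ^ 3 * cb))"
proof -
  interpret prob_space M by fact
  have s0: "s > 0" using a by (simp add: s_def)
  have m3: "m3 \<ge> 0"
  proof -
    have "0 \<le> (\<integral>y. \<bar>y\<bar> ^ 3 \<partial>std_normal_distribution)" by (rule Bochner_Integration.integral_nonneg) simp
    thus ?thesis using N unfolding std3_def by linarith
  qed
  have rho1: "(\<Sum>i\<in>I'. (c i j)\<^sup>2) \<le> 1" "(\<Sum>i\<in>I. (c i j)\<^sup>2) \<le> 1" if "j \<in> J" for j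
  proof -
    have "(\<Sum>i\<in>I. (c i j)\<^sup>2) + (\<Sum>i\<in>I'. (c i j)\<^sup>2) = 1"
      using gram[OF that that] I by (simp add: gram_of_def sum.union_disjoint power2_eq_square)
    moreover have "(\<Sum>i\<in>I. (c i j)\<^sup>2) \<ge> 0" "(\<Sum>i\<in>I'. (c i j)\<^sup>2) \<ge> 0" by (auto intro: sum_nonneg)
    ultimately show "(\<Sum>i\<in>I'. (c i j)\<^sup>2) \<le> 1" "(\<Sum>i\<in>I. (c i j)\<^sup>2) \<le> 1" by linarith+
  qed
  have m0: "m \<ge> 0" using a by (simp add: m_def)
  have Ep0: "Ep \<ge> 0" using m0 R by (simp add: Ep_def)
  have d0: "d j \<ge> 0" for j using R by (simp add: d_def sum_nonneg)
  have dD: "d j \<le> R + 1" if "j \<in> J" for j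
  proof -
    have "sqrt (\<Sum>i\<in>I'. (c i j)\<^sup>2) \<le> sqrt 1" using rho1(1)[OF that] by (rule real_sqrt_le_mono)
    hence "R * sqrt (\<Sum>i\<in>I'. (c i j)\<^sup>2) \<le> R * 1" using R by (intro mult_left_mono) auto
    thus ?thesis using R unfolding d_def by linarith
  qed
  have Bd0: "Bd \<ge> 0" unfolding Bd_def using a Ep0 d0 by (intro add_nonneg_nonneg mult_nonneg_nonneg divide_nonneg_nonneg sum_nonneg) auto
  have P0: "P \<ge> 0" unfolding P_def using s0 a by simp
  have PP: "0 \<le> \<bar>t\<bar> * P + 3 * t\<^sup>2 * P\<^sup>2 + \<bar>t\<bar> ^ 3 * P ^ 3" using P0 by simp
  define G where "G = (\<lambda>j \<omega>. \<Sum>i\<in>I. \<xi> i \<omega> * c i j)"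
  have rv: "\<xi> i \<in> borel_measurable M" if "i \<in> I" for i using \<xi>(1) that unfolding indep_vars_def2 by simp
  have Gm: "G j \<in> borel_measurable M" for j
    unfolding G_def using rv by (intro borel_measurable_sum borel_measurable_times) auto
  have f0: "\<bar>trunc_exp s z\<bar> \<le> s" for z using trunc_exp_bounds[OF s0, of z] by linarith
  define Q where "Q = exp 1 * sqrt (ln s) + 2 * m3 * (70000 * s * (ln s)\<^sup>2 * cb)"
  have Q: "(\<integral>\<omega>. trunc_exp s (G j \<omega>) \<partial>M) \<le> Q" if j: "j \<in> J" for j
  proof -
    have "\<bar>(\<integral>\<omega>. trunc_exp s (G j \<omega>) \<partial>M) - gauss_mean I c (\<lambda>z. trunc_exp s (z j))\<bar>
        \<le> 2 * m3 * (\<Sum>i\<in>I. 70000 * s * (ln s)\<^sup>2 * \<bar>c i j\<bar> ^ 3)"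
      unfolding G_def
    proof (rule indep_expectation_swap[OF M I(1,2) \<xi> N trunc_coord_measurable f0])
      show "cubic_along (\<lambda>z. trunc_exp s (z j)) (c i) (70000 * s * (ln s)\<^sup>2 * \<bar>c i j\<bar> ^ 3)" for i
        by (rule cubic_along_trunc_exp[OF ls s0])
    qed (use s0 in auto)
    moreover have "(\<Sum>i\<in>I. 70000 * s * (ln s)\<^sup>2 * \<bar>c i j\<bar> ^ 3) \<le> 70000 * s * (ln s)\<^sup>2 * cb"
    proof -
      have "(\<Sum>i\<in>I. \<bar>c i j\<bar> ^ 3) \<le> (\<Sum>i\<in>I. cb * (c i j)\<^sup>2)"
      proof (rule sum_mono)
        fix i assume "i \<in> I"
        hence "\<bar>c i j\<bar> * (c i j)\<^sup>2 \<le> cb * (c i j)\<^sup>2" using chi(1) j by (intro mult_right_mono) auto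
        thus "\<bar>c i j\<bar> ^ 3 \<le> cb * (c i j)\<^sup>2" by (simp add: power3_eq_cube power2_eq_square flip: abs_mult mult.assoc)
      qed
      also have "\<dots> \<le> cb" unfolding sum_distrib_left[symmetric] using mult_left_mono[OF rho1(2)[OF j] chi(2)] by simp
      finally show ?thesis unfolding sum_distrib_left[symmetric] using s0 by (intro mult_left_mono) auto
    qed
    hence "2 * m3 * (\<Sum>i\<in>I. 70000 * s * (ln s)\<^sup>2 * \<bar>c i j\<bar> ^ 3) \<le> 2 * m3 * (70000 * s * (ln s)\<^sup>2 * cb)"
      using m3 by (intro mult_left_mono) auto
    moreover have "gauss_mean I c (\<lambda>z. trunc_exp s (z j)) \<le> exp 1 * sqrt (ln s)"
    proof -
      obtain r where r: "r\<^sup>2 = gram_of I c j j" "gauss_mean I c (\<lambda>z. trunc_exp s (z j)) = (\<integral>y. trunc_exp s (r * y) \<partial>std_normal_distribution)"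
        using gauss_mean_one[OF I(1) trunc_exp_measurable f0, of c j] by auto
      have "r\<^sup>2 \<le> 1" using r(1) rho1(2)[OF j] by (simp add: gram_of_def power2_eq_square)
      hence "\<bar>r\<bar> \<le> 1" by (simp add: abs_square_le_1)
      from trunc_exp_normal_expectation[OF ls s0 this] r(2) show ?thesis by simp
    qed
    ultimately show ?thesis unfolding Q_def by linarith
  qed
  have Q0: "Q \<ge> 0" unfolding Q_def
    by (intro add_nonneg_nonneg mult_nonneg_nonneg real_sqrt_ge_zero order_trans[OF zero_le_one ls] zero_le_power2
        less_imp_le[OF s0] m3 chi(2) less_imp_le[OF exp_gt_zero]) simp_all
  have one: "\<bar>(\<integral>\<omega>. cos (t * S \<omega> + \<theta>) \<partial>M) - (\<integral>\<omega>. cos (t * (\<Sum>j\<in>J. trunc_exp s (G j \<omega>) / a) + \<theta>) \<partial>M)\<bar>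
    \<le> 2 * measure M (space M - E) + Q * Bd"
    unfolding Bd_def Ep_def m_def s_def
    by (rule perturb_expectation[OF M a J S Gm E])
      (use good d0 dD R Q Q0 in \<open>simp_all add: G_def s_def\<close>)
  have two: "\<bar>(\<integral>\<omega>. cos (t * (\<Sum>j\<in>J. trunc_exp s (G j \<omega>) / a) + \<theta>) \<partial>M) - gauss_mean I c (trunc_sum_cos s a t \<theta> J)\<bar>
    \<le> 2 * m3 * ((\<bar>t\<bar> * P + 3 * t\<^sup>2 * P\<^sup>2 + \<bar>t\<bar> ^ 3 * P ^ 3) * (real (card J) ^ 3 * cb))"
  proof -
    have "\<bar>(\<integral>\<omega>. trunc_sum_cos s a t \<theta> J (\<lambda>j. \<Sum>i\<in>I. \<xi> i \<omega> * c i j) \<partial>M) - gauss_mean I c (trunc_sum_cos s a t \<theta> J)\<bar>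
      \<le> 2 * m3 * (\<Sum>i\<in>I. (\<bar>t\<bar> * P + 3 * t\<^sup>2 * P\<^sup>2 + \<bar>t\<bar> ^ 3 * P ^ 3) * (\<Sum>j\<in>J. \<bar>c i j\<bar>) ^ 3)"
    proof (rule indep_expectation_swap[OF M I(1,2) \<xi> N trunc_sum_cos_measurable abs_cos_le1])
      show "cubic_along (trunc_sum_cos s a t \<theta> J) (c i) ((\<bar>t\<bar> * P + 3 * t\<^sup>2 * P\<^sup>2 + \<bar>t\<bar> ^ 3 * P ^ 3) * (\<Sum>j\<in>J. \<bar>c i j\<bar>) ^ 3)" for i
        unfolding P_def trunc_sum_cos_def[abs_def] by (rule cubic_along_cos[OF ls s0 a(1) J])
      show "0 \<le> (\<bar>t\<bar> * P + 3 * t\<^sup>2 * P\<^sup>2 + \<bar>t\<bar> ^ 3 * P ^ 3) * (\<Sum>j\<in>J. \<bar>c i j\<bar>) ^ 3" for i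
        by (intro mult_nonneg_nonneg[OF PP] zero_le_power sum_nonneg) auto
    qed
    also have "\<dots> \<le> 2 * m3 * ((\<bar>t\<bar> * P + 3 * t\<^sup>2 * P\<^sup>2 + \<bar>t\<bar> ^ 3 * P ^ 3) * (real (card J) ^ 3 * cb))"
      unfolding sum_distrib_left[symmetric]
      by (intro mult_left_mono cubed_row_sums[OF J rho1(2) chi]) (use PP m3 in auto)
    finally show ?thesis by (simp add: trunc_sum_cos_def G_def)
  qed
  have three: "\<bar>(\<integral>y. cos (t * (\<Sum>j\<in>J. exp_half_sq (y j) / a) + \<theta>) \<partial>std_gauss J) - gauss_mean I c (trunc_sum_cos s a t \<theta> J)\<bar>
    \<le> 2 * (real (card I') / R\<^sup>2) + (exp 1 * sqrt (ln s)) * Bd"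
    unfolding Bd_def Ep_def m_def s_def d_def
    by (rule gaussian_comparison[OF I(1,3,4) J gram supp a R]) (use ls in \<open>auto simp: s_def\<close>)
  have "Q * Bd + (exp 1 * sqrt (ln s)) * Bd = (2 * (exp 1 * sqrt (ln s)) + 2 * m3 * (70000 * s * (ln s)\<^sup>2 * cb)) * Bd"
    by (simp add: Q_def algebra_simps)
  thus ?thesis using one two three by linarith
qed

subsection \<open>The design\<close>

lemma sum_split_at: "(\<Sum>k<K. F k) + (\<Sum>k\<in>{K..<K+p}. F k) = (\<Sum>k<K+p. F k)" for F :: "nat \<Rightarrow> real"
  by (induction p) auto

context weighted_design
begin

text \<open>The first \<open>p\<close> functions moved behind the next \<open>K\<close> ones. In the new order the first \<open>K\<close>
  orthonormal functions are combinations of \<open>f p, \<dots>, f (p + K - 1)\<close> only, hence uniformly small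
  compared with \<open>sqrt n\<close>; the remaining \<open>p\<close> directions are treated separately.\<close>

definition reorder :: "(nat \<Rightarrow> 'x \<Rightarrow> real) \<Rightarrow> nat \<Rightarrow> nat \<Rightarrow> nat \<Rightarrow> 'x \<Rightarrow> real" where
  "reorder f p K m = (if m < K then f (p + m) else f (m - K))"

abbreviation ob :: "(nat \<Rightarrow> 'x \<Rightarrow> real) \<Rightarrow> nat \<Rightarrow> nat \<Rightarrow> nat \<Rightarrow> 'x \<Rightarrow> real" where
  "ob f p K \<equiv> gs (reorder f p K)"

lemma sum_reorder: "(\<Sum>l<p + K. c l * f l x) = (\<Sum>m<K + p. (if m < K then c (p + m) else c (m - K)) * reorder f p K m x)"
proof -
  have "(\<Sum>l<p + K. c l * f l x) = (\<Sum>l\<in>{..<p}. c l * f l x) + (\<Sum>l\<in>{p..<p + K}. c l * f l x)"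
    by (subst sum.union_disjoint[symmetric]) (auto intro!: sum.cong)
  also have "(\<Sum>l\<in>{p..<p + K}. c l * f l x) = (\<Sum>m\<in>{..<K}. c (p + m) * f (p + m) x)"
    by (rule sum.reindex_bij_witness[where i = "\<lambda>m. p + m" and j = "\<lambda>l. l - p"]) auto
  also have "(\<Sum>l\<in>{..<p}. c l * f l x) = (\<Sum>m\<in>{K..<K + p}. c (m - K) * f (m - K) x)"
    by (rule sum.reindex_bij_witness[where i = "\<lambda>m. m - K" and j = "\<lambda>l. l + K"]) auto
  also have "(\<Sum>m\<in>{K..<K + p}. c (m - K) * f (m - K) x) + (\<Sum>m\<in>{..<K}. c (p + m) * f (p + m) x) =
      (\<Sum>m\<in>{..<K}. (if m < K then c (p + m) else c (m - K)) * reorder f p K m x) +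
      (\<Sum>m\<in>{K..<K + p}. (if m < K then c (p + m) else c (m - K)) * reorder f p K m x)"
    by (subst add.commute, intro arg_cong2[where f = "(+)"] sum.cong refl) (auto simp: reorder_def)
  also have "\<dots> = (\<Sum>m<K + p. (if m < K then c (p + m) else c (m - K)) * reorder f p K m x)"
    by (subst sum.union_disjoint[symmetric]) (auto intro!: sum.cong)
  finally show ?thesis .
qed

text \<open>The span of the first p + K functions does not depend on their order, so combinations of
  the original sequence expand in the orthonormal functions of the reordered one.\<close>

lemma span_expand:
  assumes h: "\<And>i. i \<in> {1..n} \<Longrightarrow> h (X i) = (\<Sum>l<p + K. c l * f l (X i))"
  shows "i \<in> {1..n} \<Longrightarrow> h (X i) = (\<Sum>k<K + p. ip h (ob f p K k) * ob f p K k (X i))"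
    and "ip h h' = (\<Sum>k<K + p. ip h (ob f p K k) * ip h' (ob f p K k))"
proof -
  have h': "h (X i) = (\<Sum>m<K + p. (if m < K then c (p + m) else c (m - K)) * reorder f p K m (X i))" if "i \<in> {1..n}" for i
    unfolding h[OF that] by (rule sum_reorder)
  show "i \<in> {1..n} \<Longrightarrow> h (X i) = (\<Sum>k<K + p. ip h (ob f p K k) * ob f p K k (X i))"
    by (rule gs_expand[of h "\<lambda>m. if m < K then c (p + m) else c (m - K)" "reorder f p K" "K + p", OF h'])
  show "ip h h' = (\<Sum>k<K + p. ip h (ob f p K k) * ip h' (ob f p K k))"
    by (rule gs_parseval[of h "\<lambda>m. if m < K then c (p + m) else c (m - K)" "reorder f p K" "K + p", OF h'])
qed

text \<open>The projection of h onto the first K reordered functions, that is, onto the span of u_1,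
  ..., u_K when f is the sequence of \<gamma> followed by u.\<close>

definition head :: "(nat \<Rightarrow> 'x \<Rightarrow> real) \<Rightarrow> nat \<Rightarrow> nat \<Rightarrow> ('x \<Rightarrow> real) \<Rightarrow> 'x \<Rightarrow> real" where
  "head f p K h x = (\<Sum>k<K. ip h (ob f p K k) * ob f p K k x)"

lemma ip_head: "ip (head f p K h) (head f p K h') = (\<Sum>k<K. ip h (ob f p K k) * ip h' (ob f p K k))"
proof -
  have "ip (head f p K h) (ob f p K k) = ip h (ob f p K k)" if "k < K" for k
  proof -
    have "ip (head f p K h) (ob f p K k) = (\<Sum>l<K. ip h (ob f p K l) * ip (ob f p K l) (ob f p K k))"
      unfolding head_def[abs_def] by (rule design_inner_sum_left)
    also have "\<dots> = (\<Sum>l\<in>{k}. ip h (ob f p K l) * ip (ob f p K l) (ob f p K k))"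
      using that by (intro sum.mono_neutral_right) (auto simp: gs_orth)
    also have "\<dots> = ip h (ob f p K k)" using gs_norm_zero_or_one[of "reorder f p K" k h] by (simp add: mult.commute)
    finally show ?thesis .
  qed
  hence "(\<Sum>k<K. ip h' (ob f p K k) * ip (head f p K h) (ob f p K k)) = (\<Sum>k<K. ip h (ob f p K k) * ip h' (ob f p K k))"
    by (intro sum.cong) (auto simp: mult.commute)
  moreover have "ip (head f p K h) (head f p K h') = (\<Sum>k<K. ip h' (ob f p K k) * ip (head f p K h) (ob f p K k))"
    by (subst (2) head_def[abs_def]) (rule design_inner_sum_right)
  ultimately show ?thesis by simp
qed

text \<open>A projection e_1 * u_1 + ... + e_K * u_K of norm at most 1 has coefficients with sum of
  squares at most 1 / (\<kappa> * \<delta>), by the eigenvalue bound and the lower bound on the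
  weights. Cauchy-Schwarz and the bound Bk for the functions give the rest.\<close>

lemma head_sup_bound:
  assumes \<kappa>: "\<kappa> > 0" "\<And>d. \<kappa> * (\<Sum>l<K. (d l)\<^sup>2) \<le> (1 / real n) * (\<Sum>i=1..n. (\<Sum>l<K. d l * f (p + l) (X i))\<^sup>2)"
    and \<delta>: "\<delta> > 0" "\<And>i. i \<in> {1..n} \<Longrightarrow> \<delta> \<le> w (X i)"
    and Bk: "\<And>i l. i \<in> {1..n} \<Longrightarrow> l < K \<Longrightarrow> \<bar>f (p + l) (X i)\<bar> \<le> Bk" "Bk \<ge> 0"
    and h: "ip h h \<le> 1" and i: "i \<in> {1..n}"
  shows "\<bar>head f p K h (X i)\<bar> \<le> Bk * sqrt (real K) / sqrt (\<kappa> * \<delta>)"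
proof -
  have ex: "\<exists>d. \<forall>x. ob f p K k x = (\<Sum>l<K. d l * reorder f p K l x)" if "k < K" for k
    by (rule gs_lincomb_lt[OF that])
  then obtain d where d: "\<And>k x. k < K \<Longrightarrow> ob f p K k x = (\<Sum>l<K. d k l * reorder f p K l x)" by metis
  define e where "e = (\<lambda>l. \<Sum>k<K. ip h (ob f p K k) * d k l)"
  have he: "head f p K h x = (\<Sum>l<K. e l * f (p + l) x)" for x
  proof -
    have "head f p K h x = (\<Sum>k<K. \<Sum>l<K. ip h (ob f p K k) * (d k l * reorder f p K l x))"
      unfolding head_def sum_distrib_left[symmetric] by (intro sum.cong refl) (simp add: d)
    also have "\<dots> = (\<Sum>l<K. \<Sum>k<K. ip h (ob f p K k) * (d k l * reorder f p K l x))" by (rule sum.swap)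
    also have "\<dots> = (\<Sum>l<K. e l * f (p + l) x)"
      unfolding e_def sum_distrib_right by (intro sum.cong refl) (auto simp: reorder_def mult.assoc)
    finally show ?thesis .
  qed
  have n0: "real n > 0" using i by simp
  have "\<kappa> * (\<Sum>l<K. (e l)\<^sup>2) \<le> (1 / real n) * (\<Sum>i=1..n. (head f p K h (X i))\<^sup>2)"
    using \<kappa>(2)[of e] unfolding he .
  also have "\<delta> * ((1 / real n) * (\<Sum>i=1..n. (head f p K h (X i))\<^sup>2)) \<le> ip (head f p K h) (head f p K h)"
  proof -
    have "(\<Sum>i=1..n. \<delta> * (head f p K h (X i))\<^sup>2) \<le> (\<Sum>i=1..n. w (X i) * (head f p K h (X i))\<^sup>2)"
      using \<delta>(2) by (intro sum_mono mult_right_mono) auto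
    hence "(1 / real n) * (\<Sum>i=1..n. \<delta> * (head f p K h (X i))\<^sup>2) \<le> (1 / real n) * (\<Sum>i=1..n. w (X i) * (head f p K h (X i))\<^sup>2)"
      by (intro mult_left_mono) auto
    thus ?thesis by (simp add: design_inner_def sum_distrib_left[symmetric] power2_eq_square mult_ac)
  qed
  hence "(1 / real n) * (\<Sum>i=1..n. (head f p K h (X i))\<^sup>2) \<le> ip (head f p K h) (head f p K h) / \<delta>"
    using \<delta>(1) by (simp add: pos_le_divide_eq mult.commute)
  also have "ip (head f p K h) (head f p K h) \<le> 1"
  proof -
    have "(\<Sum>k<K. (ip h (ob f p K k))\<^sup>2) \<le> ip h h" by (rule bessel) (auto simp: gs_orth gs_norm_le)
    thus ?thesis using h unfolding ip_head by (simp add: power2_eq_square)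
  qed
  finally have "\<kappa> * (\<Sum>l<K. (e l)\<^sup>2) \<le> 1 / \<delta>" using \<delta>(1) by (simp add: divide_right_mono)
  hence e2: "(\<Sum>l<K. (e l)\<^sup>2) \<le> 1 / (\<kappa> * \<delta>)" using \<kappa>(1) \<delta>(1) by (simp add: field_simps)
  have "\<bar>head f p K h (X i)\<bar> \<le> (\<Sum>l<K. \<bar>e l\<bar> * Bk)"
    unfolding he by (rule order_trans[OF sum_abs sum_mono]) (use Bk i in \<open>auto simp: abs_mult intro!: mult_left_mono\<close>)
  also have "\<dots> \<le> (sqrt (real K) * sqrt (\<Sum>l<K. (e l)\<^sup>2)) * Bk"
    unfolding sum_distrib_right[symmetric] using sum_le_sqrt_card[of "{..<K}" e] Bk(2) by (intro mult_right_mono) auto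
  also have "\<dots> \<le> (sqrt (real K) * sqrt (1 / (\<kappa> * \<delta>))) * Bk"
    using e2 Bk(2) by (intro mult_right_mono mult_left_mono real_sqrt_le_mono) auto
  finally show ?thesis by (simp add: real_sqrt_divide mult_ac)
qed

text \<open>Rows 1 to n belong to the actual errors and contain the values of the projection. Rows n
  + 1 to n + p are fictitious: they hold the coordinates in the last p orthonormal directions, which
  completes the columns to orthonormal ones. Columns outside 1..K are zero.\<close>

definition ncoef :: "(nat \<Rightarrow> 'x \<Rightarrow> real) \<Rightarrow> nat \<Rightarrow> nat \<Rightarrow> nat \<Rightarrow> nat \<Rightarrow> real" where
  "ncoef f p K i j = (if j \<in> {1..K} then
     if i \<le> n then sqrt (w (X i) / real n) * head f p K (gs f (p + j - 1)) (X i)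
     else ip (gs f (p + j - 1)) (ob f p K (K + (i - n - 1))) else 0)"

lemma sum_tail: "(\<Sum>i\<in>{n+1..n+p}. F (K + (i - n - 1))) = (\<Sum>k\<in>{K..<K+p}. F k)" for F :: "nat \<Rightarrow> real" and K p :: nat
  by (rule sum.reindex_bij_witness[where i = "\<lambda>k. k + n + 1 - K" and j = "\<lambda>i. K + (i - n - 1)"]) auto

lemma gs_in_span:
  assumes "j \<in> {1..K}"
  shows "\<exists>c. \<forall>x. gs f (p + j - 1) x = (\<Sum>l<p + K. c l * f l x)"
  using gs_lincomb_lt[of "p + j - 1" "p + K" f] assms by auto

text \<open>The actual rows contribute the inner product of the projections, the fictitious rows the
  remaining p coordinates; Parseval in all K + p directions gives back the inner product of the
  functions.\<close>

lemma ncoef_gram: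
  assumes orth: "\<And>j l. j \<in> {1..K} \<Longrightarrow> l \<in> {1..K} \<Longrightarrow> ip (gs f (p + j - 1)) (gs f (p + l - 1)) = (if j = l then 1 else 0)"
    and jl: "j \<in> {1..K}" "l \<in> {1..K}"
  shows "gram_of ({1..n} \<union> {n+1..n+p}) (ncoef f p K) j l = (if j = l then 1 else 0)"
proof -
  define a where "a = (\<lambda>j k. ip (gs f (p + j - 1)) (ob f p K k))"
  obtain c where c: "\<And>x. gs f (p + j - 1) x = (\<Sum>l<p + K. c l * f l x)" using gs_in_span[OF jl(1)] by blast
  have "gram_of ({1..n} \<union> {n+1..n+p}) (ncoef f p K) j l =
    (\<Sum>i\<in>{1..n}. ncoef f p K i j * ncoef f p K i l) + (\<Sum>i\<in>{n+1..n+p}. ncoef f p K i j * ncoef f p K i l)"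
    unfolding gram_of_def by (rule sum.union_disjoint) auto
  also have "(\<Sum>i\<in>{1..n}. ncoef f p K i j * ncoef f p K i l) =
      (\<Sum>i\<in>{1..n}. 1 / real n * (w (X i) * head f p K (gs f (p + j - 1)) (X i) * head f p K (gs f (p + l - 1)) (X i)))"
  proof (rule sum.cong[OF refl])
    fix i assume i: "i \<in> {1..n}"
    have "0 \<le> w (X i) / real n" using wpos[OF i] by simp
    hence sq: "sqrt (w (X i) / real n) * sqrt (w (X i) / real n) = w (X i) / real n"
      by (rule real_sqrt_mult_self[THEN trans, OF abs_of_nonneg])
    have sw: "q * x * (q * y) = q * q * (x * y)" for q x y :: real by (simp add: mult_ac)
    have "sqrt (w (X i) / real n) * x * (sqrt (w (X i) / real n) * y) = 1 / real n * (w (X i) * x * y)" for x y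
      by (rule trans[OF sw]) (unfold sq, simp)
    thus "ncoef f p K i j * ncoef f p K i l = 1 / real n * (w (X i) * head f p K (gs f (p + j - 1)) (X i) * head f p K (gs f (p + l - 1)) (X i))"
      using i jl by (simp add: ncoef_def)
  qed
  also have "\<dots> = ip (head f p K (gs f (p + j - 1))) (head f p K (gs f (p + l - 1)))"
    unfolding design_inner_def[of n X w "head f p K (gs f (p + j - 1))"] by (rule sum_distrib_left[symmetric])
  also have "\<dots> = (\<Sum>k<K. a j k * a l k)" unfolding ip_head a_def ..
  also have "(\<Sum>i\<in>{n+1..n+p}. ncoef f p K i j * ncoef f p K i l) = (\<Sum>i\<in>{n+1..n+p}. a j (K + (i - n - 1)) * a l (K + (i - n - 1)))"
    using jl by (intro sum.cong) (auto simp: ncoef_def a_def)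
  also have "\<dots> = (\<Sum>k\<in>{K..<K+p}. a j k * a l k)" by (rule sum_tail)
  also have "(\<Sum>k<K. a j k * a l k) + (\<Sum>k\<in>{K..<K+p}. a j k * a l k) = (\<Sum>k<K+p. a j k * a l k)"
    by (rule sum_split_at)
  also have "\<dots> = ip (gs f (p + j - 1)) (gs f (p + l - 1))"
    unfolding a_def
    by (rule span_expand(2)[where h = "gs f (p + j - 1)" and h' = "gs f (p + l - 1)" and c = c and f = f and p = p and K = K, OF c, symmetric])
  finally show ?thesis using orth[OF jl] by simp
qed

text \<open>Bessel's inequality with the roles exchanged: each of the p directions has squared
  coordinates of total at most 1 in the K orthonormal functions. Cauchy-Schwarz over j then turns
  the bound p for the squares into sqrt (K * p) for the norms.\<close>

lemma ncoef_tail_sum: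
  assumes orth: "\<And>j l. j \<in> {1..K} \<Longrightarrow> l \<in> {1..K} \<Longrightarrow> ip (gs f (p + j - 1)) (gs f (p + l - 1)) = (if j = l then 1 else 0)"
  shows "(\<Sum>j\<in>{1..K}. sqrt (\<Sum>i\<in>{n+1..n+p}. (ncoef f p K i j)\<^sup>2)) \<le> sqrt (real K) * sqrt (real p)"
proof -
  have e: "(\<Sum>i\<in>{n+1..n+p}. (ncoef f p K i j)\<^sup>2) = (\<Sum>k\<in>{K..<K+p}. (ip (ob f p K k) (gs f (p + j - 1)))\<^sup>2)"
    if j: "j \<in> {1..K}" for j
  proof -
    have "(\<Sum>i\<in>{n+1..n+p}. (ncoef f p K i j)\<^sup>2) = (\<Sum>i\<in>{n+1..n+p}. (ip (ob f p K (K + (i - n - 1))) (gs f (p + j - 1)))\<^sup>2)"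
      using j by (intro sum.cong refl) (simp add: ncoef_def design_inner_sym[of n X w "gs f (p + j - 1)"] del: One_nat_def)
    thus ?thesis by (simp only: sum_tail[of "\<lambda>k. (ip (ob f p K k) (gs f (p + j - 1)))\<^sup>2"])
  qed
  have "(\<Sum>j\<in>{1..K}. sqrt (\<Sum>i\<in>{n+1..n+p}. (ncoef f p K i j)\<^sup>2))
      \<le> sqrt (real (card {1..K})) * sqrt (\<Sum>j\<in>{1..K}. (sqrt (\<Sum>i\<in>{n+1..n+p}. (ncoef f p K i j)\<^sup>2))\<^sup>2)"
    using sum_le_sqrt_card[of "{1..K}" "\<lambda>j. sqrt (\<Sum>i\<in>{n+1..n+p}. (ncoef f p K i j)\<^sup>2)"] by (simp add: sum_nonneg)
  also have "(\<Sum>j\<in>{1..K}. (sqrt (\<Sum>i\<in>{n+1..n+p}. (ncoef f p K i j)\<^sup>2))\<^sup>2) = (\<Sum>j\<in>{1..K}. \<Sum>k\<in>{K..<K+p}. (ip (ob f p K k) (gs f (p + j - 1)))\<^sup>2)"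
  proof (rule sum.cong[OF refl])
    fix j assume j: "j \<in> {1..K}"
    have "0 \<le> (\<Sum>i\<in>{n+1..n+p}. (ncoef f p K i j)\<^sup>2)" by (rule sum_nonneg) simp
    thus "(sqrt (\<Sum>i\<in>{n+1..n+p}. (ncoef f p K i j)\<^sup>2))\<^sup>2 = (\<Sum>k\<in>{K..<K+p}. (ip (ob f p K k) (gs f (p + j - 1)))\<^sup>2)"
      using e[OF j] by (simp only: real_sqrt_pow2)
  qed
  also have "\<dots> = (\<Sum>k\<in>{K..<K+p}. \<Sum>j\<in>{1..K}. (ip (ob f p K k) (gs f (p + j - 1)))\<^sup>2)" by (rule sum.swap)
  also have "\<dots> \<le> (\<Sum>k\<in>{K..<K+p}. 1)"
  proof (rule sum_mono)
    fix k
    have "(\<Sum>j\<in>{1..K}. (ip (ob f p K k) (gs f (p + j - 1)))\<^sup>2) \<le> ip (ob f p K k) (ob f p K k)"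
      by (rule bessel) (use orth in auto)
    thus "(\<Sum>j\<in>{1..K}. (ip (ob f p K k) (gs f (p + j - 1)))\<^sup>2) \<le> 1" using gs_norm_le[of "reorder f p K" k] by linarith
  qed
  finally show ?thesis by (simp add: mult_left_mono)
qed

text \<open>For standardised errors this is the normalised score: n^(-1/2) times the sum of (Y i -
  b') * h (X i), divided by sqrt a0. The factor sqrt (w / n) makes its variance equal to
  \<open>ip h h\<close>.\<close>

definition noise :: "(nat \<Rightarrow> real) \<Rightarrow> ('x \<Rightarrow> real) \<Rightarrow> real" where
  "noise \<xi> h = (\<Sum>i=1..n. \<xi> i * (sqrt (w (X i) / real n) * h (X i)))"

lemma noise_diff: "noise \<xi> (\<lambda>x. h x - h' x) = noise \<xi> h - noise \<xi> h'"
  by (simp add: noise_def algebra_simps sum_subtractf)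

lemma noise_sum:
  assumes "\<And>i. i \<in> {1..n} \<Longrightarrow> h (X i) = (\<Sum>k\<in>A. c k * g k (X i))"
  shows "noise \<xi> h = (\<Sum>k\<in>A. c k * noise \<xi> (g k))"
proof -
  have "noise \<xi> h = (\<Sum>i=1..n. \<Sum>k\<in>A. c k * (\<xi> i * (sqrt (w (X i) / real n) * g k (X i))))"
    unfolding noise_def by (intro sum.cong refl) (simp only: assms sum_distrib_left mult.left_commute)
  also have "\<dots> = (\<Sum>k\<in>A. \<Sum>i=1..n. c k * (\<xi> i * (sqrt (w (X i) / real n) * g k (X i))))" by (rule sum.swap)
  finally show ?thesis by (simp add: noise_def sum_distrib_left)
qed

text \<open>The bound holds for all functions in the span at once, hence also for one that depends
  on the data, such as the difference of estimated and true orthonormal functions. Only K + p fixed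
  noise variables have to be controlled.\<close>

lemma noise_bound:
  assumes h: "\<And>i. i \<in> {1..n} \<Longrightarrow> h (X i) = (\<Sum>l<p + K. c l * f l (X i))"
  shows "\<bar>noise \<xi> h\<bar> \<le> sqrt (ip h h) * sqrt (\<Sum>k<K+p. (noise \<xi> (ob f p K k))\<^sup>2)"
proof -
  have "noise \<xi> h = (\<Sum>k<K+p. ip h (ob f p K k) * noise \<xi> (ob f p K k))"
    by (rule noise_sum) (rule span_expand(1)[where h = h and c = c and f = f and p = p and K = K, OF h])
  moreover have "ip h h = (\<Sum>k<K+p. (ip h (ob f p K k))\<^sup>2)"
    using span_expand(2)[where h = h and h' = h and c = c and f = f and p = p and K = K, OF h] by (simp add: power2_eq_square)
  ultimately show ?thesis using cauchy_schwarz_sum_abs[of "\<lambda>k. ip h (ob f p K k)" "\<lambda>k. noise \<xi> (ob f p K k)" "{..<K+p}"] by simp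
qed

lemma noise_tail_bound:
  assumes j: "j \<in> {1..K}" and R: "R \<ge> 0" "(\<Sum>k\<in>{K..<K+p}. (noise \<xi> (ob f p K k))\<^sup>2) \<le> R\<^sup>2"
  shows "\<bar>noise \<xi> (gs f (p + j - 1)) - (\<Sum>i\<in>{1..n}. \<xi> i * ncoef f p K i j)\<bar> \<le> R * sqrt (\<Sum>i\<in>{n+1..n+p}. (ncoef f p K i j)\<^sup>2)"
proof -
  define a where "a = (\<lambda>k. ip (gs f (p + j - 1)) (ob f p K k))"
  obtain c where c: "\<And>x. gs f (p + j - 1) x = (\<Sum>l<p + K. c l * f l x)" using gs_in_span[OF j] by blast
  have "noise \<xi> (gs f (p + j - 1)) = (\<Sum>k<K+p. a k * noise \<xi> (ob f p K k))"
    unfolding a_def by (rule noise_sum) (rule span_expand(1)[where h = "gs f (p + j - 1)" and c = c and f = f and p = p and K = K, OF c])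
  also have "\<dots> = (\<Sum>k<K. a k * noise \<xi> (ob f p K k)) + (\<Sum>k\<in>{K..<K+p}. a k * noise \<xi> (ob f p K k))"
    by (rule sum_split_at[symmetric])
  also have "(\<Sum>k<K. a k * noise \<xi> (ob f p K k)) = noise \<xi> (head f p K (gs f (p + j - 1)))"
    unfolding a_def by (rule noise_sum[symmetric]) (simp add: head_def)
  also have "\<dots> = (\<Sum>i\<in>{1..n}. \<xi> i * ncoef f p K i j)"
    unfolding noise_def using j by (intro sum.cong) (auto simp: ncoef_def)
  finally have "\<bar>noise \<xi> (gs f (p + j - 1)) - (\<Sum>i\<in>{1..n}. \<xi> i * ncoef f p K i j)\<bar> = \<bar>\<Sum>k\<in>{K..<K+p}. noise \<xi> (ob f p K k) * a k\<bar>"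
    by (simp add: mult.commute)
  also have "\<dots> \<le> sqrt (\<Sum>k\<in>{K..<K+p}. (noise \<xi> (ob f p K k))\<^sup>2) * sqrt (\<Sum>k\<in>{K..<K+p}. (a k)\<^sup>2)"
    by (rule cauchy_schwarz_sum_abs)
  also have "\<dots> \<le> R * sqrt (\<Sum>k\<in>{K..<K+p}. (a k)\<^sup>2)"
    using real_sqrt_le_mono[OF R(2)] R(1) by (intro mult_right_mono) (auto simp: sum_nonneg)
  also have "(\<Sum>k\<in>{K..<K+p}. (a k)\<^sup>2) = (\<Sum>i\<in>{n+1..n+p}. (ncoef f p K i j)\<^sup>2)"
  proof -
    have "(\<Sum>i\<in>{n+1..n+p}. (ncoef f p K i j)\<^sup>2) = (\<Sum>i\<in>{n+1..n+p}. (a (K + (i - n - 1)))\<^sup>2)"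
      using j by (intro sum.cong) (auto simp: ncoef_def a_def)
    thus ?thesis by (simp only: sum_tail[of "\<lambda>k. (a k)\<^sup>2"])
  qed
  finally show ?thesis .
qed

end

text \<open>The derivative is taken at the displaced point z + t, not at z, because the
  orthogonality of the estimated functions holds with the weights at the estimate.\<close>

lemma anchored_taylor:
  fixes b1 b2 :: "real \<Rightarrow> real"
  assumes r: "\<bar>t\<bar> \<le> r" and L: "L \<ge> 0"
    and d: "\<And>s. \<bar>s\<bar> \<le> r \<Longrightarrow> (b1 has_real_derivative b2 (z + s)) (at (z + s))"
    and lip: "\<And>s. \<bar>s\<bar> \<le> r \<Longrightarrow> \<bar>b2 (z + s) - b2 z\<bar> \<le> L * \<bar>s\<bar>"
  shows "\<bar>b1 (z + t) - b1 z - b2 (z + t) * t\<bar> \<le> 2 * L * t\<^sup>2"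
proof -
  have "\<exists>x>0. x < 1 \<and> b1 (z + 1 * t) - b1 (z + 0 * t) = (1 - 0) * (b2 (z + x * t) * t)"
  proof (rule MVT2)
    fix x :: real assume x: "0 \<le> x" "x \<le> 1"
    have "\<bar>x * t\<bar> \<le> r" using x r mult_right_mono[of x 1 "\<bar>t\<bar>"] by (simp add: abs_mult)
    have "((\<lambda>x. z + x * t) has_real_derivative t) (at x)" by (auto intro!: derivative_eq_intros)
    with DERIV_chain2[where f = b1 and g = "\<lambda>x. z + x * t" and x = x and Db = t and s = UNIV, OF d[OF \<open>\<bar>x * t\<bar> \<le> r\<close>]]
    show "((\<lambda>x. b1 (z + x * t)) has_real_derivative b2 (z + x * t) * t) (at x)" by blast
  qed simp
  then obtain x where x: "0 < x" "x < 1" "b1 (z + t) - b1 z = b2 (z + x * t) * t" by auto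
  have xt: "\<bar>x * t\<bar> \<le> \<bar>t\<bar>" using x mult_right_mono[of x 1 "\<bar>t\<bar>"] by (simp add: abs_mult)
  have "L * \<bar>x * t\<bar> \<le> L * \<bar>t\<bar>" using xt L by (rule mult_left_mono)
  hence "\<bar>b2 (z + x * t) - b2 (z + t)\<bar> \<le> 2 * L * \<bar>t\<bar>"
    using lip[of "x * t"] lip[of t] xt r by linarith
  hence "\<bar>b2 (z + x * t) - b2 (z + t)\<bar> * \<bar>t\<bar> \<le> 2 * L * \<bar>t\<bar> * \<bar>t\<bar>" by (rule mult_right_mono) simp
  moreover have "b1 (z + t) - b1 z - b2 (z + t) * t = (b2 (z + x * t) - b2 (z + t)) * t"
    unfolding x(3) by (simp add: algebra_simps)
  ultimately show ?thesis by (simp add: abs_mult power2_eq_square flip: abs_mult)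
qed

lemma abs_sqrt_minus_1_le: "x \<ge> 0 \<Longrightarrow> \<bar>sqrt x - 1\<bar> \<le> \<bar>x - 1\<bar>"
proof -
  assume x: "x \<ge> 0"
  have "x - 1 = (sqrt x - 1) * (sqrt x + 1)" using x by (simp add: algebra_simps)
  hence "\<bar>x - 1\<bar> = \<bar>sqrt x - 1\<bar> * (sqrt x + 1)" using x by (simp add: abs_mult)
  moreover have "\<bar>sqrt x - 1\<bar> * 1 \<le> \<bar>sqrt x - 1\<bar> * (sqrt x + 1)" using x by (intro mult_left_mono) auto
  ultimately show ?thesis by simp
qed

context weighted_design
begin

text \<open>The first term of the bound comes from replacing v' by v in the noise, T from the
  quadratic remainder of b1 at the estimated predictor, and the last term from ah in place of a0.
  There 3 * \<Lambda> + T bounds the score itself: \<Lambda> for v, at most 2 * \<Lambda> for v' -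
  v, and T.\<close>

lemma score_deviation:
  fixes z zh :: "'x \<Rightarrow> real" and b1 b2 :: "real \<Rightarrow> real" and f :: "nat \<Rightarrow> 'x \<Rightarrow> real" and y :: "nat \<Rightarrow> real" and p j K :: nat
  defines "w' \<equiv> \<lambda>x. b2 (zh x)"
  defines "v' \<equiv> gram_schmidt_fn (design_inner n X w') f (p + j - 1)"
  assumes n: "n > 0" and a0: "a0 > 0" and j: "j \<in> {1..K}"
    and wz: "\<And>i. i \<in> {1..n} \<Longrightarrow> w (X i) = b2 (z (X i))"
    and \<delta>: "\<delta> > 0" "\<And>i. i \<in> {1..n} \<Longrightarrow> \<delta> \<le> w (X i)"
    and d: "\<And>i s. i \<in> {1..n} \<Longrightarrow> \<bar>s\<bar> \<le> r \<Longrightarrow> (b1 has_real_derivative b2 (z (X i) + s)) (at (z (X i) + s))"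
    and lip: "\<And>i s. i \<in> {1..n} \<Longrightarrow> \<bar>s\<bar> \<le> r \<Longrightarrow> \<bar>b2 (z (X i) + s) - b2 (z (X i))\<bar> \<le> L * \<bar>s\<bar>" and L: "L \<ge> 0"
    and \<tau>: "\<And>i. i \<in> {1..n} \<Longrightarrow> \<bar>zh (X i) - z (X i)\<bar> \<le> \<tau>" "\<tau> \<le> r" "L * \<tau> \<le> \<delta> / 2" "\<tau> \<ge> 0"
    and norm: "ip (gs f (p + j - 1)) (gs f (p + j - 1)) = 1" "design_inner n X w' v' v' = 1"
    and lin: "(\<Sum>i=1..n. v' (X i) * (zh (X i) - z (X i)) * w' (X i)) = 0"
    and ah: "\<bar>ah - a0\<bar> \<le> \<sigma>" "\<sigma> \<le> a0 / 2"
  defines "\<xi> \<equiv> \<lambda>i. (y i - b1 (z (X i))) / sqrt (a0 * w (X i))"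
  assumes \<Lambda>: "(\<Sum>k<K+p. (noise \<xi> (ob f p K k))\<^sup>2) \<le> \<Lambda>\<^sup>2" "\<Lambda> \<ge> 0"
  defines "T \<equiv> sqrt (real n) * (2 * L * \<tau>\<^sup>2) * sqrt (2 / \<delta>) / sqrt a0"
  shows "\<bar>sqrt (real n) * ((1 / real n) * (\<Sum>i=1..n. (y i - b1 (zh (X i))) * v' (X i))) / sqrt ah - noise \<xi> (gs f (p + j - 1))\<bar>
    \<le> 4 * (L * \<tau> / \<delta>) * \<Lambda> + T + 2 * \<sigma> / a0 * (3 * \<Lambda> + T)"
proof -
  have w'w: "\<bar>w' (X i) - w (X i)\<bar> \<le> L * \<tau>" if "i \<in> {1..n}" for i
  proof -
    have "\<bar>b2 (z (X i) + (zh (X i) - z (X i))) - b2 (z (X i))\<bar> \<le> L * \<bar>zh (X i) - z (X i)\<bar>"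
      using that \<tau>(1)[OF that] \<tau>(2) by (intro lip) auto
    also have "\<dots> \<le> L * \<tau>" using \<tau>(1)[OF that] L by (rule mult_left_mono)
    finally show ?thesis using wz[OF that] by (simp add: w'_def)
  qed
  have w'\<delta>: "\<delta> / 2 \<le> w' (X i)" if "i \<in> {1..n}" for i
    using w'w[OF that] \<delta>(2)[OF that] \<tau>(3) by linarith
  interpret W': weighted_design n X w'
    by unfold_locales (use w'\<delta> \<delta>(1) in fastforce)
  have rel: "\<bar>w' (X i) - w (X i)\<bar> \<le> L * \<tau> / \<delta> * w (X i)" if "i \<in> {1..n}" for i
  proof -
    have "L * \<tau> / \<delta> * \<delta> \<le> L * \<tau> / \<delta> * w (X i)" using \<delta> that L \<tau>(4) by (intro mult_left_mono) auto
    thus ?thesis using w'w[OF that] \<delta>(1) by simp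
  qed
  have t: "0 \<le> L * \<tau> / \<delta>" "L * \<tau> / \<delta> \<le> 1 / 2" using L \<tau> \<delta>(1) by (auto simp: field_simps)
  define v where "v = gs f (p + j - 1)"
  have st: "ip (\<lambda>x. v' x - v x) (\<lambda>x. v' x - v x) \<le> (4 * (L * \<tau> / \<delta>))\<^sup>2"
    unfolding v'_def v_def by (rule gram_schmidt_stable[OF wpos rel t norm(1)]) (use norm(2) in \<open>simp_all add: v'_def\<close>)
  obtain c where c: "\<And>x. v x = (\<Sum>l<p + K. c l * f l x)" using gs_in_span[OF j, of f p] unfolding v_def by blast
  obtain c' where c': "\<And>x. v' x = (\<Sum>l<p + K. c' l * f l x)" using W'.gs_in_span[OF j, of f p] unfolding v'_def by blast
  have sL: "sqrt (\<Sum>k<K+p. (noise \<xi> (ob f p K k))\<^sup>2) \<le> \<Lambda>" using \<Lambda> real_sqrt_le_mono[OF \<Lambda>(1)] by simp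
  \<comment> \<open>Uniform over the span, as v' depends on the data.\<close>
  have nb: "\<bar>noise \<xi> h\<bar> \<le> q * \<Lambda>" if "\<And>x. h x = (\<Sum>l<p + K. e l * f l x)" "ip h h \<le> q\<^sup>2" "q \<ge> 0" for h e q
  proof -
    have "\<bar>noise \<xi> h\<bar> \<le> sqrt (ip h h) * sqrt (\<Sum>k<K+p. (noise \<xi> (ob f p K k))\<^sup>2)"
      by (rule noise_bound[where h = h and c = e and f = f and p = p and K = K]) (rule that(1))
    also have "\<dots> \<le> q * \<Lambda>"
      using real_sqrt_le_mono[OF that(2)] that(3) sL by (intro mult_mono) (auto simp: sum_nonneg)
    finally show ?thesis .
  qed
  have b1: "\<bar>noise \<xi> v\<bar> \<le> 1 * \<Lambda>" by (rule nb[of v c]) (use c norm(1) in \<open>simp_all add: v_def\<close>)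
  have b2': "\<bar>noise \<xi> (\<lambda>x. v' x - v x)\<bar> \<le> 4 * (L * \<tau> / \<delta>) * \<Lambda>"
    by (rule nb[of _ "\<lambda>l. c' l - c l"]) (use c c' st t in \<open>simp_all add: left_diff_distrib sum_subtractf\<close>)
  have nd: "\<bar>noise \<xi> v' - noise \<xi> v\<bar> \<le> 4 * (L * \<tau> / \<delta>) * \<Lambda>" using b2' unfolding noise_diff .
  define V where "V = (1 / sqrt (real n)) * (\<Sum>i=1..n. (y i - b1 (zh (X i))) * v' (X i))"
  \<comment> \<open>The remainder of b1 expanded around the estimated predictor. The linear term
    carries the weights w', for which \<open>lin\<close> makes its sum against v' vanish.\<close>
  define e where "e = (\<lambda>i. b1 (zh (X i)) - b1 (z (X i)) - b2 (zh (X i)) * (zh (X i) - z (X i)))"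
  have eb: "\<bar>e i\<bar> \<le> 2 * L * \<tau>\<^sup>2" if "i \<in> {1..n}" for i
  proof -
    have "\<bar>b1 (z (X i) + (zh (X i) - z (X i))) - b1 (z (X i)) - b2 (z (X i) + (zh (X i) - z (X i))) * (zh (X i) - z (X i))\<bar>
        \<le> 2 * L * (zh (X i) - z (X i))\<^sup>2"
      using that \<tau>(1)[OF that] \<tau>(2) d lip L by (intro anchored_taylor[where r = r]) auto
    also have "\<dots> \<le> 2 * L * \<tau>\<^sup>2"
      using power_mono[OF \<tau>(1)[OF that] abs_ge_zero, of 2] L by (intro mult_left_mono) auto
    finally show ?thesis by (simp add: e_def)
  qed
  have sq: "(\<Sum>i=1..n. \<bar>v' (X i)\<bar>) \<le> real n * sqrt (2 / \<delta>)"
  proof -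
    have "(\<Sum>i=1..n. \<delta> / 2 * (v' (X i))\<^sup>2) \<le> (\<Sum>i=1..n. w' (X i) * (v' (X i))\<^sup>2)"
      using w'\<delta> by (intro sum_mono mult_right_mono) auto
    also have "\<dots> = real n" using norm(2) n by (simp add: design_inner_def power2_eq_square mult.assoc divide_eq_eq)
    finally have "\<delta> / 2 * (\<Sum>i=1..n. (v' (X i))\<^sup>2) \<le> real n" unfolding sum_distrib_left .
    hence "(\<Sum>i=1..n. (v' (X i))\<^sup>2) \<le> real n * (2 / \<delta>)" using \<delta>(1) by (simp add: field_simps)
    hence "sqrt (real n) * sqrt (\<Sum>i=1..n. (v' (X i))\<^sup>2) \<le> sqrt (real n) * sqrt (real n * (2 / \<delta>))"
      by (intro mult_left_mono real_sqrt_le_mono) auto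
    also have "\<dots> = real n * sqrt (2 / \<delta>)" unfolding real_sqrt_mult by (simp flip: mult.assoc)
    finally show ?thesis using sum_le_sqrt_card[of "{1..n}" "\<lambda>i. v' (X i)"] by simp
  qed
  have Vn: "\<bar>V / sqrt a0 - noise \<xi> v'\<bar> \<le> T"
  proof -
    have nv: "noise \<xi> v' = 1 / (sqrt (real n) * sqrt a0) * (\<Sum>i=1..n. (y i - b1 (z (X i))) * v' (X i))"
      unfolding noise_def sum_distrib_left
    proof (rule sum.cong)
      fix i assume i: "i \<in> {1..n}"
      have "sqrt (w (X i)) > 0" using wpos[OF i] by simp
      moreover have "u / (s * q) * (q / m * v) = 1 / (m * s) * (u * v)" if "q > 0" for u s q m v :: real
        using that by simp
      ultimately show "\<xi> i * (sqrt (w (X i) / real n) * v' (X i)) = 1 / (sqrt (real n) * sqrt a0) * ((y i - b1 (z (X i))) * v' (X i))"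
        by (simp only: \<xi>_def real_sqrt_mult real_sqrt_divide)
    qed simp
    have "V / sqrt a0 - noise \<xi> v' = - (1 / (sqrt (real n) * sqrt a0) * (\<Sum>i=1..n. (b1 (zh (X i)) - b1 (z (X i))) * v' (X i)))"
      unfolding V_def nv by (simp add: left_diff_distrib sum_subtractf right_diff_distrib diff_divide_distrib)
    also have "(\<Sum>i=1..n. (b1 (zh (X i)) - b1 (z (X i))) * v' (X i)) = (\<Sum>i=1..n. e i * v' (X i))"
    proof -
      have "(\<Sum>i=1..n. (b1 (zh (X i)) - b1 (z (X i))) * v' (X i)) =
        (\<Sum>i=1..n. e i * v' (X i)) + (\<Sum>i=1..n. v' (X i) * (zh (X i) - z (X i)) * w' (X i))"
        unfolding sum.distrib[symmetric] by (intro sum.cong refl) (simp add: e_def w'_def algebra_simps)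
      thus ?thesis using lin by simp
    qed
    finally have "\<bar>V / sqrt a0 - noise \<xi> v'\<bar> = 1 / (sqrt (real n) * sqrt a0) * \<bar>\<Sum>i=1..n. e i * v' (X i)\<bar>"
      using a0 by (simp add: abs_mult)
    also have "\<dots> \<le> 1 / (sqrt (real n) * sqrt a0) * (2 * L * \<tau>\<^sup>2 * (real n * sqrt (2 / \<delta>)))"
    proof (rule mult_left_mono)
      have "\<bar>\<Sum>i=1..n. e i * v' (X i)\<bar> \<le> (\<Sum>i=1..n. 2 * L * \<tau>\<^sup>2 * \<bar>v' (X i)\<bar>)"
        by (rule order_trans[OF sum_abs sum_mono]) (use eb in \<open>auto simp: abs_mult intro!: mult_right_mono\<close>)
      also have "\<dots> \<le> 2 * L * \<tau>\<^sup>2 * (real n * sqrt (2 / \<delta>))"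
        unfolding sum_distrib_left[symmetric] using sq L by (intro mult_left_mono) auto
      finally show "\<bar>\<Sum>i=1..n. e i * v' (X i)\<bar> \<le> 2 * L * \<tau>\<^sup>2 * (real n * sqrt (2 / \<delta>))" .
    qed (use a0 in simp)
    also have "\<dots> = T"
    proof -
      have "real n = sqrt (real n) * sqrt (real n)" by simp
      hence "1 / (q * s) * (l * (real n * x)) = q * l * x / s" if "q = sqrt (real n)" "s > 0" for q s l x :: real
        using that n by (simp add: field_simps)
      from this[of "sqrt (real n)" "sqrt a0" "2 * L * \<tau>\<^sup>2" "sqrt (2 / \<delta>)"] a0 show ?thesis by (simp add: T_def)
    qed
    finally show ?thesis .
  qed
  have ah0: "ah \<ge> a0 / 2" "ah > 0" using ah a0 by linarith+
  have V0: "\<bar>V / sqrt a0\<bar> \<le> 3 * \<Lambda> + T"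
  proof -
    have "4 * (L * \<tau> / \<delta>) * \<Lambda> \<le> 2 * \<Lambda>" using t \<Lambda>(2) by (intro mult_right_mono) auto
    thus ?thesis using Vn nd b1 by linarith
  qed
  have Va: "\<bar>V / sqrt ah - V / sqrt a0\<bar> \<le> 2 * \<sigma> / a0 * (3 * \<Lambda> + T)"
  proof -
    have "V / sqrt ah - V / sqrt a0 = (sqrt (a0 / ah) - 1) * (V / sqrt a0)"
      using a0 ah0 by (simp add: real_sqrt_divide field_simps)
    hence "\<bar>V / sqrt ah - V / sqrt a0\<bar> = \<bar>sqrt (a0 / ah) - 1\<bar> * \<bar>V / sqrt a0\<bar>" by (simp only: abs_mult)
    also have "\<bar>sqrt (a0 / ah) - 1\<bar> \<le> 2 * \<sigma> / a0"
    proof -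
      have "\<bar>sqrt (a0 / ah) - 1\<bar> \<le> \<bar>a0 / ah - 1\<bar>" using a0 ah0 by (intro abs_sqrt_minus_1_le) auto
      also have "\<dots> = \<bar>ah - a0\<bar> / ah" using ah0 by (simp add: field_simps abs_minus_commute)
      also have "\<dots> \<le> \<sigma> / (a0 / 2)" using ah ah0 a0 by (intro frac_le) auto
      finally show ?thesis by (simp add: mult.commute)
    qed
    hence "\<bar>sqrt (a0 / ah) - 1\<bar> * \<bar>V / sqrt a0\<bar> \<le> 2 * \<sigma> / a0 * (3 * \<Lambda> + T)"
      using V0 ah(1) a0 by (intro mult_mono) auto
    finally show ?thesis .
  qed
  have "sqrt (real n) * ((1 / real n) * S) = (1 / sqrt (real n)) * S" for S :: real
    using n by (simp add: field_simps flip: real_sqrt_mult)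
  hence "sqrt (real n) * ((1 / real n) * (\<Sum>i=1..n. (y i - b1 (zh (X i))) * v' (X i))) = V" unfolding V_def .
  moreover have "\<bar>V / sqrt ah - noise \<xi> v\<bar> \<le> 4 * (L * \<tau> / \<delta>) * \<Lambda> + T + 2 * \<sigma> / a0 * (3 * \<Lambda> + T)"
    using Va Vn nd by linarith
  ultimately show ?thesis by (simp add: v_def)
qed

end

section \<open>Second moments of the noise and the assembled comparison\<close>

lemma std3_moments:
  assumes M: "prob_space M" and X: "X \<in> borel_measurable M" and s: "std3 (distr M borel X) m"
  shows "integrable M X" "integrable M (\<lambda>\<omega>. (X \<omega>)\<^sup>2)" "(\<integral>\<omega>. X \<omega> \<partial>M) = 0" "(\<integral>\<omega>. (X \<omega>)\<^sup>2 \<partial>M) = 1"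
proof -
  interpret prob_space M by fact
  have i3: "integrable M (\<lambda>\<omega>. \<bar>X \<omega>\<bar> ^ 3)"
    using s X unfolding std3_def by (subst (asm) integrable_distr_eq) auto
  have cube: "\<bar>x\<bar> \<le> 1 + \<bar>x\<bar> ^ 3" "x\<^sup>2 \<le> 1 + \<bar>x\<bar> ^ 3" for x :: real
  proof -
    consider "\<bar>x\<bar> \<le> 1" | "\<bar>x\<bar> \<ge> 1" by linarith
    hence "\<bar>x\<bar> \<le> 1 + \<bar>x\<bar> ^ 3 \<and> \<bar>x\<bar> ^ 2 \<le> 1 + \<bar>x\<bar> ^ 3"
    proof cases
      case 1
      moreover have "\<bar>x\<bar> ^ 2 \<le> 1" using 1 by (simp add: abs_square_le_1)
      moreover have "\<bar>x\<bar> ^ 3 \<ge> 0" by simp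
      ultimately show ?thesis by linarith
    next
      case 2
      thus ?thesis using power_increasing[of 1 3 "\<bar>x\<bar>"] power_increasing[of 2 3 "\<bar>x\<bar>"] by simp
    qed
    thus "\<bar>x\<bar> \<le> 1 + \<bar>x\<bar> ^ 3" "x\<^sup>2 \<le> 1 + \<bar>x\<bar> ^ 3" by auto
  qed
  have i1: "integrable M (\<lambda>\<omega>. 1 + \<bar>X \<omega>\<bar> ^ 3)" using i3 by simp
  show "integrable M X" by (rule Bochner_Integration.integrable_bound[OF i1 X]) (use cube in auto)
  show "integrable M (\<lambda>\<omega>. (X \<omega>)\<^sup>2)"
    by (rule Bochner_Integration.integrable_bound[OF i1]) (use X cube in auto)
  show "(\<integral>\<omega>. X \<omega> \<partial>M) = 0"
    using s integral_distr[OF X, of "\<lambda>y. y"] by (simp add: std3_def)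
  show "(\<integral>\<omega>. (X \<omega>)\<^sup>2 \<partial>M) = 1"
    using s integral_distr[OF X, of "\<lambda>y. y\<^sup>2"] by (simp add: std3_def)
qed

lemma indep_linear_second_moment:
  fixes \<xi> :: "nat \<Rightarrow> 'w \<Rightarrow> real"
  assumes M: "prob_space M" and I: "finite I"
    and \<xi>: "prob_space.indep_vars M (\<lambda>_. borel) \<xi> I" "\<And>i. i \<in> I \<Longrightarrow> std3 (distr M borel (\<xi> i)) m"
  shows "integrable M (\<lambda>\<omega>. (\<Sum>i\<in>I. \<xi> i \<omega> * c i)\<^sup>2)" "(\<integral>\<omega>. (\<Sum>i\<in>I. \<xi> i \<omega> * c i)\<^sup>2 \<partial>M) = (\<Sum>i\<in>I. (c i)\<^sup>2)"
proof -
  interpret prob_space M by fact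
  have rv: "\<xi> i \<in> borel_measurable M" if "i \<in> I" for i using \<xi>(1) that unfolding indep_vars_def2 by simp
  note mom = std3_moments[OF M rv \<xi>(2)]
  have ind: "indep_vars (\<lambda>_. borel) (\<lambda>i \<omega>. \<xi> i \<omega> * c i) I"
    by (rule indep_vars_compose2[OF \<xi>(1)]) simp
  have "integrable M (\<lambda>\<omega>. (\<Sum>i\<in>J. \<xi> i \<omega> * c i)\<^sup>2) \<and> (\<integral>\<omega>. (\<Sum>i\<in>J. \<xi> i \<omega> * c i)\<^sup>2 \<partial>M) = (\<Sum>i\<in>J. (c i)\<^sup>2)"
    if "J \<subseteq> I" for J
    using finite_subset[OF that I] that
  proof (induction J rule: finite_induct)
    case (insert k J)
    define Z where "Z = (\<lambda>\<omega>. \<Sum>i\<in>J. \<xi> i \<omega> * c i)"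
    define U where "U = (\<lambda>\<omega>. \<xi> k \<omega> * c k)"
    have k: "k \<in> I" and J: "J \<subseteq> I" using insert.prems by auto
    have "indep_var borel ((\<lambda>i \<omega>. \<xi> i \<omega> * c i) k) borel (\<lambda>\<omega>. \<Sum>i\<in>J. \<xi> i \<omega> * c i)"
      by (rule indep_vars_sum[OF insert.hyps(1,2) indep_vars_subset[OF ind insert.prems]])
    hence iv: "indep_var borel U borel Z" by (simp add: U_def Z_def)
    have iU: "integrable M U" "integrable M (\<lambda>\<omega>. (U \<omega>)\<^sup>2)"
      using mom(1,2)[OF k k] by (auto simp: U_def power_mult_distrib)
    have iZ: "integrable M Z" unfolding Z_def using mom(1) J by (intro Bochner_Integration.integrable_sum integrable_mult_left) auto
    have iZ2: "integrable M (\<lambda>\<omega>. (Z \<omega>)\<^sup>2)" "(\<integral>\<omega>. (Z \<omega>)\<^sup>2 \<partial>M) = (\<Sum>i\<in>J. (c i)\<^sup>2)"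
      using insert.IH J by (auto simp: Z_def)
    have iUZ: "integrable M (\<lambda>\<omega>. 2 * (U \<omega> * Z \<omega>))" by (intro integrable_mult_right indep_var_integrable[OF iv iU(1) iZ])
    have UZ: "(\<integral>\<omega>. U \<omega> * Z \<omega> \<partial>M) = 0"
      using indep_var_lebesgue_integral[OF iv iU(1) iZ] mom(3)[OF k k] by (simp add: U_def)
    have e: "(\<Sum>i\<in>insert k J. \<xi> i \<omega> * c i)\<^sup>2 = (U \<omega>)\<^sup>2 + 2 * (U \<omega> * Z \<omega>) + (Z \<omega>)\<^sup>2" for \<omega>
      using insert.hyps by (simp add: U_def Z_def power2_sum)
    have "(\<integral>\<omega>. (U \<omega>)\<^sup>2 + 2 * (U \<omega> * Z \<omega>) + (Z \<omega>)\<^sup>2 \<partial>M) = (\<integral>\<omega>. (U \<omega>)\<^sup>2 \<partial>M) + (\<integral>\<omega>. 2 * (U \<omega> * Z \<omega>) \<partial>M) + (\<integral>\<omega>. (Z \<omega>)\<^sup>2 \<partial>M)"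
      using iU(2) iUZ iZ2(1) by (simp only: Bochner_Integration.integral_add Bochner_Integration.integrable_add)
    also have "(\<integral>\<omega>. (U \<omega>)\<^sup>2 \<partial>M) = (c k)\<^sup>2" using mom(4)[OF k k] by (simp add: U_def power_mult_distrib)
    finally show ?case unfolding e using iU(2) iUZ iZ2 UZ insert.hyps by simp
  qed simp
  from this[of I] show "integrable M (\<lambda>\<omega>. (\<Sum>i\<in>I. \<xi> i \<omega> * c i)\<^sup>2)" "(\<integral>\<omega>. (\<Sum>i\<in>I. \<xi> i \<omega> * c i)\<^sup>2 \<partial>M) = (\<Sum>i\<in>I. (c i)\<^sup>2)"
    by auto
qed

text \<open>The bound on the distance of the characteristic functions; \<open>cb\<close> bounds the coefficients of the
  individual errors, \<open>pr\<close> the probability of the exceptional event.\<close>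

definition cf_error :: "real \<Rightarrow> real \<Rightarrow> real \<Rightarrow> real \<Rightarrow> real \<Rightarrow> real \<Rightarrow> real \<Rightarrow> real \<Rightarrow> real \<Rightarrow> real \<Rightarrow> real" where
  "cf_error t k p a A R e0 cb m3 pr =
    (let m = sqrt (2 * ln (A * a)); Ep = (m + (R + 1)) * exp ((R + 1) * m + (R + 1)\<^sup>2 / 2);
         s = A\<^sup>2 * a; P = 70000 * (s / a) * (ln s)\<^sup>2
     in 2 * pr + 2 * (p / R\<^sup>2)
       + (2 * (exp 1 * sqrt (ln s)) + 2 * m3 * (70000 * s * (ln s)\<^sup>2 * cb))
         * ((4 + \<bar>t\<bar>) * (k / (A * a)) + 2 * \<bar>t\<bar> * Ep * (R * (sqrt k * sqrt p) + k * e0) / a)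
       + 2 * m3 * ((\<bar>t\<bar> * P + 3 * t\<^sup>2 * P\<^sup>2 + \<bar>t\<bar> ^ 3 * P ^ 3) * (k ^ 3 * cb)))"

lemma markov_square_sum:
  fixes Z :: "nat \<Rightarrow> 'w \<Rightarrow> real"
  assumes M: "prob_space M" and A: "finite A" and R: "R > 0"
    and i: "\<And>k. k \<in> A \<Longrightarrow> integrable M (\<lambda>\<omega>. (Z k \<omega>)\<^sup>2)" and e: "\<And>k. k \<in> A \<Longrightarrow> (\<integral>\<omega>. (Z k \<omega>)\<^sup>2 \<partial>M) \<le> 1"
  shows "measure M {\<omega> \<in> space M. \<not> (\<Sum>k\<in>A. (Z k \<omega>)\<^sup>2) \<le> R\<^sup>2} \<le> real (card A) / R\<^sup>2"
proof -
  interpret prob_space M by fact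
  have ii: "integrable M (\<lambda>\<omega>. \<Sum>k\<in>A. (Z k \<omega>)\<^sup>2)" using i by (intro Bochner_Integration.integrable_sum) auto
  have "measure M {\<omega> \<in> space M. \<not> (\<Sum>k\<in>A. (Z k \<omega>)\<^sup>2) \<le> R\<^sup>2} \<le> measure M {\<omega> \<in> space M. (\<Sum>k\<in>A. (Z k \<omega>)\<^sup>2) \<ge> R\<^sup>2}"
    using ii by (intro finite_measure_mono) auto
  also have "\<dots> \<le> (\<integral>\<omega>. (\<Sum>k\<in>A. (Z k \<omega>)\<^sup>2) \<partial>M) / R\<^sup>2"
    by (rule integral_Markov_inequality_measure[OF ii, where A = "{}"]) (use R in \<open>auto intro!: AE_I2 sum_nonneg\<close>)
  also have "(\<integral>\<omega>. (\<Sum>k\<in>A. (Z k \<omega>)\<^sup>2) \<partial>M) = (\<Sum>k\<in>A. (\<integral>\<omega>. (Z k \<omega>)\<^sup>2 \<partial>M))"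
    using i by (intro Bochner_Integration.integral_sum) auto
  also have "(\<Sum>k\<in>A. (\<integral>\<omega>. (Z k \<omega>)\<^sup>2 \<partial>M)) \<le> real (card A)" using sum_mono[OF e, of A "\<lambda>k. k"] by simp
  finally show ?thesis by (simp add: divide_right_mono)
qed

context weighted_design
begin

lemma noise_second_moment:
  assumes M: "prob_space M" and \<xi>: "prob_space.indep_vars M (\<lambda>_. borel) \<xi> {1..n}"
    "\<And>i. i \<in> {1..n} \<Longrightarrow> std3 (distr M borel (\<xi> i)) m3"
  shows "integrable M (\<lambda>\<omega>. (noise (\<lambda>i. \<xi> i \<omega>) h)\<^sup>2)" "(\<integral>\<omega>. (noise (\<lambda>i. \<xi> i \<omega>) h)\<^sup>2 \<partial>M) = ip h h"
proof -
  note sm = indep_linear_second_moment[OF M _ \<xi>, of "\<lambda>i. sqrt (w (X i) / real n) * h (X i)"]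
  show "integrable M (\<lambda>\<omega>. (noise (\<lambda>i. \<xi> i \<omega>) h)\<^sup>2)" unfolding noise_def by (rule sm(1)) simp
  have "(\<integral>\<omega>. (noise (\<lambda>i. \<xi> i \<omega>) h)\<^sup>2 \<partial>M) = (\<Sum>i=1..n. (sqrt (w (X i) / real n) * h (X i))\<^sup>2)"
    unfolding noise_def by (rule sm(2)) simp
  also have "\<dots> = ip h h"
    unfolding design_inner_def sum_distrib_left
  proof (rule sum.cong[OF refl])
    fix i assume "i \<in> {1..n}"
    hence "0 \<le> w (X i) / real n" using less_imp_le[OF wpos[of i]] by simp
    hence "(sqrt (w (X i) / real n))\<^sup>2 = w (X i) / real n" by (rule real_sqrt_pow2)
    thus "(sqrt (w (X i) / real n) * h (X i))\<^sup>2 = 1 / real n * (w (X i) * h (X i) * h (X i))"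
      by (simp only: power_mult_distrib) (simp add: power2_eq_square)
  qed
  finally show "(\<integral>\<omega>. (noise (\<lambda>i. \<xi> i \<omega>) h)\<^sup>2 \<partial>M) = ip h h" .
qed

text \<open>Four events are excluded: an estimate of \<theta> or of a(\<eta>) far from its target,
  large noise in all K + p directions (radius \<Lambda>), and large noise in the last p directions
  (radius R). Two radii are needed: \<Lambda> must exceed the order sqrt K but only multiplies small
  stability errors, whereas R enters the exponent of Ep and has to grow more slowly than sqrt (ln
  K).\<close>

lemma statistic_comparison:
  fixes Y :: "nat \<Rightarrow> 'w \<Rightarrow> real" and zh :: "'w \<Rightarrow> 'x \<Rightarrow> real" and z :: "'x \<Rightarrow> real" and b1 b2 :: "real \<Rightarrow> real"
    and f :: "nat \<Rightarrow> 'x \<Rightarrow> real" and t \<theta> a0 :: real and K p :: nat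
  defines "v' \<equiv> \<lambda>\<omega> j. gram_schmidt_fn (design_inner n X (\<lambda>x. b2 (zh \<omega> x))) f (p + j - 1)"
  defines "\<xi> \<equiv> \<lambda>i \<omega>. (Y i \<omega> - b1 (z (X i))) / sqrt (a0 * w (X i))"
  assumes M: "prob_space M" and n: "n > 0" and a0: "a0 > 0"
    and wz: "\<And>i. i \<in> {1..n} \<Longrightarrow> w (X i) = b2 (z (X i))"
    and \<delta>: "\<delta> > 0" "\<And>i. i \<in> {1..n} \<Longrightarrow> \<delta> \<le> w (X i)" and wm: "\<And>i. i \<in> {1..n} \<Longrightarrow> w (X i) \<le> wm"
    and d: "\<And>i s. i \<in> {1..n} \<Longrightarrow> \<bar>s\<bar> \<le> r \<Longrightarrow> (b1 has_real_derivative b2 (z (X i) + s)) (at (z (X i) + s))"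
    and lip: "\<And>i s. i \<in> {1..n} \<Longrightarrow> \<bar>s\<bar> \<le> r \<Longrightarrow> \<bar>b2 (z (X i) + s) - b2 (z (X i))\<bar> \<le> L * \<bar>s\<bar>" and L: "L \<ge> 0"
    and indep: "prob_space.indep_vars M (\<lambda>_. borel) Y {1..n}"
    and std: "\<And>i. i \<in> {1..n} \<Longrightarrow> std3 (distr M borel (\<xi> i)) m3" and N: "std3 std_normal_distribution m3"
    and orth: "\<And>j l. j \<in> {1..K} \<Longrightarrow> l \<in> {1..K} \<Longrightarrow> ip (gs f (p + j - 1)) (gs f (p + l - 1)) = (if j = l then 1 else 0)"
    and \<kappa>: "\<kappa> > 0" "\<And>d. \<kappa> * (\<Sum>l<K. (d l)\<^sup>2) \<le> (1 / real n) * (\<Sum>i=1..n. (\<Sum>l<K. d l * f (p + l) (X i))\<^sup>2)"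
    and Bk: "\<And>i l. i \<in> {1..n} \<Longrightarrow> l < K \<Longrightarrow> \<bar>f (p + l) (X i)\<bar> \<le> Bk" "Bk \<ge> 0"
    and zh: "\<And>\<omega> i. \<omega> \<in> space M \<Longrightarrow> i \<in> {1..n} \<Longrightarrow> \<bar>zh \<omega> (X i) - z (X i)\<bar> \<le> \<Gamma> * dev \<omega>" and \<Gamma>: "\<Gamma> \<ge> 0"
    and hat: "AE \<omega> in M. \<forall>j\<in>{1..K}. design_inner n X (\<lambda>x. b2 (zh \<omega> x)) (v' \<omega> j) (v' \<omega> j) = 1 \<and>
        (\<Sum>i=1..n. v' \<omega> j (X i) * (zh \<omega> (X i) - z (X i)) * b2 (zh \<omega> (X i))) = 0"
    and rv[measurable]: "dev \<in> borel_measurable M" "ah \<in> borel_measurable M" "S \<in> borel_measurable M"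
    and S: "\<And>\<omega>. \<omega> \<in> space M \<Longrightarrow> S \<omega> = (\<Sum>j=1..K. exp (real n * ((1 / real n) * (\<Sum>i=1..n. (Y i \<omega> - b1 (zh \<omega> (X i))) * v' \<omega> j (X i)))\<^sup>2 / (2 * ah \<omega>))) / a"
    and \<tau>: "\<Gamma> * \<tau> \<le> r" "L * (\<Gamma> * \<tau>) \<le> \<delta> / 2" "\<tau> \<ge> 0" and \<sigma>: "\<sigma> \<le> a0 / 2"
    and \<Lambda>: "\<Lambda> > 0"
    and pr: "measure M {\<omega> \<in> space M. \<not> dev \<omega> \<le> \<tau>} \<le> p1" "measure M {\<omega> \<in> space M. \<not> \<bar>ah \<omega> - a0\<bar> \<le> \<sigma>} \<le> p2"
    and a: "a > 0" "A \<ge> 1" "A * a \<ge> 1" and R: "R > 0" "0 \<le> e0" "e0 \<le> 1" and ls: "ln (A\<^sup>2 * a) \<ge> 1"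
  defines "T \<equiv> sqrt (real n) * (2 * L * (\<Gamma> * \<tau>)\<^sup>2) * sqrt (2 / \<delta>) / sqrt a0"
  assumes e0: "4 * (L * (\<Gamma> * \<tau>) / \<delta>) * \<Lambda> + T + 2 * \<sigma> / a0 * (3 * \<Lambda> + T) \<le> e0"
  shows "\<bar>(\<integral>\<omega>. cos (t * S \<omega> + \<theta>) \<partial>M) - (\<integral>y. cos (t * (\<Sum>j\<in>{1..K}. exp_half_sq (y j) / a) + \<theta>) \<partial>std_gauss {1..K})\<bar>
    \<le> cf_error t (real K) (real p) a A R e0 (sqrt (wm / real n) * (Bk * sqrt (real K) / sqrt (\<kappa> * \<delta>))) m3
        (p1 + p2 + (real (K + p) / \<Lambda>\<^sup>2 + real p / R\<^sup>2))"
proof -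
  interpret P: prob_space M by fact
  define cb where "cb = sqrt (wm / real n) * (Bk * sqrt (real K) / sqrt (\<kappa> * \<delta>))"
  have wm0: "wm \<ge> 0" using wm[of 1] wpos[of 1] n by force
  have cb0: "cb \<ge> 0" unfolding cb_def using wm0 Bk(2) \<kappa>(1) \<delta>(1) by simp
  have Yrv: "Y i \<in> borel_measurable M" if "i \<in> {1..n}" for i using indep that unfolding P.indep_vars_def2 by simp
  have \<xi>rv: "\<xi> i \<in> borel_measurable M" if "i \<in> {1..n}" for i using Yrv[OF that] unfolding \<xi>_def by measurable
  have \<xi>i: "prob_space.indep_vars M (\<lambda>_. borel) \<xi> {1..n}"
    unfolding \<xi>_def by (rule P.indep_vars_compose2[OF indep]) measurable
  define Z where "Z = (\<lambda>k \<omega>. noise (\<lambda>i. \<xi> i \<omega>) (ob f p K k))"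
  have Zm[measurable]: "Z k \<in> borel_measurable M" for k
    unfolding Z_def noise_def using \<xi>rv by (intro borel_measurable_sum borel_measurable_times) auto
  have Z2: "integrable M (\<lambda>\<omega>. (Z k \<omega>)\<^sup>2)" "(\<integral>\<omega>. (Z k \<omega>)\<^sup>2 \<partial>M) \<le> 1" for k
    unfolding Z_def using noise_second_moment[OF M \<xi>i std, of "ob f p K k"] gs_norm_le[of "reorder f p K" k] by auto
  define E1 where "E1 = {\<omega> \<in> space M. \<not> dev \<omega> \<le> \<tau>}"
  define E2 where "E2 = {\<omega> \<in> space M. \<not> \<bar>ah \<omega> - a0\<bar> \<le> \<sigma>}"
  define E3 where "E3 = {\<omega> \<in> space M. \<not> (\<Sum>k\<in>{..<K+p}. (Z k \<omega>)\<^sup>2) \<le> \<Lambda>\<^sup>2}"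
  define E4 where "E4 = {\<omega> \<in> space M. \<not> (\<Sum>k\<in>{K..<K+p}. (Z k \<omega>)\<^sup>2) \<le> R\<^sup>2}"
  have Em[measurable]: "E1 \<in> sets M" "E2 \<in> sets M" "E3 \<in> sets M" "E4 \<in> sets M"
    unfolding E1_def E2_def E3_def E4_def by measurable
  define E where "E = space M - ((E1 \<union> E2) \<union> (E3 \<union> E4))"
  have EM: "E \<in> sets M" unfolding E_def by measurable
  have "measure M (space M - E) \<le> measure M ((E1 \<union> E2) \<union> (E3 \<union> E4))"
    by (rule P.finite_measure_mono) (auto simp: E_def)
  also have "\<dots> \<le> (measure M E1 + measure M E2) + (measure M E3 + measure M E4)"
  proof -
    have sub: "measure M (U \<union> V) \<le> measure M U + measure M V" if "U \<in> sets M" "V \<in> sets M" for U V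
      using measure_subadditive[OF that] by (auto simp: P.emeasure_finite)
    have "E1 \<union> E2 \<in> sets M" "E3 \<union> E4 \<in> sets M" using Em by auto
    from sub[OF this] sub[OF Em(1,2)] sub[OF Em(3,4)] show ?thesis by linarith
  qed
  also have "\<dots> \<le> p1 + p2 + (real (K + p) / \<Lambda>\<^sup>2 + real p / R\<^sup>2)"
  proof -
    have "measure M E3 \<le> real (card {..<K+p}) / \<Lambda>\<^sup>2"
      unfolding E3_def by (rule markov_square_sum[OF M _ \<Lambda>(1) Z2]) simp
    moreover have "measure M E4 \<le> real (card {K..<K+p}) / R\<^sup>2"
      unfolding E4_def by (rule markov_square_sum[OF M _ R(1) Z2]) simp
    ultimately show ?thesis using pr unfolding E1_def[symmetric] E2_def[symmetric] by simp
  qed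
  finally have PE: "measure M (space M - E) \<le> p1 + p2 + (real (K + p) / \<Lambda>\<^sup>2 + real p / R\<^sup>2)" .
  define c where "c = ncoef f p K"
  define dd where "dd = (\<lambda>j. R * sqrt (\<Sum>i\<in>{n+1..n+p}. (c i j)\<^sup>2) + e0)"
  have good: "AE \<omega> in M. \<omega> \<in> E \<longrightarrow> (\<exists>W. S \<omega> = (\<Sum>j\<in>{1..K}. exp_half_sq (W j) / a) \<and>
        (\<forall>j\<in>{1..K}. \<bar>W j - (\<Sum>i\<in>{1..n}. \<xi> i \<omega> * c i j)\<bar> \<le> dd j))"
    using hat AE_space
  proof eventually_elim
    case (elim \<omega>)
    \<comment> \<open>The signed square root behind each exponent, so that the j-th summand is
      \<open>exp_half_sq (W j)\<close>; this needs a positive ah, which holds on E because \<sigma>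
      \<le> a0 / 2.\<close>
    define W where "W = (\<lambda>j. sqrt (real n) * ((1 / real n) * (\<Sum>i=1..n. (Y i \<omega> - b1 (zh \<omega> (X i))) * v' \<omega> j (X i))) / sqrt (ah \<omega>))"
    show ?case
    proof (intro impI exI conjI ballI)
      assume E: "\<omega> \<in> E"
      hence e: "dev \<omega> \<le> \<tau>" "\<bar>ah \<omega> - a0\<bar> \<le> \<sigma>" "(\<Sum>k\<in>{..<K+p}. (Z k \<omega>)\<^sup>2) \<le> \<Lambda>\<^sup>2" "(\<Sum>k\<in>{K..<K+p}. (Z k \<omega>)\<^sup>2) \<le> R\<^sup>2"
        unfolding E_def E1_def E2_def E3_def E4_def by auto
      have ah0: "ah \<omega> > 0" using e(2) \<sigma> a0 by linarith
      have "real n * x\<^sup>2 / (2 * ah \<omega>) = (sqrt (real n) * x / sqrt (ah \<omega>))\<^sup>2 / 2" for x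
        using ah0 by (simp add: power_mult_distrib power_divide)
      hence "exp (real n * x\<^sup>2 / (2 * ah \<omega>)) = exp_half_sq (sqrt (real n) * x / sqrt (ah \<omega>))" for x
        by (simp add: exp_half_sq_def)
      thus "S \<omega> = (\<Sum>j\<in>{1..K}. exp_half_sq (W j) / a)"
        using S[of \<omega>] elim(2) by (simp only: W_def sum_divide_distrib)
      fix j assume j: "j \<in> {1..K}"
      have zt: "\<bar>zh \<omega> (X i) - z (X i)\<bar> \<le> \<Gamma> * \<tau>" if "i \<in> {1..n}" for i
        using zh[OF elim(2) that] mult_left_mono[OF e(1) \<Gamma>] by linarith
      have "\<bar>W j - noise (\<lambda>i. \<xi> i \<omega>) (gs f (p + j - 1))\<bar> \<le> 4 * (L * (\<Gamma> * \<tau>) / \<delta>) * \<Lambda> + T + 2 * \<sigma> / a0 * (3 * \<Lambda> + T)"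
        unfolding W_def T_def v'_def \<xi>_def
        by (rule score_deviation[where r = r and z = z and \<Lambda> = \<Lambda> and p = p and K = K])
          (use n a0 j wz \<delta> d lip L zt \<tau> \<Gamma> orth[OF j j] elim(1)[rule_format, OF j] e(2,3) \<sigma> \<Lambda> in \<open>auto simp: v'_def Z_def \<xi>_def\<close>)
      moreover have "\<bar>noise (\<lambda>i. \<xi> i \<omega>) (gs f (p + j - 1)) - (\<Sum>i\<in>{1..n}. \<xi> i \<omega> * c i j)\<bar> \<le> R * sqrt (\<Sum>i\<in>{n+1..n+p}. (c i j)\<^sup>2)"
        unfolding c_def by (rule noise_tail_bound[OF j]) (use R e(4) in \<open>auto simp: Z_def\<close>)
      ultimately show "\<bar>W j - (\<Sum>i\<in>{1..n}. \<xi> i \<omega> * c i j)\<bar> \<le> dd j" using e0 unfolding dd_def by linarith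
    qed
  qed
  define m where "m = sqrt (2 * ln (A * a))"
  define Ep where "Ep = (m + (R + 1)) * exp ((R + 1) * m + (R + 1)\<^sup>2 / 2)"
  define s where "s = A\<^sup>2 * a"
  define Pc where "Pc = 70000 * (s / a) * (ln s)\<^sup>2"
  define Bd where "Bd = (4 + \<bar>t\<bar>) * (real (card {1..K}) / (A * a)) + 2 * \<bar>t\<bar> * Ep * (\<Sum>j\<in>{1..K}. dd j) / a"
  have m3: "m3 \<ge> 0"
  proof -
    have "0 \<le> (\<integral>y. \<bar>y\<bar> ^ 3 \<partial>std_normal_distribution)" by (rule Bochner_Integration.integral_nonneg) simp
    thus ?thesis using N unfolding std3_def by linarith
  qed
  have s0: "s > 0" using a by (simp add: s_def)
  have Ep0: "Ep \<ge> 0" using a R by (simp add: Ep_def m_def)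
  have main: "\<bar>(\<integral>\<omega>. cos (t * S \<omega> + \<theta>) \<partial>M) - (\<integral>y. cos (t * (\<Sum>j\<in>{1..K}. exp_half_sq (y j) / a) + \<theta>) \<partial>std_gauss {1..K})\<bar>
    \<le> 2 * measure M (space M - E) + 2 * (real (card {n+1..n+p}) / R\<^sup>2)
      + (2 * (exp 1 * sqrt (ln s)) + 2 * m3 * (70000 * s * (ln s)\<^sup>2 * cb)) * Bd
      + 2 * m3 * ((\<bar>t\<bar> * Pc + 3 * t\<^sup>2 * Pc\<^sup>2 + \<bar>t\<bar> ^ 3 * Pc ^ 3) * (real (card {1..K}) ^ 3 * cb))"
    unfolding Bd_def Ep_def m_def Pc_def s_def dd_def
  proof (rule exp_sum_comparison[OF M])
    show "\<And>j l. j \<in> {1..K} \<Longrightarrow> l \<in> {1..K} \<Longrightarrow> gram_of ({1..n} \<union> {n+1..n+p}) c j l = (if j = l then 1 else 0)"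
      unfolding c_def by (rule ncoef_gram[OF orth])
    show "\<And>i j. i \<in> {1..n} \<union> {n + 1..n + p} \<Longrightarrow> j \<notin> {1..K} \<Longrightarrow> c i j = 0" unfolding c_def ncoef_def by (simp only: if_False)
    show "\<bar>c i j\<bar> \<le> cb" if i: "i \<in> {1..n}" and j: "j \<in> {1..K}" for i j
    proof -
      have "\<bar>head f p K (gs f (p + j - 1)) (X i)\<bar> \<le> Bk * sqrt (real K) / sqrt (\<kappa> * \<delta>)"
        by (rule head_sup_bound[OF \<kappa> \<delta> Bk _ i]) (use orth[OF j j] in auto)
      moreover have "sqrt (w (X i) / real n) \<le> sqrt (wm / real n)" using wm[OF i] by (simp add: divide_right_mono)
      ultimately have "sqrt (w (X i) / real n) * \<bar>head f p K (gs f (p + j - 1)) (X i)\<bar> \<le> cb"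
        unfolding cb_def by (intro mult_mono) (use wm0 less_imp_le[OF wpos[OF i]] in auto)
      thus ?thesis using i j less_imp_le[OF wpos[OF i]] by (simp add: c_def ncoef_def abs_mult)
    qed
    show "AE \<omega> in M. \<omega> \<in> E \<longrightarrow> (\<exists>W. S \<omega> = (\<Sum>j\<in>{1..K}. exp_half_sq (W j) / a) \<and>
        (\<forall>j\<in>{1..K}. \<bar>W j - (\<Sum>i\<in>{1..n}. \<xi> i \<omega> * c i j)\<bar> \<le> R * sqrt (\<Sum>i\<in>{n+1..n+p}. (c i j)\<^sup>2) + e0))"
      using good unfolding dd_def .
  qed (use n cb0 \<xi>i std N a R EM ls in \<open>auto simp: dd_def\<close>)
  have sd: "(\<Sum>j\<in>{1..K}. dd j) \<le> R * (sqrt (real K) * sqrt (real p)) + real K * e0"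
  proof -
    have "(\<Sum>j\<in>{1..K}. dd j) = R * (\<Sum>j\<in>{1..K}. sqrt (\<Sum>i\<in>{n+1..n+p}. (c i j)\<^sup>2)) + real K * e0"
      by (simp add: dd_def sum.distrib sum_distrib_left)
    moreover have "R * (\<Sum>j\<in>{1..K}. sqrt (\<Sum>i\<in>{n+1..n+p}. (c i j)\<^sup>2)) \<le> R * (sqrt (real K) * sqrt (real p))"
      unfolding c_def using R by (intro mult_left_mono ncoef_tail_sum[OF orth]) auto
    ultimately show ?thesis by linarith
  qed
  define Bd' where "Bd' = (4 + \<bar>t\<bar>) * (real K / (A * a)) + 2 * \<bar>t\<bar> * Ep * (R * (sqrt (real K) * sqrt (real p)) + real K * e0) / a"
  have "Bd \<le> Bd'"
    unfolding Bd_def Bd'_def using sd Ep0 a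
    by (intro add_mono divide_right_mono mult_left_mono) auto
  moreover have "0 \<le> 2 * (exp 1 * sqrt (ln s)) + 2 * m3 * (70000 * s * (ln s)\<^sup>2 * cb)"
  proof -
    have "0 \<le> ln s" using ls by (simp add: s_def)
    thus ?thesis using m3 s0 cb0 by (intro add_nonneg_nonneg mult_nonneg_nonneg) simp_all
  qed
  ultimately have mono: "(2 * (exp 1 * sqrt (ln s)) + 2 * m3 * (70000 * s * (ln s)\<^sup>2 * cb)) * Bd \<le>
      (2 * (exp 1 * sqrt (ln s)) + 2 * m3 * (70000 * s * (ln s)\<^sup>2 * cb)) * Bd'" by (rule mult_left_mono)
  have err: "cf_error t (real K) (real p) a A R e0 cb m3 (p1 + p2 + (real (K + p) / \<Lambda>\<^sup>2 + real p / R\<^sup>2)) =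
      2 * (p1 + p2 + (real (K + p) / \<Lambda>\<^sup>2 + real p / R\<^sup>2)) + 2 * (real p / R\<^sup>2)
      + (2 * (exp 1 * sqrt (ln s)) + 2 * m3 * (70000 * s * (ln s)\<^sup>2 * cb)) * Bd'
      + 2 * m3 * ((\<bar>t\<bar> * Pc + 3 * t\<^sup>2 * Pc\<^sup>2 + \<bar>t\<bar> ^ 3 * Pc ^ 3) * (real K ^ 3 * cb))"
    unfolding cf_error_def Let_def Bd'_def Ep_def m_def Pc_def s_def ..
  have cards: "card {n+1..n+p} = p" "card {1..K} = K" by simp_all
  have arith: "I \<le> e" if "I \<le> 2 * P + r + y + v" "y \<le> y'" "P \<le> q" "e = 2 * q + r + y' + v" for I P r y v y' q e :: real
    using that by linarith
  show ?thesis unfolding cb_def[symmetric] by (rule arith[OF main[unfolded cards] mono PE err])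
qed

end

subsection \<open>Rates\<close>

text \<open>The parameters as functions of a real x in place of K; \<open>ac\<close>,
  \<open>Sc\<close>, \<open>Ec\<close>, \<open>Pc\<close> are a_K, s, Ep, P. Ac = (ln x)^2 is large
  enough for sqrt (ln s) * x / (Ac x * ac x) to vanish and small enough to keep Pc polylogarithmic.
  Rc = (ln x)^(1/4) tends to infinity, so that p / R^2 vanishes, while exp (R * m) stays below every
  positive power of x.\<close>

definition ac :: "real \<Rightarrow> real" where "ac x = sqrt pi / 2 * (x / sqrt (ln x))"
definition Ac :: "real \<Rightarrow> real" where "Ac x = (ln x)\<^sup>2"
definition Rc :: "real \<Rightarrow> real" where "Rc x = ln x powr (1 / 4)"
definition Sc :: "real \<Rightarrow> real" where "Sc x = (Ac x)\<^sup>2 * ac x"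
definition Ec :: "real \<Rightarrow> real" where
  "Ec x = (sqrt (2 * ln (Ac x * ac x)) + (Rc x + 1)) * exp ((Rc x + 1) * sqrt (2 * ln (Ac x * ac x)) + (Rc x + 1)\<^sup>2 / 2)"
definition Pc :: "real \<Rightarrow> real" where "Pc x = 70000 * (Sc x / ac x) * (ln (Sc x))\<^sup>2"

lemmas cdefs = ac_def Ac_def Rc_def Sc_def Ec_def Pc_def

lemma asymp_A:
  "((\<lambda>x. sqrt (ln (Sc x)) * (x / (Ac x * ac x))) \<longlongrightarrow> 0) at_top"
  "((\<lambda>x. x / (Ac x * ac x)) \<longlongrightarrow> 0) at_top"
  unfolding cdefs by real_asymp+

text \<open>m is O(sqrt (ln x)) and Rc x = (ln x)^(1/4), so the exponent is O((ln x)^(3/4)), finally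
  below ln x / 4. The power 1 / 4 is a choice below 1 / 2, since \<open>Ec\<close> is met with
  factors of size about x^(-1/2).\<close>

lemma Ec_bound: "eventually (\<lambda>x. \<bar>Ec x\<bar> \<le> \<bar>ln x * x powr (1 / 4)\<bar>) at_top"
proof -
  have 1: "eventually (\<lambda>x. 0 \<le> ln (Ac x * ac x) \<and> ln (Ac x * ac x) \<le> 2 * ln x) at_top"
    unfolding Ac_def ac_def by (intro eventually_conj; real_asymp)
  have 2: "eventually (\<lambda>x::real. 2 * sqrt (ln x) + (ln x powr (1 / 4) + 1) \<le> ln x) at_top" by real_asymp
  have 3: "eventually (\<lambda>x::real. (ln x powr (1 / 4) + 1) * (2 * sqrt (ln x)) + (ln x powr (1 / 4) + 1)\<^sup>2 / 2 \<le> 1 / 4 * ln x) at_top"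
    by real_asymp
  show ?thesis
    using 1 2 3 eventually_gt_at_top[of 1]
  proof eventually_elim
    case (elim x)
    define m where "m = sqrt (2 * ln (Ac x * ac x))"
    have "m \<le> sqrt (2\<^sup>2 * ln x)" unfolding m_def using elim(1) by (intro real_sqrt_le_mono) simp
    hence m: "0 \<le> m" "m \<le> 2 * sqrt (ln x)" using elim(1) by (simp_all add: m_def real_sqrt_mult)
    have R: "Rc x + 1 \<ge> 0" by (simp add: Rc_def add_nonneg_nonneg)
    have "(Rc x + 1) * m \<le> (Rc x + 1) * (2 * sqrt (ln x))" using m(2) R by (rule mult_left_mono)
    hence "(Rc x + 1) * m + (Rc x + 1)\<^sup>2 / 2 \<le> 1 / 4 * ln x" using elim(3) unfolding Rc_def by linarith
    hence "exp ((Rc x + 1) * m + (Rc x + 1)\<^sup>2 / 2) \<le> x powr (1 / 4)" using elim(4) by (simp add: powr_def)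
    moreover have "m + (Rc x + 1) \<le> ln x" using m(2) elim(2) unfolding Rc_def by linarith
    ultimately have "(m + (Rc x + 1)) * exp ((Rc x + 1) * m + (Rc x + 1)\<^sup>2 / 2) \<le> ln x * x powr (1 / 4)"
      using elim(4) by (intro mult_mono) auto
    moreover have "0 \<le> (m + (Rc x + 1)) * exp ((Rc x + 1) * m + (Rc x + 1)\<^sup>2 / 2)" using m(1) R by simp
    ultimately show ?case unfolding Ec_def m_def by linarith
  qed
qed

lemma Ec_dominated:
  assumes "((\<lambda>x. h x * (ln x * x powr (1 / 4))) \<longlongrightarrow> 0) at_top"
  shows "((\<lambda>x. h x * Ec x) \<longlongrightarrow> 0) at_top"
proof (rule Lim_null_comparison[OF _ tendsto_rabs_zero[OF assms]])
  show "eventually (\<lambda>x. norm (h x * Ec x) \<le> \<bar>h x * (ln x * x powr (1 / 4))\<bar>) at_top"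
    using Ec_bound
  proof eventually_elim
    case (elim x)
    from mult_left_mono[OF this abs_ge_zero[of "h x"]] show ?case by (simp only: abs_mult real_norm_def)
  qed
qed

lemma asymp_E:
  "((\<lambda>x. sqrt (ln (Sc x)) * (Rc x * sqrt x / ac x) * Ec x) \<longlongrightarrow> 0) at_top"
  "((\<lambda>x. Rc x * sqrt x / ac x * Ec x) \<longlongrightarrow> 0) at_top"
  "((\<lambda>x. sqrt (ln (Sc x)) * (x * (1 / x\<^sup>2) / ac x) * Ec x) \<longlongrightarrow> 0) at_top"
  "((\<lambda>x. x * (1 / x\<^sup>2) / ac x * Ec x) \<longlongrightarrow> 0) at_top"
proof -
  show "((\<lambda>x. sqrt (ln (Sc x)) * (Rc x * sqrt x / ac x) * Ec x) \<longlongrightarrow> 0) at_top"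
    by (rule Ec_dominated) (unfold Sc_def Ac_def ac_def Rc_def, real_asymp)
  show "((\<lambda>x. Rc x * sqrt x / ac x * Ec x) \<longlongrightarrow> 0) at_top"
    by (rule Ec_dominated) (unfold ac_def Rc_def, real_asymp)
  show "((\<lambda>x. sqrt (ln (Sc x)) * (x * (1 / x\<^sup>2) / ac x) * Ec x) \<longlongrightarrow> 0) at_top"
    by (rule Ec_dominated) (unfold Sc_def Ac_def ac_def, real_asymp)
  show "((\<lambda>x. x * (1 / x\<^sup>2) / ac x * Ec x) \<longlongrightarrow> 0) at_top"
    by (rule Ec_dominated) (unfold ac_def, real_asymp)
qed

text \<open>The exponent 21 stems from the cube of \<open>Pc\<close>, which is eventually at most
  (ln x)^7.\<close>

lemma log_power_dominated:
  fixes F :: "real \<Rightarrow> real"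
  assumes c: "c > 0" and F: "eventually (\<lambda>x. \<bar>F x\<bar> \<le> ln x ^ 21 * x powr (- c)) at_top"
  shows "(F \<longlongrightarrow> 0) at_top"
proof (rule Lim_null_comparison)
  show "eventually (\<lambda>x. norm (F x) \<le> ln x ^ 21 * x powr (- c)) at_top" using F by simp
  show "((\<lambda>x::real. ln x ^ 21 * x powr (- c)) \<longlongrightarrow> 0) at_top" using c by real_asymp
qed

lemma asymp_S:
  assumes "\<epsilon> > 0"
  shows "((\<lambda>x. Sc x * (ln (Sc x))\<^sup>2 * (x powr (- 3) * x powr (- 8 * \<epsilon>))) \<longlongrightarrow> 0) at_top"
proof (rule log_power_dominated[of "8 * \<epsilon>"])
  have "eventually (\<lambda>x. \<bar>Sc x * (ln (Sc x))\<^sup>2 * x powr (- 3)\<bar> \<le> ln x ^ 21) at_top"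
    unfolding Sc_def Ac_def ac_def by real_asymp
  thus "eventually (\<lambda>x. \<bar>Sc x * (ln (Sc x))\<^sup>2 * (x powr (- 3) * x powr (- 8 * \<epsilon>))\<bar> \<le> ln x ^ 21 * x powr (- (8 * \<epsilon>))) at_top"
  proof eventually_elim
    case (elim x)
    from mult_right_mono[OF this, of "x powr (- (8 * \<epsilon>))"] show ?case by (simp add: abs_mult mult.assoc)
  qed
qed (use assms in simp)

text \<open>The factor x^3 of the row sums cancels against x powr (-3). What remains is a power of
  ln x against x powr (-8 * \<epsilon>), the margin left by A8.\<close>

lemma asymp_P_power:
  assumes "\<epsilon> > 0" "i \<le> 3"
  shows "((\<lambda>x. Pc x ^ i * (x ^ 3 * (x powr (- 3) * x powr (- 8 * \<epsilon>)))) \<longlongrightarrow> 0) at_top"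
proof (rule log_power_dominated[of "8 * \<epsilon>"])
  have "eventually (\<lambda>x. 0 \<le> Pc x \<and> Pc x \<le> ln x ^ 7) at_top"
    unfolding Pc_def Sc_def Ac_def ac_def by (intro eventually_conj; real_asymp)
  moreover have "eventually (\<lambda>x::real. ln x \<ge> 1) at_top" by real_asymp
  ultimately show "eventually (\<lambda>x. \<bar>Pc x ^ i * (x ^ 3 * (x powr (- 3) * x powr (- 8 * \<epsilon>)))\<bar> \<le> ln x ^ 21 * x powr (- (8 * \<epsilon>))) at_top"
    using eventually_gt_at_top[of 0]
  proof eventually_elim
    case (elim x)
    have "x ^ 3 * x powr (- 3) = 1" using elim(3) by (simp add: powr_minus_divide)
    hence one: "x ^ 3 * (x powr (- 3) * x powr (- 8 * \<epsilon>)) = x powr (- (8 * \<epsilon>))" by (simp flip: mult.assoc)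
    have "Pc x ^ i \<le> (ln x ^ 7) ^ i" using elim(1) by (intro power_mono) auto
    also have "\<dots> \<le> ln x ^ 21"
      unfolding power_mult[symmetric] using elim(2) assms(2) by (intro power_increasing) auto
    finally have "Pc x ^ i * x powr (- (8 * \<epsilon>)) \<le> ln x ^ 21 * x powr (- (8 * \<epsilon>))" by (rule mult_right_mono) simp
    moreover have "0 \<le> Pc x ^ i" using elim(1) by simp
    ultimately show ?case unfolding one by (simp add: abs_mult)
  qed
qed (use assms in simp)

lemma asymp_P:
  assumes "\<epsilon> > 0"
  shows "((\<lambda>x. Pc x * (x ^ 3 * (x powr (- 3) * x powr (- 8 * \<epsilon>)))) \<longlongrightarrow> 0) at_top"
    "((\<lambda>x. (Pc x)\<^sup>2 * (x ^ 3 * (x powr (- 3) * x powr (- 8 * \<epsilon>)))) \<longlongrightarrow> 0) at_top"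
    "((\<lambda>x. Pc x ^ 3 * (x ^ 3 * (x powr (- 3) * x powr (- 8 * \<epsilon>)))) \<longlongrightarrow> 0) at_top"
  using asymp_P_power[OF assms, of 1] asymp_P_power[OF assms, of 2] asymp_P_power[OF assms, of 3] by simp_all

lemma parameters_eventually:
  "eventually (\<lambda>x. ac x > 0 \<and> Ac x \<ge> 1 \<and> Ac x * ac x \<ge> 1 \<and> Rc x > 0 \<and> 1 / x\<^sup>2 \<le> 1 \<and> ln (Sc x) \<ge> 1) at_top"
  unfolding cdefs by (intro eventually_conj; real_asymp)

text \<open>The error is expanded into products of sequences tending to 0. The factor l n = sqrt (ln
  s) is unbounded, so each of its products has its own limit; all products with cb are dominated by
  the assumed rate.\<close>

lemma cf_error_tendsto_0:
  fixes k cb pr :: "nat \<Rightarrow> real"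
  assumes k: "filterlim k at_top sequentially" and pr: "pr \<longlonglongrightarrow> 0" and \<epsilon>: "\<epsilon> > 0"
    and cb: "eventually (\<lambda>n. 0 \<le> cb n \<and> cb n \<le> C * (k n powr (- 3) * k n powr (- 8 * \<epsilon>))) sequentially"
  shows "(\<lambda>n. cf_error t (k n) p (ac (k n)) (Ac (k n)) (Rc (k n)) (1 / (k n)\<^sup>2) (cb n) m3 (pr n)) \<longlonglongrightarrow> 0"
proof -
  have lim: "(\<lambda>n. F (k n)) \<longlonglongrightarrow> 0" if "(F \<longlongrightarrow> 0) at_top" for F :: "real \<Rightarrow> real"
    using filterlim_compose[OF that k] .
  have ev: "eventually (\<lambda>n. k n > 0 \<and> ac (k n) > 0 \<and> Ac (k n) \<ge> 1 \<and> Ac (k n) * ac (k n) \<ge> 1 \<and> Rc (k n) > 0 \<and> 1 / (k n)\<^sup>2 \<le> 1 \<and> ln (Sc (k n)) \<ge> 1) sequentially"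
    using eventually_compose_filterlim[OF eventually_conj[OF eventually_gt_at_top[of 0] parameters_eventually] k] by simp
  have dom: "(\<lambda>n. F (k n) * cb n) \<longlonglongrightarrow> 0"
    if F: "((\<lambda>x. F x * (x powr (- 3) * x powr (- 8 * \<epsilon>))) \<longlongrightarrow> 0) at_top" for F :: "real \<Rightarrow> real"
  proof (rule Lim_null_comparison)
    show "eventually (\<lambda>n. norm (F (k n) * cb n) \<le> \<bar>C\<bar> * \<bar>F (k n) * (k n powr (- 3) * k n powr (- 8 * \<epsilon>))\<bar>) sequentially"
      using cb
    proof eventually_elim
      case (elim n)
      have "C * (k n powr (- 3) * k n powr (- 8 * \<epsilon>)) \<le> \<bar>C\<bar> * (k n powr (- 3) * k n powr (- 8 * \<epsilon>))"
        by (rule mult_right_mono) auto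
      hence "\<bar>cb n\<bar> \<le> \<bar>C\<bar> * (k n powr (- 3) * k n powr (- 8 * \<epsilon>))" using elim by linarith
      hence "\<bar>F (k n)\<bar> * \<bar>cb n\<bar> \<le> \<bar>F (k n)\<bar> * (\<bar>C\<bar> * (k n powr (- 3) * k n powr (- 8 * \<epsilon>)))" by (rule mult_left_mono) simp
      thus ?case by (simp add: abs_mult mult_ac)
    qed
    show "(\<lambda>n. \<bar>C\<bar> * \<bar>F (k n) * (k n powr (- 3) * k n powr (- 8 * \<epsilon>))\<bar>) \<longlonglongrightarrow> 0"
      using tendsto_mult_left[OF tendsto_rabs_zero[OF lim[OF F]], of "\<bar>C\<bar>"] by simp
  qed
  define q1 where "q1 = (\<lambda>n. Sc (k n) * (ln (Sc (k n)))\<^sup>2 * cb n)"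
  define l where "l = (\<lambda>n. sqrt (ln (Sc (k n))))"
  define q2 where "q2 = (\<lambda>n. k n / (Ac (k n) * ac (k n)))"
  define q3 where "q3 = (\<lambda>n. Rc (k n) * sqrt (k n) / ac (k n) * Ec (k n))"
  define q4 where "q4 = (\<lambda>n. k n * (1 / (k n)\<^sup>2) / ac (k n) * Ec (k n))"
  have q1: "q1 \<longlonglongrightarrow> 0" unfolding q1_def by (rule dom[OF asymp_S[OF \<epsilon>]])
  have q2: "q2 \<longlonglongrightarrow> 0" "(\<lambda>n. l n * q2 n) \<longlonglongrightarrow> 0" unfolding q2_def l_def using lim[OF asymp_A(2)] lim[OF asymp_A(1)] by auto
  have q3: "q3 \<longlonglongrightarrow> 0" "(\<lambda>n. l n * q3 n) \<longlonglongrightarrow> 0" unfolding q3_def l_def using lim[OF asymp_E(2)] lim[OF asymp_E(1)] by (simp_all only: mult.assoc)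
  have q4: "q4 \<longlonglongrightarrow> 0" "(\<lambda>n. l n * q4 n) \<longlonglongrightarrow> 0" unfolding q4_def l_def using lim[OF asymp_E(4)] lim[OF asymp_E(3)] by (simp_all only: mult.assoc)
  have pp: "(\<lambda>n. Pc (k n) * ((k n) ^ 3 * cb n)) \<longlonglongrightarrow> 0" "(\<lambda>n. (Pc (k n))\<^sup>2 * ((k n) ^ 3 * cb n)) \<longlonglongrightarrow> 0"
    "(\<lambda>n. Pc (k n) ^ 3 * ((k n) ^ 3 * cb n)) \<longlonglongrightarrow> 0"
    using dom[of "\<lambda>x. Pc x * x ^ 3"] dom[of "\<lambda>x. (Pc x)\<^sup>2 * x ^ 3"] dom[of "\<lambda>x. Pc x ^ 3 * x ^ 3"] asymp_P[OF \<epsilon>]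
    by (simp_all add: mult.assoc)
  have R: "(\<lambda>n. p / (Rc (k n))\<^sup>2) \<longlonglongrightarrow> 0"
  proof -
    have "((\<lambda>x. 1 / (Rc x)\<^sup>2) \<longlongrightarrow> 0) at_top" unfolding cdefs by real_asymp
    from tendsto_mult_left[OF lim[OF this], of p] show ?thesis by simp
  qed
  define D where "D = (\<lambda>n. 2 * pr n + 2 * (p / (Rc (k n))\<^sup>2)
    + ((2 * exp 1 * (4 + \<bar>t\<bar>)) * (l n * q2 n) + (4 * exp 1 * \<bar>t\<bar>) * (sqrt p * (l n * q3 n) + l n * q4 n)
      + (2 * m3 * 70000 * (4 + \<bar>t\<bar>)) * (q1 n * q2 n) + (4 * m3 * 70000 * \<bar>t\<bar>) * (q1 n * (sqrt p * q3 n + q4 n)))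
    + (2 * m3) * (\<bar>t\<bar> * (Pc (k n) * ((k n) ^ 3 * cb n)) + 3 * t\<^sup>2 * ((Pc (k n))\<^sup>2 * ((k n) ^ 3 * cb n)) + \<bar>t\<bar> ^ 3 * (Pc (k n) ^ 3 * ((k n) ^ 3 * cb n))))"
  have "D \<longlonglongrightarrow> 2 * 0 + 2 * 0
    + ((2 * exp 1 * (4 + \<bar>t\<bar>)) * 0 + (4 * exp 1 * \<bar>t\<bar>) * (sqrt p * 0 + 0)
      + (2 * m3 * 70000 * (4 + \<bar>t\<bar>)) * (0 * 0) + (4 * m3 * 70000 * \<bar>t\<bar>) * (0 * (sqrt p * 0 + 0)))
    + (2 * m3) * (\<bar>t\<bar> * 0 + 3 * t\<^sup>2 * 0 + \<bar>t\<bar> ^ 3 * 0)"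
    unfolding D_def by (intro tendsto_add tendsto_mult tendsto_const pr R q1 q2 q3 q4 pp)
  hence "D \<longlonglongrightarrow> 0" by simp
  moreover have Deq: "cf_error t (k n) p (ac (k n)) (Ac (k n)) (Rc (k n)) (1 / (k n)\<^sup>2) (cb n) m3 (pr n) = D n" for n
  proof -
    have Bd: "(4 + \<bar>t\<bar>) * (k n / (Ac (k n) * ac (k n))) + 2 * \<bar>t\<bar> * Ec (k n) * (Rc (k n) * (sqrt (k n) * sqrt p) + k n * (1 / (k n)\<^sup>2)) / ac (k n)
        = (4 + \<bar>t\<bar>) * q2 n + 2 * \<bar>t\<bar> * (sqrt p * q3 n + q4 n)"
      by (simp add: q2_def q3_def q4_def add_divide_distrib distrib_left mult_ac)
    have "cf_error t (k n) p (ac (k n)) (Ac (k n)) (Rc (k n)) (1 / (k n)\<^sup>2) (cb n) m3 (pr n) =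
      2 * pr n + 2 * (p / (Rc (k n))\<^sup>2) + (2 * (exp 1 * l n) + 2 * m3 * (70000 * Sc (k n) * (ln (Sc (k n)))\<^sup>2 * cb n))
        * ((4 + \<bar>t\<bar>) * q2 n + 2 * \<bar>t\<bar> * (sqrt p * q3 n + q4 n))
      + 2 * m3 * ((\<bar>t\<bar> * Pc (k n) + 3 * t\<^sup>2 * (Pc (k n))\<^sup>2 + \<bar>t\<bar> ^ 3 * Pc (k n) ^ 3) * (k n ^ 3 * cb n))"
      unfolding cf_error_def Let_def Bd[symmetric] l_def Pc_def Ec_def Sc_def ..
    also have "70000 * Sc (k n) * (ln (Sc (k n)))\<^sup>2 * cb n = 70000 * q1 n" by (simp add: q1_def)
    finally have c: "cf_error t (k n) p (ac (k n)) (Ac (k n)) (Rc (k n)) (1 / (k n)\<^sup>2) (cb n) m3 (pr n) =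
      2 * pr n + 2 * (p / (Rc (k n))\<^sup>2) + (2 * (exp 1 * l n) + 2 * m3 * (70000 * q1 n))
        * ((4 + \<bar>t\<bar>) * q2 n + 2 * \<bar>t\<bar> * (sqrt p * q3 n + q4 n))
      + 2 * m3 * ((\<bar>t\<bar> * Pc (k n) + 3 * t\<^sup>2 * (Pc (k n))\<^sup>2 + \<bar>t\<bar> ^ 3 * Pc (k n) ^ 3) * (k n ^ 3 * cb n))" .
    have e1: "(2 * (x * l n) + 2 * m3 * (70000 * q1 n)) * ((4 + y) * q2 n + 2 * y * (r * q3 n + q4 n))
      = (2 * x * (4 + y)) * (l n * q2 n) + (4 * x * y) * (r * (l n * q3 n) + l n * q4 n)
      + (2 * m3 * 70000 * (4 + y)) * (q1 n * q2 n) + (4 * m3 * 70000 * y) * (q1 n * (r * q3 n + q4 n))" for x y r :: real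
      by (simp add: algebra_simps)
    have e2: "(y * P + 3 * z * P\<^sup>2 + u * P ^ 3) * c = y * (P * c) + 3 * z * (P\<^sup>2 * c) + u * (P ^ 3 * c)" for y z u P c :: real
      by (simp add: algebra_simps)
    show ?thesis unfolding c e1 e2 D_def by (simp only: mult.assoc)
  qed
  ultimately show ?thesis unfolding Deq by simp
qed

section \<open>Measurability of the statistic\<close>

lemma design_inner_measurable:
  assumes "\<And>i. i \<in> {1..n} \<Longrightarrow> (\<lambda>\<omega>. w \<omega> (X i)) \<in> borel_measurable M" "\<And>i. i \<in> {1..n} \<Longrightarrow> (\<lambda>\<omega>. h \<omega> (X i)) \<in> borel_measurable M"
    "\<And>i. i \<in> {1..n} \<Longrightarrow> (\<lambda>\<omega>. h' \<omega> (X i)) \<in> borel_measurable M"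
  shows "(\<lambda>\<omega>. design_inner n X (w \<omega>) (h \<omega>) (h' \<omega>)) \<in> borel_measurable M"
  unfolding design_inner_def using assms
  by (intro borel_measurable_times borel_measurable_sum borel_measurable_const) auto

lemma gram_schmidt_measurable:
  fixes w :: "'w \<Rightarrow> 'x \<Rightarrow> real"
  assumes w: "\<And>i. i \<in> {1..n} \<Longrightarrow> (\<lambda>\<omega>. w \<omega> (X i)) \<in> borel_measurable M"
  shows "i \<in> {1..n} \<Longrightarrow> (\<lambda>\<omega>. gram_schmidt_fn (design_inner n X (w \<omega>)) f m (X i)) \<in> borel_measurable M"
proof (induction m arbitrary: i rule: less_induct)
  case (less m)
  define r where "r = (\<lambda>\<omega> x. f m x - (\<Sum>k<m. design_inner n X (w \<omega>) (f m) (gram_schmidt_fn (design_inner n X (w \<omega>)) f k) *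
      gram_schmidt_fn (design_inner n X (w \<omega>)) f k x))"
  have r: "(\<lambda>\<omega>. r \<omega> (X i)) \<in> borel_measurable M" if "i \<in> {1..n}" for i
    unfolding r_def using that w less.IH
    by (intro borel_measurable_diff borel_measurable_sum borel_measurable_times borel_measurable_const design_inner_measurable) auto
  have "gram_schmidt_fn (design_inner n X (w \<omega>)) f m (X i) = r \<omega> (X i) / sqrt (design_inner n X (w \<omega>) (r \<omega>) (r \<omega>))" for \<omega>
    by (subst gram_schmidt_fn.simps) (simp add: r_def Let_def)
  moreover have "(\<lambda>\<omega>. r \<omega> (X i) / sqrt (design_inner n X (w \<omega>) (r \<omega>) (r \<omega>))) \<in> borel_measurable M"
    by (intro borel_measurable_divide measurable_compose[OF _ borel_measurable_sqrt] design_inner_measurable r w less.prems)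
  ultimately show ?case by simp
qed

text \<open>Continuity of the derivatives of b is known on G only; extension by 0 outside G gives a
  Borel function on the line.\<close>

lemma measurable_continuous_on_open:
  fixes h :: "real \<Rightarrow> real"
  assumes G: "open G" and h: "continuous_on G h" and f: "f \<in> borel_measurable M" "\<And>\<omega>. \<omega> \<in> space M \<Longrightarrow> f \<omega> \<in> G"
  shows "(\<lambda>\<omega>. h (f \<omega>)) \<in> borel_measurable M"
proof -
  have "(\<lambda>x. indicator G x *\<^sub>R h x) \<in> borel_measurable borel"
    by (rule borel_measurable_continuous_on_indicator) (use G h in auto)
  from measurable_compose[OF f(1) this] have "(\<lambda>\<omega>. indicator G (f \<omega>) *\<^sub>R h (f \<omega>)) \<in> borel_measurable M" .
  thus ?thesis by (rule measurable_cong[THEN iffD1, rotated]) (simp add: f(2))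
qed

lemma lin_pred_measurable:
  fixes \<theta> :: "'w \<Rightarrow> real^'p"
  assumes "\<theta> \<in> borel_measurable M"
  shows "(\<lambda>\<omega>. lin_pred \<gamma> (\<theta> \<omega>) x) \<in> borel_measurable M"
proof -
  have "continuous_on UNIV (\<lambda>\<theta> :: real^'p. lin_pred \<gamma> \<theta> x)" unfolding lin_pred_def by (intro continuous_intros)
  hence "(\<lambda>\<theta> :: real^'p. lin_pred \<gamma> \<theta> x) \<in> borel_measurable borel" by (rule borel_measurable_continuous_onI)
  from measurable_compose[OF assms this] show ?thesis .
qed

lemma test_stat_measurable:
  fixes \<theta> :: "'w \<Rightarrow> real^('p::{finite,linorder})"
  assumes G: "open G" "continuous_on G (deriv b)" "continuous_on G ((deriv ^^ 2) b)"
    and \<theta>: "\<theta> \<in> borel_measurable M" "\<And>\<omega> i. \<omega> \<in> space M \<Longrightarrow> i \<in> {1..n} \<Longrightarrow> lin_pred \<gamma> (\<theta> \<omega>) (X i) \<in> G"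
    and Y: "\<And>i. i \<in> {1..n} \<Longrightarrow> Y i \<in> borel_measurable M" and \<eta>: "(\<lambda>\<omega>. a (\<eta> \<omega>)) \<in> borel_measurable M"
  shows "(\<lambda>\<omega>. test_stat a b \<gamma> u n X K (\<lambda>i. Y i \<omega>) (\<theta> \<omega>) (\<eta> \<omega>)) \<in> borel_measurable M"
proof -
  have l: "(\<lambda>\<omega>. h (lin_pred \<gamma> (\<theta> \<omega>) (X i))) \<in> borel_measurable M" if "continuous_on G h" "i \<in> {1..n}" for h :: "real \<Rightarrow> real" and i
    by (rule measurable_continuous_on_open[OF G(1) that(1) lin_pred_measurable[OF \<theta>(1)]]) (rule \<theta>(2)[OF _ that(2)])
  have o: "(\<lambda>\<omega>. orth_fn b \<gamma> u n X (\<theta> \<omega>) j (X i)) \<in> borel_measurable M" if "i \<in> {1..n}" for i j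
    unfolding orth_fn_def
    by (rule gram_schmidt_measurable[where w = "\<lambda>\<omega>. glm_weight b \<gamma> (\<theta> \<omega>)"]) (use l[OF G(3)] that in auto)
  show ?thesis
    unfolding test_stat_def alpha_hat_def using l[OF G(2)] o Y \<eta>
    by (intro borel_measurable_sum measurable_compose[OF _ borel_measurable_exp] borel_measurable_divide borel_measurable_times
        borel_measurable_power borel_measurable_const borel_measurable_diff) auto
qed

lemma (in exp_family) std3_standardized:
  assumes z: "z \<in> G" and \<delta>: "\<delta> > 0" "\<delta> \<le> deriv (deriv b) z"
    and i: "integrable (D z) (\<lambda>y. y)" "integrable (D z) (\<lambda>y. y\<^sup>2)"
    and i3: "integrable (D z) (\<lambda>y. \<bar>y - deriv b z\<bar> ^ 3)" "(\<integral>y. \<bar>y - deriv b z\<bar> ^ 3 \<partial>D z) \<le> M3"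
  shows "std3 (distr (D z) borel (\<lambda>y. (y - deriv b z) / sqrt (a0 * deriv (deriv b) z))) (M3 / sqrt (a0 * \<delta>) ^ 3)"
proof -
  interpret real_distribution "D z" by (rule rd[OF z])
  define q where "q = sqrt (a0 * deriv (deriv b) z)"
  have q: "q > 0" "q\<^sup>2 = a0 * deriv (deriv b) z" "sqrt (a0 * \<delta>) \<le> q"
    using a0 \<delta> by (auto simp: q_def mult_left_mono)
  have q0: "sqrt (a0 * \<delta>) > 0" using a0 \<delta> by simp
  have qm[measurable]: "(\<lambda>y. (y - deriv b z) / q) \<in> borel_measurable (D z)" by measurable
  have e3: "\<bar>(y - deriv b z) / q\<bar> ^ 3 = \<bar>y - deriv b z\<bar> ^ 3 / q ^ 3" for y
    using q(1) by (simp add: abs_div power_divide)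
  have "integrable (distr (D z) borel (\<lambda>y. (y - deriv b z) / q)) (\<lambda>y. \<bar>y\<bar> ^ 3)"
  proof -
    have "(\<lambda>y::real. \<bar>y\<bar> ^ 3) \<in> borel_measurable borel" by measurable
    moreover have "integrable (D z) (\<lambda>y. \<bar>y - deriv b z\<bar> ^ 3 / q ^ 3)" using i3(1) by (rule integrable_divide_zero)
    ultimately show ?thesis using integrable_distr_eq[OF qm, of "\<lambda>y. \<bar>y\<bar> ^ 3"] unfolding e3 by blast
  qed
  moreover have "integral\<^sup>L (distr (D z) borel (\<lambda>y. (y - deriv b z) / q)) (\<lambda>y. \<bar>y\<bar> ^ 3) \<le> M3 / sqrt (a0 * \<delta>) ^ 3"
  proof -
    have "integral\<^sup>L (distr (D z) borel (\<lambda>y. (y - deriv b z) / q)) (\<lambda>y. \<bar>y\<bar> ^ 3) = (\<integral>y. \<bar>(y - deriv b z) / q\<bar> ^ 3 \<partial>D z)"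
      by (rule integral_distr[OF qm]) measurable
    also have "\<dots> = (\<integral>y. \<bar>y - deriv b z\<bar> ^ 3 \<partial>D z) / q ^ 3" unfolding e3 by (rule integral_divide_zero)
    also have "\<dots> \<le> (\<integral>y. \<bar>y - deriv b z\<bar> ^ 3 \<partial>D z) / sqrt (a0 * \<delta>) ^ 3"
    proof (rule divide_left_mono)
      show "sqrt (a0 * \<delta>) ^ 3 \<le> q ^ 3" by (rule power_mono[OF q(3) less_imp_le[OF q0]])
      show "0 < q ^ 3 * sqrt (a0 * \<delta>) ^ 3" by (intro mult_pos_pos zero_less_power q(1) q0)
    qed (rule Bochner_Integration.integral_nonneg, simp)
    also have "\<dots> \<le> M3 / sqrt (a0 * \<delta>) ^ 3" using i3(2) q0 by (intro divide_right_mono) auto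
    finally show ?thesis .
  qed
  moreover have "integral\<^sup>L (distr (D z) borel (\<lambda>y. (y - deriv b z) / q)) (\<lambda>y. y) = 0"
  proof -
    have "integral\<^sup>L (distr (D z) borel (\<lambda>y. (y - deriv b z) / q)) (\<lambda>y. y) = (\<integral>y. (y - deriv b z) / q \<partial>D z)"
      by (rule integral_distr[OF qm]) measurable
    also have "\<dots> = (\<integral>y. y - deriv b z \<partial>D z) / q" by (rule integral_divide_zero)
    also have "(\<integral>y. y - deriv b z \<partial>D z) = 0" using i(1) mean[OF z] prob_space by simp
    finally show ?thesis by simp
  qed
  moreover have "integral\<^sup>L (distr (D z) borel (\<lambda>y. (y - deriv b z) / q)) (\<lambda>y. y\<^sup>2) = 1"
  proof -
    have "integral\<^sup>L (distr (D z) borel (\<lambda>y. (y - deriv b z) / q)) (\<lambda>y. y\<^sup>2) = (\<integral>y. (y\<^sup>2 - 2 * deriv b z * y + (deriv b z)\<^sup>2) / q\<^sup>2 \<partial>D z)"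
    proof -
      have "((y - deriv b z) / q)\<^sup>2 = (y\<^sup>2 - 2 * deriv b z * y + (deriv b z)\<^sup>2) / q\<^sup>2" for y
        by (simp add: power_divide power2_diff mult_ac)
      moreover have "integral\<^sup>L (distr (D z) borel (\<lambda>y. (y - deriv b z) / q)) (\<lambda>y. y\<^sup>2) = (\<integral>y. ((y - deriv b z) / q)\<^sup>2 \<partial>D z)"
        by (rule integral_distr[OF qm]) measurable
      ultimately show ?thesis by (simp only:)
    qed
    also have "\<dots> = (\<integral>y. y\<^sup>2 - 2 * deriv b z * y + (deriv b z)\<^sup>2 \<partial>D z) / q\<^sup>2" by (rule integral_divide_zero)
    also have "(\<integral>y. y\<^sup>2 - 2 * deriv b z * y + (deriv b z)\<^sup>2 \<partial>D z) = (\<integral>y. y\<^sup>2 \<partial>D z) - 2 * deriv b z * (\<integral>y. y \<partial>D z) + (deriv b z)\<^sup>2"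
      using i prob_space by simp
    also have "\<dots> = a0 * deriv (deriv b) z" unfolding second_moment[OF z] mean[OF z] by (simp add: power2_eq_square)
    finally show ?thesis unfolding q(2)[symmetric] using q(1) by simp
  qed
  ultimately show ?thesis unfolding std3_def q_def[symmetric] using qm by (auto intro: real_distribution_distr)
qed

section \<open>Rates in the sample size\<close>

lemma std3_mono: "std3 D m \<Longrightarrow> m \<le> m' \<Longrightarrow> std3 D m'"
  unfolding std3_def by auto

lemma lin_pred_diff_bound:
  fixes \<theta> \<theta>' :: "real^'p"
  assumes "\<And>j. \<bar>\<gamma> j x\<bar> \<le> B"
  shows "\<bar>lin_pred \<gamma> \<theta> x - lin_pred \<gamma> \<theta>' x\<bar> \<le> real CARD('p) * B * norm (\<theta> - \<theta>')"
proof -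
  have "\<bar>lin_pred \<gamma> \<theta> x - lin_pred \<gamma> \<theta>' x\<bar> = \<bar>\<Sum>j\<in>UNIV. (\<theta> - \<theta>') $ j * \<gamma> j x\<bar>"
    by (simp add: lin_pred_def left_diff_distrib sum_subtractf)
  also have "\<dots> \<le> (\<Sum>j\<in>(UNIV :: 'p set). norm (\<theta> - \<theta>') * B)"
    by (rule order_trans[OF sum_abs sum_mono])
      (auto simp: abs_mult simp del: vector_minus_component intro!: mult_mono component_le_norm_cart assms)
  finally show ?thesis by (simp add: mult_ac)
qed

text \<open>The second condition of A8 gives Bk * sqrt k / sqrt n \<le> k^(-3) * n^(- \<epsilon>).
  The first one gives k \<le> n^(1/8), hence k^(8 * \<epsilon>) \<le> n^\<epsilon>, which converts
  the gain in n into a gain in k.\<close>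

lemma coefficient_rate:
  fixes n k \<epsilon> Bk :: real
  assumes n: "n \<ge> 1" and k: "k > 0" "k \<le> n powr (1 / 8 - \<epsilon>)" and \<epsilon>: "\<epsilon> > 0" and B: "Bk * k powr (7 / 2) \<le> n powr (1 / 2 - \<epsilon>)"
  shows "Bk * sqrt k / sqrt n \<le> k powr (- 3) * k powr (- 8 * \<epsilon>)"
proof -
  have "k \<le> n powr (1 / 8)" using k(2) powr_mono[of "1 / 8 - \<epsilon>" "1 / 8" n] n \<epsilon> by linarith
  hence "k powr (8 * \<epsilon>) \<le> (n powr (1 / 8)) powr (8 * \<epsilon>)" using k(1) \<epsilon> by (intro powr_mono2) auto
  hence ke: "k powr (8 * \<epsilon>) \<le> n powr \<epsilon>" by (simp add: powr_powr)
  have "sqrt k = k powr (7 / 2) * k powr (- 3)" using k(1) by (simp add: powr_half_sqrt[symmetric] flip: powr_add)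
  hence "Bk * sqrt k / sqrt n = (Bk * k powr (7 / 2)) * (k powr (- 3) / sqrt n)" by simp
  also have "\<dots> \<le> n powr (1 / 2 - \<epsilon>) * (k powr (- 3) / sqrt n)" using B n by (intro mult_right_mono) auto
  also have "\<dots> = k powr (- 3) / n powr \<epsilon>" using n by (simp add: powr_diff powr_half_sqrt)
  also have "\<dots> \<le> k powr (- 3) / k powr (8 * \<epsilon>)" using ke k(1) n by (intro divide_left_mono) auto
  also have "\<dots> = k powr (- 3) * k powr (- 8 * \<epsilon>)" by (simp add: powr_minus_divide)
  finally show ?thesis .
qed

text \<open>The estimators are localised at radius n^(-7/16), the noise at n^(1/8). The terms then
  have the orders n^(-5/16), n^(-3/8) and smaller, all below n^(-1/4), which is at most K^(-2) for K
  \<le> n^(1/8).\<close>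

lemma deviation_rate:
  fixes c1 c2 c3 :: real
  shows "eventually (\<lambda>n. c1 * real n powr (- 7 / 16) * real n powr (1 / 8) + sqrt (real n) * (c2 * (real n powr (- 7 / 16))\<^sup>2)
      + c3 * real n powr (- 7 / 16) * (3 * real n powr (1 / 8) + sqrt (real n) * (c2 * (real n powr (- 7 / 16))\<^sup>2)) \<le> real n powr (- 1 / 4)) sequentially"
proof -
  define l1 where "l1 = (\<lambda>n. real n powr (1 / 4) * (real n powr (- 7 / 16) * real n powr (1 / 8)))"
  define l2 where "l2 = (\<lambda>n. real n powr (1 / 4) * (sqrt (real n) * (real n powr (- 7 / 16))\<^sup>2))"
  define l3 where "l3 = (\<lambda>n. real n powr (- 7 / 16))"
  have l: "l1 \<longlonglongrightarrow> 0" "l2 \<longlonglongrightarrow> 0" "l3 \<longlonglongrightarrow> 0" unfolding l1_def l2_def l3_def by real_asymp+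
  have "(\<lambda>n. c1 * l1 n + c2 * l2 n + c3 * (3 * l1 n + l3 n * (c2 * l2 n))) \<longlonglongrightarrow> c1 * 0 + c2 * 0 + c3 * (3 * 0 + 0 * (c2 * 0))"
    by (intro tendsto_intros l)
  hence "eventually (\<lambda>n. c1 * l1 n + c2 * l2 n + c3 * (3 * l1 n + l3 n * (c2 * l2 n)) < 1) sequentially"
    by (rule order_tendstoD(2)) simp
  thus ?thesis using eventually_gt_at_top[of 0]
  proof eventually_elim
    case (elim n)
    define q where "q = real n powr (1 / 4)"
    have q: "q > 0" "real n powr (- 1 / 4) = 1 / q" using elim by (auto simp: q_def powr_minus_divide)
    have gen: "q * (c1 * u * v + s * (c2 * y) + c3 * u * (3 * v + s * (c2 * y)))
      = c1 * (q * (u * v)) + c2 * (q * (s * y)) + c3 * (3 * (q * (u * v)) + u * (c2 * (q * (s * y))))" for u v s y :: real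
      by (simp add: algebra_simps)
    have "q * (c1 * real n powr (- 7 / 16) * real n powr (1 / 8) + sqrt (real n) * (c2 * (real n powr (- 7 / 16))\<^sup>2)
      + c3 * real n powr (- 7 / 16) * (3 * real n powr (1 / 8) + sqrt (real n) * (c2 * (real n powr (- 7 / 16))\<^sup>2)))
      = c1 * l1 n + c2 * l2 n + c3 * (3 * l1 n + l3 n * (c2 * l2 n))"
      unfolding l1_def l2_def l3_def q_def[symmetric] by (rule gen)
    thus ?case using elim q by (simp add: pos_le_divide_eq mult.commute)
  qed
qed

text \<open>A mean square of order 1 / n against the squared radius n^(-7/8) leaves the probability
  n^(-1/8). The radius must be larger than n^(-1/2) for this, and smaller than n^(-3/8) for
  \<open>deviation_rate\<close>.\<close>

lemma markov_rate:
  fixes Z :: "nat \<Rightarrow> 'w \<Rightarrow> real" and M :: "nat \<Rightarrow> 'w measure"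
  assumes M: "\<And>n. prob_space (M n)" and i: "eventually (\<lambda>n. integrable (M n) (\<lambda>\<omega>. (Z n \<omega>)\<^sup>2)) sequentially"
    and O: "(\<lambda>n. \<integral>\<omega>. (Z n \<omega>)\<^sup>2 \<partial>M n) \<in> O(\<lambda>n. 1 / real n)"
  shows "\<exists>C. eventually (\<lambda>n. measure (M n) {\<omega> \<in> space (M n). \<not> \<bar>Z n \<omega>\<bar> \<le> real n powr (- 7 / 16)} \<le> C * real n powr (- 1 / 8)) sequentially"
proof -
  obtain C where C: "C > 0" "eventually (\<lambda>n. norm (\<integral>\<omega>. (Z n \<omega>)\<^sup>2 \<partial>M n) \<le> C * norm (1 / real n)) sequentially"
    using O by (elim landau_o.bigE) auto
  have "eventually (\<lambda>n. measure (M n) {\<omega> \<in> space (M n). \<not> \<bar>Z n \<omega>\<bar> \<le> real n powr (- 7 / 16)} \<le> C * real n powr (- 1 / 8)) sequentially"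
    using C(2) i eventually_gt_at_top[of 0]
  proof eventually_elim
    case (elim n)
    interpret prob_space "M n" by (rule M)
    define q where "q = real n powr (- 7 / 16)"
    have q: "q > 0" using elim by (simp add: q_def)
    have "measure (M n) {\<omega> \<in> space (M n). \<not> \<bar>Z n \<omega>\<bar> \<le> q} \<le> measure (M n) {\<omega> \<in> space (M n). (Z n \<omega>)\<^sup>2 \<ge> q\<^sup>2}"
    proof (rule finite_measure_mono)
      have "q\<^sup>2 \<le> (Z n \<omega>)\<^sup>2" if "\<not> \<bar>Z n \<omega>\<bar> \<le> q" for \<omega>
        using that q power_mono[of q "\<bar>Z n \<omega>\<bar>" 2] by simp
      thus "{\<omega> \<in> space (M n). \<not> \<bar>Z n \<omega>\<bar> \<le> q} \<subseteq> {\<omega> \<in> space (M n). (Z n \<omega>)\<^sup>2 \<ge> q\<^sup>2}" by auto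
      show "{\<omega> \<in> space (M n). (Z n \<omega>)\<^sup>2 \<ge> q\<^sup>2} \<in> sets (M n)" using elim(2) by measurable
    qed
    also have "\<dots> \<le> (\<integral>\<omega>. (Z n \<omega>)\<^sup>2 \<partial>M n) / q\<^sup>2"
      by (rule integral_Markov_inequality_measure[OF elim(2), where A = "{}"]) (use q in auto)
    also have "\<dots> \<le> (C * (1 / real n)) / q\<^sup>2" using elim(1) by (intro divide_right_mono) auto
    also have "\<dots> = C * real n powr (- 1 / 8)"
    proof -
      have e1: "1 / real n = real n powr (- 1)" using elim(3) by (simp add: powr_minus_divide)
      have e2: "q\<^sup>2 = real n powr (- 7 / 8)" unfolding q_def power2_eq_square powr_add[symmetric] by simp
      have "real n powr (- 1) / real n powr (- 7 / 8) = real n powr (- 1 / 8)" unfolding powr_diff[symmetric] by simp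
      thus ?thesis unfolding e1 e2 by (simp only: times_divide_eq_right[symmetric])
    qed
    finally show ?case by (simp add: q_def)
  qed
  thus ?thesis by blast
qed

text \<open>The phases 0 and - pi / 2 give the real and the imaginary part of the characteristic
  function.\<close>

lemma cos_limits_imp_char:
  fixes X :: "nat \<Rightarrow> 'w \<Rightarrow> real" and M :: "nat \<Rightarrow> 'w measure" and l :: complex
  assumes M: "\<And>n. prob_space (M n)" and X[measurable]: "\<And>n. X n \<in> borel_measurable (M n)"
    and lim: "\<And>\<theta>. (\<lambda>n. \<integral>\<omega>. cos (t * X n \<omega> + \<theta>) \<partial>M n) \<longlonglongrightarrow> Re (cis \<theta> * l)"
  shows "(\<lambda>n. char (distr (M n) borel (X n)) t) \<longlonglongrightarrow> l"
proof -
  have "char (distr (M n) borel (X n)) t = Complex (\<integral>\<omega>. cos (t * X n \<omega> + 0) \<partial>M n) (\<integral>\<omega>. cos (t * X n \<omega> + - (pi / 2)) \<partial>M n)" for n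
  proof -
    interpret prob_space "M n" by (rule M)
    have i: "integrable (M n) (\<lambda>\<omega>. cis (t * X n \<omega>))"
      by (rule integrable_const_bound[where B = 1]) (auto simp: cis_conv_exp)
    have "char (distr (M n) borel (X n)) t = (\<integral>\<omega>. cis (t * X n \<omega>) \<partial>M n)"
      unfolding char_def by (subst integral_distr) (auto simp: cis_conv_exp)
    moreover have "Re (\<integral>\<omega>. cis (t * X n \<omega>) \<partial>M n) = (\<integral>\<omega>. cos (t * X n \<omega> + 0) \<partial>M n)"
      using integral_Re[OF i] by simp
    moreover have "Im (\<integral>\<omega>. cis (t * X n \<omega>) \<partial>M n) = (\<integral>\<omega>. cos (t * X n \<omega> + - (pi / 2)) \<partial>M n)"
      using integral_Im[OF i] by (simp add: cos_diff)
    ultimately show ?thesis by (simp add: complex_eq_iff)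
  qed
  moreover have "(\<lambda>n. Complex (\<integral>\<omega>. cos (t * X n \<omega> + 0) \<partial>M n) (\<integral>\<omega>. cos (t * X n \<omega> + - (pi / 2)) \<partial>M n)) \<longlonglongrightarrow>
      Complex (Re (cis 0 * l)) (Re (cis (- (pi / 2)) * l))"
    by (intro tendsto_Complex lim)
  moreover have "Complex (Re (cis 0 * l)) (Re (cis (- (pi / 2)) * l)) = l" by (simp add: complex_eq_iff)
  ultimately show ?thesis by simp
qed

theorem theorem3:
  fixes a b :: "real \<Rightarrow> real" and c :: "real \<Rightarrow> real \<Rightarrow> real"
    and G :: "real set" and \<nu> :: "real measure"
    and M :: "nat \<Rightarrow> 'w measure"
    and x :: "nat \<Rightarrow> nat \<Rightarrow> real^'d" and Y :: "nat \<Rightarrow> nat \<Rightarrow> 'w \<Rightarrow> real"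
    and S :: "(real^'d) set"
    and g :: "real^'d \<Rightarrow> real" and \<eta>\<^sub>0 :: real and H :: "real set"
    and \<gamma> :: "'p::{finite,linorder} \<Rightarrow> real^'d \<Rightarrow> real"
    and \<Theta> \<N> :: "(real^('p::{finite,linorder})) set" and \<theta>\<^sub>0 :: "real^('p::{finite,linorder})"
    and u :: "nat \<Rightarrow> real^'d \<Rightarrow> real" and B :: "nat \<Rightarrow> real"
    and \<theta>h :: "nat \<Rightarrow> 'w \<Rightarrow> real^('p::{finite,linorder})" and \<eta>h :: "nat \<Rightarrow> 'w \<Rightarrow> real"
    and K :: "nat \<Rightarrow> nat" and \<epsilon> :: real and \<mu> :: "real measure"
  \<comment> \<open>\<open>G\<close> is the natural parameter space (\<open>UNIV\<close> if \<open>b\<close> is defined on the whole line); as the \<open>\<gamma> j\<close> are bounded,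
    the closure condition is automatic for \<open>G = UNIV\<close>\<close>
  assumes "sets \<nu> = sets borel" and "sigma_finite_measure \<nu>" and "open G"
    and family: "\<And>z \<eta>. z \<in> G \<Longrightarrow> \<eta> \<in> H \<Longrightarrow>
        glm_logdens a b c z \<eta> \<in> borel_measurable \<nu> \<and>
        prob_space (density \<nu> (\<lambda>y. ennreal (exp (glm_logdens a b c z \<eta> y))))"
    and null_range: "\<And>\<theta>. \<theta> \<in> \<Theta> \<Longrightarrow> lin_pred \<gamma> \<theta> ` S \<subseteq> G"
    and "\<theta>\<^sub>0 \<in> \<Theta>" and "closure (lin_pred \<gamma> \<theta>\<^sub>0 ` S) \<subseteq> G"
    and "\<eta>\<^sub>0 \<in> H"
    and "\<And>n. prob_space (M n)"
    and indep: "\<And>n. prob_space.indep_vars (M n) (\<lambda>_. borel) (Y n) {1..n}"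
    and law: "\<And>n i. i \<in> {1..n} \<Longrightarrow>
        distributed (M n) \<nu> (Y n i) (\<lambda>y. ennreal (exp (glm_logdens a b c (g (x n i)) \<eta>\<^sub>0 y)))"
    and H0: "\<And>z. z \<in> S \<Longrightarrow> g z = lin_pred \<gamma> \<theta>\<^sub>0 z"
    and theta_rv: "\<And>n. \<theta>h n \<in> borel_measurable (M n)"
    and theta_range: "\<And>n \<omega>. \<omega> \<in> space (M n) \<Longrightarrow> \<theta>h n \<omega> \<in> \<Theta>"
    and eta_rv: "\<And>n. (\<lambda>\<omega>. a (\<eta>h n \<omega>)) \<in> borel_measurable (M n)"
    and mle: "\<forall>\<^sub>F n in sequentially. AE \<omega> in M n.
        is_arg_max (\<lambda>(\<theta>, \<eta>). glm_loglik a b c n (x n) (\<lambda>i. Y n i \<omega>) (lin_pred \<gamma> \<theta>) \<eta>)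
          (\<lambda>(\<theta>, \<eta>). \<theta> \<in> \<Theta> \<and> \<eta> \<in> H) (\<theta>h n \<omega>, \<eta>h n \<omega>)"
    and consistent: "\<And>e. e > 0 \<Longrightarrow>
        (\<lambda>n. measure (M n) {\<omega> \<in> space (M n). norm (\<theta>h n \<omega> - \<theta>\<^sub>0) > e}) \<longlonglongrightarrow> 0"
    and A1: "compact S" "\<And>n i. i \<in> {1..n} \<Longrightarrow> x n i \<in> S"
    and A2i: "\<exists>B1. \<forall>j. \<forall>z\<in>S. \<bar>\<gamma> j z\<bar> \<le> B1"
    and A2ii: "\<And>k. k \<ge> 1 \<Longrightarrow> B k > 0"
      "\<And>k j z. j \<in> {1..k} \<Longrightarrow> z \<in> S \<Longrightarrow> \<bar>u j z\<bar> \<le> B k"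
    and A3_v: "\<forall>\<^sub>F n in sequentially.
        orth_to_null b \<gamma> n (x n) \<theta>\<^sub>0 (K n) (orth_fn b \<gamma> u n (x n) \<theta>\<^sub>0) \<and>
        orthonormal_fns b \<gamma> n (x n) \<theta>\<^sub>0 (K n) (orth_fn b \<gamma> u n (x n) \<theta>\<^sub>0)"
    and A3_vh: "\<forall>\<^sub>F n in sequentially. AE \<omega> in M n.
        orth_to_null b \<gamma> n (x n) (\<theta>h n \<omega>) (K n) (orth_fn b \<gamma> u n (x n) (\<theta>h n \<omega>)) \<and>
        orthonormal_fns b \<gamma> n (x n) (\<theta>h n \<omega>) (K n) (orth_fn b \<gamma> u n (x n) (\<theta>h n \<omega>))"
    and A4_diag: "\<forall>\<^sub>F n in sequentially. \<forall>j<K n. basis_gram u n (x n) (K n) $$ (j, j) = 1"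
    and A4_eig: "\<exists>\<kappa>>0. \<forall>\<^sub>F n in sequentially. \<kappa> \<le> Min (spectrum (basis_gram u n (x n) (K n)))"
    and A5: "a \<eta>\<^sub>0 > 0"
      "\<forall>\<^sub>F n in sequentially. integrable (M n) (\<lambda>\<omega>. (a (\<eta>h n \<omega>) - a \<eta>\<^sub>0)\<^sup>2)"
      "(\<lambda>n. \<integral>\<omega>. (a (\<eta>h n \<omega>) - a \<eta>\<^sub>0)\<^sup>2 \<partial>M n) \<in> O(\<lambda>n. 1 / real n)"
      "\<forall>\<^sub>F n in sequentially. integrable (M n) (\<lambda>\<omega>. (norm (\<theta>h n \<omega> - \<theta>\<^sub>0))\<^sup>2)"
      "(\<lambda>n. \<integral>\<omega>. (norm (\<theta>h n \<omega> - \<theta>\<^sub>0))\<^sup>2 \<partial>M n) \<in> O(\<lambda>n. 1 / real n)"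
    and A6: "compact \<N>" "connected \<N>" "\<N> \<subseteq> \<Theta>" "\<theta>\<^sub>0 \<in> \<N>"
      "\<And>z. z \<in> S \<Longrightarrow> continuous_on \<N> (\<lambda>\<theta>. lin_pred \<gamma> \<theta> z)"
    and A7: "\<And>k z. k < 3 \<Longrightarrow> z \<in> G \<Longrightarrow> (deriv ^^ k) b field_differentiable at z"
      "\<exists>B2. \<forall>z\<in>S. \<forall>\<theta>\<in>\<N>. \<bar>(deriv ^^ 3) b (lin_pred \<gamma> \<theta> z)\<bar> \<le> B2"
      "\<And>z \<theta>. z \<in> S \<Longrightarrow> \<theta> \<in> \<Theta> \<Longrightarrow> (deriv ^^ 2) b (lin_pred \<gamma> \<theta> z) \<ge> 0"
      "\<exists>\<delta>>0. \<forall>z\<in>S. \<forall>\<theta>\<in>\<N>. \<delta> \<le> (deriv ^^ 2) b (lin_pred \<gamma> \<theta> z)"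
    and A8: "filterlim K at_top sequentially" "0 < \<epsilon>" "\<epsilon> < 1 / 8"
      "\<forall>\<^sub>F n in sequentially. real (K n) \<le> real n powr (1 / 8 - \<epsilon>)"
      "\<forall>\<^sub>F n in sequentially. B (K n) * real (K n) powr (7 / 2) \<le> real n powr (1 / 2 - \<epsilon>)"
    and limit: "stable_S1_1_1_0 \<mu>"
  shows "weak_conv_m
      (\<lambda>n. distr (M n) borel (\<lambda>\<omega>.
        (test_stat a b \<gamma> u n (x n) (K n) (\<lambda>i. Y n i \<omega>) (\<theta>h n \<omega>) (\<eta>h n \<omega>) - b_const (K n))
          / a_const (K n)))
      \<mu>"
proof -
  define a0 where "a0 = a \<eta>\<^sub>0"
  define z where "z = lin_pred \<gamma> \<theta>\<^sub>0"
  define b1 where "b1 = deriv b"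
  define b2 where "b2 = (deriv ^^ 2) b"
  define w where "w = (\<lambda>x. b2 (z x))"
  define f where "f = gamma_then_u \<gamma> u"
  define p where "p = CARD('p)"
  define D where "D = (\<lambda>z. density \<nu> (\<lambda>y. ennreal (exp (glm_logdens a b c z \<eta>\<^sub>0 y))))"
  have a0: "a0 > 0" using A5(1) by (simp add: a0_def)
  have b2: "b2 = deriv (deriv b)" by (simp add: b2_def numeral_2_eq_2)
  have f_u: "f (p + l) = u (l + 1)" for l by (simp add: f_def p_def gamma_then_u_def)
  have diff: "b field_differentiable at y" "b1 field_differentiable at y" "b2 field_differentiable at y" if "y \<in> G" for y
    using A7(1)[of 0 y] A7(1)[of 1 y] A7(1)[of 2 y] that by (auto simp: b1_def b2_def)
  have cont: "continuous_on G b1" "continuous_on G b2"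
    using diff field_differentiable_imp_continuous_at by (blast intro: continuous_at_imp_continuous_on)+

  \<comment> \<open>The responses as an exponential family with fixed dispersion\<close>
  interpret F: exp_family D b a0 G
  proof (rule exp_family.intro)
    show "open G" by fact
    show "real_distribution (D y)" if "y \<in> G" for y
      using family[OF that assms(8)] assms(1) by (simp add: D_def real_distribution_def real_distribution_axioms_def)
    fix y y' assume y: "y \<in> G" "y' \<in> G"
    have "glm_logdens a b c y \<eta>\<^sub>0 \<in> borel_measurable \<nu>" using family[OF y(1) assms(8)] by blast
    hence m1: "(\<lambda>v. ennreal (exp (glm_logdens a b c y \<eta>\<^sub>0 v))) \<in> borel_measurable \<nu>" by measurable
    have m2: "(\<lambda>v. ennreal (exp ((v * (y' - y) - (b y' - b y)) / a0))) \<in> borel_measurable \<nu>"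
      by (subst measurable_cong_sets[OF assms(1) refl]) measurable
    have "glm_logdens a b c y' \<eta>\<^sub>0 v = glm_logdens a b c y \<eta>\<^sub>0 v + (v * (y' - y) - (b y' - b y)) / a0" for v
      using a0 by (simp add: glm_logdens_def a0_def diff_divide_distrib add_divide_distrib right_diff_distrib)
    thus "D y' = density (D y) (\<lambda>v. ennreal (exp ((v * (y' - y) - (b y' - b y)) / a0)))"
      unfolding D_def density_density_eq[OF m1 m2] by (simp add: exp_add ennreal_mult)
  qed (use diff a0 in \<open>auto simp: b1_def\<close>)

  \<comment> \<open>Uniform constants on the range of the true linear predictor\<close>
  obtain B0 where B0: "\<And>j y. y \<in> S \<Longrightarrow> \<bar>\<gamma> j y\<bar> \<le> B0" using A2i by blast
  define \<Gamma> where "\<Gamma> = real p * \<bar>B0\<bar>"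
  have \<Gamma>0: "\<Gamma> \<ge> 0" by (simp add: \<Gamma>_def)
  have lp: "\<bar>lin_pred \<gamma> \<theta> y - lin_pred \<gamma> \<theta>' y\<bar> \<le> \<Gamma> * norm (\<theta> - \<theta>')" if "y \<in> S" for y \<theta> \<theta>'
    unfolding \<Gamma>_def p_def by (rule lin_pred_diff_bound) (rule order_trans[OF B0[OF that] abs_ge_self])
  \<comment> \<open>The range over S is bounded because the \<gamma> are, and its closure lies in G
    by assumption. Compactness inside an open set leaves a uniform margin r for estimated
    predictors.\<close>
  define C where "C = closure (z ` S)"
  have C: "compact C" "C \<subseteq> G"
  proof -
    have "norm (z y) \<le> \<Gamma> * norm \<theta>\<^sub>0" if "y \<in> S" for y
      using lp[OF that, of \<theta>\<^sub>0 0] by (simp add: z_def lin_pred_def)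
    hence "bounded (z ` S)" unfolding bounded_iff by blast
    thus "compact C" by (simp add: C_def)
    show "C \<subseteq> G" using assms(7) by (simp add: C_def z_def)
  qed
  have zC: "z y \<in> C" "z y \<in> G" if "y \<in> S" for y
    using that C(2) closure_subset[of "z ` S"] by (auto simp: C_def)
  obtain r L M3 where rlm: "r > 0 \<and> L \<ge> 0 \<and> M3 \<ge> 0 \<and>
    (\<forall>z\<in>C. \<forall>t. \<bar>t\<bar> \<le> r \<longrightarrow> z + t \<in> G \<and> \<bar>deriv (deriv b) (z + t) - deriv (deriv b) z\<bar> \<le> L * \<bar>t\<bar>) \<and>
    (\<forall>z\<in>C. integrable (D z) (\<lambda>y. \<bar>y - deriv b z\<bar> ^ 3) \<and> (\<integral>y. \<bar>y - deriv b z\<bar> ^ 3 \<partial>D z) \<le> M3) \<and>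
    (\<forall>z\<in>C. integrable (D z) (\<lambda>y. y) \<and> integrable (D z) (\<lambda>y. y\<^sup>2))"
    using F.uniform_bounds[OF C] by (elim exE) (rule that)
  have r1: "r > 0" using rlm by (elim conjE)
  have r2: "L \<ge> 0" using rlm by (elim conjE)
  have r3: "M3 \<ge> 0" using rlm by (elim conjE)
  note r = r1 r2 r3
  have loc0: "\<forall>z\<in>C. \<forall>t. \<bar>t\<bar> \<le> r \<longrightarrow> z + t \<in> G \<and> \<bar>deriv (deriv b) (z + t) - deriv (deriv b) z\<bar> \<le> L * \<bar>t\<bar>"
    using rlm by (elim conjE)
  have mom0: "\<forall>z\<in>C. integrable (D z) (\<lambda>y. \<bar>y - deriv b z\<bar> ^ 3) \<and> (\<integral>y. \<bar>y - deriv b z\<bar> ^ 3 \<partial>D z) \<le> M3"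
    using rlm by (elim conjE)
  have mom1: "\<forall>z\<in>C. integrable (D z) (\<lambda>y. y) \<and> integrable (D z) (\<lambda>y. y\<^sup>2)"
    using rlm by (elim conjE)
  have loc: "y + s \<in> G \<and> \<bar>b2 (y + s) - b2 y\<bar> \<le> L * \<bar>s\<bar>" if "y \<in> C" "\<bar>s\<bar> \<le> r" for y s
    using loc0[THEN bspec, OF that(1), THEN spec, THEN mp, OF that(2)] unfolding b2 .
  note mom = mom0[THEN bspec]
  note mom' = mom1[THEN bspec]
  have db1: "(b1 has_real_derivative b2 (y + s)) (at (y + s))" if "y \<in> C" "\<bar>s\<bar> \<le> r" for y s
    using F.ddb[of "y + s"] loc[OF that] by (simp add: b1_def b2)
  obtain wm where wm: "\<And>y. y \<in> C \<Longrightarrow> \<bar>b2 y\<bar> \<le> wm"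
  proof -
    have "compact (b2 ` C)" using cont(2) C by (intro compact_continuous_image continuous_on_subset[OF cont(2)]) auto
    hence "bounded (b2 ` C)" by (rule compact_imp_bounded)
    thus ?thesis using that unfolding bounded_iff by auto
  qed
  obtain \<delta> where \<delta>: "\<delta> > 0" "\<And>y. y \<in> S \<Longrightarrow> \<delta> \<le> w y"
    using A7(4) A6(4) unfolding w_def b2_def z_def by blast
  obtain \<kappa> where \<kappa>: "\<kappa> > 0" "eventually (\<lambda>n. \<kappa> \<le> Min (spectrum (basis_gram u n (x n) (K n)))) sequentially"
    using A4_eig by blast
  obtain mN where mN: "std3 std_normal_distribution mN" using std3_normal by blast
  \<comment> \<open>One bound for the third moments of all standardised responses and of the
    Gaussian variables that replace them.\<close>
  define m3 where "m3 = max (M3 / sqrt (a0 * \<delta>) ^ 3) mN"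
  have N: "std3 std_normal_distribution m3" by (rule std3_mono[OF mN]) (simp add: m3_def)
  have Yrv: "Y n i \<in> borel_measurable (M n)" if "i \<in> {1..n}" for n i
    using law[OF that] assms(1) unfolding distributed_def by (simp cong: measurable_cong_sets)
  have std: "std3 (distr (M n) borel (\<lambda>\<omega>. (Y n i \<omega> - b1 (z (x n i))) / sqrt (a0 * w (x n i)))) m3" if i: "i \<in> {1..n}" for n i
  proof -
    have xS: "x n i \<in> S" by (rule A1(2)[OF i])
    have "distr (M n) borel (Y n i) = distr (M n) \<nu> (Y n i)" by (rule distr_cong) (simp_all add: assms(1))
    also have "\<dots> = D (z (x n i))" using law[OF i] H0[OF xS] by (simp add: distributed_def D_def z_def)
    finally have dY: "distr (M n) borel (Y n i) = D (z (x n i))" .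
    have "distr (M n) borel (\<lambda>\<omega>. (Y n i \<omega> - b1 (z (x n i))) / sqrt (a0 * w (x n i)))
        = distr (D (z (x n i))) borel (\<lambda>v. (v - deriv b (z (x n i))) / sqrt (a0 * deriv (deriv b) (z (x n i))))"
      unfolding dY[symmetric] w_def b1_def b2 by (subst distr_distr) (use Yrv[OF i] in \<open>auto simp: comp_def\<close>)
    moreover have "std3 \<dots> (M3 / sqrt (a0 * \<delta>) ^ 3)"
      by (rule F.std3_standardized) (use zC[OF xS] \<delta>(1) \<delta>(2)[OF xS] mom mom' in \<open>auto simp: w_def b2\<close>)
    ultimately show ?thesis using std3_mono[of _ "M3 / sqrt (a0 * \<delta>) ^ 3" m3] by (simp add: m3_def)
  qed

  \<comment> \<open>Exceptional probabilities and coefficient bounds for growing n\<close>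
  obtain C1 where C1: "eventually (\<lambda>n. measure (M n) {\<omega> \<in> space (M n). \<not> \<bar>norm (\<theta>h n \<omega> - \<theta>\<^sub>0)\<bar> \<le> real n powr (- 7 / 16)} \<le> C1 * real n powr (- 1 / 8)) sequentially"
    using markov_rate[OF assms(9) A5(4,5)] by blast
  obtain C2 where C2: "eventually (\<lambda>n. measure (M n) {\<omega> \<in> space (M n). \<not> \<bar>a (\<eta>h n \<omega>) - a \<eta>\<^sub>0\<bar> \<le> real n powr (- 7 / 16)} \<le> C2 * real n powr (- 1 / 8)) sequentially"
    using markov_rate[OF assms(9) A5(2,3)] by blast
  define k where "k = (\<lambda>n. real (K n))"
  have k_lim: "filterlim k at_top sequentially"
    unfolding k_def by (rule filterlim_compose[OF filterlim_real_sequentially A8(1)])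
  define cb where "cb = (\<lambda>n. sqrt (wm / real n) * (B (K n) * sqrt (k n) / sqrt (\<kappa> * \<delta>)))"
  \<comment> \<open>In order: the two estimators, the noise in all K + p directions with radius
    n^(1/8), and the noise in the p additional directions with the logarithmic radius
    \<open>Rc\<close>.\<close>
  define pr where "pr = (\<lambda>n. C1 * real n powr (- 1 / 8) + C2 * real n powr (- 1 / 8)
    + (real (K n + p) / (real n powr (1 / 8))\<^sup>2 + real p / (Rc (k n))\<^sup>2))"
  have k_n: "eventually (\<lambda>n. k n \<le> real n powr (1 / 8)) sequentially"
    using A8(4) eventually_ge_at_top[of 1]
  proof eventually_elim
    case (elim n)
    thus ?case using powr_mono[of "1 / 8 - \<epsilon>" "1 / 8" "real n"] A8(2) by (simp add: k_def)
  qed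
  have pr_lim: "pr \<longlonglongrightarrow> 0"
  proof -
    have e: "(\<lambda>n. real n powr (- 1 / 8)) \<longlonglongrightarrow> 0" "(\<lambda>n. real n powr (- 1 / 4)) \<longlonglongrightarrow> 0" by real_asymp+
    have "(\<lambda>n. real (K n + p) / (real n powr (1 / 8))\<^sup>2) \<longlonglongrightarrow> 0"
    proof (rule Lim_null_comparison)
      show "eventually (\<lambda>n. norm (real (K n + p) / (real n powr (1 / 8))\<^sup>2) \<le> real n powr (- 1 / 8) + real p * real n powr (- 1 / 4)) sequentially"
        using k_n eventually_gt_at_top[of 0]
      proof eventually_elim
        case (elim n)
        define q where "q = real n powr (1 / 8)"
        have q: "q > 0" "real n powr (- 1 / 8) = 1 / q" "real n powr (- 1 / 4) = 1 / q\<^sup>2"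
          using elim(2) by (auto simp: q_def powr_minus_divide power2_eq_square simp flip: powr_add)
        have "real (K n + p) / q\<^sup>2 \<le> (q + real p) / q\<^sup>2" using elim(1) by (intro divide_right_mono) (auto simp: k_def q_def)
        also have "\<dots> = 1 / q + real p * (1 / q\<^sup>2)" using q(1) by (simp add: add_divide_distrib power2_eq_square)
        finally show ?case unfolding q(2,3) q_def[symmetric] by simp
      qed
      show "(\<lambda>n. real n powr (- 1 / 8) + real p * real n powr (- 1 / 4)) \<longlonglongrightarrow> 0"
        using tendsto_add[OF e(1) tendsto_mult_left[OF e(2), of "real p"]] by simp
    qed
    moreover have "(\<lambda>n. real p / (Rc (k n))\<^sup>2) \<longlonglongrightarrow> 0"
    proof -
      have "((\<lambda>y. 1 / (Rc y)\<^sup>2) \<longlongrightarrow> 0) at_top" unfolding cdefs by real_asymp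
      from tendsto_mult_left[OF filterlim_compose[OF this k_lim], of "real p"] show ?thesis by simp
    qed
    ultimately have "pr \<longlonglongrightarrow> C1 * 0 + C2 * 0 + (0 + 0)"
      unfolding pr_def by (intro tendsto_add tendsto_mult tendsto_const e)
    thus ?thesis by simp
  qed
  have cb_lim: "eventually (\<lambda>n. 0 \<le> cb n \<and> cb n \<le> sqrt wm / sqrt (\<kappa> * \<delta>) * (k n powr (- 3) * k n powr (- 8 * \<epsilon>))) sequentially"
    using A8(4,5) eventually_ge_at_top[of 1] filterlim_at_top_ge[THEN iffD1, OF A8(1), rule_format, OF order_refl[of 1]]
  proof eventually_elim
    case (elim n)
    have "x n 1 \<in> S" using elim(3) by (intro A1(2)) auto
    hence wm0: "wm \<ge> 0" using wm[OF zC(1)] abs_ge_zero order_trans by blast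
    have B: "B (K n) > 0" using elim(4) by (intro A2ii(1)) auto
    have "B (K n) * sqrt (k n) / sqrt (real n) \<le> k n powr (- 3) * k n powr (- 8 * \<epsilon>)"
      by (rule coefficient_rate) (use elim A8(2) in \<open>auto simp: k_def\<close>)
    hence "sqrt wm / sqrt (\<kappa> * \<delta>) * (B (K n) * sqrt (k n) / sqrt (real n)) \<le> sqrt wm / sqrt (\<kappa> * \<delta>) * (k n powr (- 3) * k n powr (- 8 * \<epsilon>))"
      using wm0 \<kappa>(1) \<delta>(1) by (intro mult_left_mono) auto
    moreover have "cb n = sqrt wm / sqrt (\<kappa> * \<delta>) * (B (K n) * sqrt (k n) / sqrt (real n))"
      by (simp add: cb_def real_sqrt_divide mult_ac)
    moreover have "cb n \<ge> 0" using wm0 B \<kappa>(1) \<delta>(1) by (simp add: cb_def k_def)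
    ultimately show ?case by simp
  qed
  define err where "err = (\<lambda>t n. cf_error t (k n) (real p) (ac (k n)) (Ac (k n)) (Rc (k n)) (1 / (k n)\<^sup>2) (cb n) m3 (pr n))"
  have err_lim: "err t \<longlonglongrightarrow> 0" for t
    unfolding err_def by (rule cf_error_tendsto_0[OF k_lim pr_lim A8(2) cb_lim])
  define T where "T = (\<lambda>n \<omega>. test_stat a b \<gamma> u n (x n) (K n) (\<lambda>i. Y n i \<omega>) (\<theta>h n \<omega>) (\<eta>h n \<omega>))"
  have Tm: "T n \<in> borel_measurable (M n)" for n
    unfolding T_def
  proof (rule test_stat_measurable[where G = G])
    show "lin_pred \<gamma> (\<theta>h n \<omega>) (x n i) \<in> G" if "\<omega> \<in> space (M n)" "i \<in> {1..n}" for \<omega> i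
      using null_range[OF theta_range[OF that(1)]] A1(2)[OF that(2)] by blast
  qed (use assms(3) cont theta_rv Yrv eta_rv in \<open>auto simp: b1_def b2_def\<close>)

  \<comment> \<open>Comparison with the Gaussian sum for a single large n\<close>
  define c1 where "c1 = 4 * (L * \<Gamma> / \<delta>)"
  define c2 where "c2 = 2 * L * \<Gamma>\<^sup>2 * sqrt (2 / \<delta>) / sqrt a0"
  have small: "eventually (\<lambda>n. real n powr (- 7 / 16) < q) sequentially" if "q > 0" for q :: real
  proof -
    have "(\<lambda>n. real n powr (- 7 / 16)) \<longlonglongrightarrow> 0" by real_asymp
    thus ?thesis using that by (rule order_tendstoD(2))
  qed
  \<comment> \<open>Adding 1 in the denominators here and in \<open>sm2\<close> covers the cases
    where \<Gamma> or L * \<Gamma> is 0.\<close>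
  have sm1: "eventually (\<lambda>n. real n powr (- 7 / 16) < r / (\<Gamma> + 1)) sequentially"
    using r(1) \<Gamma>0 by (intro small divide_pos_pos add_nonneg_pos) auto
  have sm2: "eventually (\<lambda>n. real n powr (- 7 / 16) < \<delta> / 2 / (L * \<Gamma> + 1)) sequentially"
    using \<delta>(1) r(2) \<Gamma>0 by (intro small divide_pos_pos add_nonneg_pos mult_nonneg_nonneg) auto
  have sm3: "eventually (\<lambda>n. real n powr (- 7 / 16) < a0 / 2) sequentially"
    using a0 by (intro small) auto
  \<comment> \<open>Uniformity in \<theta> at fixed n matters: the phase used in the end contains
    the centring and varies with n.\<close>
  have bound: "eventually (\<lambda>n. \<forall>\<theta>. \<bar>(\<integral>\<omega>. cos (t * (T n \<omega> / a_const (K n)) + \<theta>) \<partial>M n) - Re (cis \<theta> * gauss_cf (K n) t ^ K n)\<bar> \<le> err t n) sequentially" for t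
    using A3_v A3_vh \<kappa>(2) C1 C2 k_n deviation_rate[of c1 c2 "2 / a0"]
      eventually_compose_filterlim[OF parameters_eventually k_lim] eventually_gt_at_top[of 0]
      filterlim_at_top_ge[THEN iffD1, OF A8(1), rule_format, OF order_refl[of 1]]
      sm1 sm2 sm3
  proof eventually_elim
    case (elim n)
    have n: "n > 0" and K1: "K n \<ge> 1" using elim(9,10) by auto
    have xS: "x n i \<in> S" if "i \<in> {1..n}" for i by (rule A1(2)[OF that])
    interpret P: prob_space "M n" by (rule assms(9))
    interpret W: weighted_design n "x n" w
      by unfold_locales (use \<delta>(1) \<delta>(2)[OF xS] in fastforce)
    define \<tau> where "\<tau> = real n powr (- 7 / 16)"
    have \<tau>0: "\<tau> \<ge> 0" by (simp add: \<tau>_def)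
    have \<tau>r: "\<Gamma> * \<tau> \<le> r"
    proof -
      have "\<tau> * (\<Gamma> + 1) \<le> r" using elim(11) \<Gamma>0 by (simp add: \<tau>_def pos_less_divide_eq)
      thus ?thesis using \<tau>0 by (simp add: algebra_simps)
    qed
    have \<tau>\<delta>: "L * (\<Gamma> * \<tau>) \<le> \<delta> / 2"
    proof -
      have "0 < L * \<Gamma> + 1" using r(2) \<Gamma>0 by (intro add_nonneg_pos) auto
      moreover have "\<tau> < \<delta> / 2 / (L * \<Gamma> + 1)" using elim(12) by (simp only: \<tau>_def)
      ultimately have "\<tau> * (L * \<Gamma> + 1) < \<delta> / 2" by (simp only: pos_less_divide_eq)
      thus ?thesis using \<tau>0 by (simp add: algebra_simps)
    qed
    define T' where "T' = sqrt (real n) * (2 * L * (\<Gamma> * \<tau>)\<^sup>2) * sqrt (2 / \<delta>) / sqrt a0"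
    have T': "T' = sqrt (real n) * (c2 * \<tau>\<^sup>2)" by (simp add: T'_def c2_def power_mult_distrib)
    have e0: "4 * (L * (\<Gamma> * \<tau>) / \<delta>) * real n powr (1 / 8) + T' + 2 * \<tau> / a0 * (3 * real n powr (1 / 8) + T') \<le> 1 / (k n)\<^sup>2"
    proof -
      have "4 * (L * (\<Gamma> * \<tau>) / \<delta>) * real n powr (1 / 8) + T' + 2 * \<tau> / a0 * (3 * real n powr (1 / 8) + T') \<le> real n powr (- 1 / 4)"
        using elim(7) unfolding T' c1_def \<tau>_def by (simp add: mult.assoc)
      also have "\<dots> = 1 / (real n powr (1 / 8))\<^sup>2"
        using n by (simp add: powr_minus_divide power2_eq_square flip: powr_add)
      also have "\<dots> \<le> 1 / (k n)\<^sup>2"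
        using elim(6) K1 n by (intro divide_left_mono power_mono mult_pos_pos) (auto simp: k_def)
      finally show ?thesis .
    qed
    have ob: "orth_fn b \<gamma> u n (x n) \<theta> j = gram_schmidt_fn (design_inner n (x n) (\<lambda>y. b2 (lin_pred \<gamma> \<theta> y))) f (p + j - 1)" for \<theta> j
      by (simp add: orth_fn_def b2_def f_def p_def)
    have ob0: "orth_fn b \<gamma> u n (x n) \<theta>\<^sub>0 j = W.gs f (p + j - 1)" for j
      by (simp add: ob w_def z_def)
    have orth: "W.ip (W.gs f (p + j - 1)) (W.gs f (p + l - 1)) = (if j = l then 1 else 0)" if "j \<in> {1..K n}" "l \<in> {1..K n}" for j l
      using elim(1) that unfolding orthonormal_fns_def ob0 design_inner_def w_def b2_def z_def by blast
    have hat: "AE \<omega> in M n. \<forall>j\<in>{1..K n}.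
        design_inner n (x n) (\<lambda>y. b2 (lin_pred \<gamma> (\<theta>h n \<omega>) y))
          (gram_schmidt_fn (design_inner n (x n) (\<lambda>y. b2 (lin_pred \<gamma> (\<theta>h n \<omega>) y))) f (p + j - 1))
          (gram_schmidt_fn (design_inner n (x n) (\<lambda>y. b2 (lin_pred \<gamma> (\<theta>h n \<omega>) y))) f (p + j - 1)) = 1 \<and>
        (\<Sum>i=1..n. gram_schmidt_fn (design_inner n (x n) (\<lambda>y. b2 (lin_pred \<gamma> (\<theta>h n \<omega>) y))) f (p + j - 1) (x n i)
          * (lin_pred \<gamma> (\<theta>h n \<omega>) (x n i) - z (x n i)) * b2 (lin_pred \<gamma> (\<theta>h n \<omega>) (x n i))) = 0"
      using elim(2)
    proof eventually_elim
      case (elim \<omega>)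
      show ?case
      proof (intro ballI conjI)
        fix j assume j: "j \<in> {1..K n}"
        define v where "v = orth_fn b \<gamma> u n (x n) (\<theta>h n \<omega>) j"
        define w' where "w' = (\<lambda>y. b2 (lin_pred \<gamma> (\<theta>h n \<omega>) y))"
        have vj: "gram_schmidt_fn (design_inner n (x n) (\<lambda>y. b2 (lin_pred \<gamma> (\<theta>h n \<omega>) y))) f (p + j - 1) = v"
          by (simp only: v_def ob)
        have nv: "1 / real n * (\<Sum>i=1..n. w' (x n i) * v (x n i) * v (x n i)) = 1"
          using elim j unfolding orthonormal_fns_def w'_def b2_def v_def by simp
        show "design_inner n (x n) (\<lambda>y. b2 (lin_pred \<gamma> (\<theta>h n \<omega>) y))
          (gram_schmidt_fn (design_inner n (x n) (\<lambda>y. b2 (lin_pred \<gamma> (\<theta>h n \<omega>) y))) f (p + j - 1))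
          (gram_schmidt_fn (design_inner n (x n) (\<lambda>y. b2 (lin_pred \<gamma> (\<theta>h n \<omega>) y))) f (p + j - 1)) = 1"
          unfolding vj using nv by (simp only: design_inner_def w'_def)
        have o: "(\<Sum>i=1..n. v (x n i) * \<gamma> l (x n i) * w' (x n i)) = 0" for l
          using elim j unfolding orth_to_null_def w'_def b2_def v_def by blast
        \<comment> \<open>The difference of the estimated and the true predictor is a combination of
          the \<gamma>, to each of which v is orthogonal with the estimated weights.\<close>
        have "(\<Sum>i=1..n. v (x n i) * (lin_pred \<gamma> (\<theta>h n \<omega>) (x n i) - z (x n i)) * w' (x n i))
          = (\<Sum>i=1..n. \<Sum>l\<in>UNIV. (\<theta>h n \<omega> - \<theta>\<^sub>0) $ l * (v (x n i) * \<gamma> l (x n i) * w' (x n i)))"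
        proof (rule sum.cong[OF refl])
          fix i
          have "lin_pred \<gamma> (\<theta>h n \<omega>) (x n i) - z (x n i) = (\<Sum>l\<in>UNIV. (\<theta>h n \<omega> - \<theta>\<^sub>0) $ l * \<gamma> l (x n i))"
            by (simp add: z_def lin_pred_def left_diff_distrib sum_subtractf)
          thus "v (x n i) * (lin_pred \<gamma> (\<theta>h n \<omega>) (x n i) - z (x n i)) * w' (x n i)
              = (\<Sum>l\<in>UNIV. (\<theta>h n \<omega> - \<theta>\<^sub>0) $ l * (v (x n i) * \<gamma> l (x n i) * w' (x n i)))"
            by (simp only: sum_distrib_left sum_distrib_right mult_ac)
        qed
        also have "\<dots> = (\<Sum>l\<in>UNIV. (\<theta>h n \<omega> - \<theta>\<^sub>0) $ l * (\<Sum>i=1..n. v (x n i) * \<gamma> l (x n i) * w' (x n i)))"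
          unfolding sum_distrib_left by (rule sum.swap)
        also have "\<dots> = 0" by (simp only: o mult_zero_right sum.neutral_const)
        finally have s0: "(\<Sum>i=1..n. v (x n i) * (lin_pred \<gamma> (\<theta>h n \<omega>) (x n i) - z (x n i)) * w' (x n i)) = 0" .
        show "(\<Sum>i=1..n. gram_schmidt_fn (design_inner n (x n) (\<lambda>y. b2 (lin_pred \<gamma> (\<theta>h n \<omega>) y))) f (p + j - 1) (x n i)
          * (lin_pred \<gamma> (\<theta>h n \<omega>) (x n i) - z (x n i)) * b2 (lin_pred \<gamma> (\<theta>h n \<omega>) (x n i))) = 0"
          unfolding vj using s0 by (simp only: w'_def)
      qed
    qed
    have gram: "\<kappa> * (\<Sum>l<K n. (d l)\<^sup>2) \<le> (1 / real n) * (\<Sum>i=1..n. (\<Sum>l<K n. d l * f (p + l) (x n i))\<^sup>2)" for d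
      unfolding f_u by (rule basis_gram_coeff_bound[OF elim(3)])
    have ak: "a_const (K n) = ac (k n)" by (simp add: a_const_def ac_def k_def)
    have kn: "k n = real (K n)" by (simp add: k_def)
    note par = elim(8)[unfolded kn]
    have p1: "0 < ac (real (K n))" using par by (elim conjE)
    have p2: "1 \<le> Ac (real (K n))" using par by (elim conjE)
    have p3: "1 \<le> Ac (real (K n)) * ac (real (K n))" using par by (elim conjE)
    have p4: "0 < Rc (real (K n))" using par by (elim conjE)
    have p5: "1 / (real (K n))\<^sup>2 \<le> 1" using par by (elim conjE)
    have p6: "1 \<le> ln ((Ac (real (K n)))\<^sup>2 * ac (real (K n)))" using par unfolding Sc_def by (elim conjE)
    have f1: "\<bar>lin_pred \<gamma> (\<theta>h n \<omega>) (x n i) - z (x n i)\<bar> \<le> \<Gamma> * norm (\<theta>h n \<omega> - \<theta>\<^sub>0)" if "i \<in> {1..n}" for \<omega> i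
      unfolding z_def by (rule lp[OF xS[OF that]])
    have f2: "(\<lambda>\<omega>. T n \<omega> / ac (real (K n))) \<in> borel_measurable (M n)" using Tm[of n] by measurable
    have f3: "(\<lambda>\<omega>. norm (\<theta>h n \<omega> - \<theta>\<^sub>0)) \<in> borel_measurable (M n)" using theta_rv[of n] by measurable
    have f4: "T n \<omega> / ac (real (K n)) = (\<Sum>j=1..K n. exp (real n * ((1 / real n) * (\<Sum>i=1..n. (Y n i \<omega> - b1 (lin_pred \<gamma> (\<theta>h n \<omega>) (x n i))) *
            gram_schmidt_fn (design_inner n (x n) (\<lambda>y. b2 (lin_pred \<gamma> (\<theta>h n \<omega>) y))) f (p + j - 1) (x n i)))\<^sup>2 / (2 * a (\<eta>h n \<omega>)))) / ac (real (K n))" for \<omega>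
      unfolding T_def test_stat_def alpha_hat_def ob b1_def ..
    have f5: "measure (M n) {\<omega> \<in> space (M n). \<not> norm (\<theta>h n \<omega> - \<theta>\<^sub>0) \<le> \<tau>} \<le> C1 * real n powr (- 1 / 8)"
      using elim(4) unfolding \<tau>_def abs_norm_cancel .
    have f6: "measure (M n) {\<omega> \<in> space (M n). \<not> \<bar>a (\<eta>h n \<omega>) - a0\<bar> \<le> \<tau>} \<le> C2 * real n powr (- 1 / 8)"
      using elim(5) unfolding \<tau>_def a0_def .
    have f7: "\<bar>f (p + l) (x n i)\<bar> \<le> B (K n)" if "i \<in> {1..n}" "l < K n" for i l
      unfolding f_u using that by (intro A2ii(2) xS) auto
    have f8: "0 \<le> B (K n)" using A2ii(1)[OF K1] by simp
    have f9: "w (x n i) \<le> wm" if "i \<in> {1..n}" for i using wm[OF zC(1)[OF xS[OF that]]] by (simp add: w_def)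
    have f10: "\<delta> \<le> w (x n i)" if "i \<in> {1..n}" for i by (rule \<delta>(2)[OF xS[OF that]])
    have f11: "(b1 has_real_derivative b2 (z (x n i) + s)) (at (z (x n i) + s))" if "i \<in> {1..n}" "\<bar>s\<bar> \<le> r" for i s
      by (rule db1[OF zC(1)[OF xS[OF that(1)]] that(2)])
    have f12: "\<bar>b2 (z (x n i) + s) - b2 (z (x n i))\<bar> \<le> L * \<bar>s\<bar>" if "i \<in> {1..n}" "\<bar>s\<bar> \<le> r" for i s
      using loc[OF zC(1)[OF xS[OF that(1)]] that(2)] by blast
    have f13: "\<tau> \<le> a0 / 2" using elim(13) unfolding \<tau>_def by (rule less_imp_le)
    have f14: "4 * (L * (\<Gamma> * \<tau>) / \<delta>) * real n powr (1 / 8) + sqrt (real n) * (2 * L * (\<Gamma> * \<tau>)\<^sup>2) * sqrt (2 / \<delta>) / sqrt a0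
        + 2 * \<tau> / a0 * (3 * real n powr (1 / 8) + sqrt (real n) * (2 * L * (\<Gamma> * \<tau>)\<^sup>2) * sqrt (2 / \<delta>) / sqrt a0) \<le> 1 / (real (K n))\<^sup>2"
      by (rule e0[unfolded T'_def kn])
    have f15: "w (x n i) = b2 (z (x n i))" for i by (simp add: w_def)
    have f16: "0 < real n powr (1 / 8)" using n by simp
    have f17: "0 \<le> 1 / (real (K n))\<^sup>2" by simp
    show ?case
    proof
      fix \<theta>
      have "\<bar>(\<integral>\<omega>. cos (t * (T n \<omega> / ac (k n)) + \<theta>) \<partial>M n) - (\<integral>y. cos (t * (\<Sum>j\<in>{1..K n}. exp_half_sq (y j) / ac (k n)) + \<theta>) \<partial>std_gauss {1..K n})\<bar> \<le> err t n"
        unfolding err_def pr_def cb_def k_def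
        by (rule W.statistic_comparison[where Y = "Y n" and zh = "\<lambda>\<omega>. lin_pred \<gamma> (\<theta>h n \<omega>)" and z = z and ?b1.0 = b1 and ?b2.0 = b2
            and f = f and dev = "\<lambda>\<omega>. norm (\<theta>h n \<omega> - \<theta>\<^sub>0)" and ah = "\<lambda>\<omega>. a (\<eta>h n \<omega>)" and \<tau> = \<tau> and \<sigma> = \<tau> and r = r and L = L
            and \<Gamma> = \<Gamma> and \<delta> = \<delta> and ?a0.0 = a0])
          ((assumption | rule assms(9) indep std orth hat gram n a0 \<delta>(1) r2 N \<kappa>(1) \<Gamma>0 eta_rv \<tau>r \<tau>\<delta> \<tau>0 p1 p2 p3 p4 p5 p6
            f1 f2 f3 f4 f5 f6 f7 f8 f9 f10 f11 f12 f13 f14 f15 f16 f17 | (simp; fail))+)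
      thus "\<bar>(\<integral>\<omega>. cos (t * (T n \<omega> / a_const (K n)) + \<theta>) \<partial>M n) - Re (cis \<theta> * gauss_cf (K n) t ^ K n)\<bar> \<le> err t n"
        unfolding std_gauss_cos_product[OF finite_atLeastAtMost] ak[symmetric] gauss_cf_def by simp
    qed
  qed

  \<comment> \<open>Passage to the limit by the continuity theorem\<close>
  show ?thesis
  proof (rule levy_continuity)
    show "real_distribution (distr (M n) borel (\<lambda>\<omega>. (test_stat a b \<gamma> u n (x n) (K n) (\<lambda>i. Y n i \<omega>) (\<theta>h n \<omega>) (\<eta>h n \<omega>) - b_const (K n)) / a_const (K n)))" for n
      by (intro prob_space.real_distribution_distr[OF assms(9)] borel_measurable_divide borel_measurable_diff
          borel_measurable_const Tm[of n, unfolded T_def])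
    show "real_distribution \<mu>" using limit by (simp add: stable_S1_1_1_0_def)
    fix t
    define l where "l = exp (- complex_of_real \<bar>t\<bar> * (1 + \<i> * complex_of_real (2 / pi * sgn t * ln \<bar>t\<bar>)))"
    have "(\<lambda>n. char (distr (M n) borel (\<lambda>\<omega>. (T n \<omega> - b_const (K n)) / a_const (K n))) t) \<longlonglongrightarrow> l"
    proof (rule cos_limits_imp_char[OF assms(9)])
      show "(\<lambda>\<omega>. (T n \<omega> - b_const (K n)) / a_const (K n)) \<in> borel_measurable (M n)" for n using Tm[of n] by measurable
      fix \<theta>
      \<comment> \<open>The centring is moved from the statistic into the phase, so that the
        comparison for the uncentred sum applies as it stands.\<close>
      define ph where "ph = (\<lambda>n. \<theta> + - (t * (b_const (K n) / a_const (K n))))"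
      define g where "g = (\<lambda>n. Re (cis (ph n) * gauss_cf (K n) t ^ K n))"
      have "(\<lambda>n. gauss_cf (K n) t ^ K n * cis (- (t * (b_const (K n) / a_const (K n))))) \<longlonglongrightarrow> l"
        unfolding l_def by (rule filterlim_compose[OF gauss_cf_limit A8(1)])
      hence "(\<lambda>n. Re (cis \<theta> * (gauss_cf (K n) t ^ K n * cis (- (t * (b_const (K n) / a_const (K n))))))) \<longlonglongrightarrow> Re (cis \<theta> * l)"
        by (intro tendsto_Re tendsto_mult_left)
      moreover have "Re (cis \<theta> * (gauss_cf (K n) t ^ K n * cis (- (t * (b_const (K n) / a_const (K n)))))) = g n" for n
        unfolding g_def ph_def cis_mult[symmetric] by (simp only: mult_ac)
      ultimately have g: "g \<longlonglongrightarrow> Re (cis \<theta> * l)" by simp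
      have "(\<lambda>n. (\<integral>\<omega>. cos (t * (T n \<omega> / a_const (K n)) + ph n) \<partial>M n) - g n) \<longlonglongrightarrow> 0"
        by (rule Lim_null_comparison[OF _ err_lim[of t]]) (use bound[of t] in eventually_elim, simp add: g_def)
      from tendsto_add[OF this g] have "(\<lambda>n. \<integral>\<omega>. cos (t * (T n \<omega> / a_const (K n)) + ph n) \<partial>M n) \<longlonglongrightarrow> Re (cis \<theta> * l)" by simp
      moreover have "t * (T n \<omega> / a_const (K n)) + ph n = t * ((T n \<omega> - b_const (K n)) / a_const (K n)) + \<theta>" for n \<omega>
        by (simp add: ph_def diff_divide_distrib right_diff_distrib)
      ultimately show "(\<lambda>n. \<integral>\<omega>. cos (t * ((T n \<omega> - b_const (K n)) / a_const (K n)) + \<theta>) \<partial>M n) \<longlonglongrightarrow> Re (cis \<theta> * l)" by simp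
    qed
    thus "(\<lambda>n. char (distr (M n) borel (\<lambda>\<omega>. (test_stat a b \<gamma> u n (x n) (K n) (\<lambda>i. Y n i \<omega>) (\<theta>h n \<omega>) (\<eta>h n \<omega>) - b_const (K n)) / a_const (K n))) t) \<longlonglongrightarrow> char \<mu> t"
      using limit unfolding stable_S1_1_1_0_def l_def T_def by simp
  qed
qed

end
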